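(* Let $\mathcal{S}$ be a family of subsets of $\mathbb{R}^d$ of bounded Gaussian surface area $\Gamma(\mathcal{S})$. Moreover, assume that if $T$ is an affine map and $T(\mathcal{S})=\{T(S):S\in\mathcal{S}\}$ is the family of the images of the sets of $\mathcal{S}$, then $\Gamma(T(\mathcal{S}))=O(\Gamma(\mathcal{S}))$. For some $S\in\mathcal{S}$, let $\mathcal{N}(\boldsymbol\mu,\boldsymbol\Sigma,S)$ be an unknown truncated Gaussian with $\mathcal{N}(\boldsymbol\mu,\boldsymbol\Sigma;S)\ge\alpha$. Then $$d^{\,O(\Gamma(\mathcal{S})^2/\varepsilon^4)}$$ independent samples from $\mathcal{N}(\boldsymbol\mu,\boldsymbol\Sigma,S)$ are sufficient to find (with probability at least $99\%$) parameters $\widetilde{\boldsymbol\mu},\widetilde{\boldsymbol\Sigma},\widetilde S$ such that $$d_{\mathrm{TV}}\big(\mathcal{N}(\boldsymbol\mu,\boldsymbol\Sigma,S),\mathcal{N}(\widetilde{\boldsymbol\mu},\widetilde{\boldsymbol\Sigma},\widetilde S)\big)\le\varepsilon .$$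
   Context: $\mathcal{N}(\boldsymbol\mu,\boldsymbol\Sigma;S)$ is the mass assigned to $S$ by the Gaussian $\mathcal{N}(\boldsymbol\mu,\boldsymbol\Sigma)$ (with full rank covariance); $\mathcal{N}(\boldsymbol\mu,\boldsymbol\Sigma,S)$ is this Gaussian conditioned on lying in $S$. $\alpha>0$ is a known absolute constant, and the constants hidden in $O(\cdot)$ may depend on $\alpha$. The result is information-theoretic (no running time claim). Gaussian surface area: for a Borel set $A\subseteq\mathbb{R}^d$ let $A_\delta=\{x:\mathrm{dist}(x,A)\le\delta\}$ and $\Gamma(A)=\liminf_{\delta\to0}\mathcal{N}_0(A_\delta\setminus A)/\delta$, where $\mathcal{N}_0=\mathcal{N}(\boldsymbol 0,\boldsymbol I)$; for a family, $\Gamma(\mathcal{S})=\sup_{A\in\mathcal{S}}\Gamma(A)$. $d_{\mathrm{TV}}$ is total variation distance.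
   Formalization: The base d of the sample bound is replaced by max(d,2): for d = 1 the literal bound equals one sample, which does not suffice; for d at least 2 nothing changes. *)

theory Defs
  imports "HOL-Probability.Probability" "Jordan_Normal_Form.Gauss_Jordan_Elimination"
    "Jordan_Normal_Form.Determinant"
begin

(* The dimension d is a term, not a type, because the constant in the exponent of the sample
   bound has to be uniform in d.  Points of R^d are the extensional functions on {..<d}. *)

abbreviation lborel_R :: "nat \<Rightarrow> (nat \<Rightarrow> real) measure" where
  "lborel_R d \<equiv> \<Pi>\<^sub>M i\<in>{..<d}. lborel"

abbreviation R_space :: "nat \<Rightarrow> (nat \<Rightarrow> real) set" where
  "R_space d \<equiv> space (lborel_R d)"

definition full_rank_cov :: "nat \<Rightarrow> real mat \<Rightarrow> bool" where
  "full_rank_cov d \<Sigma> \<longleftrightarrow>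
     \<Sigma> \<in> carrier_mat d d \<and> transpose_mat \<Sigma> = \<Sigma> \<and>
     (\<forall>v\<in>carrier_vec d. v \<noteq> 0\<^sub>v d \<longrightarrow> scalar_prod v (\<Sigma> *\<^sub>v v) > 0)"

definition gaussian_density :: "nat \<Rightarrow> (nat \<Rightarrow> real) \<Rightarrow> real mat \<Rightarrow> (nat \<Rightarrow> real) \<Rightarrow> real" where
  "gaussian_density d \<mu> \<Sigma> x =
     (let y = vec d (\<lambda>i. x i - \<mu> i) in
        exp (- scalar_prod y (the (mat_inverse \<Sigma>) *\<^sub>v y) / 2) /
        sqrt ((2 * pi) ^ d * Determinant.det \<Sigma>))"

definition gaussian :: "nat \<Rightarrow> (nat \<Rightarrow> real) \<Rightarrow> real mat \<Rightarrow> (nat \<Rightarrow> real) measure" where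
  "gaussian d \<mu> \<Sigma> = density (lborel_R d) (\<lambda>x. ennreal (gaussian_density d \<mu> \<Sigma> x))"

definition std_gaussian :: "nat \<Rightarrow> (nat \<Rightarrow> real) measure" where
  "std_gaussian d = gaussian d (\<lambda>i\<in>{..<d}. 0) (1\<^sub>m d)"

(* uniform_measure M S is M conditioned on S: it maps B to M (S \<inter> B) / M S. *)
definition truncated_gaussian ::
    "nat \<Rightarrow> (nat \<Rightarrow> real) \<Rightarrow> real mat \<Rightarrow> (nat \<Rightarrow> real) set \<Rightarrow> (nat \<Rightarrow> real) measure" where
  "truncated_gaussian d \<mu> \<Sigma> S = uniform_measure (gaussian d \<mu> \<Sigma>) S"

(* Extended-valued, so that the distance to the empty set is infinite (infdist would give 0). *)
definition dist_set :: "nat \<Rightarrow> (nat \<Rightarrow> real) \<Rightarrow> (nat \<Rightarrow> real) set \<Rightarrow> ennreal" where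
  "dist_set d x A = (INF a\<in>A. ennreal (L2_set (\<lambda>i. x i - a i) {..<d}))"

definition thickening :: "nat \<Rightarrow> real \<Rightarrow> (nat \<Rightarrow> real) set \<Rightarrow> (nat \<Rightarrow> real) set" where
  "thickening d \<delta> A = {x \<in> R_space d. dist_set d x A \<le> ennreal \<delta>}"

(* The completion does not change anything for Borel A.  It only matters for the image of a Borel
   set under a singular affine map: such an image is a subset of a hyperplane but need not be
   Borel. *)
definition gaussian_surface_area :: "nat \<Rightarrow> (nat \<Rightarrow> real) set \<Rightarrow> ennreal" where
  "gaussian_surface_area d A =
     Liminf (at_right 0)
       (\<lambda>\<delta>. emeasure (completion (std_gaussian d)) (thickening d \<delta> A - A) / ennreal \<delta>)"

definition family_surface_area :: "nat \<Rightarrow> (nat \<Rightarrow> real) set set \<Rightarrow> ennreal" where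
  "family_surface_area d \<S> = (SUP A\<in>\<S>. gaussian_surface_area d A)"

definition affine_map :: "nat \<Rightarrow> real mat \<Rightarrow> (nat \<Rightarrow> real) \<Rightarrow> (nat \<Rightarrow> real) \<Rightarrow> (nat \<Rightarrow> real)" where
  "affine_map d A b x = (\<lambda>i\<in>{..<d}. (\<Sum>j<d. A $$ (i, j) * x j) + b i)"

definition tv_dist :: "'a measure \<Rightarrow> 'a measure \<Rightarrow> real" where
  "tv_dist M N = (SUP B\<in>sets M. \<bar>measure M B - measure N B\<bar>)"

end

theory Submission
  imports Defs
begin

text \<open>The noise sensitivity of a set at rotation angle \<open>\<theta>\<close> is at most \<open>\<theta>\<close> times its Gaussian surface area.
  Hence the noise operator nearly preserves its indicator, which is therefore within \<open>\<theta> * \<Gamma>\<close> (in squared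
  \<open>L2\<close> norm) of a polynomial of degree \<open>4 / \<theta>\<^sup>2\<close>. As the family is stable under affine maps, standardization
  transfers this to every Gaussian: each truncated Gaussian is \<open>O(\<epsilon>)\<close>-close to one truncated to the
  positivity set of a polynomial of degree \<open>k = O(\<Gamma>\<^sup>2 / \<epsilon>\<^sup>2)\<close>. The logarithms of two such densities differ
  by a polynomial of degree \<open>k\<close>, so the Scheffe sets have VC dimension at most a constant times
  \<open>(d + 1) ^ k\<close>, and the minimum distance estimator over a countable dense family of hypotheses learns from
  \<open>d\<close> to the power \<open>O(k)\<close> samples. Constants and logarithms are absorbed into the exponent because
  the projections among the affine maps force \<open>\<Gamma>\<close> to be at least a constant.\<close>

section \<open>Gaussian measures\<close>

text \<open>The sets are arbitrary Borel sets and the surface area is only a lower limit over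
  thickenings, so no boundary integral is available. Lipschitz plateau functions that vary only
  inside \<open>thickening d \<delta> A - A\<close> take its place. Gaussian smoothing gives them a
  gradient, and because noise sensitivity is subadditive in the angle, only the first order at angle
  0 has to be computed.

  Low-degree approximation is obtained without Hermite expansions. A function orthogonal to degree k
  has a noise form of order c^(k+1) for small c, with a constant that depends on the dimension.
  Log-convexity carries this exponent to all c < 1 and replaces the constant by the squared norm.

  The squared error is linear in \<theta>, and by Markov's inequality so is the disagreement between
  the two sets. Accuracy \<epsilon> thus needs \<theta> proportional to \<epsilon> * \<alpha> /
  \<Gamma>, which gives k its order.

  The estimator has to return a Gaussian and a set. Its hypotheses are therefore coefficient vectors
  that represent truncated Gaussians exactly, and a countable subset dense in that class makes the
  selected index measurable.\<close>

lemma mat_inverse_eqI: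
  assumes "A \<in> carrier_mat n n" "B \<in> carrier_mat n n" "A * B = 1\<^sub>m n" "B * A = 1\<^sub>m n"
  shows "the (mat_inverse (A :: real mat)) = B"
proof (cases "mat_inverse A")
  case None
  from mat_inverse(1)[OF assms(1) None, of "()"] have "A \<notin> Units (ring_mat TYPE(real) n ())" .
  moreover have "A \<in> Units (ring_mat TYPE(real) n ())"
    using assms by (auto simp: Units_def ring_mat_simps)
  ultimately show ?thesis by blast
next
  case (Some C)
  from mat_inverse(2)[OF assms(1) Some] have C: "A * C = 1\<^sub>m n" "C * A = 1\<^sub>m n" "C \<in> carrier_mat n n" by auto
  have "C = C * (A * B)" using assms C by simp
  also have "\<dots> = (C * A) * B" using assoc_mult_mat[of C n n A n B n] assms C by simp
  also have "\<dots> = B" using C assms(2) by (metis left_mult_one_mat)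
  finally show ?thesis using Some by simp
qed

interpretation lborel_prod: product_sigma_finite "\<lambda>_::nat. lborel :: real measure"
  by standard

interpretation lborel_R: sigma_finite_measure "lborel_R d" for d
  by (rule lborel_prod.sigma_finite) simp

interpretation lborel_RR: pair_sigma_finite "lborel_R d" "lborel_R d" for d ..

lemma space_lborel_R: "space (lborel_R d) = extensional {..<d}"
  by (simp add: space_PiM PiE_def)

text \<open>Translations, reflections, scalings and the whitening map are all triangular, so this
  one substitution rule replaces a general Jacobian formula. Triangularity lets Fubini peel off the
  last coordinate, which is a one-dimensional affine substitution once the earlier coordinates are
  fixed.\<close>

lemma nn_integral_lower_triangular:
  fixes A :: "nat \<Rightarrow> nat \<Rightarrow> real" and b :: "nat \<Rightarrow> real"
  assumes "\<And>i. i < d \<Longrightarrow> A i i \<noteq> 0" and [measurable]: "F \<in> borel_measurable (lborel_R d)"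
  shows "(\<integral>\<^sup>+x. F x \<partial>lborel_R d) =
    ennreal (\<Prod>i<d. \<bar>A i i\<bar>) * (\<integral>\<^sup>+x. F (\<lambda>i\<in>{..<d}. (\<Sum>j\<le>i. A i j * x j) + b i) \<partial>lborel_R d)"
  using assms
proof (induction d arbitrary: F)
  case 0
  show ?case by (simp add: PiM_empty nn_integral_count_space_finite)
next
  case (Suc d)
  let ?T = "\<lambda>x. \<lambda>i\<in>{..<d}. (\<Sum>j\<le>i. A i j * x j) + b i"
  let ?T' = "\<lambda>x. \<lambda>i\<in>{..<Suc d}. (\<Sum>j\<le>i. A i j * x j) + b i"
  have eq: "{..<Suc d} = insert d {..<d}" by auto
  have F[measurable]: "F \<in> borel_measurable (\<Pi>\<^sub>M i\<in>insert d {..<d}. lborel)"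
    using Suc.prems by (simp add: eq)
  have Tm[measurable]: "?T \<in> measurable (lborel_R d) (lborel_R d)"
    by (intro measurable_restrict) (auto intro!: borel_measurable_add borel_measurable_sum borel_measurable_times measurable_component_singleton)
  have comp: "(\<lambda>x. x j) \<in> borel_measurable (\<Pi>\<^sub>M i\<in>insert d {..<d}. lborel)" if "j \<le> d" for j
    using measurable_component_singleton[of j "insert d {..<d}" "\<lambda>_. lborel"] that by (auto simp: le_less)
  have Tm'[measurable]: "?T' \<in> measurable (\<Pi>\<^sub>M i\<in>insert d {..<d}. lborel) (\<Pi>\<^sub>M i\<in>insert d {..<d}. lborel)"
    unfolding eq
    by (intro measurable_restrict) (auto intro!: borel_measurable_add borel_measurable_sum borel_measurable_times comp)
  \<comment> \<open>Coordinate \<open>d\<close> enters only row \<open>d\<close>, with slope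
    \<open>A d d\<close>; the rest of that row is a constant offset for the inner integral.\<close>
  have T'_upd: "?T' (x(d := y)) = (?T x)(d := ((\<Sum>j<d. A d j * x j) + b d) + A d d * y)" for x y
  proof
    fix i show "?T' (x(d := y)) i = ((?T x)(d := ((\<Sum>j<d. A d j * x j) + b d) + A d d * y)) i"
      by (auto simp: lessThan_Suc_atMost[symmetric] intro!: sum.cong)
  qed
  define G where "G = (\<lambda>x. \<integral>\<^sup>+y. F (x(d := y)) \<partial>lborel)"
  have G[measurable]: "G \<in> borel_measurable (lborel_R d)"
    unfolding G_def by measurable
  have inner: "ennreal \<bar>A d d\<bar> * (\<integral>\<^sup>+y. F (?T' (x(d := y))) \<partial>lborel) = G (?T x)" if x: "x \<in> space (lborel_R d)" for x
  proof -
    have "?T x \<in> space (lborel_R d)" by (auto simp: space_lborel_R)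
    then have "(\<lambda>y. F ((?T x)(d := y))) \<in> borel_measurable borel" by measurable
    from nn_integral_real_affine[OF this, of "A d d" "(\<Sum>j<d. A d j * x j) + b d"] Suc.prems(1)
    show ?thesis unfolding G_def T'_upd by simp
  qed
  have "(\<integral>\<^sup>+x. F x \<partial>lborel_R (Suc d)) = (\<integral>\<^sup>+x. G x \<partial>lborel_R d)"
    unfolding eq G_def by (subst lborel_prod.product_nn_integral_insert) auto
  also have "\<dots> = ennreal (\<Prod>i<d. \<bar>A i i\<bar>) * (\<integral>\<^sup>+x. G (?T x) \<partial>lborel_R d)"
    using Suc.prems by (intro Suc.IH) auto
  also have "(\<integral>\<^sup>+x. G (?T x) \<partial>lborel_R d) = (\<integral>\<^sup>+x. ennreal \<bar>A d d\<bar> * (\<integral>\<^sup>+y. F (?T' (x(d := y))) \<partial>lborel) \<partial>lborel_R d)"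
    by (rule nn_integral_cong) (rule inner[symmetric])
  also have "\<dots> = ennreal \<bar>A d d\<bar> * (\<integral>\<^sup>+x. (\<integral>\<^sup>+y. F (?T' (x(d := y))) \<partial>lborel) \<partial>lborel_R d)"
    by (intro nn_integral_cmult) measurable
  also have "(\<integral>\<^sup>+x. (\<integral>\<^sup>+y. F (?T' (x(d := y))) \<partial>lborel) \<partial>lborel_R d) = (\<integral>\<^sup>+x. F (?T' x) \<partial>lborel_R (Suc d))"
    unfolding eq by (subst lborel_prod.product_nn_integral_insert) (auto intro!: measurable_compose[OF Tm'[unfolded eq] F])
  finally have *: "(\<integral>\<^sup>+x. F x \<partial>lborel_R (Suc d)) = ennreal (\<Prod>i<d. \<bar>A i i\<bar>) * (ennreal \<bar>A d d\<bar> * (\<integral>\<^sup>+x. F (?T' x) \<partial>lborel_R (Suc d)))" .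
  have "ennreal (\<Prod>i<Suc d. \<bar>A i i\<bar>) = ennreal (\<Prod>i<d. \<bar>A i i\<bar>) * ennreal \<bar>A d d\<bar>"
    by (simp add: ennreal_mult prod_nonneg)
  then show ?case
    unfolding * by (simp only: mult.assoc)
qed

lemma nn_integral_lborel_R_translate:
  assumes [measurable]: "F \<in> borel_measurable (lborel_R d)"
  shows "(\<integral>\<^sup>+x. F (\<lambda>i\<in>{..<d}. x i + b i) \<partial>lborel_R d) = (\<integral>\<^sup>+x. F x \<partial>lborel_R d)"
proof -
  have *: "(\<Sum>j\<le>i. (if i = j then 1 else 0) * x j) = x i" for i and x :: "nat \<Rightarrow> real"
    by (subst sum.cong[OF refl, of _ _ "\<lambda>j. if i = j then x j else 0"]) auto
  show ?thesis
    by (subst (2) nn_integral_lower_triangular[where A = "\<lambda>i j. if i = j then 1 else 0" and b = b])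
      (auto simp: * cong: restrict_cong)
qed

lemma nn_integral_lborel_R_reflect:
  assumes [measurable]: "F \<in> borel_measurable (lborel_R d)"
  shows "(\<integral>\<^sup>+x. F (\<lambda>i\<in>{..<d}. - x i) \<partial>lborel_R d) = (\<integral>\<^sup>+x. F x \<partial>lborel_R d)"
proof -
  have *: "(\<Sum>j\<le>i. (if i = j then -1 else 0) * x j) = - x i" for i and x :: "nat \<Rightarrow> real"
    by (subst sum.cong[OF refl, of _ _ "\<lambda>j. if i = j then - x j else 0"]) auto
  show ?thesis
    by (subst (2) nn_integral_lower_triangular[where A = "\<lambda>i j. if i = j then -1 else 0" and b = "\<lambda>_. 0"])
      (auto simp: * cong: restrict_cong)
qed

definition norm2 :: "nat \<Rightarrow> (nat \<Rightarrow> real) \<Rightarrow> real" where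
  "norm2 d x = (\<Sum>i<d. (x i)\<^sup>2)"

definition inner_R :: "nat \<Rightarrow> (nat \<Rightarrow> real) \<Rightarrow> (nat \<Rightarrow> real) \<Rightarrow> real" where
  "inner_R d x y = (\<Sum>i<d. x i * y i)"

text \<open>Linear combination. The restriction makes the result a point of
  \<open>R_space d\<close>, whatever \<open>x\<close> and \<open>z\<close> do outside the index
  range.\<close>

definition lc :: "nat \<Rightarrow> real \<Rightarrow> (nat \<Rightarrow> real) \<Rightarrow> real \<Rightarrow> (nat \<Rightarrow> real) \<Rightarrow> (nat \<Rightarrow> real)" where
  "lc d a x b z = (\<lambda>i\<in>{..<d}. a * x i + b * z i)"

lemma lc_apply [simp]: "i < d \<Longrightarrow> lc d a x b z i = a * x i + b * z i"
  by (simp add: lc_def)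

lemma lc_in_space [simp]: "lc d a x b z \<in> extensional {..<d}"
  by (simp add: lc_def)

lemma lc_lc: "lc d a (lc d a1 x b1 z) b (lc d a2 x b2 z) = lc d (a * a1 + b * a2) x (a * b1 + b * b2) z"
  by (auto simp: lc_def algebra_simps)

lemma norm2_nonneg [simp]: "0 \<le> norm2 d x"
  by (simp add: norm2_def sum_nonneg)

lemma norm2_eq_inner: "norm2 d x = inner_R d x x"
  by (simp add: norm2_def inner_R_def power2_eq_square)

lemma norm2_lc: "norm2 d (lc d a x b z) = a\<^sup>2 * norm2 d x + 2 * a * b * inner_R d x z + b\<^sup>2 * norm2 d z"
  by (simp add: norm2_def inner_R_def power2_sum sum.distrib sum_distrib_left power_mult_distrib algebra_simps)

lemma L2_set_norm2: "L2_set x {..<d} = sqrt (norm2 d x)"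
  by (simp add: L2_set_def norm2_def)

lemma measurable_norm2 [measurable]: "norm2 d \<in> borel_measurable (lborel_R d)"
  unfolding norm2_def [abs_def] by measurable

lemma measurable_inner_R [measurable]:
  assumes "f \<in> measurable M (lborel_R d)" "g \<in> measurable M (lborel_R d)"
  shows "(\<lambda>p. inner_R d (f p) (g p)) \<in> borel_measurable M"
  unfolding inner_R_def using assms
  by (intro borel_measurable_sum borel_measurable_times)
    (auto intro: measurable_compose[OF _ measurable_component_singleton[of _ "{..<d}" "\<lambda>_. lborel", simplified]])

lemma measurable_inner_R_const [measurable]:
  assumes "g \<in> measurable M (lborel_R d)"
  shows "(\<lambda>p. inner_R d a (g p)) \<in> borel_measurable M"
  unfolding inner_R_def using assms
  by (intro borel_measurable_sum borel_measurable_times)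
    (auto intro: measurable_compose[OF _ measurable_component_singleton[of _ "{..<d}" "\<lambda>_. lborel", simplified]])

lemma measurable_lc [measurable]:
  assumes "f \<in> measurable M (lborel_R d)" "g \<in> measurable M (lborel_R d)"
  shows "(\<lambda>p. lc d a (f p) b (g p)) \<in> measurable M (lborel_R d)"
proof -
  have "(\<lambda>p. h p i) \<in> borel_measurable M" if "h \<in> measurable M (lborel_R d)" "i < d" for h i
    using measurable_compose[OF that(1) measurable_component_singleton[of i "{..<d}" "\<lambda>_. lborel"]] that(2) by simp
  with assms show ?thesis
    unfolding lc_def by (intro measurable_restrict) auto
qed

section \<open>The standard Gaussian as a density and as a product measure\<close>

definition std_dens :: "nat \<Rightarrow> (nat \<Rightarrow> real) \<Rightarrow> real" where
  "std_dens d x = exp (- norm2 d x / 2) / sqrt ((2 * pi) ^ d)"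

lemma std_dens_nonneg [simp]: "0 \<le> std_dens d x"
  by (simp add: std_dens_def)

lemma measurable_std_dens [measurable]: "std_dens d \<in> borel_measurable (lborel_R d)"
  unfolding std_dens_def [abs_def] by measurable

lemma std_gaussian_density: "std_gaussian d = density (lborel_R d) (\<lambda>x. ennreal (std_dens d x))"
proof -
  have inv: "the (mat_inverse (1\<^sub>m d)) = (1\<^sub>m d :: real mat)"
    by (rule mat_inverse_eqI) auto
  have "gaussian_density d (\<lambda>i\<in>{..<d}. 0) (1\<^sub>m d) x = std_dens d x" for x
    by (simp add: gaussian_density_def inv Let_def std_dens_def scalar_prod_def norm2_def
        power2_eq_square lessThan_atLeast0 one_mult_mat_vec del: index_mult_mat_vec)
  then show ?thesis by (simp add: std_gaussian_def gaussian_def)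
qed

lemma sets_std_gaussian [simp, measurable_cong]: "sets (std_gaussian d) = sets (lborel_R d)"
  by (simp add: std_gaussian_density)

lemma space_std_gaussian [simp]: "space (std_gaussian d) = extensional {..<d}"
  by (simp add: std_gaussian_density space_lborel_R)

definition stdn :: "real measure" where
  "stdn = density lborel (\<lambda>x. ennreal (std_normal_density x))"

lemma sets_stdn [simp, measurable_cong]: "sets stdn = sets borel"
  by (simp add: stdn_def)

lemma space_stdn [simp]: "space stdn = UNIV"
  by (simp add: stdn_def)

interpretation stdn: prob_space stdn
  unfolding stdn_def by (rule prob_space_normal_density) simp

interpretation stdn_prod: product_sigma_finite "\<lambda>_::nat. stdn"
  by standard

lemma std_dens_prod: "std_dens d x = (\<Prod>i<d. std_normal_density (x i))"
proof -
  have e: "exp (- norm2 d x / 2) = (\<Prod>i<d. exp (- (x i)\<^sup>2 / 2))"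
    unfolding norm2_def exp_sum[OF finite_lessThan, symmetric] by (simp only: sum_negf sum_divide_distrib[symmetric])
  have "(\<Prod>i<d. std_normal_density (x i)) = (\<Prod>i<d. 1 / sqrt (2 * pi)) * (\<Prod>i<d. exp (- (x i)\<^sup>2 / 2))"
    unfolding std_normal_density_def prod.distrib ..
  also have "(\<Prod>i<d. 1 / sqrt (2 * pi)) = 1 / sqrt ((2 * pi) ^ d)"
    by (simp only: prod_constant card_lessThan power_one_over real_sqrt_power)
  finally show ?thesis unfolding std_dens_def e by simp
qed

text \<open>The product form reduces integrability and moments to one coordinate and lets a slab in
  the last coordinate split off; the density form serves for substitutions.\<close>

lemma std_gaussian_PiM: "std_gaussian d = (\<Pi>\<^sub>M i\<in>{..<d}. stdn)"
proof (rule stdn_prod.PiM_eqI)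
  show "sets (std_gaussian d) = sets (\<Pi>\<^sub>M i\<in>{..<d}. stdn)"
    by (simp cong: sets_PiM_cong)
next
  fix A :: "nat \<Rightarrow> real set" assume A: "\<And>i. i \<in> {..<d} \<Longrightarrow> A i \<in> sets stdn"
  have m: "Pi\<^sub>E {..<d} A \<in> sets (lborel_R d)"
    using A by (intro sets_PiM_I_finite) auto
  have "emeasure (std_gaussian d) (Pi\<^sub>E {..<d} A) =
      (\<integral>\<^sup>+x. ennreal (std_dens d x) * indicator (Pi\<^sub>E {..<d} A) x \<partial>lborel_R d)"
    unfolding std_gaussian_density using m by (intro emeasure_density) auto
  also have "\<dots> = (\<integral>\<^sup>+x. (\<Prod>i<d. ennreal (std_normal_density (x i)) * indicator (A i) (x i)) \<partial>lborel_R d)"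
  proof (rule nn_integral_cong)
    fix x assume "x \<in> space (lborel_R d)"
    then have "indicator (Pi\<^sub>E {..<d} A) x = (\<Prod>i<d. indicator (A i) (x i) :: ennreal)"
      by (auto simp: space_lborel_R indicator_def PiE_def Pi_def split: if_splits)
    then show "ennreal (std_dens d x) * indicator (Pi\<^sub>E {..<d} A) x =
        (\<Prod>i<d. ennreal (std_normal_density (x i)) * indicator (A i) (x i))"
      by (simp add: std_dens_prod prod_ennreal prod.distrib)
  qed
  also have "\<dots> = (\<Prod>i<d. \<integral>\<^sup>+x. ennreal (std_normal_density x) * indicator (A i) x \<partial>lborel)"
    using A by (intro lborel_prod.product_nn_integral_prod) auto
  also have "\<dots> = (\<Prod>i<d. emeasure stdn (A i))"
    using A by (intro prod.cong refl) (simp add: stdn_def emeasure_density)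
  finally show "emeasure (std_gaussian d) (Pi\<^sub>E {..<d} A) = (\<Prod>i<d. emeasure stdn (A i))" .
qed simp

interpretation N: prob_space "std_gaussian d" for d
  unfolding std_gaussian_PiM by (rule prob_space_PiM) (rule stdn.prob_space_axioms)

interpretation NN: pair_prob_space "std_gaussian d" "std_gaussian d" for d ..

lemma nn_integral_std_gaussian:
  assumes [measurable]: "F \<in> borel_measurable (lborel_R d)"
  shows "(\<integral>\<^sup>+x. F x \<partial>std_gaussian d) = (\<integral>\<^sup>+x. ennreal (std_dens d x) * F x \<partial>lborel_R d)"
  unfolding std_gaussian_density by (intro nn_integral_density) measurable

section \<open>Rotation invariance of a pair of independent Gaussians\<close>

abbreviation std_gaussian2 :: "nat \<Rightarrow> ((nat \<Rightarrow> real) \<times> (nat \<Rightarrow> real)) measure" where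
  "std_gaussian2 d \<equiv> std_gaussian d \<Otimes>\<^sub>M std_gaussian d"

lemma nn_integral_std_gaussian2:
  assumes [measurable]: "F \<in> borel_measurable (lborel_R d \<Otimes>\<^sub>M lborel_R d)"
  shows "(\<integral>\<^sup>+p. F p \<partial>std_gaussian2 d) =
    (\<integral>\<^sup>+p. ennreal (std_dens d (fst p) * std_dens d (snd p)) * F p \<partial>(lborel_R d \<Otimes>\<^sub>M lborel_R d))"
proof -
  have "std_gaussian2 d = density (lborel_R d \<Otimes>\<^sub>M lborel_R d) (\<lambda>(x,y). ennreal (std_dens d x) * ennreal (std_dens d y))"
    unfolding std_gaussian_density
    by (intro pair_measure_density) (auto intro: lborel_R.sigma_finite_measure_axioms N.sigma_finite_measure_axioms[unfolded std_gaussian_density])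
  also have "(\<lambda>(x,y). ennreal (std_dens d x) * ennreal (std_dens d y)) = (\<lambda>p. ennreal (std_dens d (fst p) * std_dens d (snd p)))"
    by (auto simp: ennreal_mult)
  finally show ?thesis
    by (simp only:) (intro nn_integral_density; measurable)
qed

lemma nn_integral_shear_fst:
  assumes [measurable]: "F \<in> borel_measurable (lborel_R d \<Otimes>\<^sub>M lborel_R d)"
  shows "(\<integral>\<^sup>+p. F (lc d 1 (fst p) t (snd p), snd p) \<partial>(lborel_R d \<Otimes>\<^sub>M lborel_R d)) =
    (\<integral>\<^sup>+p. F p \<partial>(lborel_R d \<Otimes>\<^sub>M lborel_R d))"
proof -
  have "(\<integral>\<^sup>+p. F (lc d 1 (fst p) t (snd p), snd p) \<partial>(lborel_R d \<Otimes>\<^sub>M lborel_R d)) =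
      (\<integral>\<^sup>+z. \<integral>\<^sup>+x. F (lc d 1 x t z, z) \<partial>lborel_R d \<partial>lborel_R d)"
    by (subst lborel_RR.nn_integral_snd[symmetric]) auto
  also have "\<dots> = (\<integral>\<^sup>+z. \<integral>\<^sup>+x. F (x, z) \<partial>lborel_R d \<partial>lborel_R d)"
  proof (rule nn_integral_cong)
    fix z assume "z \<in> R_space d"
    then show "(\<integral>\<^sup>+x. F (lc d 1 x t z, z) \<partial>lborel_R d) = (\<integral>\<^sup>+x. F (x, z) \<partial>lborel_R d)"
      unfolding lc_def by (simp add: nn_integral_lborel_R_translate[where F = "\<lambda>x. F (x, z)"])
  qed
  also have "\<dots> = (\<integral>\<^sup>+p. F p \<partial>(lborel_R d \<Otimes>\<^sub>M lborel_R d))"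
    by (subst lborel_RR.nn_integral_snd[symmetric]) auto
  finally show ?thesis .
qed

lemma nn_integral_shear_snd:
  assumes [measurable]: "F \<in> borel_measurable (lborel_R d \<Otimes>\<^sub>M lborel_R d)"
  shows "(\<integral>\<^sup>+p. F (fst p, lc d t (fst p) 1 (snd p)) \<partial>(lborel_R d \<Otimes>\<^sub>M lborel_R d)) =
    (\<integral>\<^sup>+p. F p \<partial>(lborel_R d \<Otimes>\<^sub>M lborel_R d))"
proof -
  have "(\<integral>\<^sup>+p. F (fst p, lc d t (fst p) 1 (snd p)) \<partial>(lborel_R d \<Otimes>\<^sub>M lborel_R d)) =
      (\<integral>\<^sup>+x. \<integral>\<^sup>+z. F (x, lc d t x 1 z) \<partial>lborel_R d \<partial>lborel_R d)"
    by (subst lborel_R.nn_integral_fst[symmetric]) auto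
  also have "\<dots> = (\<integral>\<^sup>+x. \<integral>\<^sup>+z. F (x, z) \<partial>lborel_R d \<partial>lborel_R d)"
  proof (rule nn_integral_cong)
    fix x assume "x \<in> R_space d"
    then show "(\<integral>\<^sup>+z. F (x, lc d t x 1 z) \<partial>lborel_R d) = (\<integral>\<^sup>+z. F (x, z) \<partial>lborel_R d)"
      unfolding lc_def by (simp add: nn_integral_lborel_R_translate[where F = "\<lambda>z. F (x, z)"] add.commute)
  qed
  also have "\<dots> = (\<integral>\<^sup>+p. F p \<partial>(lborel_R d \<Otimes>\<^sub>M lborel_R d))"
    by (subst lborel_R.nn_integral_fst[symmetric]) auto
  finally show ?thesis .
qed

definition rot :: "nat \<Rightarrow> real \<Rightarrow> real \<Rightarrow> (nat \<Rightarrow> real) \<times> (nat \<Rightarrow> real) \<Rightarrow> (nat \<Rightarrow> real) \<times> (nat \<Rightarrow> real)" where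
  "rot d c s p = (lc d c (fst p) s (snd p), lc d (- s) (fst p) c (snd p))"

lemma measurable_rot [measurable]: "rot d c s \<in> measurable (lborel_R d \<Otimes>\<^sub>M lborel_R d) (lborel_R d \<Otimes>\<^sub>M lborel_R d)"
  unfolding rot_def [abs_def] by measurable

lemma norm2_rot:
  assumes "c\<^sup>2 + s\<^sup>2 = 1"
  shows "norm2 d (fst (rot d c s p)) + norm2 d (snd (rot d c s p)) = norm2 d (fst p) + norm2 d (snd p)"
proof -
  have "norm2 d (fst (rot d c s p)) + norm2 d (snd (rot d c s p)) = (c\<^sup>2 + s\<^sup>2) * (norm2 d (fst p) + norm2 d (snd p))"
    by (simp add: rot_def norm2_lc algebra_simps)
  with assms show ?thesis by simp
qed

text \<open>A rotation is a product of three shears, and shears preserve Lebesgue measure by Fubini.\<close>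
lemma nn_integral_rot_lborel:
  assumes cs: "c\<^sup>2 + s\<^sup>2 = 1" "c > -1" and [measurable]: "F \<in> borel_measurable (lborel_R d \<Otimes>\<^sub>M lborel_R d)"
  shows "(\<integral>\<^sup>+p. F (rot d c s p) \<partial>(lborel_R d \<Otimes>\<^sub>M lborel_R d)) = (\<integral>\<^sup>+p. F p \<partial>(lborel_R d \<Otimes>\<^sub>M lborel_R d))"
proof -
  \<comment> \<open>The tangent of half the rotation angle; \<open>c > -1\<close> excludes just the
    half-turn, where it is infinite.\<close>
  define t where "t = s / (1 + c)"
  have "s * s = (1 - c) * (1 + c)" using cs(1) by (simp add: power2_eq_square algebra_simps)
  then have ts: "t * s = 1 - c" using cs(2) by (simp add: t_def field_simps)
  have t1: "t * (1 + c) = s" using cs(2) by (simp add: t_def)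
  let ?S1 = "\<lambda>p. (lc d 1 (fst p) t (snd p), snd p)"
  let ?S2 = "\<lambda>p. (fst p, lc d (- s) (fst p) 1 (snd p))"
  have m1[measurable]: "?S1 \<in> measurable (lborel_R d \<Otimes>\<^sub>M lborel_R d) (lborel_R d \<Otimes>\<^sub>M lborel_R d)"
    and m2[measurable]: "?S2 \<in> measurable (lborel_R d \<Otimes>\<^sub>M lborel_R d) (lborel_R d \<Otimes>\<^sub>M lborel_R d)"
    by measurable
  have e1: "1 * (1 * x + t * z) + t * (- s * x + c * z) = c * x + s * z" for x z
  proof -
    have "1 * (1 * x + t * z) + t * (- s * x + c * z) = (1 - t * s) * x + (t * (1 + c)) * z"
      by (simp add: algebra_simps)
    then show ?thesis unfolding ts t1 by simp
  qed
  have e2: "- s * (1 * x + t * z) + 1 * z = - s * x + c * z" for x z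
  proof -
    have "- s * (1 * x + t * z) + 1 * z = - s * x + (1 - t * s) * z" by (simp add: algebra_simps)
    then show ?thesis by (simp add: ts)
  qed
  have comp: "rot d c s p = ?S1 (?S2 (?S1 p))" for p
    unfolding rot_def lc_def fst_conv snd_conv
    by (intro arg_cong2[where f = Pair] restrict_ext) (simp_all only: restrict_apply' e2 e1)
  have "(\<integral>\<^sup>+p. F (rot d c s p) \<partial>(lborel_R d \<Otimes>\<^sub>M lborel_R d)) = (\<integral>\<^sup>+p. (\<lambda>p. F (?S1 (?S2 p))) (?S1 p) \<partial>(lborel_R d \<Otimes>\<^sub>M lborel_R d))"
    by (simp add: comp)
  also have "\<dots> = (\<integral>\<^sup>+p. (\<lambda>p. F (?S1 p)) (?S2 p) \<partial>(lborel_R d \<Otimes>\<^sub>M lborel_R d))"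
    by (intro nn_integral_shear_fst) measurable
  also have "\<dots> = (\<integral>\<^sup>+p. F (?S1 p) \<partial>(lborel_R d \<Otimes>\<^sub>M lborel_R d))"
    by (intro nn_integral_shear_snd) measurable
  also have "\<dots> = (\<integral>\<^sup>+p. F p \<partial>(lborel_R d \<Otimes>\<^sub>M lborel_R d))"
    by (intro nn_integral_shear_fst) measurable
  finally show ?thesis .
qed

lemma nn_integral_rot:
  assumes cs: "c\<^sup>2 + s\<^sup>2 = 1" "c > -1" and [measurable]: "F \<in> borel_measurable (lborel_R d \<Otimes>\<^sub>M lborel_R d)"
  shows "(\<integral>\<^sup>+p. F (rot d c s p) \<partial>std_gaussian2 d) = (\<integral>\<^sup>+p. F p \<partial>std_gaussian2 d)"
proof -
  let ?w = "\<lambda>p. ennreal (std_dens d (fst p) * std_dens d (snd p))"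
  have w: "?w (rot d c s p) = ?w p" for p
    using norm2_rot[OF cs(1), of d p]
    by (simp add: std_dens_def exp_add[symmetric] add_divide_distrib[symmetric] diff_divide_distrib[symmetric] algebra_simps)
  have "(\<integral>\<^sup>+p. F (rot d c s p) \<partial>std_gaussian2 d) =
      (\<integral>\<^sup>+p. (\<lambda>p. ?w p * F p) (rot d c s p) \<partial>(lborel_R d \<Otimes>\<^sub>M lborel_R d))"
    by (simp add: nn_integral_std_gaussian2 w)
  also have "\<dots> = (\<integral>\<^sup>+p. ?w p * F p \<partial>(lborel_R d \<Otimes>\<^sub>M lborel_R d))"
    by (intro nn_integral_rot_lborel cs) measurable
  finally show ?thesis by (simp add: nn_integral_std_gaussian2)
qed

lemma distr_rot:
  assumes cs: "c\<^sup>2 + s\<^sup>2 = 1" "c > -1"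
  shows "distr (std_gaussian2 d) (std_gaussian2 d) (rot d c s) = std_gaussian2 d"
proof (rule measure_eqI)
  fix A assume "A \<in> sets (distr (std_gaussian2 d) (std_gaussian2 d) (rot d c s))"
  then have A[measurable]: "A \<in> sets (lborel_R d \<Otimes>\<^sub>M lborel_R d)" by (simp cong: sets_pair_measure_cong)
  have [measurable]: "rot d c s \<in> measurable (std_gaussian2 d) (std_gaussian2 d)" by measurable
  have "emeasure (distr (std_gaussian2 d) (std_gaussian2 d) (rot d c s)) A = (\<integral>\<^sup>+p. indicator A (rot d c s p) \<partial>std_gaussian2 d)"
    using nn_integral_distr[of "rot d c s" "std_gaussian2 d" "std_gaussian2 d" "indicator A"] by simp
  also have "\<dots> = emeasure (std_gaussian2 d) A"
    using nn_integral_rot[OF cs, of "indicator A" d] by simp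
  finally show "emeasure (distr (std_gaussian2 d) (std_gaussian2 d) (rot d c s)) A = emeasure (std_gaussian2 d) A" .
qed simp

lemma distr_reflect: "distr (std_gaussian d) (std_gaussian d) (\<lambda>x. \<lambda>i\<in>{..<d}. - x i) = std_gaussian d"
proof (rule measure_eqI)
  fix A assume "A \<in> sets (distr (std_gaussian d) (std_gaussian d) (\<lambda>x. \<lambda>i\<in>{..<d}. - x i))"
  then have A[measurable]: "A \<in> sets (lborel_R d)" by simp
  have r[measurable]: "(\<lambda>x. \<lambda>i\<in>{..<d}. - x i) \<in> measurable (lborel_R d) (lborel_R d)"
    by (intro measurable_restrict) auto
  have "norm2 d (\<lambda>i\<in>{..<d}. - x i) = norm2 d x" for x by (simp add: norm2_def)
  then have w: "std_dens d (\<lambda>i\<in>{..<d}. - x i) = std_dens d x" for x by (simp add: std_dens_def)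
  have "emeasure (distr (std_gaussian d) (std_gaussian d) (\<lambda>x. \<lambda>i\<in>{..<d}. - x i)) A =
      (\<integral>\<^sup>+x. indicator A (\<lambda>i\<in>{..<d}. - x i) \<partial>std_gaussian d)"
    using nn_integral_distr[of "\<lambda>x. \<lambda>i\<in>{..<d}. - x i" "std_gaussian d" "std_gaussian d" "indicator A"] by simp
  also have "\<dots> = (\<integral>\<^sup>+x. (\<lambda>x. ennreal (std_dens d x) * indicator A x) (\<lambda>i\<in>{..<d}. - x i) \<partial>lborel_R d)"
    by (simp add: nn_integral_std_gaussian w)
  also have "\<dots> = (\<integral>\<^sup>+x. ennreal (std_dens d x) * indicator A x \<partial>lborel_R d)"
    by (rule nn_integral_lborel_R_reflect) measurable
  also have "\<dots> = emeasure (std_gaussian d) A"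
    using nn_integral_std_gaussian[of "indicator A" d] by simp
  finally show "emeasure (distr (std_gaussian d) (std_gaussian d) (\<lambda>x. \<lambda>i\<in>{..<d}. - x i)) A = emeasure (std_gaussian d) A" .
qed simp

section \<open>Polynomials\<close>

text \<open>The index bounds the degree without being equal to it. A predicate on functions lets the
  closure properties go by induction and makes affine substitution immediate; coefficients appear
  only through \<open>poly_fun_span\<close>.\<close>

inductive poly_fun :: "nat \<Rightarrow> nat \<Rightarrow> ((nat \<Rightarrow> real) \<Rightarrow> real) \<Rightarrow> bool" for d where
  const0: "poly_fun d 0 (\<lambda>x. c)"
| lift: "poly_fun d k p \<Longrightarrow> poly_fun d (Suc k) p"
| mult_var: "i < d \<Longrightarrow> poly_fun d k p \<Longrightarrow> poly_fun d (Suc k) (\<lambda>x. x i * p x)"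
| add: "poly_fun d k p \<Longrightarrow> poly_fun d k q \<Longrightarrow> poly_fun d k (\<lambda>x. p x + q x)"

lemma poly_fun_mono: "poly_fun d k p \<Longrightarrow> k \<le> l \<Longrightarrow> poly_fun d l p"
  by (induction l rule: nat_induct) (auto simp: le_Suc_eq intro: poly_fun.lift)

lemma poly_fun_const: "poly_fun d k (\<lambda>x. c)"
  using poly_fun_mono[OF poly_fun.const0] by simp

lemma poly_fun_scale: "poly_fun d k p \<Longrightarrow> poly_fun d k (\<lambda>x. c * p x)"
proof (induction rule: poly_fun.induct)
  case (mult_var i k p)
  from poly_fun.mult_var[OF mult_var(1,3)] show ?case by (simp add: mult.left_commute)
next
  case (add k p q)
  from poly_fun.add[OF add(3,4)] show ?case by (simp add: algebra_simps)
qed (auto intro: poly_fun.intros)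

lemma poly_fun_mult:
  assumes "poly_fun d a p" "poly_fun d b q"
  shows "poly_fun d (a + b) (\<lambda>x. p x * q x)"
  using assms(1)
proof (induction rule: poly_fun.induct)
  case (const0 c)
  then show ?case using poly_fun_scale[OF assms(2)] by simp
next
  case (mult_var i k p)
  from poly_fun.mult_var[OF mult_var(1,3)] show ?case by (simp add: mult.assoc)
next
  case (add k p q')
  from poly_fun.add[OF add(3,4)] show ?case by (simp add: algebra_simps)
qed (auto intro: poly_fun.intros)

lemma poly_fun_sum:
  "finite I \<Longrightarrow> (\<And>i. i \<in> I \<Longrightarrow> poly_fun d k (p i)) \<Longrightarrow> poly_fun d k (\<lambda>x. \<Sum>i\<in>I. p i x)"
  by (induction I rule: finite_induct) (auto intro: poly_fun_const poly_fun.add)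

lemma poly_fun_diff: "poly_fun d k p \<Longrightarrow> poly_fun d k q \<Longrightarrow> poly_fun d k (\<lambda>x. p x - q x)"
  using poly_fun.add[OF _ poly_fun_scale[of d k q "-1"]] by simp

lemma poly_fun_var: "i < d \<Longrightarrow> poly_fun d 1 (\<lambda>x. x i)"
  using poly_fun.mult_var[OF _ poly_fun.const0[of d 1]] by simp

lemma poly_fun_inner: "poly_fun d 1 (\<lambda>x. inner_R d v x)"
  unfolding inner_R_def by (intro poly_fun_sum poly_fun_scale poly_fun_var) auto

lemma poly_fun_norm2: "poly_fun d 2 (\<lambda>x. norm2 d x)"
  unfolding norm2_def power2_eq_square
  using poly_fun_mult[OF poly_fun_var poly_fun_var]
  by (intro poly_fun_sum) (auto simp: numeral_2_eq_2)

lemma poly_fun_subst: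
  assumes "poly_fun d k p" "\<And>i. i < d \<Longrightarrow> poly_fun d' 1 (\<lambda>x. T x i)"
  shows "poly_fun d' k (\<lambda>x. p (T x))"
  using assms(1)
proof (induction rule: poly_fun.induct)
  case (mult_var i k p)
  from poly_fun_mult[OF assms(2)[OF mult_var(1)] mult_var(3)] show ?case by simp
qed (auto intro: poly_fun.intros)

lemma measurable_poly_fun [measurable_dest]: "poly_fun d k p \<Longrightarrow> p \<in> borel_measurable (lborel_R d)"
  by (induction rule: poly_fun.induct)
    (auto intro!: borel_measurable_times borel_measurable_add measurable_component_singleton[where M = "\<lambda>_. lborel", simplified])

text \<open>Domination by an arbitrarily small Gaussian growth rate keeps every product with
  \<open>exp (t * norm2 d x)\<close>, \<open>t < 1/2\<close>, integrable. The multiplication step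
  spends half of \<open>t\<close> on the new variable and half on the remaining factor.\<close>

lemma poly_fun_le_exp:
  assumes "poly_fun d k p" "t > 0"
  shows "\<exists>C\<ge>0. \<forall>x. \<bar>p x\<bar> \<le> C * exp (t * norm2 d x)"
  using assms
proof (induction arbitrary: t rule: poly_fun.induct)
  case (const0 c)
  show ?case
  proof (intro exI[of _ "\<bar>c\<bar>"] conjI allI)
    fix x
    have "1 \<le> exp (t * norm2 d x)" using const0 by simp
    then show "\<bar>c\<bar> \<le> \<bar>c\<bar> * exp (t * norm2 d x)" by (simp add: mult_le_cancel_left1)
  qed simp
next
  case (mult_var i k p)
  from mult_var.IH[of "t/2"] mult_var.prems obtain C where C: "C \<ge> 0" "\<And>x. \<bar>p x\<bar> \<le> C * exp (t/2 * norm2 d x)" by auto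
  have "\<bar>x i * p x\<bar> \<le> (1 + 2/t) * C * exp (t * norm2 d x)" for x
  proof -
    have "\<bar>x i\<bar> \<le> 1 + (x i)\<^sup>2"
      using zero_le_power2[of "\<bar>x i\<bar> - 1"] by (simp add: power2_eq_square algebra_simps)
    also have "\<dots> \<le> (1 + 2/t) * (1 + t/2 * (x i)\<^sup>2)" using mult_var.prems by (simp add: field_simps)
    also have "\<dots> \<le> (1 + 2/t) * exp (t/2 * (x i)\<^sup>2)"
      using mult_var.prems exp_ge_add_one_self[of "t/2 * (x i)\<^sup>2"] by (intro mult_left_mono) auto
    also have "\<dots> \<le> (1 + 2/t) * exp (t/2 * norm2 d x)"
    proof -
      have "(x i)\<^sup>2 \<le> norm2 d x" unfolding norm2_def using mult_var(1) by (intro member_le_sum) auto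
      then show ?thesis using mult_var.prems by (intro mult_left_mono) auto
    qed
    finally have "\<bar>x i\<bar> * \<bar>p x\<bar> \<le> ((1 + 2/t) * exp (t/2 * norm2 d x)) * (C * exp (t/2 * norm2 d x))"
      using C mult_var.prems by (intro mult_mono) auto
    also have "\<dots> = (1 + 2/t) * C * exp (t * norm2 d x)"
      by (simp add: exp_add[symmetric])
    finally show ?thesis by (simp add: abs_mult)
  qed
  then show ?case using C mult_var.prems by (intro exI[of _ "(1 + 2/t) * C"]) auto
next
  case (add k p q)
  from add.IH(1)[OF add.prems] obtain C where C: "C \<ge> 0" "\<And>x. \<bar>p x\<bar> \<le> C * exp (t * norm2 d x)" by auto
  from add.IH(2)[OF add.prems] obtain C' where C': "C' \<ge> 0" "\<And>x. \<bar>q x\<bar> \<le> C' * exp (t * norm2 d x)" by auto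
  have "\<bar>p x + q x\<bar> \<le> (C + C') * exp (t * norm2 d x)" for x
    using C(2)[of x] C'(2)[of x] by (simp add: algebra_simps)
  then show ?case using C C' by (intro exI[of _ "C + C'"]) auto
qed

text \<open>In one coordinate the weight \<open>exp (t * x\<^sup>2)\<close> turns the standard
  normal density into a multiple of the centred normal density of variance
  \<open>1 / (1 - 2 * t)\<close>; the product measure does the rest.\<close>

lemma integrable_exp_norm2:
  assumes "t < 1/2"
  shows "integrable (std_gaussian d) (\<lambda>x. exp (t * norm2 d x))"
proof -
  define \<sigma> where "\<sigma> = sqrt (1 / (1 - 2 * t))"
  have \<sigma>: "\<sigma> > 0" "\<sigma>\<^sup>2 = 1 / (1 - 2 * t)" using assms by (auto simp: \<sigma>_def)
  have "integrable lborel (normal_density 0 \<sigma>)" using \<sigma> by simp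
  then have "integrable lborel (\<lambda>x. (sqrt (2 * pi * \<sigma>\<^sup>2) / sqrt (2 * pi)) * normal_density 0 \<sigma> x)"
    by (rule integrable_mult_right)
  also have "(\<lambda>x. (sqrt (2 * pi * \<sigma>\<^sup>2) / sqrt (2 * pi)) * normal_density 0 \<sigma> x) = (\<lambda>x. std_normal_density x * exp (t * x\<^sup>2))"
  proof
    fix x :: real
    have "- x\<^sup>2 / (2 * \<sigma>\<^sup>2) = - x\<^sup>2 / 2 + t * x\<^sup>2" using assms by (simp add: \<sigma> field_simps)
    then have "exp (- x\<^sup>2 / (2 * \<sigma>\<^sup>2)) = exp (- x\<^sup>2 / 2) * exp (t * x\<^sup>2)" by (simp only: exp_add)
    then show "(sqrt (2 * pi * \<sigma>\<^sup>2) / sqrt (2 * pi)) * normal_density 0 \<sigma> x = std_normal_density x * exp (t * x\<^sup>2)"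
      using \<sigma>(1) by (simp add: normal_density_def std_normal_density_def)
  qed
  finally have "integrable stdn (\<lambda>x. exp (t * x\<^sup>2))"
    unfolding stdn_def by (subst integrable_density) auto
  then have "integrable (\<Pi>\<^sub>M i\<in>{..<d}. stdn) (\<lambda>x. \<Prod>i<d. exp (t * (x i)\<^sup>2))"
    by (intro stdn_prod.product_integrable_prod) auto
  then show ?thesis
    by (simp add: std_gaussian_PiM norm2_def sum_distrib_left exp_sum)
qed

lemma integrable_poly_fun_exp:
  assumes "poly_fun d k p" "t < 1/2"
  shows "integrable (std_gaussian d) (\<lambda>x. p x * exp (t * norm2 d x))"
proof -
  have [measurable]: "p \<in> borel_measurable (lborel_R d)" using assms(1) by measurable
  \<comment> \<open>Half of the gap between \<open>t\<close> and \<open>1/2\<close>, so that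
    \<open>t' + t\<close> still lies below the threshold of integrability.\<close>
  define t' where "t' = 1/4 - t/2"
  have t': "t' > 0" using assms(2) by (simp add: t'_def)
  have t'2: "t' + t < 1/2" unfolding t'_def using assms(2) by linarith
  from poly_fun_le_exp[OF assms(1) t'] obtain C where C: "C \<ge> 0" "\<And>x. \<bar>p x\<bar> \<le> C * exp (t' * norm2 d x)" by auto
  show ?thesis
  proof (rule Bochner_Integration.integrable_bound)
    show "integrable (std_gaussian d) (\<lambda>x. C * exp ((t' + t) * norm2 d x))"
      using integrable_exp_norm2[OF t'2] by simp
    show "AE x in std_gaussian d. norm (p x * exp (t * norm2 d x)) \<le> norm (C * exp ((t' + t) * norm2 d x))"
      using C by (intro AE_I2) (auto simp: abs_mult exp_add distrib_right mult.assoc[symmetric] intro!: mult_right_mono)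
  qed measurable
qed

lemma integrable_poly_fun: "poly_fun d k p \<Longrightarrow> integrable (std_gaussian d) p"
  using integrable_poly_fun_exp[of d k p 0] by simp

lemma integrable_poly_fun_sq: "poly_fun d k p \<Longrightarrow> integrable (std_gaussian d) (\<lambda>x. (p x)\<^sup>2)"
  unfolding power2_eq_square using poly_fun_mult by (rule integrable_poly_fun)

section \<open>A finite spanning family of monomials\<close>

definition monomials :: "nat \<Rightarrow> nat \<Rightarrow> nat list set" where
  "monomials d k = {l. set l \<subseteq> {..d} \<and> length l = k}"

text \<open>The index \<open>d\<close> stands for the constant 1, so that lists of length exactly \<open>k\<close> give all
  monomials of degree at most \<open>k\<close>.\<close>
definition mono_fun :: "nat \<Rightarrow> nat list \<Rightarrow> (nat \<Rightarrow> real) \<Rightarrow> real" where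
  "mono_fun d l x = prod_list (map (\<lambda>i. if i < d then x i else 1) l)"

lemma finite_monomials [simp]: "finite (monomials d k)"
  unfolding monomials_def by (intro finite_lists_length_eq) simp

lemma card_monomials: "card (monomials d k) = (d + 1) ^ k"
  unfolding monomials_def by (subst card_lists_length_eq) auto

lemma poly_fun_mono_fun: "l \<in> monomials d k \<Longrightarrow> poly_fun d k (mono_fun d l)"
proof (induction l arbitrary: k)
  case (Cons i l)
  then obtain k' where k': "k = Suc k'" "l \<in> monomials d k'" by (auto simp: monomials_def)
  show ?case
  proof (cases "i < d")
    case True
    with poly_fun.mult_var[OF this Cons.IH[OF k'(2)]] show ?thesis by (simp add: k' mono_fun_def [abs_def])
  next
    case False
    with poly_fun.lift[OF Cons.IH[OF k'(2)]] show ?thesis by (simp add: k' mono_fun_def [abs_def])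
  qed
qed (auto simp: monomials_def mono_fun_def [abs_def] intro: poly_fun.intros)

lemma monomials_Suc: "monomials d (Suc k) = (\<lambda>(i, l). i # l) ` ({..d} \<times> monomials d k)"
  by (auto simp: monomials_def image_iff length_Suc_conv)

text \<open>A finite spanning set is needed twice: for the \<open>L2\<close> projection onto low
  degree and, through its cardinality \<open>(d + 1) ^ k\<close>, for counting sign patterns.
  Distinct lists may give the same function, so coefficients are not unique.\<close>

lemma poly_fun_span:
  "poly_fun d k p \<longleftrightarrow> (\<exists>c. p = (\<lambda>x. \<Sum>l\<in>monomials d k. c l * mono_fun d l x))"
proof
  assume "\<exists>c. p = (\<lambda>x. \<Sum>l\<in>monomials d k. c l * mono_fun d l x)"
  then show "poly_fun d k p"
    by (auto intro!: poly_fun_sum poly_fun_scale poly_fun_mono_fun)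
next
  \<comment> \<open>Multiplying by a variable prepends its index: the new coefficient of
    \<open>i # l\<close> is the old one of \<open>l\<close>, and lists with another head get 0. The
    case \<open>i = d\<close> multiplies by 1 and serves for \<open>lift\<close>.\<close>
  have var: "\<exists>c'. (\<lambda>x. (if i < d then x i else 1) * (\<Sum>l\<in>monomials d k. c l * mono_fun d l x)) =
      (\<lambda>x. \<Sum>l\<in>monomials d (Suc k). c' l * mono_fun d l x)" if "i \<le> d" for i k c
  proof (intro exI[of _ "\<lambda>l. if hd l = i then c (tl l) else 0"] ext)
    fix x
    have "(\<Sum>l\<in>monomials d (Suc k). (if hd l = i then c (tl l) else 0) * mono_fun d l x) =
        (\<Sum>j\<le>d. \<Sum>l\<in>monomials d k. (if j = i then c l else 0) * mono_fun d (j # l) x)"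
      unfolding monomials_Suc
      by (subst sum.reindex) (auto simp: inj_on_def sum.cartesian_product o_def intro!: sum.cong)
    also have "\<dots> = (\<Sum>j\<le>d. if j = i then (\<Sum>l\<in>monomials d k. c l * mono_fun d (i # l) x) else 0)"
      by (intro sum.cong refl) (auto intro!: sum.neutral)
    also have "\<dots> = (\<Sum>l\<in>monomials d k. c l * mono_fun d (i # l) x)"
      using that by simp
    also have "\<dots> = (if i < d then x i else 1) * (\<Sum>l\<in>monomials d k. c l * mono_fun d l x)"
      by (simp add: mono_fun_def sum_distrib_left mult_ac)
    finally show "(if i < d then x i else 1) * (\<Sum>l\<in>monomials d k. c l * mono_fun d l x) =
        (\<Sum>l\<in>monomials d (Suc k). (if hd l = i then c (tl l) else 0) * mono_fun d l x)" ..
  qed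
  assume "poly_fun d k p"
  then show "\<exists>c. p = (\<lambda>x. \<Sum>l\<in>monomials d k. c l * mono_fun d l x)"
  proof (induction rule: poly_fun.induct)
    case (const0 c)
    have "monomials d 0 = {[]}" by (auto simp: monomials_def)
    then show ?case by (intro exI[of _ "\<lambda>_. c"]) (simp add: mono_fun_def)
  next
    case (lift k p)
    then obtain c where p: "p = (\<lambda>x. \<Sum>l\<in>monomials d k. c l * mono_fun d l x)" by auto
    from var[where i = d and k = k and c = c] show ?case by (auto simp: p)
  next
    case (mult_var i k p)
    then obtain c where p: "p = (\<lambda>x. \<Sum>l\<in>monomials d k. c l * mono_fun d l x)" by auto
    from var[where i = i and k = k and c = c] mult_var(1) show ?case by (auto simp: p)
  next
    case (add k p q)
    then obtain c c' where p: "p = (\<lambda>x. \<Sum>l\<in>monomials d k. c l * mono_fun d l x)"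
      and q: "q = (\<lambda>x. \<Sum>l\<in>monomials d k. c' l * mono_fun d l x)" by auto
    show ?case
      by (intro exI[of _ "\<lambda>l. c l + c' l"]) (simp add: p q sum.distrib distrib_right)
  qed
qed

text \<open>A sum of products separates the two points. In this form the total degree can be split
  between them, as orthogonality requires, and one point can be integrated out.\<close>

inductive bipoly :: "nat \<Rightarrow> nat \<Rightarrow> ((nat \<Rightarrow> real) \<Rightarrow> (nat \<Rightarrow> real) \<Rightarrow> real) \<Rightarrow> bool" for d where
  prod: "poly_fun d a P \<Longrightarrow> poly_fun d b Q \<Longrightarrow> a + b \<le> m \<Longrightarrow> bipoly d m (\<lambda>x y. P x * Q y)"
| add: "bipoly d m F \<Longrightarrow> bipoly d m G \<Longrightarrow> bipoly d m (\<lambda>x y. F x y + G x y)"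

lemma bipoly_mono: "bipoly d m F \<Longrightarrow> m \<le> n \<Longrightarrow> bipoly d n F"
  by (induction rule: bipoly.induct) (auto intro: bipoly.intros order_trans)

lemma bipoly_left: "poly_fun d m P \<Longrightarrow> bipoly d m (\<lambda>x y. P x)"
  using bipoly.prod[OF _ poly_fun.const0[of d 1]] by simp

lemma bipoly_right: "poly_fun d m P \<Longrightarrow> bipoly d m (\<lambda>x y. P y)"
  using bipoly.prod[OF poly_fun.const0[of d 1]] by simp

lemma bipoly_mult:
  assumes "bipoly d m F" "bipoly d n G"
  shows "bipoly d (m + n) (\<lambda>x y. F x y * G x y)"
  using assms
proof (induction rule: bipoly.induct)
  case (prod a P b Q m)
  from prod(4) show ?case
  proof (induction rule: bipoly.induct)
    case (prod a' P' b' Q' n)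
    have "bipoly d (m + n) (\<lambda>x y. (P x * P' x) * (Q y * Q' y))"
      using \<open>a + b \<le> m\<close> prod(3)
      by (intro bipoly.prod[OF poly_fun_mult[OF \<open>poly_fun d a P\<close> prod(1)] poly_fun_mult[OF \<open>poly_fun d b Q\<close> prod(2)]]) simp
    then show ?case by (simp add: mult_ac)
  next
    case (add n F G)
    from bipoly.add[OF add(3,4)] show ?case by (simp add: algebra_simps)
  qed
next
  case (add m F F')
  from bipoly.add[OF add(3)[OF add(5)] add(4)[OF add(5)]] show ?case by (simp add: algebra_simps)
qed

lemma bipoly_scale: "bipoly d m F \<Longrightarrow> bipoly d m (\<lambda>x y. c * F x y)"
  using bipoly_mult[OF bipoly_left[OF poly_fun.const0[of d c]]] by simp

lemma bipoly_power: "bipoly d m F \<Longrightarrow> bipoly d (j * m) (\<lambda>x y. F x y ^ j)"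
proof (induction j)
  case 0
  show ?case using bipoly_left[OF poly_fun.const0[of d 1]] by simp
next
  case (Suc j)
  from bipoly_mult[OF Suc.prems Suc.IH[OF Suc.prems]] show ?case by simp
qed

lemma bipoly_sum:
  "finite I \<Longrightarrow> (\<And>i. i \<in> I \<Longrightarrow> bipoly d k (p i)) \<Longrightarrow> bipoly d k (\<lambda>x y. \<Sum>i\<in>I. p i x y)"
proof (induction I rule: finite_induct)
  case empty
  show ?case using bipoly_left[OF poly_fun_const[of d k 0]] by simp
qed (auto intro: bipoly.add)

lemma bipoly_inner: "bipoly d 2 (\<lambda>x y. inner_R d x y)"
  unfolding inner_R_def
  by (intro bipoly_sum bipoly.prod[OF poly_fun_var poly_fun_var]) auto

lemma bipoly_lc:
  assumes "poly_fun d k p"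
  shows "bipoly d k (\<lambda>x z. p (lc d a x b z))"
  using assms
proof (induction rule: poly_fun.induct)
  case (const0 c)
  show ?case by (rule bipoly_left[OF poly_fun.const0])
next
  case (lift k p)
  then show ?case by (auto intro: bipoly_mono)
next
  case (mult_var i k p)
  have "bipoly d 1 (\<lambda>x z. a * x i + b * z i)"
    using mult_var(1) by (intro bipoly.add bipoly_scale bipoly_left bipoly_right poly_fun_var)
  from bipoly_mult[OF this mult_var(3)] show ?case using mult_var(1) by simp
next
  case (add k p q)
  then show ?case by (intro bipoly.add)
qed

lemma bipoly_integral_snd:
  assumes "bipoly d m F"
  shows "(\<forall>x. integrable (std_gaussian d) (F x)) \<and> poly_fun d m (\<lambda>x. \<integral>z. F x z \<partial>std_gaussian d)"
  using assms
proof (induction rule: bipoly.induct)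
  case (prod a P b Q m)
  have "poly_fun d m (\<lambda>x. (\<integral>z. Q z \<partial>std_gaussian d) * P x)"
    using prod by (intro poly_fun_scale poly_fun_mono[OF prod(1)]) auto
  then show ?case using integrable_poly_fun[OF prod(2)] by (simp add: mult.commute)
next
  case (add m F G)
  then show ?case by (auto intro: poly_fun.add)
qed

section \<open>The noise operator\<close>

definition L2 :: "'a measure \<Rightarrow> ('a \<Rightarrow> real) \<Rightarrow> bool" where
  "L2 M f \<longleftrightarrow> f \<in> borel_measurable M \<and> integrable M (\<lambda>x. (f x)\<^sup>2)"

lemma L2_mult_integrable:
  assumes "L2 M f" "L2 M g"
  shows "integrable M (\<lambda>x. f x * g x)"
proof (rule Bochner_Integration.integrable_bound)
  show "integrable M (\<lambda>x. (f x)\<^sup>2 + (g x)\<^sup>2)" using assms by (simp add: L2_def)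
  show "(\<lambda>x. f x * g x) \<in> borel_measurable M" using assms by (auto simp: L2_def intro!: borel_measurable_times)
  show "AE x in M. norm (f x * g x) \<le> norm ((f x)\<^sup>2 + (g x)\<^sup>2)"
  proof (rule AE_I2)
    fix x
    have "2 * \<bar>f x * g x\<bar> \<le> (f x)\<^sup>2 + (g x)\<^sup>2"
      using sum_squares_bound[of "\<bar>f x\<bar>" "\<bar>g x\<bar>"] by (simp add: abs_mult mult.assoc)
    then show "norm (f x * g x) \<le> norm ((f x)\<^sup>2 + (g x)\<^sup>2)" by simp
  qed
qed

lemma L2_scale: "L2 M f \<Longrightarrow> L2 M (\<lambda>x. c * f x)"
  by (auto simp: L2_def power_mult_distrib)

lemma L2_add: "L2 M f \<Longrightarrow> L2 M g \<Longrightarrow> L2 M (\<lambda>x. f x + g x)"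
  using L2_mult_integrable[of M f g] by (auto simp: L2_def power2_sum mult.assoc)

lemma L2_diff: "L2 M f \<Longrightarrow> L2 M g \<Longrightarrow> L2 M (\<lambda>x. f x - g x)"
  using L2_add[OF _ L2_scale[of M g "-1"]] by simp

lemma L2_sum: "finite I \<Longrightarrow> (\<And>i. i \<in> I \<Longrightarrow> L2 M (f i)) \<Longrightarrow> L2 M (\<lambda>x. \<Sum>i\<in>I. f i x)"
  by (induction I rule: finite_induct) (auto intro: L2_add simp: L2_def[of _ "\<lambda>_. 0"])

lemma L2_abs: "L2 M f \<Longrightarrow> L2 M (\<lambda>x. \<bar>f x\<bar>)"
  by (auto simp: L2_def)

lemma integral_Cauchy_Schwarz:
  assumes "L2 M f" "L2 M g"
  shows "(\<integral>x. f x * g x \<partial>M)\<^sup>2 \<le> (\<integral>x. (f x)\<^sup>2 \<partial>M) * (\<integral>x. (g x)\<^sup>2 \<partial>M)"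
proof -
  let ?A = "\<integral>x. (f x)\<^sup>2 \<partial>M" and ?B = "\<integral>x. (g x)\<^sup>2 \<partial>M" and ?C = "\<integral>x. f x * g x \<partial>M"
  have int: "integrable M (\<lambda>x. (f x)\<^sup>2)" "integrable M (\<lambda>x. (g x)\<^sup>2)" "integrable M (\<lambda>x. f x * g x)"
    using assms L2_mult_integrable by (auto simp: L2_def)
  \<comment> \<open>The integral of \<open>(f x + t * g x)\<^sup>2\<close> as a quadratic in
    \<open>t\<close>; its nonnegativity at one well-chosen \<open>t\<close> gives the
    inequality.\<close>
  have q: "?A + 2 * t * ?C + t\<^sup>2 * ?B \<ge> 0" for t
  proof -
    have "0 \<le> (\<integral>x. (f x + t * g x)\<^sup>2 \<partial>M)" by (rule Bochner_Integration.integral_nonneg) simp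
    also have "(\<lambda>x. (f x + t * g x)\<^sup>2) = (\<lambda>x. (f x)\<^sup>2 + 2 * t * (f x * g x) + t\<^sup>2 * (g x)\<^sup>2)"
      by (auto simp: power2_sum power_mult_distrib algebra_simps)
    also have "(\<integral>x. (f x)\<^sup>2 + 2 * t * (f x * g x) + t\<^sup>2 * (g x)\<^sup>2 \<partial>M) = ?A + 2 * t * ?C + t\<^sup>2 * ?B"
      using int by (simp del: mult.assoc)
    finally show ?thesis .
  qed
  have B: "?B \<ge> 0" by (rule Bochner_Integration.integral_nonneg) simp
  show ?thesis
  proof (cases "?B = 0")
    case True
    have "?C = 0"
    proof (rule ccontr)
      assume "?C \<noteq> 0"
      \<comment> \<open>With \<open>?B = 0\<close> the quadratic is affine in \<open>t\<close>, and
        this \<open>t\<close> would make it -1.\<close>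
      then have "?A + 2 * (- (?A + 1) / (2 * ?C)) * ?C = -1" by (simp add: field_simps)
      with q[of "- (?A + 1) / (2 * ?C)"] True show False by simp
    qed
    then show ?thesis using True by simp
  next
    case False
    have B': "?B > 0" by (rule le_neq_trans[OF B]) (use False in auto)
    have "?A + 2 * (- ?C / ?B) * ?C + (- ?C / ?B)\<^sup>2 * ?B = ?A - ?C\<^sup>2 / ?B"
      using B' by (simp add: power2_eq_square)
    with q[of "- ?C / ?B"] have "?C\<^sup>2 / ?B \<le> ?A" by simp
    then show ?thesis using B' by (simp add: pos_divide_le_eq)
  qed
qed

lemma (in prob_space) L2_const: "L2 M (\<lambda>_. c)"
  by (simp add: L2_def)

lemma (in prob_space) L2_integrable: "L2 M f \<Longrightarrow> integrable M f"
  using L2_mult_integrable[OF _ L2_const[of 1]] by simp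

lemma (in prob_space) integral_power2_le: "L2 M f \<Longrightarrow> (\<integral>x. f x \<partial>M)\<^sup>2 \<le> (\<integral>x. (f x)\<^sup>2 \<partial>M)"
  using integral_Cauchy_Schwarz[OF _ L2_const[of 1]] by (simp add: prob_space)

text \<open>Gram-Schmidt instead of completeness: project \<open>f\<close> and the new function
  \<open>\<phi> m\<close> onto the old span, then correct the residual of \<open>f\<close> along the
  residual of \<open>\<phi> m\<close>.\<close>

lemma L2_projection:
  assumes "finite I" "\<And>i. i \<in> I \<Longrightarrow> L2 M (\<phi> i)" "L2 M f"
  shows "\<exists>c. \<forall>j\<in>I. (\<integral>x. (f x - (\<Sum>i\<in>I. c i * \<phi> i x)) * \<phi> j x \<partial>M) = 0"
  using assms
proof (induction I arbitrary: f rule: finite_induct)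
  case (insert m I)
  have L2I: "L2 M (\<lambda>x. \<Sum>i\<in>I. c i * \<phi> i x)" for c
    using insert by (intro L2_sum L2_scale) auto
  obtain c where c: "\<And>j. j \<in> I \<Longrightarrow> (\<integral>x. (f x - (\<Sum>i\<in>I. c i * \<phi> i x)) * \<phi> j x \<partial>M) = 0"
    using insert.IH[OF _ insert.prems(2)] insert.prems by auto
  obtain e where e: "\<And>j. j \<in> I \<Longrightarrow> (\<integral>x. (\<phi> m x - (\<Sum>i\<in>I. e i * \<phi> i x)) * \<phi> j x \<partial>M) = 0"
    using insert.IH[of "\<phi> m"] insert.prems by auto
  define r where "r = (\<lambda>x. f x - (\<Sum>i\<in>I. c i * \<phi> i x))"
  define q where "q = (\<lambda>x. \<phi> m x - (\<Sum>i\<in>I. e i * \<phi> i x))"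
  have Lr: "L2 M r" and Lq: "L2 M q" unfolding r_def q_def
    using insert.prems by (auto intro!: L2_diff L2I)
  have rI: "(\<integral>x. r x * \<phi> j x \<partial>M) = 0" and qI: "(\<integral>x. q x * \<phi> j x \<partial>M) = 0" if "j \<in> I" for j
    using c[OF that] e[OF that] by (auto simp: r_def q_def)
  have orth: "(\<integral>x. u x * \<phi> m x \<partial>M) = (\<integral>x. u x * q x \<partial>M)"
    if u: "L2 M u" "\<And>j. j \<in> I \<Longrightarrow> (\<integral>x. u x * \<phi> j x \<partial>M) = 0" for u
  proof -
    have "(\<integral>x. u x * \<phi> m x \<partial>M) = (\<integral>x. u x * q x + (\<Sum>i\<in>I. e i * (u x * \<phi> i x)) \<partial>M)"
      by (intro Bochner_Integration.integral_cong refl) (simp add: q_def sum_distrib_left algebra_simps)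
    also have "\<dots> = (\<integral>x. u x * q x \<partial>M) + (\<Sum>i\<in>I. e i * (\<integral>x. u x * \<phi> i x \<partial>M))"
      using u(1) Lq insert.prems by (subst Bochner_Integration.integral_add) (auto simp: L2_mult_integrable)
    finally show ?thesis using u(2) by simp
  qed
  \<comment> \<open>If \<open>q\<close> has norm 0, its inner product with \<open>r\<close> vanishes
    by Cauchy-Schwarz, so the coefficient 0 solves the equation as well.\<close>
  define lam0 where "lam0 = (if (\<integral>x. (q x)\<^sup>2 \<partial>M) = 0 then 0 else (\<integral>x. r x * q x \<partial>M) / (\<integral>x. (q x)\<^sup>2 \<partial>M))"
  have lam: "lam0 * (\<integral>x. q x * q x \<partial>M) = (\<integral>x. r x * q x \<partial>M)"
  proof (cases "(\<integral>x. (q x)\<^sup>2 \<partial>M) = 0")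
    case True
    with integral_Cauchy_Schwarz[OF Lr Lq] have "(\<integral>x. r x * q x \<partial>M)\<^sup>2 \<le> 0" by simp
    then show ?thesis using True by (simp add: lam0_def)
  qed (simp add: lam0_def power2_eq_square)
  define u where "u = (\<lambda>x. r x - lam0 * q x)"
  have Lu: "L2 M u" unfolding u_def by (intro L2_diff L2_scale Lr Lq)
  have lin: "(\<integral>x. u x * w x \<partial>M) = (\<integral>x. r x * w x \<partial>M) - lam0 * (\<integral>x. q x * w x \<partial>M)" if "L2 M w" for w
  proof -
    have "(\<integral>x. u x * w x \<partial>M) = (\<integral>x. r x * w x - lam0 * (q x * w x) \<partial>M)"
      by (simp add: u_def algebra_simps)
    then show ?thesis using that Lr Lq by (simp add: L2_mult_integrable)
  qed
  have uI: "(\<integral>x. u x * \<phi> j x \<partial>M) = 0" if "j \<in> I" for j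
    using lin[of "\<phi> j"] insert.prems(1)[of j] that rI qI by simp
  have um: "(\<integral>x. u x * \<phi> m x \<partial>M) = 0"
    using orth[OF Lu uI] lin[OF Lq] lam by simp
  define c' where "c' = (\<lambda>i. if i = m then lam0 else c i - lam0 * e i)"
  have "u x = f x - (\<Sum>i\<in>insert m I. c' i * \<phi> i x)" for x
  proof -
    have "(\<Sum>i\<in>I. c' i * \<phi> i x) = (\<Sum>i\<in>I. c i * \<phi> i x) - lam0 * (\<Sum>i\<in>I. e i * \<phi> i x)"
      using insert.hyps unfolding c'_def
      by (simp add: sum_distrib_left sum_subtractf[symmetric]) (intro sum.cong; auto simp: algebra_simps)
    then show ?thesis using insert.hyps by (simp add: u_def r_def q_def c'_def algebra_simps)
  qed
  then show ?case using uI um by (intro exI[of _ c']) auto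
qed auto

lemma measurable_std_gaussian2: "sets (std_gaussian2 d) = sets (lborel_R d \<Otimes>\<^sub>M lborel_R d)"
  by (intro sets_pair_measure_cong) auto

lemma measurable_gauss [simp]: "borel_measurable (std_gaussian d) = borel_measurable (lborel_R d)"
  by (rule measurable_cong_sets) auto

lemma measurable_gauss2 [simp]: "borel_measurable (std_gaussian2 d) = borel_measurable (lborel_R d \<Otimes>\<^sub>M lborel_R d)"
  by (rule measurable_cong_sets) (auto simp: measurable_std_gaussian2)

lemma integral_rot:
  assumes cs: "c\<^sup>2 + s\<^sup>2 = 1" "c > -1" and G: "(G :: _ \<Rightarrow> real) \<in> borel_measurable (lborel_R d \<Otimes>\<^sub>M lborel_R d)"
  shows "(\<integral>p. G (rot d c s p) \<partial>std_gaussian2 d) = (\<integral>p. G p \<partial>std_gaussian2 d)" (is ?A)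
    and "integrable (std_gaussian2 d) (\<lambda>p. G (rot d c s p)) \<longleftrightarrow> integrable (std_gaussian2 d) G" (is ?B)
proof -
  have r: "rot d c s \<in> measurable (std_gaussian2 d) (std_gaussian2 d)" by measurable
  have G': "G \<in> borel_measurable (std_gaussian2 d)" using G by simp
  show ?A using integral_distr[OF r G'] by (simp add: distr_rot[OF cs])
  show ?B using integrable_distr_eq[OF r G'] by (simp add: distr_rot[OF cs])
qed

lemma integral_fst_std_gaussian2:
  assumes g: "g \<in> borel_measurable (lborel_R d)"
  shows "(\<integral>p. g (fst p) \<partial>std_gaussian2 d) = (\<integral>x. (g x :: real) \<partial>std_gaussian d)" (is ?A)
    and "integrable (std_gaussian2 d) (\<lambda>p. g (fst p)) \<longleftrightarrow> integrable (std_gaussian d) g" (is ?B)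
proof -
  have r: "fst \<in> measurable (std_gaussian2 d) (std_gaussian d)" by measurable
  have G': "g \<in> borel_measurable (std_gaussian d)" using g by simp
  show ?A using integral_distr[OF r G'] by (simp add: N.distr_pair_fst)
  show ?B using integrable_distr_eq[OF r G'] by (simp add: N.distr_pair_fst)
qed

lemma integral_lc_std_gaussian2:
  assumes cs: "c\<^sup>2 + s\<^sup>2 = 1" "c > -1" and g[measurable]: "g \<in> borel_measurable (lborel_R d)"
  shows "(\<integral>p. g (lc d c (fst p) s (snd p)) \<partial>std_gaussian2 d) = (\<integral>x. (g x :: real) \<partial>std_gaussian d)"
    and "integrable (std_gaussian2 d) (\<lambda>p. g (lc d c (fst p) s (snd p))) \<longleftrightarrow> integrable (std_gaussian d) g"
  using integral_rot[OF cs, of "\<lambda>p. g (fst p)" d] integral_fst_std_gaussian2[OF g]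
  by (simp_all add: rot_def)

lemma L2_lc:
  assumes cs: "c\<^sup>2 + s\<^sup>2 = 1" "c > -1" and g: "L2 (std_gaussian d) g"
  shows "L2 (std_gaussian2 d) (\<lambda>p. g (lc d c (fst p) s (snd p)))"
proof -
  have [measurable]: "g \<in> borel_measurable (lborel_R d)" using g by (simp add: L2_def)
  show ?thesis using integral_lc_std_gaussian2(2)[OF cs, of "\<lambda>x. (g x)\<^sup>2" d] g
    unfolding L2_def by simp
qed

lemma L2_fst:
  assumes g: "L2 (std_gaussian d) g"
  shows "L2 (std_gaussian2 d) (\<lambda>p. g (fst p))"
proof -
  have [measurable]: "g \<in> borel_measurable (lborel_R d)" using g by (simp add: L2_def)
  show ?thesis using integral_fst_std_gaussian2(2)[of "\<lambda>x. (g x)\<^sup>2" d] g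
    unfolding L2_def by simp
qed

text \<open>The Ornstein-Uhlenbeck operator at correlation \<open>c\<close>.\<close>

definition noise_op :: "nat \<Rightarrow> real \<Rightarrow> ((nat \<Rightarrow> real) \<Rightarrow> real) \<Rightarrow> (nat \<Rightarrow> real) \<Rightarrow> real" where
  "noise_op d c g x = (\<integral>z. g (lc d c x (sqrt (1 - c\<^sup>2)) z) \<partial>std_gaussian d)"

text \<open>The bilinear form of that operator, taken over the product space because rotations act
  there; \<open>noise_form_op\<close> relates the two.\<close>

definition noise_form :: "nat \<Rightarrow> real \<Rightarrow> ((nat \<Rightarrow> real) \<Rightarrow> real) \<Rightarrow> ((nat \<Rightarrow> real) \<Rightarrow> real) \<Rightarrow> real" where
  "noise_form d c g h = (\<integral>p. g (lc d c (fst p) (sqrt (1 - c\<^sup>2)) (snd p)) * h (fst p) \<partial>std_gaussian2 d)"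

lemma sqrt_one_minus: "0 \<le> c \<Longrightarrow> c \<le> 1 \<Longrightarrow> c\<^sup>2 + (sqrt (1 - c\<^sup>2))\<^sup>2 = 1"
  by (simp add: power_le_one)

context
  fixes d :: nat and c :: real
  assumes c: "0 \<le> c" "c \<le> 1"
begin

lemma c_cs: "c\<^sup>2 + (sqrt (1 - c\<^sup>2))\<^sup>2 = 1" "c > -1"
  using sqrt_one_minus[OF c] c by auto

lemma noise_form_integrable:
  assumes "L2 (std_gaussian d) g" "L2 (std_gaussian d) h"
  shows "integrable (std_gaussian2 d) (\<lambda>p. g (lc d c (fst p) (sqrt (1 - c\<^sup>2)) (snd p)) * h (fst p))"
  by (intro L2_mult_integrable L2_lc L2_fst c_cs assms)

lemma noise_form_op:
  assumes "L2 (std_gaussian d) g" "L2 (std_gaussian d) h"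
  shows "noise_form d c g h = (\<integral>x. noise_op d c g x * h x \<partial>std_gaussian d)"
  unfolding noise_form_def NN.integral_fst'[OF noise_form_integrable[OF assms], symmetric]
  by (simp add: noise_op_def)

lemma noise_op_L2:
  assumes g: "L2 (std_gaussian d) g"
  shows "L2 (std_gaussian d) (noise_op d c g)" (is ?A)
    and "(\<integral>x. (noise_op d c g x)\<^sup>2 \<partial>std_gaussian d) \<le> (\<integral>x. (g x)\<^sup>2 \<partial>std_gaussian d)" (is ?B)
    and "AE x in std_gaussian d. L2 (std_gaussian d) (\<lambda>z. g (lc d c x (sqrt (1 - c\<^sup>2)) z))" (is ?C)
proof -
  let ?s = "sqrt (1 - c\<^sup>2)"
  have gm[measurable]: "g \<in> borel_measurable (lborel_R d)" using g by (simp add: L2_def)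
  have L: "L2 (std_gaussian2 d) (\<lambda>p. g (lc d c (fst p) ?s (snd p)))"
    by (rule L2_lc[OF c_cs g])
  then have int: "integrable (std_gaussian2 d) (\<lambda>p. (g (lc d c (fst p) ?s (snd p)))\<^sup>2)"
    by (simp add: L2_def)
  from NN.AE_integrable_fst'[OF int] AE_space show C: ?C
  proof eventually_elim
    case (elim x)
    then have "x \<in> R_space d" by (simp add: space_lborel_R)
    then have "(\<lambda>z. g (lc d c x ?s z)) \<in> borel_measurable (lborel_R d)" by measurable
    with elim show ?case by (simp add: L2_def)
  qed
  have m: "noise_op d c g \<in> borel_measurable (lborel_R d)"
  proof -
    have "(\<lambda>x. \<integral>z. g (lc d c x ?s z) \<partial>std_gaussian d) \<in> borel_measurable (lborel_R d)" by measurable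
    then show ?thesis by (simp add: noise_op_def [abs_def])
  qed
  have le: "AE x in std_gaussian d. (noise_op d c g x)\<^sup>2 \<le> (\<integral>z. (g (lc d c x ?s z))\<^sup>2 \<partial>std_gaussian d)"
    using C by eventually_elim (simp add: noise_op_def N.integral_power2_le)
  have int1: "integrable (std_gaussian d) (\<lambda>x. \<integral>z. (g (lc d c x ?s z))\<^sup>2 \<partial>std_gaussian d)"
    using NN.integrable_fst'[OF int] by simp
  have int2: "integrable (std_gaussian d) (\<lambda>x. (noise_op d c g x)\<^sup>2)"
  proof (rule Bochner_Integration.integrable_bound[OF int1])
    show "(\<lambda>x. (noise_op d c g x)\<^sup>2) \<in> borel_measurable (std_gaussian d)" using m by simp
    show "AE x in std_gaussian d. norm ((noise_op d c g x)\<^sup>2) \<le> norm (\<integral>z. (g (lc d c x ?s z))\<^sup>2 \<partial>std_gaussian d)"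
      using le by eventually_elim simp
  qed
  show ?A using m int2 by (simp add: L2_def)
  have "(\<integral>x. (noise_op d c g x)\<^sup>2 \<partial>std_gaussian d) \<le> (\<integral>x. (\<integral>z. (g (lc d c x ?s z))\<^sup>2 \<partial>std_gaussian d) \<partial>std_gaussian d)"
    by (intro integral_mono_AE int1 int2 le)
  also have "\<dots> = (\<integral>p. (g (lc d c (fst p) ?s (snd p)))\<^sup>2 \<partial>std_gaussian2 d)"
    using NN.integral_fst'[OF int] by simp
  also have "\<dots> = (\<integral>x. (g x)\<^sup>2 \<partial>std_gaussian d)"
    using integral_lc_std_gaussian2(1)[OF c_cs, of "\<lambda>x. (g x)\<^sup>2" d] by simp
  finally show ?B .
qed

text \<open>The rotation with cosine \<open>c\<close> carries the correlated pair to itself in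
  reverse order, up to the sign of the noise; the reflection \<open>z \<mapsto> -z\<close> repairs
  the sign.\<close>

lemma noise_form_commute:
  assumes g: "L2 (std_gaussian d) g" and h: "L2 (std_gaussian d) h"
  shows "noise_form d c g h = noise_form d c h g"
proof -
  let ?s = "sqrt (1 - c\<^sup>2)"
  have [measurable]: "g \<in> borel_measurable (lborel_R d)" "h \<in> borel_measurable (lborel_R d)"
    using g h by (auto simp: L2_def)
  let ?H = "\<lambda>p. g (lc d c (fst p) (- ?s) (snd p)) * h (fst p)"
  have cs': "c\<^sup>2 + (- ?s)\<^sup>2 = 1" using c_cs by simp
  have intH: "integrable (std_gaussian2 d) ?H"
    by (intro L2_mult_integrable L2_lc[OF cs' c_cs(2)] L2_fst assms)
  have rotp: "g (lc d c (fst (rot d c ?s p)) (- ?s) (snd (rot d c ?s p))) = g (fst p)" if "p \<in> space (std_gaussian2 d)" for p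
  proof -
    have "lc d c (fst (rot d c ?s p)) (- ?s) (snd (rot d c ?s p)) = lc d 1 (fst p) 0 (snd p)"
      unfolding rot_def fst_conv snd_conv lc_lc using c_cs(1) by (simp add: power2_eq_square)
    also have "\<dots> = fst p"
      using that by (auto simp: lc_def space_pair_measure extensional_def)
    finally show ?thesis by simp
  qed
  have "noise_form d c h g = (\<integral>p. ?H (rot d c ?s p) \<partial>std_gaussian2 d)"
    unfolding noise_form_def
    by (intro Bochner_Integration.integral_cong refl) (subst rotp, auto simp: rot_def mult.commute)
  also have "\<dots> = (\<integral>p. ?H p \<partial>std_gaussian2 d)"
    by (intro integral_rot c_cs) measurable
  also have "\<dots> = (\<integral>x. (\<integral>z. g (lc d c x (- ?s) z) * h x \<partial>std_gaussian d) \<partial>std_gaussian d)"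
    using NN.integral_fst'[OF intH] by simp
  also have "\<dots> = (\<integral>x. (\<integral>z. g (lc d c x ?s z) * h x \<partial>std_gaussian d) \<partial>std_gaussian d)"
  proof (rule Bochner_Integration.integral_cong[OF refl])
    fix x assume "x \<in> space (std_gaussian d)"
    then have x: "x \<in> R_space d" by (simp add: space_lborel_R)
    then have gx: "(\<lambda>z. g (lc d c x ?s z) * h x) \<in> borel_measurable (lborel_R d)" by measurable
    have r: "(\<lambda>x. \<lambda>i\<in>{..<d}. - x i) \<in> measurable (lborel_R d) (lborel_R d)"
      by (intro measurable_restrict) auto
    have "lc d c x ?s (\<lambda>i\<in>{..<d}. - z i) = lc d c x (- ?s) z" for z
      by (auto simp: lc_def)
    moreover have "(\<integral>z. g (lc d c x ?s z) * h x \<partial>distr (std_gaussian d) (std_gaussian d) (\<lambda>x. \<lambda>i\<in>{..<d}. - x i)) =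
        (\<integral>z. g (lc d c x ?s (\<lambda>i\<in>{..<d}. - z i)) * h x \<partial>std_gaussian d)"
      using gx r by (intro integral_distr) auto
    ultimately show "(\<integral>z. g (lc d c x (- ?s) z) * h x \<partial>std_gaussian d) = (\<integral>z. g (lc d c x ?s z) * h x \<partial>std_gaussian d)"
      by (simp only: distr_reflect)
  qed
  also have "\<dots> = noise_form d c g h"
    unfolding noise_form_def using NN.integral_fst'[OF noise_form_integrable[OF assms]] by simp
  finally show ?thesis ..
qed

text \<open>Semigroup law. Two independent noises combine as
  \<open>c * ?s * z + ?s * z' = r * z''\<close> with
  \<open>r\<^sup>2 = 1 - (c\<^sup>2)\<^sup>2\<close>, and a rotation shows \<open>z''\<close> to be
  standard. Integrability of the section at \<open>x\<close>, which Fubini needs, holds for almost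
  every \<open>x\<close>.\<close>

lemma noise_op_noise_op:
  assumes g: "L2 (std_gaussian d) g" and "c < 1"
  shows "AE x in std_gaussian d. noise_op d c (noise_op d c g) x = noise_op d (c\<^sup>2) g x"
proof -
  let ?s = "sqrt (1 - c\<^sup>2)"
  have [measurable]: "g \<in> borel_measurable (lborel_R d)" using g by (simp add: L2_def)
  have c2: "0 \<le> c\<^sup>2" "c\<^sup>2 \<le> 1" using c by (auto simp: power_le_one)
  define r where "r = sqrt (1 - (c\<^sup>2)\<^sup>2)"
  have c21: "c\<^sup>2 < 1" using \<open>c < 1\<close> c by (simp add: power_less_one_iff)
  then have c41: "(c\<^sup>2)\<^sup>2 < 1" using c2 power_strict_mono[of "c\<^sup>2" 1 2] by simp
  have r: "r > 0" "r\<^sup>2 = 1 - (c\<^sup>2)\<^sup>2" using c41 by (auto simp: r_def)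
  have cs2: "(c\<^sup>2)\<^sup>2 + r\<^sup>2 = 1" "c\<^sup>2 > -1"
    using r(2) less_le_trans[OF _ c2(1), of "-1"] by simp_all
  have L: "L2 (std_gaussian2 d) (\<lambda>p. g (lc d (c\<^sup>2) (fst p) r (snd p)))"
    by (rule L2_lc[OF cs2 g])
  from NN.AE_integrable_fst'[OF NN.L2_integrable[OF L]] AE_space show ?thesis
  proof eventually_elim
    case (elim x)
    then have x: "x \<in> R_space d" by (simp add: space_lborel_R)
    let ?G = "\<lambda>p. g (lc d (c\<^sup>2) x r (fst p))"
    have [measurable]: "?G \<in> borel_measurable (lborel_R d \<Otimes>\<^sub>M lborel_R d)"
      using x by measurable
    have cs3: "(c * ?s / r)\<^sup>2 + (?s / r)\<^sup>2 = 1" "c * ?s / r > -1"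
    proof -
      have "(c * ?s / r)\<^sup>2 + (?s / r)\<^sup>2 = (c\<^sup>2 + 1) * ?s\<^sup>2 / r\<^sup>2"
        by (simp add: power_divide power_mult_distrib add_divide_distrib[symmetric] algebra_simps)
      also have "\<dots> = (c\<^sup>2 + 1) * (1 - c\<^sup>2) / (1 - (c\<^sup>2)\<^sup>2)" using c21 by (simp add: r)
      also have "\<dots> = 1" using c41 by (simp add: field_simps power2_eq_square)
      finally show "(c * ?s / r)\<^sup>2 + (?s / r)\<^sup>2 = 1" .
      have "c * ?s / r \<ge> 0" using c r c21 by simp
      then show "c * ?s / r > -1" by linarith
    qed
    have intG: "integrable (std_gaussian2 d) ?G"
      using elim x integral_fst_std_gaussian2(2)[of "\<lambda>z. g (lc d (c\<^sup>2) x r z)" d] by simp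
    have "integrable (std_gaussian2 d) (\<lambda>p. ?G (rot d (c * ?s / r) (?s / r) p))"
      using integral_rot(2)[OF cs3, of ?G d] intG by simp
    moreover have eq: "?G (rot d (c * ?s / r) (?s / r) p) = g (lc d c (lc d c x ?s (fst p)) ?s (snd p))" for p
    proof -
      have "lc d (c\<^sup>2) x r (fst (rot d (c * ?s / r) (?s / r) p)) = lc d c (lc d c x ?s (fst p)) ?s (snd p)"
        using r(1) by (auto simp: rot_def lc_def algebra_simps power2_eq_square intro!: restrict_ext)
      then show ?thesis by simp
    qed
    ultimately have "integrable (std_gaussian2 d) (\<lambda>p. g (lc d c (lc d c x ?s (fst p)) ?s (snd p)))" by simp
    from NN.integral_fst'[OF this]
    have "noise_op d c (noise_op d c g) x = (\<integral>p. g (lc d c (lc d c x ?s (fst p)) ?s (snd p)) \<partial>std_gaussian2 d)"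
      by (simp add: noise_op_def)
    also have "\<dots> = (\<integral>p. ?G (rot d (c * ?s / r) (?s / r) p) \<partial>std_gaussian2 d)"
      by (simp only: eq)
    also have "\<dots> = (\<integral>p. ?G p \<partial>std_gaussian2 d)" by (intro integral_rot cs3) measurable
    also have "\<dots> = noise_op d (c\<^sup>2) g x"
      using x by (subst integral_fst_std_gaussian2(1)) (auto simp: noise_op_def r_def)
    finally show ?case .
  qed
qed

end

text \<open>Consequence of the semigroup law and self-adjointness; the second half is log-convexity of
  the noise form along \<open>c \<mapsto> c\<^sup>2\<close>.\<close>
lemma noise_form_square:
  assumes c: "0 \<le> c" "c < 1" and g: "L2 (std_gaussian d) g"
  shows "noise_form d (c\<^sup>2) g g = (\<integral>x. (noise_op d c g x)\<^sup>2 \<partial>std_gaussian d)" (is ?A)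
    and "(noise_form d c g g)\<^sup>2 \<le> (\<integral>x. (g x)\<^sup>2 \<partial>std_gaussian d) * noise_form d (c\<^sup>2) g g" (is ?B)
proof -
  have c': "0 \<le> c" "c \<le> 1" and c2: "0 \<le> c\<^sup>2" "c\<^sup>2 \<le> 1" using c by (auto simp: power_le_one)
  have Pg: "L2 (std_gaussian d) (noise_op d c g)" by (rule noise_op_L2(1)[OF c' g])
  have "(\<integral>x. (noise_op d c g x)\<^sup>2 \<partial>std_gaussian d) = noise_form d c g (noise_op d c g)"
    by (simp add: noise_form_op[OF c' g Pg] power2_eq_square)
  also have "\<dots> = noise_form d c (noise_op d c g) g" by (rule noise_form_commute[OF c' g Pg])
  also have "\<dots> = (\<integral>x. noise_op d c (noise_op d c g) x * g x \<partial>std_gaussian d)"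
    by (rule noise_form_op[OF c' Pg g])
  also have "\<dots> = (\<integral>x. noise_op d (c\<^sup>2) g x * g x \<partial>std_gaussian d)"
  proof (rule integral_cong_AE)
    have g1: "g \<in> borel_measurable (std_gaussian d)" using g by (simp add: L2_def)
    have g2: "noise_op d c (noise_op d c g) \<in> borel_measurable (std_gaussian d)"
      using noise_op_L2(1)[OF c' Pg] by (simp add: L2_def)
    have "L2 (std_gaussian d) (noise_op d (c\<^sup>2) g)" 
      by (rule noise_op_L2(1)[OF c2 g])
    then have g3: "noise_op d (c\<^sup>2) g \<in> borel_measurable (std_gaussian d)" by (simp add: L2_def)
    show "(\<lambda>x. noise_op d c (noise_op d c g) x * g x) \<in> borel_measurable (std_gaussian d)"
      "(\<lambda>x. noise_op d (c\<^sup>2) g x * g x) \<in> borel_measurable (std_gaussian d)"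
      using g1 g2 g3 by auto
    show "AE x in std_gaussian d. noise_op d c (noise_op d c g) x * g x = noise_op d (c\<^sup>2) g x * g x"
      using noise_op_noise_op[OF c' g c(2)] by eventually_elim simp
  qed
  also have "\<dots> = noise_form d (c\<^sup>2) g g" by (rule noise_form_op[OF c2 g g, symmetric])
  finally show A: ?A ..
  have "(noise_form d c g g)\<^sup>2 = (\<integral>x. noise_op d c g x * g x \<partial>std_gaussian d)\<^sup>2"
    by (simp add: noise_form_op[OF c' g g])
  also have "\<dots> \<le> (\<integral>x. (noise_op d c g x)\<^sup>2 \<partial>std_gaussian d) * (\<integral>x. (g x)\<^sup>2 \<partial>std_gaussian d)"
    by (rule integral_Cauchy_Schwarz[OF Pg g])
  finally show ?B by (simp add: A mult.commute)
qed

section \<open>Low-degree approximation\<close>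

text \<open>The exponent of the Mehler kernel: divided by \<open>sqrt (1 - c\<^sup>2) ^ d\<close>,
  its exponential is the density of the noisy copy of \<open>x\<close> relative to the standard
  Gaussian, as \<open>distr_lc_mehler\<close> shows.\<close>

definition mehler :: "nat \<Rightarrow> real \<Rightarrow> (nat \<Rightarrow> real) \<Rightarrow> (nat \<Rightarrow> real) \<Rightarrow> real" where
  "mehler d c x y = - (c\<^sup>2 * (norm2 d x + norm2 d y) - 2 * c * inner_R d x y) / (2 * (1 - c\<^sup>2))"

lemma measurable_mehler [measurable]:
  "(\<lambda>p. mehler d c (fst p) (snd p)) \<in> borel_measurable (lborel_R d \<Otimes>\<^sub>M lborel_R d)"
  "x \<in> R_space d \<Longrightarrow> mehler d c x \<in> borel_measurable (lborel_R d)"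
  unfolding mehler_def [abs_def] by measurable

lemma bipoly_mehler: "bipoly d 2 (mehler d c)"
proof -
  have "bipoly d 2 (\<lambda>x y. (- c\<^sup>2 / (2 * (1 - c\<^sup>2))) * (norm2 d x + norm2 d y) + (2 * c / (2 * (1 - c\<^sup>2))) * inner_R d x y)"
    by (intro bipoly.add bipoly_scale bipoly_left bipoly_right poly_fun_norm2 bipoly_inner)
  also have "(\<lambda>x y. (- c\<^sup>2 / (2 * (1 - c\<^sup>2))) * (norm2 d x + norm2 d y) + (2 * c / (2 * (1 - c\<^sup>2))) * inner_R d x y) = mehler d c"
    by (intro ext) (simp add: mehler_def diff_divide_distrib add_divide_distrib algebra_simps)
  finally show ?thesis .
qed

lemma abs_inner_R_le: "\<bar>inner_R d x y\<bar> \<le> (norm2 d x + norm2 d y) / 2"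
proof -
  have "\<bar>inner_R d x y\<bar> \<le> (\<Sum>i<d. \<bar>x i * y i\<bar>)" unfolding inner_R_def by (rule sum_abs)
  also have "\<dots> \<le> (\<Sum>i<d. ((x i)\<^sup>2 + (y i)\<^sup>2) / 2)"
  proof (rule sum_mono)
    fix i
    show "\<bar>x i * y i\<bar> \<le> ((x i)\<^sup>2 + (y i)\<^sup>2) / 2"
      using sum_squares_bound[of "\<bar>x i\<bar>" "\<bar>y i\<bar>"] by (simp add: abs_mult)
  qed
  also have "\<dots> = (norm2 d x + norm2 d y) / 2"
    by (simp add: norm2_def sum.distrib sum_divide_distrib[symmetric])
  finally show ?thesis .
qed

text \<open>The factor \<open>c\<close> turns the Taylor remainder of order \<open>k + 1\<close> of
  the kernel into a multiple of \<open>c ^ (k + 1)\<close>. The range \<open>c \<le> 1/2\<close>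
  gives \<open>c + 1 \<le> 2 * (1 - c\<^sup>2)\<close>, which absorbs the denominator.\<close>

lemma abs_mehler_le:
  assumes "0 \<le> c" "c \<le> 1/2"
  shows "\<bar>mehler d c x y\<bar> \<le> c * (norm2 d x + norm2 d y)"
proof -
  let ?u = "norm2 d x + norm2 d y"
  have u: "?u \<ge> 0" by simp
  have c2: "1 - c\<^sup>2 > 0" "1 - c \<noteq> 0"
  proof -
    have "c\<^sup>2 \<le> (1/2)\<^sup>2" using assms by (intro power_mono) auto
    then show "1 - c\<^sup>2 > 0" by (simp add: power2_eq_square)
  qed (use assms in auto)
  have "\<bar>c\<^sup>2 * ?u - 2 * c * inner_R d x y\<bar> \<le> c\<^sup>2 * ?u + c * ?u"
  proof -
    have "\<bar>c * inner_R d x y\<bar> \<le> c * (?u / 2)"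
      unfolding abs_mult using assms abs_inner_R_le[of d x y] by (intro mult_mono) auto
    moreover have "\<bar>c\<^sup>2 * ?u - 2 * c * inner_R d x y\<bar> \<le> \<bar>c\<^sup>2 * ?u\<bar> + 2 * \<bar>c * inner_R d x y\<bar>"
      using abs_triangle_ineq4[of "c\<^sup>2 * ?u" "2 * c * inner_R d x y"] by (simp add: abs_mult)
    moreover have "\<bar>c\<^sup>2 * ?u\<bar> = c\<^sup>2 * ?u" using u by simp
    ultimately show ?thesis by linarith
  qed
  also have "\<dots> \<le> c * ?u * (2 * (1 - c\<^sup>2))"
  proof -
    have "c + 1 \<le> 2 * (1 - c\<^sup>2)"
    proof -
      have "2 * c\<^sup>2 \<le> c" using mult_right_mono[of "2 * c" 1 c] assms by (simp add: power2_eq_square)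
      then show ?thesis using assms by simp
    qed
    then have "(c * ?u) * (c + 1) \<le> (c * ?u) * (2 * (1 - c\<^sup>2))" using assms u by (intro mult_left_mono) auto
    then show ?thesis by (simp add: power2_eq_square algebra_simps)
  qed
  finally have "\<bar>c\<^sup>2 * ?u - 2 * c * inner_R d x y\<bar> / (2 * (1 - c\<^sup>2)) \<le> c * ?u"
    using c2 by (simp add: pos_divide_le_eq)
  then show ?thesis using c2 by (simp add: mehler_def abs_divide abs_minus_commute)
qed

text \<open>Substitute \<open>y = c * x + s * z\<close> and complete the square; the fact
  \<open>key\<close> is the resulting pointwise identity of densities.\<close>

lemma distr_lc_mehler:
  assumes c: "0 \<le> c" "c < 1" and x: "x \<in> R_space d"
  shows "distr (std_gaussian d) (lborel_R d) (\<lambda>z. lc d c x (sqrt (1 - c\<^sup>2)) z) =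
    density (std_gaussian d) (\<lambda>y. ennreal (exp (mehler d c x y) / sqrt (1 - c\<^sup>2) ^ d))"
proof -
  define s where "s = sqrt (1 - c\<^sup>2)"
  let ?K = "\<lambda>y. exp (mehler d c x y) / s ^ d"
  have c2: "c\<^sup>2 < 1" using c by (simp add: power_less_one_iff)
  then have s: "s > 0" "1 - c\<^sup>2 = s\<^sup>2" by (auto simp: s_def)
  then have sc: "s\<^sup>2 + c\<^sup>2 = 1" by simp
  have [measurable]: "mehler d c x \<in> borel_measurable (lborel_R d)" using x by measurable
  have lcm[measurable]: "(\<lambda>z. lc d c x s z) \<in> measurable (lborel_R d) (lborel_R d)" using x by measurable
  have "distr (std_gaussian d) (lborel_R d) (\<lambda>z. lc d c x s z) = density (std_gaussian d) (\<lambda>y. ennreal (?K y))"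
  proof (rule measure_eqI)
  fix A assume "A \<in> sets (distr (std_gaussian d) (lborel_R d) (\<lambda>z. lc d c x s z))"
  then have A[measurable]: "A \<in> sets (lborel_R d)" by simp
  have key: "std_dens d (lc d c x s z) * ?K (lc d c x s z) * s ^ d = std_dens d z" for z
  proof -
    let ?y = "lc d c x s z"
    have ny: "norm2 d ?y = c\<^sup>2 * norm2 d x + 2 * c * s * inner_R d x z + s\<^sup>2 * norm2 d z" by (rule norm2_lc)
    have iy: "inner_R d x ?y = c * norm2 d x + s * inner_R d x z"
      by (simp add: inner_R_def norm2_def sum.distrib sum_distrib_left power2_eq_square algebra_simps)
    have "- norm2 d ?y / 2 + mehler d c x ?y =
        - (norm2 d ?y * s\<^sup>2 + c\<^sup>2 * (norm2 d x + norm2 d ?y) - 2 * c * inner_R d x ?y) / (2 * s\<^sup>2)"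
      using s(1) unfolding mehler_def s(2) by (simp add: field_simps)
    also have "norm2 d ?y * s\<^sup>2 + c\<^sup>2 * (norm2 d x + norm2 d ?y) - 2 * c * inner_R d x ?y =
        norm2 d ?y * (s\<^sup>2 + c\<^sup>2) + c\<^sup>2 * norm2 d x - 2 * c * inner_R d x ?y"
      by (simp add: algebra_simps)
    also have "\<dots> = s\<^sup>2 * norm2 d z"
      unfolding sc ny iy by (simp add: algebra_simps power2_eq_square)
    also have "- (s\<^sup>2 * norm2 d z) / (2 * s\<^sup>2) = - norm2 d z / 2" using s(1) by simp
    finally have "exp (- norm2 d ?y / 2) * exp (mehler d c x ?y) = exp (- norm2 d z / 2)"
      by (simp only: exp_add[symmetric])
    then show ?thesis using s(1) by (simp add: std_dens_def)
  qed
  have prodS: "(\<Prod>i<d. \<bar>s\<bar>) = s ^ d" using s by simp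
  have *: "(\<Sum>j\<le>i. (if i = j then s else 0) * z j) = s * z i" for i and z :: "nat \<Rightarrow> real"
    by (subst sum.cong[OF refl, of _ _ "\<lambda>j. if i = j then s * z j else 0"]) auto
  have lceq: "(\<lambda>i\<in>{..<d}. (\<Sum>j\<le>i. (if i = j then s else 0) * z j) + c * x i) = lc d c x s z" for z
    unfolding * by (simp add: lc_def add.commute)
  have "emeasure (density (std_gaussian d) (\<lambda>y. ennreal (?K y))) A =
      (\<integral>\<^sup>+y. ennreal (?K y) * indicator A y \<partial>std_gaussian d)"
    by (intro emeasure_density) auto
  also have "\<dots> = (\<integral>\<^sup>+y. ennreal (std_dens d y) * (ennreal (?K y) * indicator A y) \<partial>lborel_R d)"
    by (intro nn_integral_std_gaussian) measurable
  also have "\<dots> = ennreal (s ^ d) * (\<integral>\<^sup>+z. ennreal (std_dens d (lc d c x s z)) * (ennreal (?K (lc d c x s z)) * indicator A (lc d c x s z)) \<partial>lborel_R d)"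
    using s(1) by (subst nn_integral_lower_triangular[where A = "\<lambda>i j. if i = j then s else 0" and b = "\<lambda>i. c * x i"])
      (auto simp: lceq prodS)
  also have "\<dots> = (\<integral>\<^sup>+z. ennreal (s ^ d) * (ennreal (std_dens d (lc d c x s z)) * (ennreal (?K (lc d c x s z)) * indicator A (lc d c x s z))) \<partial>lborel_R d)"
    by (intro nn_integral_cmult[symmetric]) measurable
  also have "\<dots> = (\<integral>\<^sup>+z. ennreal (std_dens d z) * indicator A (lc d c x s z) \<partial>lborel_R d)"
  proof (rule nn_integral_cong)
    fix z
    have "ennreal (s ^ d) * (ennreal (std_dens d (lc d c x s z)) * ennreal (?K (lc d c x s z))) = ennreal (std_dens d z)"
      using s(1) unfolding key[of z, symmetric] by (simp add: ennreal_mult[symmetric] mult_ac)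
    then show "ennreal (s ^ d) * (ennreal (std_dens d (lc d c x s z)) * (ennreal (?K (lc d c x s z)) * indicator A (lc d c x s z))) =
        ennreal (std_dens d z) * indicator A (lc d c x s z)"
      by (simp only: mult.assoc[symmetric])
  qed
  also have "\<dots> = (\<integral>\<^sup>+z. indicator A (lc d c x s z) \<partial>std_gaussian d)"
    by (intro nn_integral_std_gaussian[symmetric]) measurable
  also have "\<dots> = emeasure (distr (std_gaussian d) (lborel_R d) (\<lambda>z. lc d c x s z)) A"
    using nn_integral_distr[of "\<lambda>z. lc d c x s z" "std_gaussian d" "lborel_R d" "indicator A"] lcm by simp
  finally show "emeasure (distr (std_gaussian d) (lborel_R d) (\<lambda>z. lc d c x s z)) A =
    emeasure (density (std_gaussian d) (\<lambda>y. ennreal (?K y))) A" ..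
qed simp
  then show ?thesis unfolding s_def .
qed

lemma exp_taylor_remainder: "\<bar>exp (x::real) - (\<Sum>m\<le>k. x ^ m / fact m)\<bar> \<le> \<bar>x\<bar> ^ Suc k / fact (Suc k) * exp \<bar>x\<bar>"
proof -
  obtain t where t: "\<bar>t\<bar> \<le> \<bar>x\<bar>" "exp x = (\<Sum>m<Suc k. x ^ m / fact m) + exp t / fact (Suc k) * x ^ Suc k"
    using Maclaurin_exp_le[of x "Suc k"] by blast
  have "exp x - (\<Sum>m\<le>k. x ^ m / fact m) = exp t / fact (Suc k) * x ^ Suc k"
    using t(2) by (simp only: lessThan_Suc_atMost)
  then have "\<bar>exp x - (\<Sum>m\<le>k. x ^ m / fact m)\<bar> = \<bar>x\<bar> ^ Suc k / fact (Suc k) * exp t"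
    by (simp add: abs_mult power_abs)
  also have "\<dots> \<le> \<bar>x\<bar> ^ Suc k / fact (Suc k) * exp \<bar>x\<bar>"
    using t(1) by (intro mult_left_mono) (auto simp del: fact_Suc power_Suc)
  finally show ?thesis .
qed

lemma power_div_fact_le_exp:
  assumes "0 \<le> (x :: real)"
  shows "x ^ n / fact n \<le> exp x"
proof -
  obtain t where "exp x = (\<Sum>m<Suc n. x ^ m / fact m) + exp t / fact (Suc n) * x ^ Suc n"
    using Maclaurin_exp_le[of x "Suc n"] by blast
  moreover have "x ^ n / fact n \<le> (\<Sum>m<Suc n. x ^ m / fact m)"
    using assms by (intro member_le_sum) auto
  moreover have "0 \<le> exp t / fact (Suc n) * x ^ Suc n" using assms by simp
  ultimately show ?thesis by linarith
qed

text \<open>In a product \<open>P x * Q y\<close> of total degree at most \<open>2 * k\<close>, one factor has degree at most \<open>k\<close>.\<close>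
lemma integral_bipoly_orthogonal:
  assumes g: "L2 (std_gaussian d) g"
    and orth: "\<And>p. poly_fun d k p \<Longrightarrow> (\<integral>x. g x * p x \<partial>std_gaussian d) = 0"
    and F: "bipoly d m F" and m: "m \<le> 2 * k"
  shows "integrable (std_gaussian2 d) (\<lambda>p. g (fst p) * g (snd p) * F (fst p) (snd p)) \<and>
    (\<integral>p. g (fst p) * g (snd p) * F (fst p) (snd p) \<partial>std_gaussian2 d) = 0"
  using F m
proof (induction rule: bipoly.induct)
  case (prod a P b Q m)
  have P: "L2 (std_gaussian d) P" and Q: "L2 (std_gaussian d) Q"
    using prod integrable_poly_fun_sq by (auto simp: L2_def measurable_poly_fun)
  have i1: "integrable (std_gaussian d) (\<lambda>x. g x * P x)" and i2: "integrable (std_gaussian d) (\<lambda>x. g x * Q x)"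
    by (auto intro!: L2_mult_integrable g P Q)
  have gPm[measurable]: "(\<lambda>x. g x * P x) \<in> borel_measurable (lborel_R d)" "(\<lambda>x. g x * Q x) \<in> borel_measurable (lborel_R d)"
    using borel_measurable_integrable[OF i1] borel_measurable_integrable[OF i2] by simp_all
  have int: "integrable (std_gaussian2 d) (\<lambda>p. (g (fst p) * P (fst p)) * (g (snd p) * Q (snd p)))"
  proof (rule NN.Fubini_integrable)
    show "(\<lambda>p. (g (fst p) * P (fst p)) * (g (snd p) * Q (snd p))) \<in> borel_measurable (std_gaussian2 d)"
      by (simp del: mult.assoc) measurable
    show "integrable (std_gaussian d) (\<lambda>x. \<integral>y. norm (g (fst (x, y)) * P (fst (x, y)) * (g (snd (x, y)) * Q (snd (x, y)))) \<partial>std_gaussian d)"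
      using integrable_norm[OF i1] by (simp add: norm_mult abs_mult)
    show "AE x in std_gaussian d. integrable (std_gaussian d) (\<lambda>y. g (fst (x, y)) * P (fst (x, y)) * (g (snd (x, y)) * Q (snd (x, y))))"
      using i2 by simp
  qed
  have "(\<integral>p. (g (fst p) * P (fst p)) * (g (snd p) * Q (snd p)) \<partial>std_gaussian2 d) =
      (\<integral>x. g x * P x \<partial>std_gaussian d) * (\<integral>x. g x * Q x \<partial>std_gaussian d)"
    unfolding NN.integral_fst'[OF int, symmetric] by simp
  also have "\<dots> = 0"
  proof -
    have "a \<le> k \<or> b \<le> k" using prod by linarith
    then show ?thesis using orth[OF poly_fun_mono[OF prod(1)]] orth[OF poly_fun_mono[OF prod(2)]] by auto
  qed
  finally show ?case using int by (simp add: mult_ac)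
next
  case (add m F G)
  then show ?case by (simp add: distrib_left)
qed

text \<open>A function orthogonal to all polynomials of degree at most \<open>k\<close> kills the first terms of the
  Taylor expansion of the Mehler kernel. The dimension-dependent constant is removed later by
  log-convexity.\<close>
lemma noise_form_small:
  assumes g: "L2 (std_gaussian d) g"
    and orth: "\<And>p. poly_fun d k p \<Longrightarrow> (\<integral>x. g x * p x \<partial>std_gaussian d) = 0"
  shows "\<exists>C\<ge>0. \<forall>c. 0 \<le> c \<longrightarrow> c \<le> 1/16 \<longrightarrow> noise_form d c g g \<le> C * c ^ Suc k"
proof -
  let ?N = "std_gaussian d"
  have gm[measurable]: "g \<in> borel_measurable (lborel_R d)" using g by (simp add: L2_def)
  \<comment> \<open>The square is \<open>exp (norm2 d x / 4)\<close>, within the integrable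
    exponents below 1/2.\<close>
  have E2: "L2 ?N (\<lambda>x. exp (norm2 d x / 8))"
    using integrable_exp_norm2[of "1/4" d] by (auto simp: L2_def power2_eq_square exp_add[symmetric])
  have ig: "integrable ?N (\<lambda>x. \<bar>g x\<bar> * exp (norm2 d x / 8))"
    by (intro L2_mult_integrable L2_abs g E2)
  define I where "I = (\<integral>x. \<bar>g x\<bar> * exp (norm2 d x / 8) \<partial>?N)"
  have I: "I \<ge> 0" unfolding I_def by (rule Bochner_Integration.integral_nonneg) auto
  let ?B = "\<lambda>p. (\<bar>g (fst p)\<bar> * exp (norm2 d (fst p) / 8)) * (\<bar>g (snd p)\<bar> * exp (norm2 d (snd p) / 8))"
  have iB: "integrable (std_gaussian2 d) ?B"
  proof (rule NN.Fubini_integrable)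
    show "?B \<in> borel_measurable (std_gaussian2 d)" by (simp del: mult.assoc) measurable
    show "integrable ?N (\<lambda>x. \<integral>y. norm (?B (x, y)) \<partial>?N)" using ig by (simp add: abs_mult)
    show "AE x in ?N. integrable ?N (\<lambda>y. ?B (x, y))" using ig by simp
  qed
  have IB: "(\<integral>p. ?B p \<partial>std_gaussian2 d) = I * I"
    unfolding NN.integral_fst'[OF iB, symmetric] by (simp add: I_def)
  \<comment> \<open>The power \<open>2 ^ d\<close> bounds the normalisation of the kernel, as
    \<open>?s \<ge> 1/2\<close>. The power of 16 comes from rescaling \<open>?u\<close> by 16: the
    exponential in the remainder and the power divided by the factorial then each cost
    \<open>exp (?u / 16)\<close>, together \<open>exp (?u / 8)\<close>.\<close>
  have "noise_form d c g g \<le> (2 ^ d * 16 ^ Suc k * (I * I)) * c ^ Suc k" if c: "0 \<le> c" "c \<le> 1/16" for c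
  proof -
    let ?s = "sqrt (1 - c\<^sup>2)"
    let ?T = "mehler d c"
    define R where "R = (\<lambda>x y. exp (?T x y) - (\<Sum>m\<le>k. ?T x y ^ m / fact m))"
    have c1: "0 \<le> c" "c < 1" "c \<le> 1" "c \<le> 1/2" using c by auto
    have s: "?s \<ge> 1/2"
    proof (rule real_le_rsqrt)
      have "c\<^sup>2 \<le> (1/16)\<^sup>2" using c by (intro power_mono) auto
      then show "(1/2)\<^sup>2 \<le> 1 - c\<^sup>2" by (simp add: power2_eq_square)
    qed
    have sd: "1 / ?s ^ d \<le> 2 ^ d" "?s ^ d > 0"
    proof -
      have "(1/2) ^ d \<le> ?s ^ d" using s by (intro power_mono) auto
      moreover show "?s ^ d > 0" using s by (intro zero_less_power) linarith
      ultimately show "1 / ?s ^ d \<le> 2 ^ d" by (simp add: power_one_over field_simps)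
    qed
    have Tm: "bipoly d (2 * k) (\<lambda>x y. \<Sum>m\<le>k. ?T x y ^ m / fact m)"
    proof (rule bipoly_sum)
      fix m assume "m \<in> {..k}"
      then have "bipoly d (2 * k) (\<lambda>x y. (1 / fact m) * ?T x y ^ m)"
        by (intro bipoly_scale bipoly_mono[OF bipoly_power[OF bipoly_mehler]]) auto
      then show "bipoly d (2 * k) (\<lambda>x y. ?T x y ^ m / fact m)" by simp
    qed simp
    note kill = integral_bipoly_orthogonal[OF g orth Tm order_refl]
    have Rb: "\<bar>R x y\<bar> \<le> (16 * c) ^ Suc k * (exp (norm2 d x / 8) * exp (norm2 d y / 8))" for x y
    proof -
      let ?u = "norm2 d x + norm2 d y"
      have u: "?u \<ge> 0" by simp
      have T: "\<bar>?T x y\<bar> \<le> c * ?u" by (rule abs_mehler_le) fact+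
      have T2: "c * ?u \<le> ?u / 16" using mult_right_mono[OF c(2) u] by simp
      have "\<bar>R x y\<bar> \<le> \<bar>?T x y\<bar> ^ Suc k / fact (Suc k) * exp \<bar>?T x y\<bar>"
        unfolding R_def by (rule exp_taylor_remainder)
      also have "\<dots> \<le> (c * ?u) ^ Suc k / fact (Suc k) * exp (?u / 16)"
        using T T2 by (intro mult_mono divide_right_mono power_mono) (auto simp del: fact_Suc power_Suc)
      also have "\<dots> = (16 * c) ^ Suc k * ((?u / 16) ^ Suc k / fact (Suc k)) * exp (?u / 16)"
      proof -
        have "(c * ?u) ^ Suc k = (16 * c * (?u / 16)) ^ Suc k" by (simp del: power_Suc)
        also have "\<dots> = (16 * c) ^ Suc k * (?u / 16) ^ Suc k" by (rule power_mult_distrib)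
        finally show ?thesis by (simp only: times_divide_eq_right)
      qed
      also have "\<dots> \<le> (16 * c) ^ Suc k * exp (?u / 16) * exp (?u / 16)"
      proof -
        have "(?u / 16) ^ Suc k / fact (Suc k) \<le> exp (?u / 16)"
          using u by (intro power_div_fact_le_exp) simp
        then show ?thesis using c by (intro mult_right_mono mult_left_mono) (auto simp del: fact_Suc power_Suc)
      qed
      also have "\<dots> = (16 * c) ^ Suc k * (exp (norm2 d x / 8) * exp (norm2 d y / 8))"
        by (simp add: exp_add[symmetric] mult.assoc add_divide_distrib del: power_Suc)
      finally show ?thesis .
    qed
    let ?GR = "\<lambda>p. g (fst p) * g (snd p) * R (fst p) (snd p)"
    have Rm[measurable]: "(\<lambda>p. R (fst p) (snd p)) \<in> borel_measurable (lborel_R d \<Otimes>\<^sub>M lborel_R d)"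
      unfolding R_def by measurable
    have GRb: "\<bar>?GR p\<bar> \<le> (16 * c) ^ Suc k * ?B p" for p
      using mult_left_mono[OF Rb[of "fst p" "snd p"], of "\<bar>g (fst p)\<bar> * \<bar>g (snd p)\<bar>"]
      by (simp add: abs_mult mult_ac del: power_Suc)
    have iGR: "integrable (std_gaussian2 d) ?GR"
    proof (rule Bochner_Integration.integrable_bound)
      show "integrable (std_gaussian2 d) (\<lambda>p. (16 * c) ^ Suc k * ?B p)" using iB by (rule integrable_mult_right)
      show "?GR \<in> borel_measurable (std_gaussian2 d)" by (simp del: mult.assoc) measurable
      show "AE p in std_gaussian2 d. norm (?GR p) \<le> norm ((16 * c) ^ Suc k * ?B p)"
        using GRb by (intro AE_I2) (simp add: order.trans[OF _ abs_ge_self] del: power_Suc)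
    qed
    let ?K = "\<lambda>p. g (fst p) * g (snd p) * exp (?T (fst p) (snd p))"
    have Keq: "?K p = g (fst p) * g (snd p) * (\<Sum>m\<le>k. ?T (fst p) (snd p) ^ m / fact m) + ?GR p" for p
      by (simp add: R_def algebra_simps)
    have iK: "integrable (std_gaussian2 d) ?K"
      unfolding Keq using kill iGR by (intro Bochner_Integration.integrable_add) auto
    have "(\<integral>p. ?K p \<partial>std_gaussian2 d) = 0 + (\<integral>p. ?GR p \<partial>std_gaussian2 d)"
      unfolding Keq using kill iGR by (subst Bochner_Integration.integral_add) auto
    also have "\<dots> \<le> (\<integral>p. (16 * c) ^ Suc k * ?B p \<partial>std_gaussian2 d)"
      using iGR iB GRb by (simp only: add_0, intro integral_mono) (auto intro: order.trans[OF abs_ge_self] simp del: power_Suc)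
    also have "\<dots> = (16 * c) ^ Suc k * (I * I)" using IB by simp
    finally have Kb: "(\<integral>p. ?K p \<partial>std_gaussian2 d) \<le> (16 * c) ^ Suc k * (I * I)" .
    have "noise_form d c g g = (\<integral>x. noise_op d c g x * g x \<partial>?N)"
      by (rule noise_form_op[OF c1(1,3) g g])
    also have "\<dots> = (\<integral>x. (1 / ?s ^ d) * (\<integral>y. ?K (x, y) \<partial>?N) \<partial>?N)"
    proof (rule Bochner_Integration.integral_cong[OF refl])
      fix x assume "x \<in> space ?N"
      then have x: "x \<in> R_space d" by (simp add: space_lborel_R)
      have [measurable]: "mehler d c x \<in> borel_measurable (lborel_R d)" using x by measurable
      have lcm: "(\<lambda>z. lc d c x ?s z) \<in> measurable (lborel_R d) (lborel_R d)" using x by measurable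
      have "noise_op d c g x = (\<integral>y. g y \<partial>distr ?N (lborel_R d) (\<lambda>z. lc d c x ?s z))"
        unfolding noise_op_def using lcm by (subst integral_distr) auto
      also have "\<dots> = (\<integral>y. (exp (mehler d c x y) / ?s ^ d) *\<^sub>R g y \<partial>?N)"
        unfolding distr_lc_mehler[OF c1(1,2) x] using sd by (intro integral_density) auto
      finally have "noise_op d c g x * g x = (\<integral>y. (exp (mehler d c x y) / ?s ^ d) * g y \<partial>?N) * g x" by simp
      also have "\<dots> = (\<integral>y. (exp (mehler d c x y) / ?s ^ d) * g y * g x \<partial>?N)"
        by (rule integral_mult_left_zero[symmetric])
      also have "\<dots> = (\<integral>y. (1 / ?s ^ d) * ?K (x, y) \<partial>?N)"
        by (intro Bochner_Integration.integral_cong refl) simp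
      also have "\<dots> = (1 / ?s ^ d) * (\<integral>y. ?K (x, y) \<partial>?N)"
        by (rule integral_mult_right_zero)
      finally show "noise_op d c g x * g x = (1 / ?s ^ d) * (\<integral>y. ?K (x, y) \<partial>?N)" .
    qed
    also have "\<dots> = (1 / ?s ^ d) * (\<integral>p. ?K p \<partial>std_gaussian2 d)"
      using NN.integral_fst'[OF iK] by simp
    also have "\<dots> \<le> (1 / ?s ^ d) * ((16 * c) ^ Suc k * (I * I))"
      using Kb sd by (intro mult_left_mono) auto
    also have "\<dots> \<le> 2 ^ d * ((16 * c) ^ Suc k * (I * I))"
      using sd c I by (intro mult_right_mono) auto
    also have "\<dots> = (2 ^ d * 16 ^ Suc k * (I * I)) * c ^ Suc k"
      unfolding power_mult_distrib by (simp only: mult_ac)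
    finally show ?thesis .
  qed
  then show ?thesis by (intro exI[of _ "2 ^ d * 16 ^ Suc k * (I * I)"]) (use I in auto)
qed

text \<open>Write \<open>c\<close> as the square of \<open>sqrt c\<close>; the form is then the
  squared norm of a smoothed function.\<close>

lemma noise_form_nonneg:
  assumes c: "0 \<le> c" "c < 1" and g: "L2 (std_gaussian d) g"
  shows "0 \<le> noise_form d c g g"
proof -
  have "sqrt c < 1" using c by simp
  then have "noise_form d ((sqrt c)\<^sup>2) g g = (\<integral>x. (noise_op d (sqrt c) g x)\<^sup>2 \<partial>std_gaussian d)"
    using c by (intro noise_form_square g) auto
  then show ?thesis using c by (simp add: Bochner_Integration.integral_nonneg)
qed

text \<open>Iterated log-convexity gives
  \<open>(?b c / B) ^ (2 ^ m) \<le> ?b (c ^ (2 ^ m)) / B\<close>. Eventually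
  \<open>c ^ (2 ^ m)\<close> enters the range of the crude bound, so the powers
  \<open>u ^ (2 ^ m)\<close> of the ratio \<open>u\<close> stay below \<open>C / B\<close>, which
  forces \<open>u \<le> 1\<close>. This takes the place of a decomposition into Hermite
  eigenspaces.\<close>

lemma noise_form_orthogonal_le:
  assumes g: "L2 (std_gaussian d) g"
    and orth: "\<And>p. poly_fun d k p \<Longrightarrow> (\<integral>x. g x * p x \<partial>std_gaussian d) = 0"
    and c: "0 < c" "c < 1"
  shows "noise_form d c g g \<le> c ^ Suc k * (\<integral>x. (g x)\<^sup>2 \<partial>std_gaussian d)"
proof -
  let ?b = "\<lambda>c. noise_form d c g g"
  define B where "B = (\<integral>x. (g x)\<^sup>2 \<partial>std_gaussian d)"
  have B: "B \<ge> 0" unfolding B_def by (rule Bochner_Integration.integral_nonneg) auto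
  have b0: "?b e \<ge> 0" if "0 \<le> e" "e < 1" for e using noise_form_nonneg[OF that g] .
  have sq: "(?b e)\<^sup>2 \<le> B * ?b (e\<^sup>2)" if "0 \<le> e" "e < 1" for e
    unfolding B_def by (rule noise_form_square(2)[OF that g])
  show ?thesis
  proof (cases "B = 0")
    case True
    then have "?b c = 0" using sq[of c] c by simp
    then show ?thesis using True by (simp add: B_def)
  next
    case False
    with B have Bp: "B > 0" by simp
    obtain C where C: "C \<ge> 0" "\<And>e. 0 \<le> e \<Longrightarrow> e \<le> 1/16 \<Longrightarrow> ?b e \<le> C * e ^ Suc k"
      using noise_form_small[OF g orth] by blast
    have iter: "(?b c / B) ^ (2 ^ m) \<le> ?b (c ^ (2 ^ m)) / B" for m
    proof (induction m)
      case (Suc m)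
      have e: "0 \<le> c ^ (2 ^ m)" "c ^ (2 ^ m) < 1" using c by (auto simp: power_less_one_iff)
      have "(?b c / B) ^ (2 ^ Suc m) = ((?b c / B) ^ (2 ^ m))\<^sup>2" by (metis power_Suc2 power_mult)
      also have "\<dots> \<le> (?b (c ^ (2 ^ m)) / B)\<^sup>2"
        using Suc b0[of c] c Bp by (intro power_mono) auto
      also have "\<dots> \<le> B * ?b ((c ^ (2 ^ m))\<^sup>2) / B\<^sup>2"
        using sq[OF e] unfolding power_divide by (intro divide_right_mono) auto
      also have "\<dots> = ?b (c ^ (2 ^ Suc m)) / B"
        using Bp by (simp add: power2_eq_square[of B] power_mult[symmetric] mult.commute)
      finally show ?case .
    qed simp
    define u where "u = ?b c / (B * c ^ Suc k)"
    have u0: "u \<ge> 0" unfolding u_def using b0[of c] c Bp by simp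
    have "u \<le> 1"
    proof (rule ccontr)
      assume "\<not> u \<le> 1"
      then have u1: "u > 1" by simp
      have "filterlim (\<lambda>m. (2::nat) ^ m) at_top sequentially"
        by (rule filterlim_subseq) (simp add: strict_mono_def)
      then have "(\<lambda>m. c ^ (2 ^ m)) \<longlonglongrightarrow> 0"
        using filterlim_compose[OF LIMSEQ_realpow_zero[of c]] c by simp
      then have "\<forall>\<^sub>F m in sequentially. c ^ (2 ^ m) < 1/16"
        by (rule order_tendstoD) simp
      then obtain M where M: "\<And>m. m \<ge> M \<Longrightarrow> c ^ (2 ^ m) < 1/16"
        by (auto simp: eventually_sequentially)
      have bd: "u ^ (2 ^ m) \<le> C / B" if "m \<ge> M" for m
      proof -
        have "u ^ (2 ^ m) = (?b c / B) ^ (2 ^ m) / (c ^ Suc k) ^ (2 ^ m)"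
          unfolding u_def divide_divide_eq_left[symmetric] by (rule power_divide)
        also have "\<dots> \<le> ?b (c ^ (2 ^ m)) / B / (c ^ Suc k) ^ (2 ^ m)"
          using c by (intro divide_right_mono iter) auto
        also have "\<dots> \<le> C * (c ^ (2 ^ m)) ^ Suc k / B / (c ^ Suc k) ^ (2 ^ m)"
          using C(2)[of "c ^ (2 ^ m)"] M[OF that] c Bp by (intro divide_right_mono) auto
        also have "(c ^ (2 ^ m)) ^ Suc k = (c ^ Suc k) ^ (2 ^ m)"
          by (simp only: power_mult[symmetric] mult.commute)
        also have "C * (c ^ Suc k) ^ (2 ^ m) / B / (c ^ Suc k) ^ (2 ^ m) = C / B"
          using c by simp
        finally show ?thesis .
      qed
      obtain n where n: "C / B < u ^ n" using real_arch_pow[OF u1] by blast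
      have "n \<le> 2 ^ (max M n)"
        using less_exp[of "max M n"] by linarith
      then have "u ^ n \<le> u ^ (2 ^ (max M n))" using u1 by (intro power_increasing) auto
      then show False using n bd[of "max M n"] by simp
    qed
    then show ?thesis unfolding u_def using Bp c by (simp add: pos_divide_le_eq B_def[symmetric] mult_ac)
  qed
qed

lemma noise_op_poly_fun:
  assumes "poly_fun d k p"
  shows "poly_fun d k (noise_op d c p)"
  unfolding noise_op_def using bipoly_integral_snd[OF bipoly_lc[OF assms]] by blast

lemma poly_fun_L2: "poly_fun d k p \<Longrightarrow> L2 (std_gaussian d) p"
  using integrable_poly_fun_sq by (auto simp: L2_def measurable_poly_fun)

text \<open>Here \<open>p\<close> is the projection to degree \<open>k\<close> and \<open>g\<close>
  the residual. Smoothing does not raise degrees, so the mixed noise forms vanish; on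
  \<open>p\<close> the form is at most the squared norm, and on \<open>g\<close> it is smaller by
  the factor \<open>c ^ Suc k\<close>.\<close>

theorem poly_fun_approx:
  assumes f: "L2 (std_gaussian d) f" and c: "0 < c" "c < 1"
  shows "\<exists>p. poly_fun d k p \<and>
    (1 - c ^ Suc k) * (\<integral>x. (f x - p x)\<^sup>2 \<partial>std_gaussian d) \<le> (\<integral>x. (f x)\<^sup>2 \<partial>std_gaussian d) - noise_form d c f f"
proof -
  let ?N = "std_gaussian d"
  have c': "0 \<le> c" "c \<le> 1" using c by auto
  have "\<exists>w. \<forall>l\<in>monomials d k. (\<integral>x. (f x - (\<Sum>l\<in>monomials d k. w l * mono_fun d l x)) * mono_fun d l x \<partial>?N) = 0"
    by (intro L2_projection f poly_fun_L2[OF poly_fun_mono_fun] finite_monomials)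
  then obtain w where w: "\<And>l. l \<in> monomials d k \<Longrightarrow>
      (\<integral>x. (f x - (\<Sum>l\<in>monomials d k. w l * mono_fun d l x)) * mono_fun d l x \<partial>?N) = 0"
    by blast
  define p where "p = (\<lambda>x. \<Sum>l\<in>monomials d k. w l * mono_fun d l x)"
  define g where "g = (\<lambda>x. f x - p x)"
  have p: "poly_fun d k p" unfolding poly_fun_span p_def by blast
  have Lp: "L2 ?N p" by (rule poly_fun_L2[OF p])
  have Lg: "L2 ?N g" unfolding g_def by (intro L2_diff f Lp)
  have orth: "(\<integral>x. g x * q x \<partial>?N) = 0" if q: "poly_fun d k q" for q
  proof -
    from q obtain v where v: "q = (\<lambda>x. \<Sum>l\<in>monomials d k. v l * mono_fun d l x)"
      unfolding poly_fun_span by blast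
    have "(\<integral>x. g x * q x \<partial>?N) = (\<integral>x. (\<Sum>l\<in>monomials d k. v l * (g x * mono_fun d l x)) \<partial>?N)"
      by (intro Bochner_Integration.integral_cong refl) (simp add: v sum_distrib_left mult_ac)
    also have "\<dots> = (\<Sum>l\<in>monomials d k. v l * (\<integral>x. g x * mono_fun d l x \<partial>?N))"
      by (subst Bochner_Integration.integral_sum) (auto intro!: L2_mult_integrable Lg poly_fun_L2[OF poly_fun_mono_fun])
    also have "\<dots> = 0" using w by (simp add: g_def p_def)
    finally show ?thesis .
  qed
  have f_eq: "f = (\<lambda>x. p x + g x)" by (simp add: g_def)
  have "(\<integral>x. (f x)\<^sup>2 \<partial>?N) = (\<integral>x. (p x)\<^sup>2 + 2 * (g x * p x) + (g x)\<^sup>2 \<partial>?N)"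
    by (simp add: f_eq power2_sum algebra_simps)
  also have "\<dots> = (\<integral>x. (p x)\<^sup>2 \<partial>?N) + (\<integral>x. (g x)\<^sup>2 \<partial>?N)"
    using Lp Lg L2_mult_integrable[OF Lg Lp] orth[OF p] by (simp add: L2_def)
  finally have ff: "(\<integral>x. (f x)\<^sup>2 \<partial>?N) = (\<integral>x. (p x)\<^sup>2 \<partial>?N) + (\<integral>x. (g x)\<^sup>2 \<partial>?N)" .
  have "noise_form d c f f = noise_form d c p p + noise_form d c p g + noise_form d c g p + noise_form d c g g"
    using noise_form_integrable[OF c' Lp Lp] noise_form_integrable[OF c' Lp Lg]
      noise_form_integrable[OF c' Lg Lp] noise_form_integrable[OF c' Lg Lg]
    unfolding noise_form_def f_eq distrib_left distrib_right by simp
  moreover have "noise_form d c p g = 0"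
    using orth[OF noise_op_poly_fun[OF p, of c]] by (simp add: noise_form_op[OF c' Lp Lg] mult.commute)
  moreover have "noise_form d c g p = noise_form d c p g" by (rule noise_form_commute[OF c' Lg Lp])
  moreover have "noise_form d c g g \<le> c ^ Suc k * (\<integral>x. (g x)\<^sup>2 \<partial>?N)"
    by (rule noise_form_orthogonal_le[OF Lg orth c])
  moreover have "noise_form d c p p \<le> (\<integral>x. (p x)\<^sup>2 \<partial>?N)"
  proof -
    have P: "(\<integral>x. (p x)\<^sup>2 \<partial>?N) \<ge> 0" by (rule Bochner_Integration.integral_nonneg) auto
    have "(noise_form d c p p)\<^sup>2 \<le> (\<integral>x. (noise_op d c p x)\<^sup>2 \<partial>?N) * (\<integral>x. (p x)\<^sup>2 \<partial>?N)"
      unfolding noise_form_op[OF c' Lp Lp] by (intro integral_Cauchy_Schwarz noise_op_L2 c' Lp)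
    also have "\<dots> \<le> (\<integral>x. (p x)\<^sup>2 \<partial>?N) * (\<integral>x. (p x)\<^sup>2 \<partial>?N)"
      by (intro mult_right_mono noise_op_L2 c' Lp P)
    finally have "(noise_form d c p p)\<^sup>2 \<le> (\<integral>x. (p x)\<^sup>2 \<partial>?N)\<^sup>2" by (simp add: power2_eq_square)
    then show ?thesis using P by (rule power2_le_imp_le)
  qed
  ultimately have "(1 - c ^ Suc k) * (\<integral>x. (g x)\<^sup>2 \<partial>?N) \<le> (\<integral>x. (f x)\<^sup>2 \<partial>?N) - noise_form d c f f"
    unfolding ff by (simp add: left_diff_distrib)
  then show ?thesis using p unfolding g_def by blast
qed

section \<open>Noise sensitivity of Lipschitz functions\<close>

abbreviation nrm :: "nat \<Rightarrow> (nat \<Rightarrow> real) \<Rightarrow> real" where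
  "nrm d x \<equiv> L2_set x {..<d}"

lemma nrm_nonneg [simp]: "0 \<le> nrm d x"
  by (rule L2_set_nonneg)

lemma nrm_power2: "(nrm d x)\<^sup>2 = norm2 d x"
  by (simp add: L2_set_norm2)

lemma nrm_scale: "nrm d (\<lambda>i. a * x i) = \<bar>a\<bar> * nrm d x"
  by (simp add: L2_set_norm2 norm2_def power_mult_distrib sum_distrib_left[symmetric] real_sqrt_mult)

lemma nrm_cong: "(\<And>i. i < d \<Longrightarrow> x i = y i) \<Longrightarrow> nrm d x = nrm d y"
  by (rule L2_set_cong) auto

lemma nrm_lc_le: "nrm d (lc d a x b z) \<le> \<bar>a\<bar> * nrm d x + \<bar>b\<bar> * nrm d z"
proof -
  have "nrm d (lc d a x b z) = nrm d (\<lambda>i. a * x i + b * z i)"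
    by (rule nrm_cong) simp
  also have "\<dots> \<le> nrm d (\<lambda>i. a * x i) + nrm d (\<lambda>i. b * z i)" by (rule L2_set_triangle_ineq)
  finally show ?thesis by (simp add: nrm_scale)
qed

lemma measurable_nrm [measurable]: "nrm d \<in> borel_measurable (lborel_R d)"
  unfolding L2_set_norm2 [abs_def] by measurable

lemma measurable_lborel_R_component [measurable]: "i < d \<Longrightarrow> (\<lambda>x. x i) \<in> borel_measurable (lborel_R d)"
  using measurable_component_singleton[of i "{..<d}" "\<lambda>_. lborel :: real measure"] by simp

lemma integrable_nrm: "integrable (std_gaussian d) (nrm d)"
proof (rule N.L2_integrable)
  show "L2 (std_gaussian d) (nrm d)"
    using integrable_poly_fun[OF poly_fun_norm2] by (simp add: L2_def nrm_power2)
qed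

lemma integrable_bounded_mult:
  fixes F u :: "'a \<Rightarrow> real"
  assumes "integrable M u" "F \<in> borel_measurable M" "\<And>x. \<bar>F x\<bar> \<le> 1"
  shows "integrable M (\<lambda>x. F x * u x)"
proof (rule Bochner_Integration.integrable_bound[OF assms(1)])
  show "(\<lambda>x. F x * u x) \<in> borel_measurable M" using assms by (intro borel_measurable_times) auto
  show "AE x in M. norm (F x * u x) \<le> norm (u x)"
    using assms(3) by (intro AE_I2) (simp add: abs_mult mult_left_le_one_le)
qed

section \<open>Cameron-Martin shifts and Gaussian moments\<close>

lemma distr_translate_std_gaussian:
  shows "distr (std_gaussian d) (lborel_R d) (\<lambda>w. lc d 1 w 1 a) =
    density (std_gaussian d) (\<lambda>y. ennreal (exp (inner_R d a y - norm2 d a / 2)))"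
proof (rule measure_eqI)
  have lcm[measurable]: "(\<lambda>w. lc d 1 w 1 a) \<in> measurable (lborel_R d) (lborel_R d)"
    unfolding lc_def by (intro measurable_restrict) auto
  fix A assume "A \<in> sets (distr (std_gaussian d) (lborel_R d) (\<lambda>w. lc d 1 w 1 a))"
  then have A[measurable]: "A \<in> sets (lborel_R d)" by simp
  let ?K = "\<lambda>y. exp (inner_R d a y - norm2 d a / 2)"
  have key: "std_dens d (lc d 1 w 1 a) * ?K (lc d 1 w 1 a) = std_dens d w" for w
  proof -
    have i: "inner_R d a (lc d 1 w 1 a) = inner_R d w a + norm2 d a"
      by (simp add: inner_R_def norm2_def sum.distrib power2_eq_square algebra_simps)
    have "- norm2 d (lc d 1 w 1 a) / 2 + (inner_R d a (lc d 1 w 1 a) - norm2 d a / 2) = - norm2 d w / 2"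
      unfolding norm2_lc i by (simp add: field_simps)
    then have "exp (- norm2 d (lc d 1 w 1 a) / 2) * ?K (lc d 1 w 1 a) = exp (- norm2 d w / 2)"
      by (simp only: exp_add[symmetric])
    then show ?thesis by (simp add: std_dens_def)
  qed
  have "emeasure (density (std_gaussian d) (\<lambda>y. ennreal (?K y))) A =
      (\<integral>\<^sup>+y. ennreal (?K y) * indicator A y \<partial>std_gaussian d)"
    by (intro emeasure_density) auto
  also have "\<dots> = (\<integral>\<^sup>+y. ennreal (std_dens d y) * (ennreal (?K y) * indicator A y) \<partial>lborel_R d)"
    by (intro nn_integral_std_gaussian) measurable
  also have "\<dots> = (\<integral>\<^sup>+w. ennreal (std_dens d (\<lambda>i\<in>{..<d}. w i + a i)) * (ennreal (?K (\<lambda>i\<in>{..<d}. w i + a i)) * indicator A (\<lambda>i\<in>{..<d}. w i + a i)) \<partial>lborel_R d)"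
    by (rule nn_integral_lborel_R_translate[symmetric]) measurable
  also have "\<dots> = (\<integral>\<^sup>+w. ennreal (std_dens d w) * indicator A (lc d 1 w 1 a) \<partial>lborel_R d)"
  proof (rule nn_integral_cong)
    fix w
    have e: "(\<lambda>i\<in>{..<d}. w i + a i) = lc d 1 w 1 a" by (auto simp: lc_def)
    have "ennreal (std_dens d (lc d 1 w 1 a)) * ennreal (?K (lc d 1 w 1 a)) = ennreal (std_dens d w)"
      unfolding key[of w, symmetric] by (simp add: ennreal_mult[symmetric])
    then show "ennreal (std_dens d (\<lambda>i\<in>{..<d}. w i + a i)) * (ennreal (?K (\<lambda>i\<in>{..<d}. w i + a i)) * indicator A (\<lambda>i\<in>{..<d}. w i + a i)) = ennreal (std_dens d w) * indicator A (lc d 1 w 1 a)"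
      unfolding e by (simp only: mult.assoc[symmetric])
  qed
  also have "\<dots> = (\<integral>\<^sup>+w. indicator A (lc d 1 w 1 a) \<partial>std_gaussian d)"
    by (intro nn_integral_std_gaussian[symmetric]) measurable
  also have "\<dots> = emeasure (distr (std_gaussian d) (lborel_R d) (\<lambda>w. lc d 1 w 1 a)) A"
    using nn_integral_distr[of "\<lambda>w. lc d 1 w 1 a" "std_gaussian d" "lborel_R d" "indicator A"] lcm by simp
  finally show "emeasure (distr (std_gaussian d) (lborel_R d) (\<lambda>w. lc d 1 w 1 a)) A =
    emeasure (density (std_gaussian d) (\<lambda>y. ennreal (?K y))) A" ..
qed simp

lemma cameron_martin:
  assumes F: "F \<in> borel_measurable (lborel_R d)"
  shows "(\<integral>w. F (lc d 1 w 1 a) \<partial>std_gaussian d) =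
    (\<integral>w. F w * exp (inner_R d a w - norm2 d a / 2) \<partial>std_gaussian d)"
proof -
  have lcm: "(\<lambda>w. lc d 1 w 1 a) \<in> measurable (std_gaussian d) (lborel_R d)"
    unfolding lc_def by (intro measurable_restrict) auto
  have "(\<integral>w. F (lc d 1 w 1 a) \<partial>std_gaussian d) = (\<integral>y. F y \<partial>distr (std_gaussian d) (lborel_R d) (\<lambda>w. lc d 1 w 1 a))"
    by (rule integral_distr[symmetric, OF lcm F])
  also have "\<dots> = (\<integral>y. exp (inner_R d a y - norm2 d a / 2) *\<^sub>R F y \<partial>std_gaussian d)"
    unfolding distr_translate_std_gaussian using F by (intro integral_density) auto
  finally show ?thesis by (simp add: mult.commute)
qed

lemma stdn_moments:
  "integrable stdn (\<lambda>x. x)" "(\<integral>x. x \<partial>stdn) = 0"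
  "integrable stdn (\<lambda>x. x\<^sup>2)" "(\<integral>x. x\<^sup>2 \<partial>stdn) = 1"
proof -
  have 1: "integrable lborel (\<lambda>x. std_normal_density x * x ^ k)" for k
    by (rule integrable_std_normal_moment)
  show "integrable stdn (\<lambda>x. x)" using 1[of 1] by (simp add: stdn_def integrable_density)
  show "integrable stdn (\<lambda>x. x\<^sup>2)" using 1[of 2] by (simp add: stdn_def integrable_density)
  show "(\<integral>x. x \<partial>stdn) = 0"
    using integral_std_normal_moment_odd[of 0] by (simp add: stdn_def integral_density)
  show "(\<integral>x. x\<^sup>2 \<partial>stdn) = 1"
    using integral_std_normal_moment_even[of 1] by (simp add: stdn_def integral_density fact_2)
qed

lemma std_gaussian_covariance:
  assumes "i < d" "j < d"
  shows "(\<integral>x. x i * x j \<partial>std_gaussian d) = (if i = j then 1 else 0)"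
proof -
  let ?f = "\<lambda>k x::real. (if k = i then x else 1) * (if k = j then x else 1)"
  have int: "integrable stdn (?f k)" for k
    by (cases "k = i"; cases "k = j") (simp_all add: stdn_moments power2_eq_square[symmetric])
  have prod: "(\<Prod>k<d. ?f k (x k)) = x i * x j" for x :: "nat \<Rightarrow> real"
    using assms by (simp add: prod.distrib)
  have "(\<integral>x. x i * x j \<partial>std_gaussian d) = (\<integral>x. (\<Prod>k<d. ?f k (x k)) \<partial>(\<Pi>\<^sub>M i\<in>{..<d}. stdn))"
    by (simp only: prod std_gaussian_PiM)
  also have "\<dots> = (\<Prod>k<d. \<integral>x. ?f k x \<partial>stdn)"
    using int by (intro stdn_prod.product_integral_prod) auto
  also have "\<dots> = (\<Prod>k<d. if k = i then (if i = j then 1 else 0) else 1)"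
  proof (cases "i = j")
    case True
    show ?thesis
    proof (rule prod.cong[OF refl])
      fix k
      show "(\<integral>x. ?f k x \<partial>stdn) = (if k = i then (if i = j then 1 else 0) else 1)"
        using True stdn.prob_space by (cases "k = i") (simp_all add: stdn_moments power2_eq_square[symmetric])
    qed
  next
    case False
    have "(\<integral>x. ?f i x \<partial>stdn) = 0" using False by (simp add: stdn_moments)
    then have "(\<Prod>k<d. \<integral>x. ?f k x \<partial>stdn) = 0"
      using assms by (intro prod_zero) blast+
    moreover have "(\<Prod>k<d. if k = i then (if i = j then 1 else 0) else 1) = (0::real)"
      using assms False by simp
    ultimately show ?thesis by simp
  qed
  also have "\<dots> = (if i = j then 1 else 0)" using assms by simp
  finally show ?thesis .
qed

text \<open>By Jensen the absolute mean is at most the root of the second moment, which is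
  \<open>norm2 d v\<close> because the coordinates are uncorrelated with variance 1.\<close>

lemma integral_abs_inner_R_le: "(\<integral>z. \<bar>inner_R d v z\<bar> \<partial>std_gaussian d) \<le> nrm d v"
proof -
  let ?N = "std_gaussian d"
  have p: "poly_fun d 1 (\<lambda>z. inner_R d v z)" by (rule poly_fun_inner)
  have "(\<integral>z. \<bar>inner_R d v z\<bar> \<partial>?N)\<^sup>2 \<le> (\<integral>z. \<bar>inner_R d v z\<bar>\<^sup>2 \<partial>?N)"
    by (intro N.integral_power2_le L2_abs poly_fun_L2[OF p])
  also have "\<dots> = (\<integral>z. (\<Sum>i<d. \<Sum>j<d. v i * v j * (z i * z j)) \<partial>?N)"
    by (simp add: inner_R_def power2_eq_square sum_product mult_ac)
  also have "\<dots> = (\<Sum>i<d. \<Sum>j<d. v i * v j * (\<integral>z. z i * z j \<partial>?N))"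
  proof -
    have int: "integrable ?N (\<lambda>z. z i * z j)" if "i < d" "j < d" for i j
      using integrable_poly_fun[OF poly_fun_mult[OF poly_fun_var poly_fun_var]] that by auto
    have "(\<integral>z. (\<Sum>i<d. \<Sum>j<d. v i * v j * (z i * z j)) \<partial>?N) = (\<Sum>i<d. \<integral>z. (\<Sum>j<d. v i * v j * (z i * z j)) \<partial>?N)"
      by (intro Bochner_Integration.integral_sum Bochner_Integration.integrable_sum integrable_mult_right int) auto
    also have "\<dots> = (\<Sum>i<d. \<Sum>j<d. \<integral>z. v i * v j * (z i * z j) \<partial>?N)"
      by (intro sum.cong refl Bochner_Integration.integral_sum integrable_mult_right int) auto
    finally show ?thesis by simp
  qed
  also have "\<dots> = (\<Sum>i<d. \<Sum>j<d. if i = j then v i * v j else 0)"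
    by (intro sum.cong refl) (auto simp: std_gaussian_covariance)
  also have "\<dots> = (nrm d v)\<^sup>2" unfolding nrm_power2 norm2_def by (simp add: power2_eq_square)
  finally show ?thesis by (rule power2_le_imp_le) simp
qed

text \<open>For an indicator this is the probability that the set contains exactly one of the two
  correlated points. The parameter is the angle and not the correlation \<open>cos \<theta>\<close>,
  because angles of rotations add.\<close>

definition noise_sens :: "nat \<Rightarrow> ((nat \<Rightarrow> real) \<Rightarrow> real) \<Rightarrow> real \<Rightarrow> real" where
  "noise_sens d g \<theta> = (\<integral>p. \<bar>g (lc d (cos \<theta>) (fst p) (sin \<theta>) (snd p)) - g (fst p)\<bar> \<partial>std_gaussian2 d)"

lemma integrable_noise_sens:
  assumes [measurable]: "g \<in> borel_measurable (lborel_R d)" and "integrable (std_gaussian d) (g :: _ \<Rightarrow> real)" and "cos \<theta> > -1"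
  shows "integrable (std_gaussian2 d) (\<lambda>p. \<bar>g (lc d (cos \<theta>) (fst p) (sin \<theta>) (snd p)) - g (fst p)\<bar>)"
  using assms integral_lc_std_gaussian2(2)[OF _ assms(3), of "sin \<theta>" g d] integral_fst_std_gaussian2(2)[of g d]
  by (intro Bochner_Integration.integrable_abs Bochner_Integration.integrable_diff) auto

text \<open>Insert the point rotated by \<open>a\<close> and use the triangle inequality: by
  rotation invariance the second leg has the law of a first leg of angle \<open>b\<close>.\<close>

lemma noise_sens_add:
  assumes g[measurable]: "g \<in> borel_measurable (lborel_R d)" and gi: "integrable (std_gaussian d) g"
    and cos: "cos a > -1" "cos b > -1" "cos (a + b) > -1"
  shows "noise_sens d g (a + b) \<le> noise_sens d g a + noise_sens d g b"
proof -
  let ?G = "\<lambda>p. \<bar>g (lc d (cos b) (fst p) (sin b) (snd p)) - g (fst p)\<bar>"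
  have Gm: "?G \<in> borel_measurable (lborel_R d \<Otimes>\<^sub>M lborel_R d)" by measurable
  have cs: "(cos a)\<^sup>2 + (sin a)\<^sup>2 = 1" by simp
  have e: "lc d (cos b) (fst (rot d (cos a) (sin a) p)) (sin b) (snd (rot d (cos a) (sin a) p)) =
      lc d (cos (a + b)) (fst p) (sin (a + b)) (snd p)" for p
    unfolding rot_def fst_conv snd_conv lc_lc by (simp add: cos_add sin_add mult.commute add.commute)
  have Geq: "?G (rot d (cos a) (sin a) p) = \<bar>g (lc d (cos (a + b)) (fst p) (sin (a + b)) (snd p)) - g (lc d (cos a) (fst p) (sin a) (snd p))\<bar>" for p
    unfolding e by (simp add: rot_def)
  have int: "integrable (std_gaussian2 d) (\<lambda>p. ?G (rot d (cos a) (sin a) p))"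
    unfolding integral_rot(2)[OF cs cos(1) Gm] by (rule integrable_noise_sens) (use assms in auto)
  have "noise_sens d g (a + b) \<le> (\<integral>p. \<bar>g (lc d (cos a) (fst p) (sin a) (snd p)) - g (fst p)\<bar> + ?G (rot d (cos a) (sin a) p) \<partial>std_gaussian2 d)"
    unfolding noise_sens_def
    by (intro integral_mono Bochner_Integration.integrable_add int integrable_noise_sens g gi cos) (simp add: Geq)
  also have "\<dots> = noise_sens d g a + (\<integral>p. ?G (rot d (cos a) (sin a) p) \<partial>std_gaussian2 d)"
    unfolding noise_sens_def by (intro Bochner_Integration.integral_add int integrable_noise_sens g gi cos)
  also have "(\<integral>p. ?G (rot d (cos a) (sin a) p) \<partial>std_gaussian2 d) = noise_sens d g b"
    unfolding noise_sens_def by (rule integral_rot(1)[OF cs cos(1) Gm])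
  finally show ?thesis .
qed

lemma cos_gt_minus_one: "0 \<le> (t::real) \<Longrightarrow> t \<le> 1 \<Longrightarrow> cos t > -1"
  using cos_gt_zero_pi[of t] pi_gt3 by auto

text \<open>Reduces a fixed angle to arbitrarily small ones, where the derivative takes over. The
  bound 1 on the total angle keeps every cosine above -1.\<close>

lemma noise_sens_mult:
  assumes g: "g \<in> borel_measurable (lborel_R d)" "integrable (std_gaussian d) g"
    and h: "0 \<le> h" "real m * h \<le> 1"
  shows "noise_sens d g (real m * h) \<le> real m * noise_sens d g h"
  using h(2)
proof (induction m)
  case 0
  have "noise_sens d g 0 = (\<integral>p. 0 \<partial>std_gaussian2 d)"
    unfolding noise_sens_def
  proof (rule Bochner_Integration.integral_cong[OF refl])
    fix p assume "p \<in> space (std_gaussian2 d)"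
    then have "lc d 1 (fst p) 0 (snd p) = fst p" by (auto simp: lc_def space_pair_measure extensional_def)
    then show "\<bar>g (lc d (cos 0) (fst p) (sin 0) (snd p)) - g (fst p)\<bar> = 0" by simp
  qed
  then show ?case by simp
next
  case (Suc m)
  have mh: "0 \<le> real m * h" "real m * h \<le> 1" "h \<le> 1" "0 \<le> real m * h + h" "real m * h + h \<le> 1"
  proof -
    show 1: "0 \<le> real m * h" using h(1) by simp
    show 2: "real m * h + h \<le> 1" using Suc.prems by (simp add: algebra_simps)
    show "real m * h \<le> 1" "h \<le> 1" "0 \<le> real m * h + h" using 1 2 h(1) by linarith+
  qed
  have "noise_sens d g (real (Suc m) * h) = noise_sens d g (real m * h + h)" by (simp add: algebra_simps)
  also have "\<dots> \<le> noise_sens d g (real m * h) + noise_sens d g h"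
    using mh h by (intro noise_sens_add g cos_gt_minus_one) auto
  also have "\<dots> \<le> real m * noise_sens d g h + noise_sens d g h" using Suc.IH mh by simp
  finally show ?case by (simp add: algebra_simps)
qed

lemma prob_extensional [simp]: "measure (std_gaussian d) (extensional {..<d}) = 1"
  using N.prob_space[of d] by simp

lemma abs_exp_minus_one_le: "\<bar>exp (x::real) - 1\<bar> \<le> \<bar>x\<bar> * exp \<bar>x\<bar>"
  using exp_taylor_remainder[of x 0] by simp

text \<open>Both points of the correlated pair are standard Gaussian, so each contributes one
  \<open>L1\<close> distance.\<close>

lemma noise_sens_close_le:
  assumes g[measurable]: "g \<in> borel_measurable (lborel_R d)" and int: "integrable (std_gaussian d) g" "integrable (std_gaussian d) u"
    and u[measurable]: "u \<in> borel_measurable (lborel_R d)" and \<theta>: "cos \<theta> > -1"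
  shows "noise_sens d u \<theta> \<le> noise_sens d g \<theta> + 2 * (\<integral>x. \<bar>g x - u x\<bar> \<partial>std_gaussian d)"
proof -
  let ?NN = "std_gaussian2 d" and ?X = "\<lambda>p. lc d (cos \<theta>) (fst p) (sin \<theta>) (snd p)"
  let ?e = "\<lambda>x. \<bar>g x - u x\<bar>"
  have e[measurable]: "?e \<in> borel_measurable (lborel_R d)" by measurable
  have ei: "integrable (std_gaussian d) ?e" using int by simp
  have cs: "(cos \<theta>)\<^sup>2 + (sin \<theta>)\<^sup>2 = 1" by simp
  have i1: "integrable ?NN (\<lambda>p. ?e (?X p))" using integral_lc_std_gaussian2(2)[OF cs \<theta> e] ei by simp
  have i2: "integrable ?NN (\<lambda>p. ?e (fst p))" using integral_fst_std_gaussian2(2)[OF e] ei by simp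
  have i3: "integrable ?NN (\<lambda>p. \<bar>g (?X p) - g (fst p)\<bar>)" by (rule integrable_noise_sens[OF g int(1) \<theta>])
  have "noise_sens d u \<theta> \<le> (\<integral>p. (\<bar>g (?X p) - g (fst p)\<bar> + ?e (?X p)) + ?e (fst p) \<partial>?NN)"
    unfolding noise_sens_def
    by (intro integral_mono integrable_noise_sens[OF u int(2) \<theta>] Bochner_Integration.integrable_add i1 i2 i3) auto
  also have "\<dots> = noise_sens d g \<theta> + (\<integral>p. ?e (?X p) \<partial>?NN) + (\<integral>p. ?e (fst p) \<partial>?NN)"
    unfolding noise_sens_def using i1 i2 i3 by (simp only: Bochner_Integration.integral_add Bochner_Integration.integrable_add)
  also have "(\<integral>p. ?e (?X p) \<partial>?NN) = (\<integral>x. ?e x \<partial>std_gaussian d)"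
    by (rule integral_lc_std_gaussian2(1)[OF cs \<theta> e])
  also have "(\<integral>p. ?e (fst p) \<partial>?NN) = (\<integral>x. ?e x \<partial>std_gaussian d)"
    by (rule integral_fst_std_gaussian2(1)[OF e])
  finally show ?thesis by simp
qed

section \<open>Smoothing a Lipschitz function that is locally constant outside
  \<open>B\<close>\<close>

context
  fixes d :: nat and f :: "(nat \<Rightarrow> real) \<Rightarrow> real" and L \<eta> :: real and B :: "(nat \<Rightarrow> real) set"
  assumes fm [measurable]: "f \<in> borel_measurable (lborel_R d)"
    and f01: "\<And>x. 0 \<le> f x" "\<And>x. f x \<le> 1"
    and Bm [measurable]: "B \<in> sets (lborel_R d)" and L: "L \<ge> 0" and \<eta>: "\<eta> > 0"
    and lip: "\<And>x y. x \<in> R_space d \<Longrightarrow> y \<in> R_space d \<Longrightarrow> \<bar>f x - f y\<bar> \<le> L * nrm d (lc d 1 x (-1) y)"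
    and loc: "\<And>x y. x \<in> R_space d \<Longrightarrow> y \<in> R_space d \<Longrightarrow> nrm d (lc d 1 x (-1) y) \<le> \<eta> \<Longrightarrow>
      \<bar>f x - f y\<bar> \<le> L * nrm d (lc d 1 x (-1) y) * indicator B x"
begin

lemma f_abs_le: "\<bar>f x\<bar> \<le> 1"
  using f01[of x] by auto

lemma lc_R_space [simp]: "lc d a x b z \<in> R_space d"
  by (simp add: space_lborel_R)

context
  fixes c \<sigma> :: real
  assumes c: "0 < c" "c < 1" and \<sigma>_def: "\<sigma> = sqrt (1 - c\<^sup>2)"
begin

text \<open>The gradient of \<open>noise_op d c f\<close>, written by Gaussian integration by parts
  so that no derivative of \<open>f\<close> occurs.\<close>

definition smooth_grad :: "(nat \<Rightarrow> real) \<Rightarrow> (nat \<Rightarrow> real)" where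
  "smooth_grad x = (\<lambda>i\<in>{..<d}. c / \<sigma> * (\<integral>w. f (lc d c x \<sigma> w) * w i \<partial>std_gaussian d))"

lemma \<sigma>: "\<sigma> > 0" "c\<^sup>2 + \<sigma>\<^sup>2 = 1"
proof -
  have "c\<^sup>2 < 1" using c by (simp add: power_less_one_iff)
  then show "\<sigma> > 0" "c\<^sup>2 + \<sigma>\<^sup>2 = 1" by (auto simp: \<sigma>_def)
qed

lemma integrable_f_lc: "x \<in> R_space d \<Longrightarrow> integrable (std_gaussian d) (\<lambda>w. f (lc d c x \<sigma> w))"
  using f_abs_le by (intro N.integrable_const_bound[of _ 1]) auto

lemma noise_op_eq: "noise_op d c f x = (\<integral>w. f (lc d c x \<sigma> w) \<partial>std_gaussian d)"
  by (simp add: noise_op_def \<sigma>_def)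

lemma noise_op_measurable [measurable]: "noise_op d c f \<in> borel_measurable (lborel_R d)"
  unfolding noise_op_eq [abs_def] by measurable

lemma noise_op_lip:
  assumes "x \<in> R_space d" "y \<in> R_space d"
  shows "\<bar>noise_op d c f x - noise_op d c f y\<bar> \<le> L * nrm d (lc d 1 x (-1) y)"
proof -
  have "\<bar>noise_op d c f x - noise_op d c f y\<bar> = \<bar>\<integral>w. f (lc d c x \<sigma> w) - f (lc d c y \<sigma> w) \<partial>std_gaussian d\<bar>"
    unfolding noise_op_eq using assms by (simp add: integrable_f_lc)
  also have "\<dots> \<le> (\<integral>w. \<bar>f (lc d c x \<sigma> w) - f (lc d c y \<sigma> w)\<bar> \<partial>std_gaussian d)"
    by (rule integral_abs_bound)
  also have "\<dots> \<le> (\<integral>w. L * nrm d (lc d 1 x (-1) y) \<partial>std_gaussian d)"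
  proof (intro integral_mono Bochner_Integration.integrable_abs Bochner_Integration.integrable_diff integrable_f_lc assms)
    fix w
    have "nrm d (lc d 1 (lc d c x \<sigma> w) (-1) (lc d c y \<sigma> w)) = nrm d (\<lambda>i. c * lc d 1 x (-1) y i)"
      by (rule nrm_cong) (simp add: algebra_simps)
    also have "\<dots> \<le> nrm d (lc d 1 x (-1) y)"
      unfolding nrm_scale using c by (intro mult_left_le_one_le) auto
    finally have "nrm d (lc d 1 (lc d c x \<sigma> w) (-1) (lc d c y \<sigma> w)) \<le> nrm d (lc d 1 x (-1) y)" .
    from order_trans[OF lip[OF lc_R_space lc_R_space] mult_left_mono[OF this L]]
    show "\<bar>f (lc d c x \<sigma> w) - f (lc d c y \<sigma> w)\<bar> \<le> L * nrm d (lc d 1 x (-1) y)" .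
  qed simp
  finally show ?thesis by simp
qed

lemma integrable_f_lc_comp:
  assumes "x \<in> R_space d" "i < d"
  shows "integrable (std_gaussian d) (\<lambda>w. f (lc d c x \<sigma> w) * w i)"
  using assms integrable_poly_fun[OF poly_fun_var[of i d]] f_abs_le
  by (intro integrable_bounded_mult) auto

text \<open>By Cameron-Martin, a shift of \<open>x\<close> only reweights the Gaussian, and the weight is
  differentiable; this gives a gradient although \<open>f\<close> itself need not be differentiable.\<close>
lemma noise_op_directional_derivative:
  assumes x: "x \<in> R_space d" and z: "z \<in> R_space d"
    and h: "\<And>m. 0 < h m" "\<And>m. h m \<le> 1" "h \<longlonglongrightarrow> 0"
  shows "(\<lambda>m. (noise_op d c f (lc d 1 x (h m) z) - noise_op d c f x) / h m) \<longlonglongrightarrow> inner_R d (smooth_grad x) z"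
proof -
  let ?N = "std_gaussian d"
  define F where "F = (\<lambda>w. f (lc d c x \<sigma> w))"
  define a where "a = (\<lambda>i. c / \<sigma> * z i)"
  define q where "q = norm2 d a"
  have Fm[measurable]: "F \<in> borel_measurable (lborel_R d)" unfolding F_def using x by measurable
  have F1: "\<bar>F w\<bar> \<le> 1" for w using f_abs_le by (simp add: F_def)
  have q: "q \<ge> 0" by (simp add: q_def)
  have shift: "noise_op d c f (lc d 1 x t z) = (\<integral>w. F w * exp (t * inner_R d a w - t\<^sup>2 * q / 2) \<partial>?N)" for t
  proof -
    have e: "lc d c (lc d 1 x t z) \<sigma> w = lc d c x \<sigma> (lc d 1 w 1 (\<lambda>i. t * a i))" for w
      using \<sigma>(1) by (auto simp: lc_def a_def algebra_simps intro!: restrict_ext)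
    have i: "inner_R d (\<lambda>i. t * a i) w = t * inner_R d a w" for w
      by (simp add: inner_R_def sum_distrib_left mult.assoc)
    have n: "norm2 d (\<lambda>i. t * a i) = t\<^sup>2 * q"
      by (simp add: q_def norm2_def sum_distrib_left power_mult_distrib)
    have "noise_op d c f (lc d 1 x t z) = (\<integral>w. F (lc d 1 w 1 (\<lambda>i. t * a i)) \<partial>?N)"
      unfolding noise_op_eq e F_def ..
    also have "\<dots> = (\<integral>w. F w * exp (inner_R d (\<lambda>i. t * a i) w - norm2 d (\<lambda>i. t * a i) / 2) \<partial>?N)"
      by (rule cameron_martin) measurable
    finally show ?thesis unfolding i n .
  qed
  \<comment> \<open>Dominates the difference quotients: \<open>1/8\<close> is an integrable
    exponent, and \<open>9 * q\<close> collects \<open>8 * q\<close> from splitting the inner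
    product in \<open>G2\<close> and \<open>q\<close> from the quadratic term.\<close>
  let ?W = "\<lambda>w. exp (9 * q) * exp (1/8 * norm2 d w)"
  have W: "integrable ?N ?W" using integrable_exp_norm2[of "1/8" d] by simp
  have G2: "2 * \<bar>inner_R d a w\<bar> \<le> 8 * q + 1/8 * norm2 d w" for w
  proof -
    have "8 * \<bar>inner_R d a w\<bar> = \<bar>inner_R d (\<lambda>i. 8 * a i) w\<bar>"
      by (simp add: inner_R_def sum_distrib_left mult.assoc abs_mult[symmetric])
        (simp add: sum_distrib_left[symmetric] abs_mult)
    also have "\<dots> \<le> (norm2 d (\<lambda>i. 8 * a i) + norm2 d w) / 2" by (rule abs_inner_R_le)
    also have "norm2 d (\<lambda>i. 8 * a i) = 64 * q" by (simp add: q_def norm2_def sum_distrib_left power_mult_distrib)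
    finally show ?thesis using q norm2_nonneg[of d w] by simp
  qed
  have bnd: "\<bar>F w * ((exp (t * inner_R d a w - t\<^sup>2 * q / 2) - 1) / t)\<bar> \<le> ?W w" if t: "0 < t" "t \<le> 1" for t w
  proof -
    let ?G = "inner_R d a w"
    let ?e = "t * ?G - t\<^sup>2 * q / 2"
    have "\<bar>?e\<bar> \<le> \<bar>t * ?G\<bar> + \<bar>t\<^sup>2 * q / 2\<bar>" by (rule abs_triangle_ineq4)
    also have "\<bar>t\<^sup>2 * q / 2\<bar> \<le> t * q / 2"
      using t q by (simp add: power2_eq_square mult_right_mono mult_left_le_one_le)
    also have "\<bar>t * ?G\<bar> + t * q / 2 = t * (\<bar>?G\<bar> + q / 2)" using t by (simp add: abs_mult algebra_simps)
    finally have e1: "\<bar>?e\<bar> \<le> t * (\<bar>?G\<bar> + q / 2)" by simp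
    let ?u = "\<bar>?G\<bar> + q / 2"
    have u: "?u \<ge> 0" using q by simp
    have e2: "\<bar>?e\<bar> \<le> ?u" using e1 t u mult_left_le_one_le[of ?u t] by linarith
    have "\<bar>F w * ((exp ?e - 1) / t)\<bar> \<le> 1 * (\<bar>exp ?e - 1\<bar> / t)"
      unfolding abs_mult using F1[of w] t by (intro mult_mono) auto
    also have "\<dots> \<le> \<bar>?e\<bar> * exp \<bar>?e\<bar> / t"
      using t abs_exp_minus_one_le[of ?e] by (simp add: divide_right_mono)
    also have "\<dots> \<le> (t * ?u) * exp ?u / t"
      using t e1 e2 u by (intro divide_right_mono mult_mono) auto
    also have "\<dots> = ?u * exp ?u" using t by simp
    also have "\<dots> \<le> exp ?u * exp ?u"
    proof (rule mult_right_mono)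
      show "?u \<le> exp ?u" using exp_ge_add_one_self[of ?u] by linarith
    qed simp
    also have "\<dots> = exp (2 * \<bar>?G\<bar> + q)" by (simp add: exp_add[symmetric])
    also have "\<dots> \<le> exp (9 * q + 1/8 * norm2 d w)" using G2[of w] by simp
    also have "\<dots> = ?W w" by (simp add: exp_add)
    finally show ?thesis .
  qed
  have lim: "(\<lambda>m. F w * ((exp (h m * inner_R d a w - (h m)\<^sup>2 * q / 2) - 1) / h m)) \<longlonglongrightarrow> F w * inner_R d a w" for w
  proof (rule tendsto_mult_left)
    let ?\<phi> = "\<lambda>t. exp (t * inner_R d a w - t\<^sup>2 * q / 2)"
    have "DERIV ?\<phi> 0 :> inner_R d a w"
      by (auto intro!: derivative_eq_intros)
    then have "((\<lambda>t. (?\<phi> (0 + t) - ?\<phi> 0) / t) \<longlongrightarrow> inner_R d a w) (at 0)" by (rule DERIV_D)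
    moreover have "filterlim h (at 0) sequentially"
      using h by (intro filterlim_atI) (auto simp: less_imp_neq[THEN not_sym])
    ultimately show "(\<lambda>m. (?\<phi> (h m) - 1) / h m) \<longlonglongrightarrow> inner_R d a w"
      using filterlim_compose by fastforce
  qed
  have "(\<lambda>m. \<integral>w. F w * ((exp (h m * inner_R d a w - (h m)\<^sup>2 * q / 2) - 1) / h m) \<partial>?N) \<longlonglongrightarrow> (\<integral>w. F w * inner_R d a w \<partial>?N)"
  proof (rule integral_dominated_convergence)
    show "AE w in ?N. norm (F w * ((exp (h m * inner_R d a w - (h m)\<^sup>2 * q / 2) - 1) / h m)) \<le> ?W w" for m
      using bnd[OF h(1,2)] by simp
    show "AE w in ?N. (\<lambda>m. F w * ((exp (h m * inner_R d a w - (h m)\<^sup>2 * q / 2) - 1) / h m)) \<longlonglongrightarrow> F w * inner_R d a w"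
      using lim by simp
  qed (use W in auto)
  moreover have "(\<integral>w. F w * ((exp (h m * inner_R d a w - (h m)\<^sup>2 * q / 2) - 1) / h m) \<partial>?N) =
      (noise_op d c f (lc d 1 x (h m) z) - noise_op d c f x) / h m" for m
  proof -
    have i1: "integrable ?N F" using F1 by (intro N.integrable_const_bound[of _ 1]) auto
    have i2: "integrable ?N (\<lambda>w. F w * ((exp (h m * inner_R d a w - (h m)\<^sup>2 * q / 2) - 1) / h m))"
      by (rule Bochner_Integration.integrable_bound[OF W]) (use bnd[OF h(1,2)] in \<open>auto intro!: AE_I2 order.trans[OF _ abs_ge_self]\<close>)
    have "noise_op d c f (lc d 1 x (h m) z) = (\<integral>w. F w + h m * (F w * ((exp (h m * inner_R d a w - (h m)\<^sup>2 * q / 2) - 1) / h m)) \<partial>?N)"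
      unfolding shift using h(1)[of m] by (intro Bochner_Integration.integral_cong refl) (simp add: field_simps)
    also have "\<dots> = (\<integral>w. F w \<partial>?N) + h m * (\<integral>w. F w * ((exp (h m * inner_R d a w - (h m)\<^sup>2 * q / 2) - 1) / h m) \<partial>?N)"
      using i1 integrable_mult_right[OF i2, of "h m"] by (subst Bochner_Integration.integral_add) auto
    finally show ?thesis using h(1)[of m] by (simp add: noise_op_eq[of x] F_def field_simps)
  qed
  moreover have "(\<integral>w. F w * inner_R d a w \<partial>?N) = inner_R d (smooth_grad x) z"
  proof -
    have "(\<integral>w. F w * inner_R d a w \<partial>?N) = (\<integral>w. (\<Sum>i<d. a i * (F w * w i)) \<partial>?N)"
      by (simp add: inner_R_def sum_distrib_left mult_ac)
    also have "\<dots> = (\<Sum>i<d. a i * (\<integral>w. F w * w i \<partial>?N))"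
      using integrable_f_lc_comp[OF x] by (subst Bochner_Integration.integral_sum) (auto simp: F_def)
    also have "\<dots> = inner_R d (smooth_grad x) z"
      unfolding inner_R_def by (intro sum.cong refl) (simp add: smooth_grad_def a_def F_def)
    finally show ?thesis .
  qed
  ultimately show ?thesis by (simp only:)
qed

lemma smooth_grad_space [simp]: "smooth_grad x \<in> R_space d"
  by (simp add: smooth_grad_def space_lborel_R)

lemma measurable_smooth_grad [measurable]: "smooth_grad \<in> measurable (lborel_R d) (lborel_R d)"
  unfolding smooth_grad_def [abs_def]
proof (intro measurable_restrict)
  fix i assume "i \<in> {..<d}"
  then have [measurable]: "(\<lambda>w. w i) \<in> borel_measurable (lborel_R d)" by simp
  have "(\<lambda>x. c / \<sigma> * (\<integral>w. f (lc d c x \<sigma> w) * w i \<partial>std_gaussian d)) \<in> borel_measurable (lborel_R d)"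
    by measurable
  then show "(\<lambda>x. c / \<sigma> * (\<integral>w. f (lc d c x \<sigma> w) * w i \<partial>std_gaussian d)) \<in> measurable (lborel_R d) lborel"
    by simp
qed

text \<open>Its Gaussian mean is the mass of \<open>B\<close>, because the noisy copy of a standard
  Gaussian point is standard Gaussian; this turns a pointwise bound on the gradient into a bound by
  that mass.\<close>

definition bdry_prob :: "(nat \<Rightarrow> real) \<Rightarrow> real" where
  "bdry_prob x = (\<integral>w. indicator B (lc d c x \<sigma> w) \<partial>std_gaussian d)"

lemma bdry_prob_nonneg: "0 \<le> bdry_prob x"
  unfolding bdry_prob_def by (rule Bochner_Integration.integral_nonneg) simp

lemma bdry_prob_integral: "(\<integral>x. bdry_prob x \<partial>std_gaussian d) = measure (std_gaussian d) B"
  and bdry_prob_integrable: "integrable (std_gaussian d) bdry_prob"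
proof -
  have c1: "c > -1" using c by simp
  have ind: "integrable (std_gaussian d) (indicator B :: _ \<Rightarrow> real)"
    by (intro N.integrable_const_bound[of _ 1]) auto
  have i: "integrable (std_gaussian2 d) (\<lambda>p. indicator B (lc d c (fst p) \<sigma> (snd p)) :: real)"
    using integral_lc_std_gaussian2(2)[OF \<sigma>(2) c1, of "indicator B" d] ind by simp
  show "integrable (std_gaussian d) bdry_prob"
    using NN.integrable_fst'[OF i] by (simp add: bdry_prob_def [abs_def])
  have "(\<integral>x. bdry_prob x \<partial>std_gaussian d) = (\<integral>p. indicator B (lc d c (fst p) \<sigma> (snd p)) \<partial>std_gaussian2 d)"
    using NN.integral_fst'[OF i] by (simp add: bdry_prob_def [abs_def])
  also have "\<dots> = (\<integral>x. indicator B x \<partial>std_gaussian d)"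
    by (rule integral_lc_std_gaussian2(1)[OF \<sigma>(2) c1]) measurable
  also have "\<dots> = measure (std_gaussian d) B"
    using sets.sets_into_space[OF Bm] by (simp add: space_lborel_R Int_absorb2)
  finally show "(\<integral>x. bdry_prob x \<partial>std_gaussian d) = measure (std_gaussian d) B" .
qed

text \<open>Differentiating along the gradient itself gives its squared norm. For steps shorter than
  \<open>\<eta>\<close> only noisy copies inside \<open>B\<close> contribute to the difference
  quotient, which is thus at most \<open>L * nrm d ?v * bdry_prob x\<close>; one factor
  cancels.\<close>

lemma nrm_smooth_grad_le:
  assumes x: "x \<in> R_space d"
  shows "nrm d (smooth_grad x) \<le> L * bdry_prob x"
proof -
  let ?N = "std_gaussian d" and ?g = "noise_op d c f"
  let ?v = "smooth_grad x"
  define h :: "nat \<Rightarrow> real" where "h m = 1 / real (Suc m)" for m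
  have h: "\<And>m. 0 < h m" "\<And>m. h m \<le> 1" "h \<longlonglongrightarrow> 0"
    unfolding h_def using LIMSEQ_inverse_real_of_nat by (auto simp: inverse_eq_divide)
  have lim: "(\<lambda>m. (?g (lc d 1 x (h m) ?v) - ?g x) / h m) \<longlonglongrightarrow> inner_R d ?v ?v"
    by (rule noise_op_directional_derivative[OF x smooth_grad_space h])
  have "(\<lambda>m. h m * nrm d ?v) \<longlonglongrightarrow> 0" using tendsto_mult_left_zero[OF h(3)] .
  then have "\<forall>\<^sub>F m in sequentially. h m * nrm d ?v < \<eta>" by (rule order_tendstoD(2)) (rule \<eta>)
  then have ev: "\<forall>\<^sub>F m in sequentially. (?g (lc d 1 x (h m) ?v) - ?g x) / h m \<le> L * nrm d ?v * bdry_prob x"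
  proof eventually_elim
    case (elim m)
    have pt: "\<bar>f (lc d c x \<sigma> w) - f (lc d c (lc d 1 x (h m) ?v) \<sigma> w)\<bar> \<le> L * (h m * nrm d ?v) * indicator B (lc d c x \<sigma> w)" for w
    proof -
      have "nrm d (lc d 1 (lc d c x \<sigma> w) (-1) (lc d c (lc d 1 x (h m) ?v) \<sigma> w)) = nrm d (\<lambda>i. (- c * h m) * ?v i)"
        by (rule nrm_cong) (simp add: algebra_simps)
      also have "\<dots> = c * (h m * nrm d ?v)" unfolding nrm_scale using c h(1)[of m] by (simp add: abs_mult)
      finally have n: "nrm d (lc d 1 (lc d c x \<sigma> w) (-1) (lc d c (lc d 1 x (h m) ?v) \<sigma> w)) = c * (h m * nrm d ?v)" .
      have le: "c * (h m * nrm d ?v) \<le> h m * nrm d ?v" using c h(1)[of m] by (intro mult_left_le_one_le) auto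
      have "\<bar>f (lc d c x \<sigma> w) - f (lc d c (lc d 1 x (h m) ?v) \<sigma> w)\<bar> \<le> L * (c * (h m * nrm d ?v)) * indicator B (lc d c x \<sigma> w)"
        using loc[of "lc d c x \<sigma> w" "lc d c (lc d 1 x (h m) ?v) \<sigma> w"] elim le unfolding n by simp
      also have "\<dots> \<le> L * (h m * nrm d ?v) * indicator B (lc d c x \<sigma> w)"
        using le L by (intro mult_right_mono mult_left_mono) auto
      finally show ?thesis .
    qed
    have "?g (lc d 1 x (h m) ?v) - ?g x = (\<integral>w. f (lc d c (lc d 1 x (h m) ?v) \<sigma> w) - f (lc d c x \<sigma> w) \<partial>?N)"
      unfolding noise_op_eq using x by (simp add: integrable_f_lc)
    also have "\<dots> \<le> (\<integral>w. L * (h m * nrm d ?v) * indicator B (lc d c x \<sigma> w) \<partial>?N)"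
    proof (rule integral_mono)
      show "integrable ?N (\<lambda>w. f (lc d c (lc d 1 x (h m) ?v) \<sigma> w) - f (lc d c x \<sigma> w))"
        using x by (simp add: integrable_f_lc)
      have "integrable ?N (\<lambda>w. indicator B (lc d c x \<sigma> w) :: real)"
        using x by (intro N.integrable_const_bound[of _ 1]) auto
      then show "integrable ?N (\<lambda>w. L * (h m * nrm d ?v) * indicator B (lc d c x \<sigma> w))" by simp
      show "f (lc d c (lc d 1 x (h m) ?v) \<sigma> w) - f (lc d c x \<sigma> w) \<le> L * (h m * nrm d ?v) * indicator B (lc d c x \<sigma> w)" for w
        using pt[of w] by linarith
    qed
    also have "\<dots> = L * nrm d ?v * bdry_prob x * h m" by (simp add: bdry_prob_def)
    finally show ?case using h(1)[of m] by (simp add: pos_divide_le_eq)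
  qed
  from tendsto_upperbound[OF lim ev] have "nrm d ?v * nrm d ?v \<le> (L * bdry_prob x) * nrm d ?v"
    by (simp add: norm2_eq_inner[symmetric] nrm_power2[symmetric] power2_eq_square mult_ac)
  then show ?thesis
    using L bdry_prob_nonneg[of x] nrm_nonneg[of ?v d]
    by (cases "nrm d ?v = 0") (auto simp: mult_le_cancel_right)
qed

text \<open>Subadditivity bounds the sensitivity by \<open>\<theta>\<close> times difference
  quotients at angles tending to 0. Their limit is the mean absolute derivative along an independent
  Gaussian direction, at most the mean norm of the gradient.\<close>

lemma noise_sens_noise_op_le:
  assumes \<theta>: "0 < \<theta>" "\<theta> \<le> 1"
  shows "noise_sens d (noise_op d c f) \<theta> \<le> \<theta> * (L * measure (std_gaussian d) B)"
proof -
  let ?N = "std_gaussian d" and ?NN = "std_gaussian2 d" and ?g = "noise_op d c f"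
  define h :: "nat \<Rightarrow> real" where "h m = \<theta> / real (Suc m)" for m
  have h: "0 < h m" "h m \<le> 1" for m
  proof -
    show "0 < h m" using \<theta> by (simp add: h_def)
    have "\<theta> \<le> 1" by (rule \<theta>(2))
    also have "1 \<le> 1 * real (Suc m)" by simp
    finally have "\<theta> \<le> 1 * real (Suc m)" .
    then show "h m \<le> 1" by (simp add: h_def pos_divide_le_eq)
  qed
  have h0: "h \<longlonglongrightarrow> 0"
    using tendsto_mult_right_zero[OF LIMSEQ_inverse_real_of_nat, of \<theta>] by (simp add: h_def [abs_def] divide_inverse)
  have hat: "filterlim h (at 0) sequentially"
    using h h0 by (intro filterlim_atI) (auto simp: less_imp_neq[THEN not_sym])
  have gi: "integrable ?N ?g"
  proof (intro N.integrable_const_bound[of _ 1])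
    show "AE x in ?N. norm (?g x) \<le> 1"
    proof (rule AE_I2)
      fix x assume "x \<in> space ?N"
      then have "x \<in> R_space d" by (simp add: space_lborel_R)
      then have "?g x \<le> (\<integral>w. 1 \<partial>?N)"
        unfolding noise_op_eq by (intro integral_mono integrable_f_lc f01) auto
      moreover have "0 \<le> ?g x"
        unfolding noise_op_eq by (intro Bochner_Integration.integral_nonneg f01)
      ultimately show "norm (?g x) \<le> 1" by simp
    qed
  qed simp
  let ?u = "\<lambda>m p. \<bar>?g (lc d (cos (h m)) (fst p) (sin (h m)) (snd p)) - ?g (fst p)\<bar> / h m"
  let ?v = "\<lambda>p. \<bar>inner_R d (smooth_grad (fst p)) (snd p)\<bar>"
  let ?w = "\<lambda>p. L * (nrm d (fst p) + nrm d (snd p))"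
  have cosh: "\<bar>cos t - 1\<bar> \<le> t" if "0 \<le> t" "t \<le> 1" for t :: real
  proof -
    have "cos t = 1 - 2 * (sin (t / 2))\<^sup>2" using cos_double_sin[of "t / 2"] by simp
    moreover have "(sin (t / 2))\<^sup>2 \<le> (t / 2)\<^sup>2"
      using abs_sin_x_le_abs_x[of "t / 2"] by (simp add: abs_le_square_iff[symmetric])
    moreover have "2 * (t / 2)\<^sup>2 \<le> t"
      using mult_right_mono[of t 1 t] that by (simp add: power2_eq_square)
    ultimately show ?thesis using zero_le_power2[of "sin (t / 2)"] by linarith
  qed
  have w: "integrable ?NN ?w"
  proof -
    have "integrable ?NN (\<lambda>p. nrm d (fst p))"
      using integral_fst_std_gaussian2(2)[of "nrm d" d] integrable_nrm by simp
    moreover have "integrable ?NN (\<lambda>p. nrm d (snd p))"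
      using NN.integrable_product_swap[of d "\<lambda>p. nrm d (fst p)"] calculation by (simp add: case_prod_beta')
    ultimately show ?thesis by simp
  qed
  have bnd: "\<bar>?u m p\<bar> \<le> ?w p" if "p \<in> space ?NN" for m p
  proof -
    have p: "fst p \<in> R_space d" "snd p \<in> R_space d" using that by (auto simp: space_pair_measure space_lborel_R)
    have "nrm d (lc d 1 (lc d (cos (h m)) (fst p) (sin (h m)) (snd p)) (-1) (fst p)) =
        nrm d (lc d (cos (h m) - 1) (fst p) (sin (h m)) (snd p))"
      by (rule nrm_cong) (simp add: algebra_simps)
    also have "\<dots> \<le> \<bar>cos (h m) - 1\<bar> * nrm d (fst p) + \<bar>sin (h m)\<bar> * nrm d (snd p)" by (rule nrm_lc_le)
    also have "\<dots> \<le> h m * nrm d (fst p) + h m * nrm d (snd p)"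
      using cosh[of "h m"] abs_sin_x_le_abs_x[of "h m"] h[of m] by (intro add_mono mult_right_mono) auto
    finally have n: "nrm d (lc d 1 (lc d (cos (h m)) (fst p) (sin (h m)) (snd p)) (-1) (fst p)) \<le> h m * (nrm d (fst p) + nrm d (snd p))"
      by (simp add: algebra_simps)
    have "\<bar>?g (lc d (cos (h m)) (fst p) (sin (h m)) (snd p)) - ?g (fst p)\<bar> \<le> L * (h m * (nrm d (fst p) + nrm d (snd p)))"
      using noise_op_lip[of "lc d (cos (h m)) (fst p) (sin (h m)) (snd p)" "fst p"] p mult_left_mono[OF n L] by simp
    then show ?thesis using h[of m] by (simp add: pos_divide_le_eq abs_mult mult_ac)
  qed
  have lim: "(\<lambda>m. ?u m p) \<longlonglongrightarrow> ?v p" if "p \<in> space ?NN" for p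
  proof -
    have p: "fst p \<in> R_space d" "snd p \<in> R_space d" using that by (auto simp: space_pair_measure space_lborel_R)
    \<comment> \<open>\<open>X\<close> runs along the circle and \<open>Y\<close> along its tangent.
      The Lipschitz bound makes their difference negligible against \<open>h m\<close>, so the
      derivative along \<open>Y\<close> carries over to \<open>X\<close>.\<close>
    define X where "X m = lc d (cos (h m)) (fst p) (sin (h m)) (snd p)" for m
    define Y where "Y m = lc d 1 (fst p) (h m) (snd p)" for m
    have l1: "(\<lambda>m. (?g (Y m) - ?g (fst p)) / h m) \<longlonglongrightarrow> inner_R d (smooth_grad (fst p)) (snd p)"
      unfolding Y_def by (rule noise_op_directional_derivative[OF p h h0])
    have "DERIV sin (0::real) :> 1" "DERIV cos (0::real) :> 0"
      by (auto intro!: derivative_eq_intros)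
    then have s0: "((\<lambda>t. (sin (0 + t) - sin 0) / t) \<longlongrightarrow> (1::real)) (at 0)"
      and c0: "((\<lambda>t. (cos (0 + t) - cos 0) / t) \<longlongrightarrow> (0::real)) (at 0)"
      by (auto dest!: DERIV_D)
    have s1: "(\<lambda>m. sin (h m) / h m) \<longlonglongrightarrow> 1" using filterlim_compose[OF s0 hat] by simp
    have c1: "(\<lambda>m. (cos (h m) - 1) / h m) \<longlonglongrightarrow> 0" using filterlim_compose[OF c0 hat] by simp
    let ?r = "\<lambda>m. L * (\<bar>(cos (h m) - 1) / h m\<bar> * nrm d (fst p) + \<bar>sin (h m) / h m - 1\<bar> * nrm d (snd p))"
    have "?r \<longlonglongrightarrow> L * (\<bar>0\<bar> * nrm d (fst p) + \<bar>1 - 1\<bar> * nrm d (snd p))"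
      by (intro tendsto_intros s1 c1)
    then have r0: "?r \<longlonglongrightarrow> 0" by simp
    have "\<bar>(?g (X m) - ?g (Y m)) / h m\<bar> \<le> ?r m" for m
    proof -
      have "nrm d (lc d 1 (X m) (-1) (Y m)) = nrm d (lc d (cos (h m) - 1) (fst p) (sin (h m) - h m) (snd p))"
        by (rule nrm_cong) (simp add: X_def Y_def algebra_simps)
      also have "\<dots> \<le> \<bar>cos (h m) - 1\<bar> * nrm d (fst p) + \<bar>sin (h m) - h m\<bar> * nrm d (snd p)" by (rule nrm_lc_le)
      finally have n: "nrm d (lc d 1 (X m) (-1) (Y m)) \<le> \<bar>cos (h m) - 1\<bar> * nrm d (fst p) + \<bar>sin (h m) - h m\<bar> * nrm d (snd p)" .
      have XY: "X m \<in> R_space d" "Y m \<in> R_space d" by (simp_all add: X_def Y_def)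
      have "\<bar>?g (X m) - ?g (Y m)\<bar> \<le> L * (\<bar>cos (h m) - 1\<bar> * nrm d (fst p) + \<bar>sin (h m) - h m\<bar> * nrm d (snd p))"
        by (rule order_trans[OF noise_op_lip[OF XY] mult_left_mono[OF n L]])
      then have "\<bar>(?g (X m) - ?g (Y m)) / h m\<bar> \<le> L * (\<bar>cos (h m) - 1\<bar> * nrm d (fst p) + \<bar>sin (h m) - h m\<bar> * nrm d (snd p)) / h m"
        using h[of m] by (simp add: divide_right_mono)
      also have "\<dots> = ?r m"
      proof -
        have "\<bar>sin (h m) / h m - 1\<bar> = \<bar>sin (h m) - h m\<bar> / h m"
          using h[of m] by (simp add: diff_divide_distrib[symmetric] abs_divide field_simps)
        then show ?thesis using h[of m] by (simp add: abs_divide add_divide_distrib distrib_left)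
      qed
      finally show ?thesis .
    qed
    then have "(\<lambda>m. (?g (X m) - ?g (Y m)) / h m) \<longlonglongrightarrow> 0"
      by (intro Lim_null_comparison[OF _ r0]) auto
    from tendsto_add[OF this l1] have "(\<lambda>m. (?g (X m) - ?g (fst p)) / h m) \<longlonglongrightarrow> inner_R d (smooth_grad (fst p)) (snd p)"
      by (simp add: add_divide_distrib[symmetric])
    from tendsto_rabs[OF this] show ?thesis using abs_of_pos[OF h(1)] by (simp add: X_def abs_divide)
  qed
  have dom: "integrable ?NN ?v" "(\<lambda>m. \<integral>p. ?u m p \<partial>?NN) \<longlonglongrightarrow> (\<integral>p. ?v p \<partial>?NN)"
  proof -
    have um: "?u m \<in> borel_measurable ?NN" for m by simp
    have vm: "?v \<in> borel_measurable ?NN" by simp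
    have l: "AE p in ?NN. (\<lambda>m. ?u m p) \<longlonglongrightarrow> ?v p" using lim by (intro AE_I2)
    have b: "AE p in ?NN. norm (?u m p) \<le> ?w p" for m using bnd[of _ m] by (intro AE_I2) simp
    show "integrable ?NN ?v" by (rule integrable_dominated_convergence[OF vm um w l b])
    show "(\<lambda>m. \<integral>p. ?u m p \<partial>?NN) \<longlonglongrightarrow> (\<integral>p. ?v p \<partial>?NN)"
      by (rule integral_dominated_convergence[OF vm um w l b])
  qed
  have "noise_sens d ?g \<theta> \<le> \<theta> * (\<integral>p. ?u m p \<partial>?NN)" for m
  proof -
    have t: "real (Suc m) * h m = \<theta>" by (simp add: h_def)
    have "noise_sens d ?g (real (Suc m) * h m) \<le> real (Suc m) * noise_sens d ?g (h m)"
      using gi h[of m] \<theta> t by (intro noise_sens_mult) auto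
    also have "noise_sens d ?g (h m) = (\<integral>p. h m * ?u m p \<partial>?NN)"
      unfolding noise_sens_def using h(1)[of m] by (intro Bochner_Integration.integral_cong refl) simp
    also have "\<dots> = h m * (\<integral>p. ?u m p \<partial>?NN)" by (rule integral_mult_right_zero)
    finally show ?thesis by (simp only: t mult.assoc[symmetric])
  qed
  then have "noise_sens d ?g \<theta> \<le> \<theta> * (\<integral>p. ?v p \<partial>?NN)"
    by (intro LIMSEQ_le_const[OF tendsto_mult_left[OF dom(2)]]) auto
  also have "(\<integral>p. ?v p \<partial>?NN) = (\<integral>x. (\<integral>z. \<bar>inner_R d (smooth_grad x) z\<bar> \<partial>?N) \<partial>?N)"
    using NN.integral_fst'[OF dom(1)] by simp
  also have "\<dots> \<le> (\<integral>x. L * bdry_prob x \<partial>?N)"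
  proof (rule integral_mono_AE)
    show "integrable ?N (\<lambda>x. \<integral>z. \<bar>inner_R d (smooth_grad x) z\<bar> \<partial>?N)"
      using NN.integrable_fst'[OF dom(1)] by simp
    show "integrable ?N (\<lambda>x. L * bdry_prob x)" using bdry_prob_integrable by simp
    show "AE x in ?N. (\<integral>z. \<bar>inner_R d (smooth_grad x) z\<bar> \<partial>?N) \<le> L * bdry_prob x"
      by (rule AE_I2) (use integral_abs_inner_R_le nrm_smooth_grad_le order_trans space_lborel_R in \<open>auto, blast\<close>)
  qed
  also have "\<dots> = L * measure ?N B" using bdry_prob_integral by simp
  finally show ?thesis using \<theta> by simp
qed

text \<open>The noisy copy differs from \<open>x\<close> by
  \<open>(c - 1) * x + \<sigma> * w\<close>, and both coefficients vanish as \<open>c\<close> tends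
  to 1.\<close>

lemma noise_op_close:
  "(\<integral>x. \<bar>noise_op d c f x - f x\<bar> \<partial>std_gaussian d) \<le> L * ((1 - c) + \<sigma>) * (\<integral>x. nrm d x \<partial>std_gaussian d)"
  and noise_op_close_integrable: "integrable (std_gaussian d) (\<lambda>x. \<bar>noise_op d c f x - f x\<bar>)"
proof -
  let ?N = "std_gaussian d"
  have pt: "\<bar>noise_op d c f x - f x\<bar> \<le> L * ((1 - c) * nrm d x + \<sigma> * (\<integral>x. nrm d x \<partial>?N))" if "x \<in> space ?N" for x
  proof -
    have x: "x \<in> R_space d" using that by (simp add: space_lborel_R)
    have "\<bar>noise_op d c f x - f x\<bar> = \<bar>\<integral>w. f (lc d c x \<sigma> w) - f x \<partial>?N\<bar>"
      using integrable_f_lc[OF x] N.prob_space by (simp add: noise_op_eq)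
    also have "\<dots> \<le> (\<integral>w. \<bar>f (lc d c x \<sigma> w) - f x\<bar> \<partial>?N)" by (rule integral_abs_bound)
    also have "\<dots> \<le> (\<integral>w. L * ((1 - c) * nrm d x + \<sigma> * nrm d w) \<partial>?N)"
    proof (rule integral_mono)
      show "integrable ?N (\<lambda>w. \<bar>f (lc d c x \<sigma> w) - f x\<bar>)" using integrable_f_lc[OF x] by simp
      show "integrable ?N (\<lambda>w. L * ((1 - c) * nrm d x + \<sigma> * nrm d w))" using integrable_nrm by simp
      fix w
      have "nrm d (lc d 1 (lc d c x \<sigma> w) (-1) x) = nrm d (lc d (c - 1) x \<sigma> w)"
        by (rule nrm_cong) (simp add: algebra_simps)
      also have "\<dots> \<le> (1 - c) * nrm d x + \<sigma> * nrm d w"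
        using nrm_lc_le[of d "c - 1" x \<sigma> w] c \<sigma> by simp
      finally have "nrm d (lc d 1 (lc d c x \<sigma> w) (-1) x) \<le> (1 - c) * nrm d x + \<sigma> * nrm d w" .
      from order_trans[OF lip[OF lc_R_space x] mult_left_mono[OF this L]]
      show "\<bar>f (lc d c x \<sigma> w) - f x\<bar> \<le> L * ((1 - c) * nrm d x + \<sigma> * nrm d w)" .
    qed
    also have "\<dots> = L * ((1 - c) * nrm d x + \<sigma> * (\<integral>x. nrm d x \<partial>?N))"
      using integrable_nrm N.prob_space by simp
    finally show ?thesis .
  qed
  have i2: "integrable ?N (\<lambda>x. L * ((1 - c) * nrm d x + \<sigma> * (\<integral>x. nrm d x \<partial>?N)))"
    using integrable_nrm by simp
  show i1: "integrable ?N (\<lambda>x. \<bar>noise_op d c f x - f x\<bar>)"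
    by (rule Bochner_Integration.integrable_bound[OF i2]) (use pt in \<open>auto intro!: AE_I2 order.trans[OF _ abs_ge_self]\<close>)
  have "(\<integral>x. \<bar>noise_op d c f x - f x\<bar> \<partial>?N) \<le> (\<integral>x. L * ((1 - c) * nrm d x + \<sigma> * (\<integral>x. nrm d x \<partial>?N)) \<partial>?N)"
    by (rule integral_mono_AE[OF i1 i2]) (use pt in auto)
  also have "\<dots> = L * ((1 - c) + \<sigma>) * (\<integral>x. nrm d x \<partial>?N)"
    using integrable_nrm N.prob_space by (simp add: algebra_simps)
  finally show "(\<integral>x. \<bar>noise_op d c f x - f x\<bar> \<partial>?N) \<le> L * ((1 - c) + \<sigma>) * (\<integral>x. nrm d x \<partial>?N)" .
qed

end

text \<open>The bound for the smoothed function does not depend on \<open>c\<close>, so the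
  smoothing can be removed by letting \<open>c\<close> tend to 1.\<close>

lemma noise_sens_lipschitz_le:
  assumes \<theta>: "0 < \<theta>" "\<theta> \<le> 1"
  shows "noise_sens d f \<theta> \<le> \<theta> * (L * measure (std_gaussian d) B)"
proof -
  let ?N = "std_gaussian d"
  \<comment> \<open>The shift by 2 keeps \<open>c m\<close> strictly positive at
    \<open>m = 0\<close>.\<close>
  define c :: "nat \<Rightarrow> real" where "c m = 1 - 1 / real (m + 2)" for m
  have c: "0 < c m" "c m < 1" for m by (auto simp: c_def field_simps)
  have "(\<lambda>m. 1 / real (m + 2)) \<longlonglongrightarrow> 0"
    using LIMSEQ_ignore_initial_segment[OF lim_1_over_n, of 2] by simp
  then have c1: "c \<longlonglongrightarrow> 1" unfolding c_def using tendsto_diff[OF tendsto_const[of 1]] by fastforce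
  have fi: "integrable ?N f" using f_abs_le by (intro N.integrable_const_bound[of _ 1]) auto
  have le: "noise_sens d f \<theta> \<le> \<theta> * (L * measure ?N B) + 2 * (L * ((1 - c m) + sqrt (1 - (c m)\<^sup>2)) * (\<integral>x. nrm d x \<partial>?N))" for m
  proof -
    have m: "noise_op d (c m) f \<in> borel_measurable (lborel_R d)" by (rule noise_op_measurable[OF c refl])
    have i: "integrable ?N (\<lambda>x. noise_op d (c m) f x - f x)"
      using noise_op_close_integrable[OF c refl] m by (subst integrable_abs_iff[symmetric]) auto
    then have gi: "integrable ?N (noise_op d (c m) f)" using Bochner_Integration.integrable_add[OF i fi] by simp
    have "noise_sens d f \<theta> \<le> noise_sens d (noise_op d (c m) f) \<theta> + 2 * (\<integral>x. \<bar>noise_op d (c m) f x - f x\<bar> \<partial>?N)"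
      using cos_gt_minus_one[of \<theta>] \<theta> by (intro noise_sens_close_le m gi fi fm) auto
    then show ?thesis
      using noise_sens_noise_op_le[OF c refl \<theta>, of m] noise_op_close[OF c refl, of m] by linarith
  qed
  have "(\<lambda>m. \<theta> * (L * measure ?N B) + 2 * (L * ((1 - c m) + sqrt (1 - (c m)\<^sup>2)) * (\<integral>x. nrm d x \<partial>?N)))
      \<longlonglongrightarrow> \<theta> * (L * measure ?N B) + 2 * (L * ((1 - 1) + sqrt (1 - 1\<^sup>2)) * (\<integral>x. nrm d x \<partial>?N))"
    by (intro tendsto_intros c1)
  then have "(\<lambda>m. \<theta> * (L * measure ?N B) + 2 * (L * ((1 - c m) + sqrt (1 - (c m)\<^sup>2)) * (\<integral>x. nrm d x \<partial>?N)))
      \<longlonglongrightarrow> \<theta> * (L * measure ?N B)" by simp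
  then show ?thesis by (rule LIMSEQ_le_const) (use le in auto)
qed

end

section \<open>Noise sensitivity and surface area\<close>

lemma dist_set_nrm: "dist_set d x A = (INF a\<in>A. ennreal (nrm d (lc d 1 x (-1) a)))"
  unfolding dist_set_def by (intro INF_cong refl arg_cong[of _ _ ennreal] L2_set_cong) auto

text \<open>\<open>A\<close> is arbitrary: the infimum is attained on a countable subset that is dense in the
  product topology.\<close>
lemma measurable_dist_set [measurable]: "(\<lambda>x. dist_set d x A) \<in> borel_measurable (lborel_R d)"
proof -
  obtain Q :: "(nat \<Rightarrow> real) set" where Q: "countable Q" "Q \<subseteq> A" "A \<subseteq> closure Q"
    using separable[of A] by blast
  have eq: "dist_set d x A = (INF a\<in>Q. ennreal (L2_set (\<lambda>i. x i - a i) {..<d}))" for x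
    unfolding dist_set_def
  proof (rule antisym)
    show "(INF a\<in>A. ennreal (L2_set (\<lambda>i. x i - a i) {..<d})) \<le> (INF a\<in>Q. ennreal (L2_set (\<lambda>i. x i - a i) {..<d}))"
      using Q by (intro INF_superset_mono) auto
    show "(INF a\<in>Q. ennreal (L2_set (\<lambda>i. x i - a i) {..<d})) \<le> (INF a\<in>A. ennreal (L2_set (\<lambda>i. x i - a i) {..<d}))"
    proof (rule INF_greatest)
      fix a assume "a \<in> A"
      with Q have "a \<in> closure Q" by auto
      then obtain s where s: "\<And>n. s n \<in> Q" "s \<longlonglongrightarrow> a" unfolding closure_sequential by auto
      have comp: "(\<lambda>n. s n i) \<longlonglongrightarrow> a i" for i
      proof -
        have "continuous_on UNIV (\<lambda>x::nat \<Rightarrow> real. x i)" by simp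
        then have "isCont (\<lambda>x::nat \<Rightarrow> real. x i) a" 
          using continuous_on_eq_continuous_at[OF open_UNIV] by blast
        from isCont_tendsto_compose[OF this s(2)] show ?thesis .
      qed
      have "(\<lambda>n. L2_set (\<lambda>i. x i - s n i) {..<d}) \<longlonglongrightarrow> L2_set (\<lambda>i. x i - a i) {..<d}"
        unfolding L2_set_def by (intro tendsto_intros comp)
      then have "(\<lambda>n. ennreal (L2_set (\<lambda>i. x i - s n i) {..<d})) \<longlonglongrightarrow> ennreal (L2_set (\<lambda>i. x i - a i) {..<d})"
        by (rule tendsto_ennrealI)
      then show "(INF a\<in>Q. ennreal (L2_set (\<lambda>i. x i - a i) {..<d})) \<le> ennreal (L2_set (\<lambda>i. x i - a i) {..<d})"
        by (rule LIMSEQ_le_const)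
          (use INF_lower[OF s(1), of "\<lambda>a. ennreal (L2_set (\<lambda>i. x i - a i) {..<d})"] in blast)
    qed
  qed
  show ?thesis
    unfolding eq by (intro borel_measurable_INF Q(1)) (simp add: L2_set_def)
qed

lemma dist_set_triangle:
  shows "dist_set d x A \<le> dist_set d y A + ennreal (nrm d (lc d 1 x (-1) y))"
proof -
  have "dist_set d x A - ennreal (nrm d (lc d 1 x (-1) y)) \<le> dist_set d y A"
    unfolding dist_set_nrm[of d y]
  proof (rule INF_greatest)
    fix a assume a: "a \<in> A"
    have "nrm d (lc d 1 x (-1) a) = nrm d (lc d 1 (lc d 1 y (-1) a) 1 (lc d 1 x (-1) y))"
      by (rule nrm_cong) simp
    also have "\<dots> \<le> nrm d (lc d 1 y (-1) a) + nrm d (lc d 1 x (-1) y)"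
      using nrm_lc_le[of d 1 _ 1] by simp
    finally have "ennreal (nrm d (lc d 1 x (-1) a)) \<le> ennreal (nrm d (lc d 1 x (-1) y)) + ennreal (nrm d (lc d 1 y (-1) a))"
      by (simp add: ennreal_plus[symmetric] add.commute del: ennreal_plus)
    moreover have "dist_set d x A \<le> ennreal (nrm d (lc d 1 x (-1) a))"
      unfolding dist_set_nrm using a by (rule INF_lower)
    ultimately have "dist_set d x A \<le> ennreal (nrm d (lc d 1 x (-1) y)) + ennreal (nrm d (lc d 1 y (-1) a))"
      by (rule order_trans[rotated])
    then show "dist_set d x A - ennreal (nrm d (lc d 1 x (-1) y)) \<le> ennreal (nrm d (lc d 1 y (-1) a))"
      by (simp add: ennreal_minus_le_iff)
  qed
  then show ?thesis by (simp add: ennreal_minus_le_iff add.commute)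
qed

lemma measurable_thickening [measurable]: "thickening d \<delta> A \<in> sets (lborel_R d)"
  unfolding thickening_def by measurable

lemma dist_set_self:
  assumes "x \<in> A"
  shows "dist_set d x A = 0"
proof -
  have "nrm d (lc d 1 x (-1) x) = nrm d (\<lambda>i. 0)" by (rule nrm_cong) simp
  also have "\<dots> = 0" by (simp add: L2_set_def)
  finally have "dist_set d x A \<le> ennreal 0"
    unfolding dist_set_nrm using INF_lower[OF assms, of "\<lambda>a. ennreal (nrm d (lc d 1 x (-1) a))"] by simp
  then show ?thesis by simp
qed

text \<open>The Lipschitz approximations of the indicator have slope \<open>1 / (\<delta> - 3 * \<eta>)\<close>, and only on the
  part of the thickening that is \<open>\<eta>\<close>-far from \<open>A\<close> and from the outside.\<close>
lemma noise_sens_thickening_le: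
  assumes A [measurable]: "A \<in> sets (lborel_R d)" and \<delta>: "0 < \<eta>" "3 * \<eta> < \<delta>" and \<theta>: "0 < \<theta>" "\<theta> \<le> 1"
  shows "noise_sens d (indicator A) \<theta> \<le> (2 + \<theta> / (\<delta> - 3 * \<eta>)) * measure (std_gaussian d) (thickening d \<delta> A - A)"
proof (cases "A = {}")
  case True
  then show ?thesis
    using \<delta> \<theta> by (simp add: noise_sens_def)
next
  case False
  let ?N = "std_gaussian d" and ?B = "thickening d \<delta> A - A"
  define r where "r x = enn2real (dist_set d x A)" for x
  define L where "L = 1 / (\<delta> - 3 * \<eta>)"
  \<comment> \<open>A plateau of height 1 up to distance \<open>2 * \<eta>\<close>, then a ramp that
    reaches 0 at \<open>\<delta> - \<eta>\<close>. The flat margins make \<open>f\<close> constant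
    on the \<open>\<eta>\<close>-neighbourhood of every point outside \<open>?B\<close>.\<close>
  define f where "f x = max 0 (min 1 ((\<delta> - \<eta> - r x) * L))" for x
  have L: "L > 0" using \<delta> by (simp add: L_def)
  have \<delta>0: "0 \<le> \<delta>" using \<delta> by linarith
  have [measurable]: "r \<in> borel_measurable (lborel_R d)" unfolding r_def by measurable
  have fm: "f \<in> borel_measurable (lborel_R d)" unfolding f_def by measurable
  have Bm[measurable]: "?B \<in> sets (lborel_R d)" by measurable
  have fin: "dist_set d x A < \<infinity>" for x
  proof -
    obtain a where "a \<in> A" using False by auto
    then have "dist_set d x A \<le> ennreal (nrm d (lc d 1 x (-1) a))"
      unfolding dist_set_nrm by (rule INF_lower)
    then show ?thesis using le_less_trans by fastforce
  qed
  then have er: "ennreal (r x) = dist_set d x A" for x by (simp add: r_def)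
  have r0: "r x \<ge> 0" for x by (simp add: r_def)
  have rtri: "r x \<le> r y + nrm d (lc d 1 x (-1) y)" if "x \<in> R_space d" "y \<in> R_space d" for x y
    using dist_set_triangle[of d x A y] r0[of y]
    by (simp add: er[symmetric] ennreal_plus[symmetric] r0 del: ennreal_plus)
  have sym: "nrm d (lc d 1 x (-1) y) = nrm d (lc d 1 y (-1) x)" for x y
  proof -
    have "nrm d (lc d 1 x (-1) y) = nrm d (\<lambda>i. (-1) * lc d 1 y (-1) x i)" by (rule nrm_cong) simp
    then show ?thesis by (simp only: nrm_scale)
  qed
  have rlip: "\<bar>r x - r y\<bar> \<le> nrm d (lc d 1 x (-1) y)" if "x \<in> R_space d" "y \<in> R_space d" for x y
    using rtri[OF that] rtri[OF that(2,1)] sym[of x y] by linarith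
  have lip: "\<bar>f x - f y\<bar> \<le> L * nrm d (lc d 1 x (-1) y)" if xy: "x \<in> R_space d" "y \<in> R_space d" for x y
  proof -
    have "\<bar>f x - f y\<bar> \<le> \<bar>(\<delta> - \<eta> - r x) * L - (\<delta> - \<eta> - r y) * L\<bar>"
      unfolding f_def by (auto simp: max_def min_def)
    also have "\<dots> = \<bar>r x - r y\<bar> * L" using L
      by (simp add: left_diff_distrib[symmetric] abs_mult)
    also have "\<dots> \<le> L * nrm d (lc d 1 x (-1) y)"
      using rlip[OF xy] L by (simp add: mult.commute)
    finally show ?thesis .
  qed
  have f1: "f x = 1" if "r x \<le> 2 * \<eta>" for x
  proof -
    have "1 \<le> (\<delta> - \<eta> - r x) * L" using that \<delta> by (simp add: L_def field_simps)
    then show ?thesis by (simp add: f_def)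
  qed
  have f0: "f x = 0" if "\<delta> - \<eta> \<le> r x" for x
  proof -
    have "(\<delta> - \<eta> - r x) * L \<le> 0" using that L by (intro mult_nonpos_nonneg) auto
    then show ?thesis by (simp add: f_def)
  qed
  have out: "r x = 0 \<or> r x > \<delta>" if "x \<in> R_space d" "x \<notin> ?B" for x
  proof (cases "x \<in> A")
    case True
    then show ?thesis by (simp add: r_def dist_set_self)
  next
    case False
    then have "\<not> dist_set d x A \<le> ennreal \<delta>" using that by (simp add: thickening_def)
    then show ?thesis unfolding er[symmetric] using \<delta>0 by (simp add: ennreal_le_iff not_le)
  qed
  have loc: "\<bar>f x - f y\<bar> \<le> L * nrm d (lc d 1 x (-1) y) * indicator ?B x"
    if xy: "x \<in> R_space d" "y \<in> R_space d" and n: "nrm d (lc d 1 x (-1) y) \<le> \<eta>" for x y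
  proof (cases "x \<in> ?B")
    case True
    then show ?thesis using lip[OF xy] by simp
  next
    case False
    have d: "\<bar>r x - r y\<bar> \<le> \<eta>" using rlip[OF xy] n by linarith
    from out[OF xy(1) False] show ?thesis
    proof
      assume "r x = 0"
      then have "f x = 1" "f y = 1" using d \<delta> by (auto intro!: f1)
      then show ?thesis using False by simp
    next
      assume "r x > \<delta>"
      then have "f x = 0" "f y = 0" using d \<delta> by (auto intro!: f0)
      then show ?thesis using False by simp
    qed
  qed
  have sens_f: "noise_sens d f \<theta> \<le> \<theta> * (L * measure ?N ?B)"
  proof (rule noise_sens_lipschitz_le[where \<eta> = \<eta>])
    show "0 \<le> f x" "f x \<le> 1" for x by (auto simp: f_def)
  qed (use fm Bm L \<delta> lip loc \<theta> in auto)
  have close: "\<bar>f x - indicator A x\<bar> \<le> indicator ?B x" if "x \<in> R_space d" for x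
  proof (cases "x \<in> ?B")
    case True
    then show ?thesis by (auto simp: f_def)
  next
    case False
    show ?thesis
    proof (cases "x \<in> A")
      case True
      then have "f x = 1" using \<delta> by (intro f1) (simp add: r_def dist_set_self)
      then show ?thesis using True by simp
    next
      case notA: False
      then have "\<not> dist_set d x A \<le> ennreal \<delta>" using that False by (simp add: thickening_def)
      then have "r x > \<delta>" unfolding er[symmetric] using \<delta>0 by (simp add: ennreal_le_iff not_le)
      then have "f x = 0" using \<delta> by (intro f0) simp
      then show ?thesis using notA by simp
    qed
  qed
  have bnd1: "integrable ?N u" if "u \<in> borel_measurable (lborel_R d)" "\<And>x. \<bar>u x\<bar> \<le> 1" for u :: "_ \<Rightarrow> real"
    using that by (intro N.integrable_const_bound[of _ 1]) auto
  have fi: "integrable ?N f" by (rule bnd1[OF fm]) (auto simp: f_def)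
  have Ai: "integrable ?N (indicator A :: _ \<Rightarrow> real)" by (rule bnd1) auto
  have "(\<integral>x. \<bar>f x - indicator A x\<bar> \<partial>?N) \<le> (\<integral>x. indicator ?B x \<partial>?N)"
    by (intro integral_mono_AE Bochner_Integration.integrable_abs Bochner_Integration.integrable_diff fi Ai bnd1 AE_I2)
      (use close in \<open>auto simp: space_lborel_R\<close>)
  also have "\<dots> = measure ?N ?B"
    using sets.sets_into_space[OF Bm] by (simp add: space_lborel_R Int_absorb2)
  finally have "(\<integral>x. \<bar>f x - indicator A x\<bar> \<partial>?N) \<le> measure ?N ?B" .
  moreover have "noise_sens d (indicator A) \<theta> \<le> noise_sens d f \<theta> + 2 * (\<integral>x. \<bar>f x - indicator A x\<bar> \<partial>?N)"
    using cos_gt_minus_one[of \<theta>] \<theta> by (intro noise_sens_close_le fm fi Ai) auto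
  moreover have "(2 + \<theta> / (\<delta> - 3 * \<eta>)) * measure ?N ?B = \<theta> * (L * measure ?N ?B) + 2 * measure ?N ?B"
    by (simp add: L_def algebra_simps)
  ultimately show ?thesis using sens_f by linarith
qed

text \<open>Let the margin of the plateau tend to 0; its slope then tends to
  \<open>1 / \<delta>\<close>. The summand \<open>2 * \<delta>\<close> is the price of replacing the
  indicator by the plateau function.\<close>

lemma noise_sens_le_thickening:
  assumes A: "A \<in> sets (lborel_R d)" and \<delta>: "0 < \<delta>" and \<theta>: "0 < \<theta>" "\<theta> \<le> 1"
  shows "noise_sens d (indicator A) \<theta> \<le> (2 * \<delta> + \<theta>) * (measure (std_gaussian d) (thickening d \<delta> A - A) / \<delta>)"
proof -
  let ?m = "measure (std_gaussian d) (thickening d \<delta> A - A)"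
  define e where "e m = \<delta> / (4 * real (Suc m))" for m
  have e: "0 < e m" "3 * e m < \<delta>" for m
  proof -
    show "0 < e m" using \<delta> by (simp add: e_def)
    have "3 * \<delta> < \<delta> * (4 * real (Suc m))"
      using mult_strict_left_mono[of 3 "4 * real (Suc m)" \<delta>] \<delta> by simp
    then show "3 * e m < \<delta>" by (simp add: e_def pos_divide_less_eq del: of_nat_Suc)
  qed
  have e0: "e \<longlonglongrightarrow> 0"
  proof -
    have "e = (\<lambda>m. \<delta> / 4 * inverse (real (Suc m)))"
      unfolding e_def by (simp only: divide_inverse inverse_mult_distrib mult.assoc)
    then show ?thesis using tendsto_mult_right_zero[OF LIMSEQ_inverse_real_of_nat, of "\<delta> / 4"] by simp
  qed
  have "(\<lambda>m. (2 + \<theta> / (\<delta> - 3 * e m)) * ?m) \<longlonglongrightarrow> (2 + \<theta> / (\<delta> - 3 * 0)) * ?m"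
    by (intro tendsto_intros e0) (use \<delta> in auto)
  then have "noise_sens d (indicator A) \<theta> \<le> (2 + \<theta> / (\<delta> - 3 * 0)) * ?m"
    by (rule LIMSEQ_le_const) (use noise_sens_thickening_le[OF A e \<theta>] in blast)
  also have "\<dots> = (2 * \<delta> + \<theta>) * (?m / \<delta>)" using \<delta> by (simp add: field_simps)
  finally show ?thesis .
qed

text \<open>The lower limit provides arbitrarily small \<open>\<delta>\<close> whose quotient is
  nearly the surface area. One such \<open>\<delta>\<close> is enough, since the error,
  \<open>2 * \<delta>\<close> times the quotient, disappears with it.\<close>

theorem noise_sens_le_surface_area:
  assumes A [measurable]: "A \<in> sets (lborel_R d)" and fin: "gaussian_surface_area d A < \<infinity>" and \<theta>: "0 < \<theta>" "\<theta> \<le> 1"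
  shows "noise_sens d (indicator A) \<theta> \<le> \<theta> * enn2real (gaussian_surface_area d A)"
proof (rule field_le_epsilon)
  fix e :: real assume e: "e > 0"
  define \<Gamma> where "\<Gamma> = enn2real (gaussian_surface_area d A)"
  have \<Gamma>: "\<Gamma> \<ge> 0" "gaussian_surface_area d A = ennreal \<Gamma>" using fin by (auto simp: \<Gamma>_def)
  \<comment> \<open>Chosen so that both errors, \<open>2 * t * (\<Gamma> + t)\<close> and
    \<open>\<theta> * t\<close>, are at most \<open>e / 4\<close>.\<close>
  define t where "t = min 1 (min (e / 4) (e / (8 * (\<Gamma> + 1))))"
  have t: "t > 0" "t \<le> 1" "t \<le> e / 4" "t \<le> e / (8 * (\<Gamma> + 1))"
  proof -
    show "t > 0" using e \<Gamma> by (auto simp: t_def)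
    show "t \<le> 1" unfolding t_def by (rule min.cobounded1)
    show "t \<le> e / 4" unfolding t_def by (intro min.coboundedI2 min.cobounded1)
    show "t \<le> e / (8 * (\<Gamma> + 1))" unfolding t_def by (intro min.coboundedI2 min.cobounded2)
  qed
  let ?q = "\<lambda>\<delta>. emeasure (completion (std_gaussian d)) (thickening d \<delta> A - A) / ennreal \<delta>"
  have "\<exists>\<delta>. 0 < \<delta> \<and> \<delta> < t \<and> ?q \<delta> < ennreal (\<Gamma> + t)"
  proof (rule ccontr)
    assume "\<not> ?thesis"
    then have "ennreal (\<Gamma> + t) \<le> ?q \<delta>" if "0 < \<delta>" "\<delta> < t" for \<delta>
      using that by (meson not_less)
    then have "\<forall>\<^sub>F \<delta> in at_right 0. ennreal (\<Gamma> + t) \<le> ?q \<delta>"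
      by (intro eventually_at_rightI[OF _ t(1)]) (simp del: emeasure_completion)
    then have "ennreal (\<Gamma> + t) \<le> gaussian_surface_area d A"
      unfolding gaussian_surface_area_def by (rule Liminf_bounded)
    then show False using \<Gamma> t by simp
  qed
  then obtain \<delta> where \<delta>: "0 < \<delta>" "\<delta> < t" "?q \<delta> < ennreal (\<Gamma> + t)" by blast
  let ?m = "measure (std_gaussian d) (thickening d \<delta> A - A)"
  have "?q \<delta> = ennreal ?m / ennreal \<delta>"
    by (simp add: N.emeasure_eq_measure)
  also have "\<dots> = ennreal (?m / \<delta>)" using \<delta> by (simp add: divide_ennreal)
  finally have q: "?m / \<delta> < \<Gamma> + t" using \<delta>(1,3) \<Gamma> t by (simp add: ennreal_less_iff del: ennreal_plus)
  have "noise_sens d (indicator A) \<theta> \<le> (2 * \<delta> + \<theta>) * (?m / \<delta>)"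
    by (rule noise_sens_le_thickening[OF A \<delta>(1) \<theta>])
  also have "\<dots> \<le> (2 * t + \<theta>) * (\<Gamma> + t)"
    using q \<delta> \<theta> by (intro mult_mono) auto
  also have "\<dots> = \<theta> * \<Gamma> + (2 * t * (\<Gamma> + t) + \<theta> * t)" by (simp add: algebra_simps)
  also have "\<dots> \<le> \<theta> * \<Gamma> + (e / 4 + e / 4)"
  proof -
    have "2 * t * (\<Gamma> + t) \<le> 2 * t * (\<Gamma> + 1)" using t \<Gamma> by (intro mult_left_mono) auto
    also have "\<dots> \<le> e / 4" using t(4) \<Gamma> by (simp add: pos_le_divide_eq mult_ac)
    finally have "2 * t * (\<Gamma> + t) \<le> e / 4" .
    moreover have "\<theta> * t \<le> e / 4" using \<theta> t mult_left_le_one_le[of t \<theta>] by linarith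
    ultimately show ?thesis by linarith
  qed
  finally show "noise_sens d (indicator A) \<theta> \<le> \<theta> * enn2real (gaussian_surface_area d A) + e"
    using e by (simp add: \<Gamma>_def)
qed

section \<open>Affine maps\<close>

definition bilinear_form :: "nat \<Rightarrow> (nat \<Rightarrow> nat \<Rightarrow> real) \<Rightarrow> (nat \<Rightarrow> real) \<Rightarrow> (nat \<Rightarrow> real) \<Rightarrow> real" where
  "bilinear_form d s v w = (\<Sum>i<d. \<Sum>j<d. v i * s i j * w j)"

lemma bilinear_form_scale: "bilinear_form d s (\<lambda>i. a * v i) (\<lambda>i. b * w i) = a * b * bilinear_form d s v w"
  by (simp add: bilinear_form_def sum_distrib_left mult_ac)

lemma bilinear_form_diff_left: "bilinear_form d s (\<lambda>i. v i - v' i) w = bilinear_form d s v w - bilinear_form d s v' w"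
  by (simp add: bilinear_form_def left_diff_distrib sum_subtractf)

lemma bilinear_form_sum_left: "bilinear_form d s (\<lambda>i. \<Sum>k\<in>K. a k * u k i) w = (\<Sum>k\<in>K. a k * bilinear_form d s (u k) w)"
proof -
  have "bilinear_form d s (\<lambda>i. \<Sum>k\<in>K. a k * u k i) w = (\<Sum>i<d. \<Sum>j<d. \<Sum>k\<in>K. a k * (u k i * s i j * w j))"
    by (simp add: bilinear_form_def sum_distrib_right mult.assoc)
  also have "\<dots> = (\<Sum>i<d. \<Sum>k\<in>K. \<Sum>j<d. a k * (u k i * s i j * w j))"
    by (intro sum.cong refl sum.swap)
  also have "\<dots> = (\<Sum>k\<in>K. \<Sum>i<d. \<Sum>j<d. a k * (u k i * s i j * w j))"
    by (rule sum.swap)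
  finally show ?thesis by (simp add: bilinear_form_def sum_distrib_left)
qed

lemma bilinear_form_commute:
  assumes "\<And>i j. i < d \<Longrightarrow> j < d \<Longrightarrow> s i j = s j i"
  shows "bilinear_form d s v w = bilinear_form d s w v"
  unfolding bilinear_form_def by (subst sum.swap) (intro sum.cong refl, simp add: assms mult_ac)

text \<open>Orthogonalising the coordinate vectors in their order keeps \<open>u a\<close> supported
  on \<open>{..a}\<close>, so the rows form a lower triangular matrix, the inverse of the Cholesky
  factor of \<open>s\<close>.\<close>

lemma gram_schmidt_lower_triangular:
  assumes sym: "\<And>i j. i < d \<Longrightarrow> j < d \<Longrightarrow> s i j = s j i"
    and pd: "\<And>v. \<exists>i<d. v i \<noteq> 0 \<Longrightarrow> bilinear_form d s v v > 0"
    and "m \<le> d"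
  shows "\<exists>u. \<forall>a<m. u a a > 0 \<and> (\<forall>i>a. u a i = 0) \<and> (\<forall>b<m. bilinear_form d s (u a) (u b) = (if a = b then 1 else 0))"
  using \<open>m \<le> d\<close>
proof (induction m)
  case (Suc m)
  then obtain u where u: "\<And>a. a < m \<Longrightarrow> u a a > 0" "\<And>a i. a < m \<Longrightarrow> i > a \<Longrightarrow> u a i = 0"
    "\<And>a b. a < m \<Longrightarrow> b < m \<Longrightarrow> bilinear_form d s (u a) (u b) = (if a = b then 1 else 0)" by auto
  define e :: "nat \<Rightarrow> real" where "e i = (if i = m then 1 else 0)" for i
  define w where "w i = e i - (\<Sum>k<m. bilinear_form d s e (u k) * u k i)" for i
  have w0: "w i = 0" if "i > m" for i
    using that u(2) by (simp add: w_def e_def)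
  have wm: "w m = 1" using u(2) by (simp add: w_def e_def)
  have wu: "bilinear_form d s w (u b) = 0" if "b < m" for b
  proof -
    have "bilinear_form d s w (u b) = bilinear_form d s e (u b) - (\<Sum>k<m. bilinear_form d s e (u k) * bilinear_form d s (u k) (u b))"
      unfolding w_def [abs_def] bilinear_form_diff_left bilinear_form_sum_left ..
    also have "(\<Sum>k<m. bilinear_form d s e (u k) * bilinear_form d s (u k) (u b)) = (\<Sum>k<m. if k = b then bilinear_form d s e (u k) else 0)"
      using that u(3) by (intro sum.cong refl) auto
    also have "\<dots> = bilinear_form d s e (u b)" using that by simp
    finally show ?thesis by simp
  qed
  define q where "q = bilinear_form d s w w"
  have q: "q > 0" unfolding q_def using wm Suc.prems by (intro pd exI[of _ m]) auto
  define u' where "u' a = (if a = m then (\<lambda>i. (1 / sqrt q) * w i) else u a)" for a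
  have mm: "bilinear_form d s (u' m) (u' m) = 1"
    using q by (simp only: u'_def if_True refl bilinear_form_scale q_def[symmetric]) simp
  have mb: "bilinear_form d s (u' m) (u' b) = 0" if "b < m" for b
    using that wu[OF that] bilinear_form_scale[of d s "1 / sqrt q" w 1 "u b"] by (simp add: u'_def)
  have "u' a a > 0 \<and> (\<forall>i>a. u' a i = 0) \<and> (\<forall>b<Suc m. bilinear_form d s (u' a) (u' b) = (if a = b then 1 else 0))" if "a < Suc m" for a
  proof (cases "a = m")
    case True
    then show ?thesis using mm mb q wm w0 by (auto simp: u'_def less_Suc_eq)
  next
    case False
    then have a: "a < m" using that by simp
    have "bilinear_form d s (u' a) (u' b) = (if a = b then 1 else 0)" if "b < Suc m" for b
    proof (cases "b = m")
      case True
      then show ?thesis using mb[OF a] bilinear_form_commute[OF sym, where v = "u' a" and w = "u' m"] a by simp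
    next
      case False
      then show ?thesis using that a u(3)[OF a, of b] by (simp add: u'_def)
    qed
    then show ?thesis using a u by (auto simp: u'_def)
  qed
  then show ?case by blast
qed simp

lemma affine_map_R_space [simp]: "affine_map d A b x \<in> R_space d"
  by (simp add: affine_map_def space_lborel_R)

lemma affine_map_comp:
  assumes "A \<in> carrier_mat d d" "B \<in> carrier_mat d d" "A * B = 1\<^sub>m d" "x \<in> R_space d"
    and "\<And>i. i < d \<Longrightarrow> b i = - (\<Sum>j<d. A $$ (i, j) * b' j)"
  shows "affine_map d A b (affine_map d B b' x) = x"
proof
  fix i
  show "affine_map d A b (affine_map d B b' x) i = x i"
  proof (cases "i < d")
    case True
    have AB: "(\<Sum>j<d. A $$ (i, j) * B $$ (j, k)) = (if i = k then 1 else 0)" if "k < d" for k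
    proof -
      have "(\<Sum>j<d. A $$ (i, j) * B $$ (j, k)) = (A * B) $$ (i, k)"
        using assms(1,2) True that by (simp add: scalar_prod_def lessThan_atLeast0)
      then show ?thesis using assms(3) True that by simp
    qed
    have "(\<Sum>j<d. A $$ (i, j) * ((\<Sum>k<d. B $$ (j, k) * x k) + b' j)) =
        (\<Sum>j<d. \<Sum>k<d. A $$ (i, j) * B $$ (j, k) * x k) + (\<Sum>j<d. A $$ (i, j) * b' j)"
      by (simp add: distrib_left sum.distrib sum_distrib_left mult.assoc)
    also have "(\<Sum>j<d. \<Sum>k<d. A $$ (i, j) * B $$ (j, k) * x k) = (\<Sum>k<d. (\<Sum>j<d. A $$ (i, j) * B $$ (j, k)) * x k)"
      by (subst sum.swap) (simp add: sum_distrib_right)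
    also have "\<dots> = (\<Sum>k<d. if i = k then x k else 0)" by (intro sum.cong refl) (simp add: AB)
    also have "\<dots> = x i" using True by simp
    finally show ?thesis using True assms(5)[OF True] by (simp add: affine_map_def)
  next
    case False
    then show ?thesis using assms(4) by (simp add: affine_map_def space_lborel_R extensional_def)
  qed
qed

lemma poly_fun_affine_map:
  assumes "poly_fun d k p"
  shows "poly_fun d k (\<lambda>x. p (affine_map d A b x))"
proof (rule poly_fun_subst[OF assms])
  fix i assume i: "i < d"
  have "poly_fun d 1 (\<lambda>x. (\<Sum>j<d. A $$ (i, j) * x j) + b i)"
    by (intro poly_fun.add poly_fun_sum poly_fun_scale poly_fun_var poly_fun_const) auto
  then show "poly_fun d 1 (\<lambda>x. affine_map d A b x i)" using i by (simp add: affine_map_def)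
qed

lemma measurable_affine_map [measurable]: "affine_map d A b \<in> measurable (lborel_R d) (lborel_R d)"
proof -
  have "(\<lambda>x. \<lambda>i\<in>{..<d}. (\<Sum>j<d. A $$ (i, j) * x j) + b i) \<in> measurable (lborel_R d) (lborel_R d)"
  proof (intro measurable_restrict)
    fix i assume "i \<in> {..<d}"
    have "(\<lambda>x. (\<Sum>j<d. A $$ (i, j) * x j) + b i) \<in> borel_measurable (lborel_R d)"
      by (intro borel_measurable_add borel_measurable_sum borel_measurable_times measurable_lborel_R_component) auto
    then show "(\<lambda>x. (\<Sum>j<d. A $$ (i, j) * x j) + b i) \<in> measurable (lborel_R d) lborel" by simp
  qed
  then show ?thesis by (simp add: affine_map_def [abs_def])
qed

text \<open>Gram-Schmidt for the form \<open>\<Sigma>\<close> gives a lower triangular \<open>B\<close> with \<open>B * \<Sigma> * B\<^sup>T = 1\<close>, so that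
  \<open>x \<mapsto> B (x - \<mu>)\<close> maps the Gaussian to the standard one, by triangular substitution.\<close>
theorem gaussian_standardize:
  assumes \<Sigma>: "full_rank_cov d \<Sigma>" and \<mu>: "\<mu> \<in> R_space d"
  obtains B A b q where "B \<in> carrier_mat d d" "A \<in> carrier_mat d d" "b \<in> R_space d"
    "\<And>x. x \<in> R_space d \<Longrightarrow> affine_map d A \<mu> (affine_map d B b x) = x"
    "\<And>y. y \<in> R_space d \<Longrightarrow> affine_map d B b (affine_map d A \<mu> y) = y"
    "distr (gaussian d \<mu> \<Sigma>) (lborel_R d) (affine_map d B b) = std_gaussian d"
    "poly_fun d 2 q" "\<And>x. gaussian_density d \<mu> \<Sigma> x = exp (q x)"
proof -
  have S: "\<Sigma> \<in> carrier_mat d d" and St: "transpose_mat \<Sigma> = \<Sigma>"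
    and pd: "\<And>v. v \<in> carrier_vec d \<Longrightarrow> v \<noteq> 0\<^sub>v d \<Longrightarrow> scalar_prod v (\<Sigma> *\<^sub>v v) > 0"
    using \<Sigma> by (auto simp: full_rank_cov_def)
  let ?s = "\<lambda>i j. \<Sigma> $$ (i, j)"
  have sym: "?s i j = ?s j i" if "i < d" "j < d" for i j
    using that S St index_transpose_mat(1)[of j \<Sigma> i] by auto
  have pdf: "bilinear_form d ?s v v > 0" if "\<exists>i<d. v i \<noteq> 0" for v
  proof -
    have "vec d v \<noteq> 0\<^sub>v d" using that by (auto simp: vec_eq_iff)
    then have "scalar_prod (vec d v) (\<Sigma> *\<^sub>v vec d v) > 0" by (intro pd) auto
    also have "scalar_prod (vec d v) (\<Sigma> *\<^sub>v vec d v) = bilinear_form d ?s v v"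
      using S by (simp add: scalar_prod_def bilinear_form_def lessThan_atLeast0 sum_distrib_left mult_ac)
    finally show ?thesis .
  qed
  obtain u where u: "\<And>a. a < d \<Longrightarrow> u a a > 0" "\<And>a i. a < d \<Longrightarrow> i > a \<Longrightarrow> u a i = 0"
    "\<And>a b. a < d \<Longrightarrow> b < d \<Longrightarrow> bilinear_form d ?s (u a) (u b) = (if a = b then 1 else 0)"
    using gram_schmidt_lower_triangular[of d ?s d, OF sym pdf] by auto
  define B where "B = mat d d (\<lambda>(a, i). u a i)"
  have B: "B \<in> carrier_mat d d" by (simp add: B_def)
  have Bt: "transpose_mat B \<in> carrier_mat d d" using B by simp
  \<comment> \<open>Orthonormality of the rows of \<open>B\<close> for the form
    \<open>\<Sigma>\<close> says exactly that this is a right inverse of \<open>B\<close>.\<close>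
  define A where "A = \<Sigma> * transpose_mat B"
  have A: "A \<in> carrier_mat d d" unfolding A_def using S Bt by (rule mult_carrier_mat)
  have BA: "B * A = 1\<^sub>m d"
  proof (rule eq_matI)
    fix a c assume "a < dim_row (1\<^sub>m d)" "c < dim_col (1\<^sub>m d)"
    then have ac: "a < d" "c < d" by auto
    have "(B * A) $$ (a, c) = (\<Sum>i<d. u a i * (\<Sum>j<d. ?s i j * u c j))"
      using ac S by (simp add: A_def B_def scalar_prod_def lessThan_atLeast0)
    also have "\<dots> = bilinear_form d ?s (u a) (u c)"
      by (simp add: bilinear_form_def sum_distrib_left mult.assoc)
    finally show "(B * A) $$ (a, c) = 1\<^sub>m d $$ (a, c)" using u(3)[OF ac] ac by simp
  qed (use A B in auto)
  have AB: "A * B = 1\<^sub>m d" using mat_mult_left_right_inverse[OF B A BA] .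
  define P where "P = transpose_mat B * B"
  have P: "P \<in> carrier_mat d d" using B Bt by (simp add: P_def)
  have SP: "\<Sigma> * P = 1\<^sub>m d"
    using AB S B Bt by (simp add: A_def P_def assoc_mult_mat[of _ d d _ d _ d])
  have PS: "P * \<Sigma> = 1\<^sub>m d" using mat_mult_left_right_inverse[OF S P SP] .
  have inv: "the (mat_inverse \<Sigma>) = P" by (rule mat_inverse_eqI[OF S P SP PS])
  define D where "D = (\<Prod>i<d. u i i)"
  have Dpos: "D > 0" unfolding D_def using u(1) by (intro prod_pos) auto
  have detB: "det B = D"
  proof -
    have "det B = prod_list (diag_mat B)"
      by (rule det_lower_triangular[OF _ B]) (use u(2) in \<open>auto simp: B_def\<close>)
    also have "\<dots> = D"
      by (simp add: diag_mat_def B_def D_def prod.list_conv_set_nth lessThan_atLeast0)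
    finally show ?thesis .
  qed
  have detS: "det \<Sigma> * D\<^sup>2 = 1"
  proof -
    have "det (B * A) = det B * (det \<Sigma> * det (transpose_mat B))"
      unfolding A_def using det_mult[OF B A[unfolded A_def]] det_mult[OF S Bt] by simp
    then show ?thesis using BA detB det_transpose[OF B] by (simp add: power2_eq_square mult_ac)
  qed
  have detS': "det \<Sigma> = 1 / D\<^sup>2" using detS Dpos by (simp add: field_simps)
  define b where "b = (\<lambda>i\<in>{..<d}. - (\<Sum>j<d. B $$ (i, j) * \<mu> j))"
  let ?T = "affine_map d B b"
  have Tx: "?T x i = (\<Sum>j\<le>i. u i j * x j) + b i" if "i < d" for x i
  proof -
    have "(\<Sum>j<d. B $$ (i, j) * x j) = (\<Sum>j<d. u i j * x j)"
      using that by (intro sum.cong refl) (simp add: B_def)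
    also have "\<dots> = (\<Sum>j\<le>i. u i j * x j)"
      using that u(2) by (intro sum.mono_neutral_right) auto
    finally show ?thesis using that by (simp add: affine_map_def)
  qed
  have T_eq: "?T x = (\<lambda>i\<in>{..<d}. (\<Sum>j\<le>i. u i j * x j) + b i)" for x
    using Tx by (auto simp: affine_map_def intro!: restrict_ext)
  have dens: "gaussian_density d \<mu> \<Sigma> x = D * std_dens d (?T x)" for x
  proof -
    define y where "y = vec d (\<lambda>i. x i - \<mu> i)"
    have y: "y \<in> carrier_vec d" by (simp add: y_def)
    have By: "(B *\<^sub>v y) $ i = ?T x i" if "i < d" for i
      using that B by (simp add: y_def scalar_prod_def affine_map_def b_def lessThan_atLeast0 right_diff_distrib sum_subtractf)
    have "scalar_prod y (P *\<^sub>v y) = scalar_prod y (transpose_mat B *\<^sub>v (B *\<^sub>v y))"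
      unfolding P_def using assoc_mult_mat_vec[OF Bt B y] by simp
    also have "\<dots> = scalar_prod (transpose_mat B *\<^sub>v (B *\<^sub>v y)) y"
      using B y by (intro comm_scalar_prod[of _ d]) auto
    also have "\<dots> = scalar_prod (B *\<^sub>v y) (B *\<^sub>v y)"
      by (rule transpose_vec_mult_scalar[OF B y]) (use B y in auto)
    also have "\<dots> = norm2 d (?T x)"
      using B By by (simp add: scalar_prod_def norm2_def lessThan_atLeast0 power2_eq_square)
    finally have sp: "scalar_prod y (P *\<^sub>v y) = norm2 d (?T x)" .
    have "sqrt ((2 * pi) ^ d * det \<Sigma>) = sqrt ((2 * pi) ^ d) / D"
      using Dpos by (simp add: detS' real_sqrt_divide)
    then show ?thesis
      unfolding gaussian_density_def Let_def inv y_def[symmetric] sp by (simp add: std_dens_def)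
  qed
  \<comment> \<open>The logarithm of the density, a quadratic polynomial; the mass of a truncation
    set can later be absorbed into it.\<close>
  define q where "q x = (ln D - ln (sqrt ((2 * pi) ^ d))) + (-1/2) * norm2 d (?T x)" for x
  have q: "poly_fun d 2 q"
    unfolding q_def [abs_def] by (intro poly_fun.add poly_fun_const poly_fun_scale poly_fun_affine_map poly_fun_norm2)
  have qe: "gaussian_density d \<mu> \<Sigma> x = exp (q x)" for x
  proof -
    have "exp (q x) = exp (ln D) / exp (ln (sqrt ((2 * pi) ^ d))) * exp (- norm2 d (?T x) / 2)"
    proof -
      have "(-1/2) * norm2 d (?T x) = - norm2 d (?T x) / 2" by simp
      then show ?thesis unfolding q_def by (simp only: exp_add exp_diff)
    qed
    then show ?thesis using Dpos by (simp add: dens std_dens_def)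
  qed
  have distr: "distr (gaussian d \<mu> \<Sigma>) (lborel_R d) ?T = std_gaussian d"
  proof (rule measure_eqI)
    fix E assume "E \<in> sets (distr (gaussian d \<mu> \<Sigma>) (lborel_R d) ?T)"
    then have E[measurable]: "E \<in> sets (lborel_R d)" by simp
    have gm: "(\<lambda>x. ennreal (gaussian_density d \<mu> \<Sigma> x)) \<in> borel_measurable (lborel_R d)"
      unfolding dens by measurable
    have Tg: "?T \<in> measurable (gaussian d \<mu> \<Sigma>) (lborel_R d)" by (simp add: gaussian_def)
    have "emeasure (distr (gaussian d \<mu> \<Sigma>) (lborel_R d) ?T) E = (\<integral>\<^sup>+x. indicator E (?T x) \<partial>gaussian d \<mu> \<Sigma>)"
      using nn_integral_distr[OF Tg, of "indicator E"] by simp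
    also have "\<dots> = (\<integral>\<^sup>+x. ennreal D * (ennreal (std_dens d (?T x)) * indicator E (?T x)) \<partial>lborel_R d)"
      unfolding gaussian_def using Dpos
      by (subst nn_integral_density[OF gm]) (auto simp: dens ennreal_mult mult.assoc)
    also have "\<dots> = ennreal D * (\<integral>\<^sup>+x. ennreal (std_dens d (?T x)) * indicator E (?T x) \<partial>lborel_R d)"
      by (intro nn_integral_cmult) measurable
    also have "\<dots> = (\<integral>\<^sup>+y. ennreal (std_dens d y) * indicator E y \<partial>lborel_R d)"
    proof -
      have "(\<Prod>i<d. \<bar>u i i\<bar>) = D" unfolding D_def using u(1) by (intro prod.cong refl) (simp add: abs_of_pos)
      moreover have "(\<integral>\<^sup>+y. ennreal (std_dens d y) * indicator E y \<partial>lborel_R d) =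
          ennreal (\<Prod>i<d. \<bar>u i i\<bar>) * (\<integral>\<^sup>+x. ennreal (std_dens d (?T x)) * indicator E (?T x) \<partial>lborel_R d)"
        unfolding T_eq using u(1) by (intro nn_integral_lower_triangular) (auto simp: less_imp_neq[THEN not_sym])
      ultimately show ?thesis by simp
    qed
    also have "\<dots> = (\<integral>\<^sup>+y. indicator E y \<partial>std_gaussian d)"
      by (rule nn_integral_std_gaussian[symmetric]) measurable
    also have "\<dots> = emeasure (std_gaussian d) E" by simp
    finally show "emeasure (distr (gaussian d \<mu> \<Sigma>) (lborel_R d) ?T) E = emeasure (std_gaussian d) E" .
  qed simp
  show thesis
  proof (rule that[OF B A _ _ _ distr q qe])
    show "b \<in> R_space d" by (simp add: b_def space_lborel_R)
    show "affine_map d A \<mu> (?T x) = x" if "x \<in> R_space d" for x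
    proof (rule affine_map_comp[OF A B AB that])
      fix i assume i: "i < d"
      have "affine_map d B b (affine_map d A \<mu> (\<lambda>i\<in>{..<d}. 0)) = (\<lambda>i\<in>{..<d}. 0)"
        by (rule affine_map_comp[OF B A BA]) (auto simp: space_lborel_R b_def)
      have "(\<Sum>j<d. A $$ (i, j) * b j) = - (\<Sum>j<d. \<Sum>k<d. A $$ (i, j) * B $$ (j, k) * \<mu> k)"
        by (simp add: b_def sum_negf sum_distrib_left mult.assoc)
      also have "(\<Sum>j<d. \<Sum>k<d. A $$ (i, j) * B $$ (j, k) * \<mu> k) = (\<Sum>k<d. (A * B) $$ (i, k) * \<mu> k)"
        using A B i by (subst sum.swap) (simp add: scalar_prod_def lessThan_atLeast0 sum_distrib_right)
      also have "\<dots> = (\<Sum>k<d. if i = k then \<mu> k else 0)" unfolding AB using i by (intro sum.cong refl) auto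
      also have "\<dots> = \<mu> i" using i by simp
      finally show "\<mu> i = - (\<Sum>j<d. A $$ (i, j) * b j)" by simp
    qed
    show "?T (affine_map d A \<mu> y) = y" if "y \<in> R_space d" for y
      by (rule affine_map_comp[OF B A BA that]) (simp add: b_def)
  qed
qed

text \<open>On \<open>{-1..1}\<close> the density is at least \<open>1/3 * 1/2\<close>, and the
  interval has length \<open>2 * \<delta>\<close>.\<close>

lemma stdn_interval_ge:
  assumes "0 < \<delta>" "\<delta> \<le> 1"
  shows "emeasure stdn {-\<delta>..\<delta>} \<ge> ennreal (\<delta> / 3)"
proof -
  have "ennreal (\<delta> / 3) = ennreal (1 / 6) * emeasure lborel {-\<delta>..\<delta>}"
    using assms by (simp add: ennreal_mult[symmetric])
  also have "\<dots> = (\<integral>\<^sup>+x. ennreal (1 / 6) * indicator {-\<delta>..\<delta>} x \<partial>lborel)"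
    by (simp add: nn_integral_cmult)
  also have "\<dots> \<le> (\<integral>\<^sup>+x. ennreal (std_normal_density x) * indicator {-\<delta>..\<delta>} x \<partial>lborel)"
  proof (rule nn_integral_mono)
    fix x :: real
    have "1 / 6 \<le> std_normal_density x" if "x \<in> {-\<delta>..\<delta>}"
    proof -
      have "\<bar>x\<bar> \<le> 1" using that assms by auto
      then have "x\<^sup>2 \<le> 1" using power_mono[of "\<bar>x\<bar>" 1 2] by simp
      then have "1 / 2 \<le> exp (- x\<^sup>2 / 2)" using exp_ge_add_one_self[of "- x\<^sup>2 / 2"] by linarith
      moreover have "1 / 3 \<le> 1 / sqrt (2 * pi)"
      proof -
        have "sqrt (2 * pi) \<le> 3" by (rule real_le_lsqrt) (use pi_less_4 in auto)
        then show ?thesis by (intro divide_left_mono) auto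
      qed
      ultimately have "(1 / 3) * (1 / 2) \<le> 1 / sqrt (2 * pi) * exp (- x\<^sup>2 / 2)" by (intro mult_mono) auto
      then show ?thesis by (simp add: std_normal_density_def)
    qed
    then show "ennreal (1 / 6) * indicator {-\<delta>..\<delta>} x \<le> ennreal (std_normal_density x) * indicator {-\<delta>..\<delta>} x"
      by (auto simp: indicator_def intro!: ennreal_leI)
  qed
  also have "\<dots> = emeasure stdn {-\<delta>..\<delta>}" by (simp add: stdn_def emeasure_density)
  finally show ?thesis .
qed

text \<open>By \<open>cyl\<close>, membership in \<open>E\<close> does not involve the last
  coordinate, which is independent of the others.\<close>

lemma emeasure_std_gaussian_slab:
  assumes E: "E \<in> sets (lborel_R (Suc l))" and I: "I \<in> sets borel"
    and cyl: "\<And>x t. x \<in> R_space l \<Longrightarrow> x(l := t) \<in> E \<longleftrightarrow> x(l := 0) \<in> E"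
  shows "emeasure (std_gaussian (Suc l)) {y \<in> E. y l \<in> I} = emeasure (std_gaussian (Suc l)) E * emeasure stdn I"
proof -
  have eq: "{..<Suc l} = insert l {..<l}" by auto
  let ?P = "\<Pi>\<^sub>M i\<in>insert l {..<l}. stdn"
  have P: "std_gaussian (Suc l) = ?P" by (simp add: std_gaussian_PiM eq)
  have Es: "E \<in> sets ?P" using E unfolding P[symmetric] by simp
  have yl: "(\<lambda>y. y l) \<in> measurable ?P stdn" by (rule measurable_component_singleton) simp
  have EI: "{y \<in> E. y l \<in> I} \<in> sets ?P"
  proof -
    have "{y \<in> E. y l \<in> I} = E \<inter> ((\<lambda>y. y l) -` I \<inter> space ?P)" using sets.sets_into_space[OF Es] by auto
    then show ?thesis using Es measurable_sets[OF yl, of I] I by auto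
  qed
  have x0: "(\<lambda>x. indicator E (x(l := 0)) :: ennreal) \<in> borel_measurable (\<Pi>\<^sub>M i\<in>{..<l}. stdn)"
  proof -
    have "(\<lambda>x. x(l := 0)) \<in> measurable (\<Pi>\<^sub>M i\<in>{..<l}. stdn) ?P"
      using measurable_compose[OF measurable_Pair[OF measurable_ident_sets[OF refl] measurable_const[of 0 stdn]] measurable_add_dim[of l "{..<l}" "\<lambda>_. stdn"]] by simp
    then show ?thesis using borel_measurable_indicator[OF Es] by (rule measurable_compose)
  qed
  have gen: "emeasure ?P {y \<in> E. y l \<in> J} = (\<integral>\<^sup>+x. indicator E (x(l := 0)) \<partial>(\<Pi>\<^sub>M i\<in>{..<l}. stdn)) * emeasure stdn J"
    if J: "J \<in> sets borel" "{y \<in> E. y l \<in> J} \<in> sets ?P" for J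
  proof -
    have "emeasure ?P {y \<in> E. y l \<in> J} = (\<integral>\<^sup>+y. indicator {y \<in> E. y l \<in> J} y \<partial>?P)"
      using J(2) by simp
    also have "\<dots> = (\<integral>\<^sup>+x. (\<integral>\<^sup>+t. indicator {y \<in> E. y l \<in> J} (x(l := t)) \<partial>stdn) \<partial>(\<Pi>\<^sub>M i\<in>{..<l}. stdn))"
      using J(2) by (intro stdn_prod.product_nn_integral_insert) auto
    also have "\<dots> = (\<integral>\<^sup>+x. indicator E (x(l := 0)) * emeasure stdn J \<partial>(\<Pi>\<^sub>M i\<in>{..<l}. stdn))"
    proof (rule nn_integral_cong)
      fix x assume "x \<in> space (\<Pi>\<^sub>M i\<in>{..<l}. stdn)"
      then have x: "x \<in> R_space l" by (simp add: space_PiM)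
      have "(\<integral>\<^sup>+t. indicator {y \<in> E. y l \<in> J} (x(l := t)) \<partial>stdn) = (\<integral>\<^sup>+t. indicator E (x(l := 0)) * indicator J t \<partial>stdn)"
      proof (rule nn_integral_cong)
        fix t
        show "(indicator {y \<in> E. y l \<in> J} (x(l := t)) :: ennreal) = indicator E (x(l := 0)) * indicator J t"
          using cyl[OF x, of t] by (simp add: indicator_def)
      qed
      also have "\<dots> = indicator E (x(l := 0)) * emeasure stdn J"
        using J(1) by (subst nn_integral_cmult_indicator) auto
      finally show "(\<integral>\<^sup>+t. indicator {y \<in> E. y l \<in> J} (x(l := t)) \<partial>stdn) = indicator E (x(l := 0)) * emeasure stdn J" .
    qed
    also have "\<dots> = (\<integral>\<^sup>+x. indicator E (x(l := 0)) \<partial>(\<Pi>\<^sub>M i\<in>{..<l}. stdn)) * emeasure stdn J"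
      using x0 by (rule nn_integral_multc)
    finally show ?thesis .
  qed
  have "emeasure ?P E = (\<integral>\<^sup>+x. indicator E (x(l := 0)) \<partial>(\<Pi>\<^sub>M i\<in>{..<l}. stdn))"
    using gen[of UNIV] Es stdn.emeasure_space_1 by simp
  then show ?thesis unfolding P using gen[OF I EI] by simp
qed

text \<open>A projection to the hyperplane \<open>y l = 0\<close> turns any set into one of surface area bounded below,
  because the thickening contains a slab over a cylinder containing the set.\<close>
lemma surface_area_projection_ge:
  assumes S: "S \<in> sets (lborel_R (Suc l))"
  shows "gaussian_surface_area (Suc l) ((\<lambda>y. y(l := 0)) ` S) \<ge> ennreal (measure (std_gaussian (Suc l)) S / 3)"
proof -
  let ?d = "Suc l" and ?N = "std_gaussian (Suc l)"
  let ?\<pi> = "\<lambda>y::nat \<Rightarrow> real. y(l := 0)"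
  let ?P = "?\<pi> ` S"
  have Ssp: "S \<subseteq> R_space ?d" using sets.sets_into_space[OF S] .
  have \<pi>sp: "?\<pi> y \<in> R_space ?d" if "y \<in> R_space ?d" for y
    using that by (auto simp: space_lborel_R extensional_def)
  have \<pi>m: "?\<pi> \<in> measurable (lborel_R ?d) (lborel_R ?d)"
  proof -
    have "(\<lambda>y. \<lambda>i\<in>{..<?d}. if i = l then 0 else y i) \<in> measurable (lborel_R ?d) (lborel_R ?d)"
      by (intro measurable_restrict) auto
    also have "?this \<longleftrightarrow> ?thesis"
      by (intro measurable_cong) (auto simp: space_lborel_R extensional_def fun_eq_iff)
    finally show ?thesis .
  qed
  \<comment> \<open>The cylinder over the closure of the projected set. It is measurable although
    the projection of a Borel set need not be Borel, and it contains \<open>S\<close>.\<close>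
  define V where "V = {y \<in> R_space ?d. dist_set ?d (?\<pi> y) ?P = 0}"
  have V: "V \<in> sets (lborel_R ?d)"
    unfolding V_def using measurable_compose[OF \<pi>m measurable_dist_set[of ?d ?P]] by simp
  have SV: "S \<subseteq> V" using Ssp by (auto simp: V_def dist_set_self)
  have cylV: "x(l := t) \<in> V \<longleftrightarrow> x(l := 0) \<in> V" if "x \<in> R_space l" for x t
    using that by (auto simp: V_def space_lborel_R extensional_def)
  have zero: "emeasure ?N {y \<in> R_space ?d. y l \<in> {0}} = 0"
  proof -
    have "emeasure ?N {y \<in> R_space ?d. y l \<in> {0}} = emeasure ?N (R_space ?d) * emeasure stdn {0}"
      by (rule emeasure_std_gaussian_slab[OF sets.top]) (auto simp: space_lborel_R extensional_def)
    also have "emeasure stdn {0} = 0"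
      by (simp add: stdn_def emeasure_density nn_integral_indicator_singleton)
    finally show ?thesis by simp
  qed
  \<comment> \<open>The projected set lies in a hyperplane, so removing it from its thickening costs
    no mass; the completion gives this a meaning for a set that is not Borel.\<close>
  have null: "?P \<in> null_sets (completion ?N)"
  proof (rule null_sets_completion_subset)
    have "{y \<in> R_space ?d. y l \<in> {0}} \<in> sets (lborel_R ?d)" by measurable
    then show "{y \<in> R_space ?d. y l \<in> {0}} \<in> null_sets (completion ?N)"
      using zero by (intro null_sets_completionI) auto
    show "?P \<subseteq> {y \<in> R_space ?d. y l \<in> {0}}" using Ssp \<pi>sp by auto
  qed
  have "ennreal (measure ?N S / 3) \<le> emeasure (completion ?N) (thickening ?d \<delta> ?P - ?P) / ennreal \<delta>"
    if \<delta>: "0 < \<delta>" "\<delta> < 1" for \<delta>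
  proof -
    have sub: "{y \<in> V. y l \<in> {-\<delta>..\<delta>}} \<subseteq> thickening ?d \<delta> ?P"
    proof
      fix y assume y: "y \<in> {y \<in> V. y l \<in> {-\<delta>..\<delta>}}"
      then have ysp: "y \<in> R_space ?d" by (simp add: V_def)
      have "nrm ?d (lc ?d 1 y (-1) (?\<pi> y)) = sqrt (\<Sum>i<?d. if i = l then (y l)\<^sup>2 else 0)"
        unfolding L2_set_def by (intro arg_cong[of _ _ sqrt] sum.cong refl) auto
      also have "\<dots> = \<bar>y l\<bar>" by simp
      finally have n: "nrm ?d (lc ?d 1 y (-1) (?\<pi> y)) \<le> \<delta>" using y by auto
      have "dist_set ?d y ?P \<le> dist_set ?d (?\<pi> y) ?P + ennreal (nrm ?d (lc ?d 1 y (-1) (?\<pi> y)))"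
        by (rule dist_set_triangle)
      also have "\<dots> \<le> ennreal \<delta>" using y n by (simp add: V_def ennreal_leI)
      finally show "y \<in> thickening ?d \<delta> ?P" using ysp by (simp add: thickening_def)
    qed
    have "ennreal (measure ?N S / 3) * ennreal \<delta> = ennreal (measure ?N S) * ennreal (\<delta> / 3)"
      using \<delta> by (simp add: ennreal_mult[symmetric])
    also have "\<dots> \<le> emeasure ?N V * emeasure stdn {-\<delta>..\<delta>}"
      using stdn_interval_ge[of \<delta>] \<delta> emeasure_mono[OF SV, of ?N] V
      by (intro mult_mono) (auto simp: N.emeasure_eq_measure)
    also have "\<dots> = emeasure ?N {y \<in> V. y l \<in> {-\<delta>..\<delta>}}"
      by (rule emeasure_std_gaussian_slab[symmetric, OF V _ cylV]) auto
    also have "\<dots> \<le> emeasure ?N (thickening ?d \<delta> ?P)"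
      using sub by (intro emeasure_mono) auto
    also have "\<dots> = emeasure (completion ?N) (thickening ?d \<delta> ?P)"
      by simp
    also have "\<dots> = emeasure (completion ?N) (thickening ?d \<delta> ?P - ?P)"
      by (rule emeasure_Diff_null_set[symmetric, OF null]) simp
    finally have le: "ennreal (measure ?N S / 3) * ennreal \<delta> \<le> emeasure (completion ?N) (thickening ?d \<delta> ?P - ?P)" .
    have "ennreal \<delta> \<noteq> 0" using \<delta> by auto
    from divide_less_ennreal[OF this ennreal_less_top] le show ?thesis by (meson not_less)
  qed
  then have "\<forall>\<^sub>F \<delta> in at_right 0. ennreal (measure ?N S / 3) \<le> emeasure (completion ?N) (thickening ?d \<delta> ?P - ?P) / ennreal \<delta>"
    by (intro eventually_at_rightI[of 0 1]) auto
  then show ?thesis unfolding gaussian_surface_area_def by (rule Liminf_bounded)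
qed

section \<open>Traces of positivity sets\<close>

text \<open>Gaussian elimination: a variable \<open>j\<close> that occurs in equation
  \<open>m\<close> is solved for, which removes one equation and one unknown.\<close>

lemma homogeneous_system_nontrivial:
  fixes a :: "'l \<Rightarrow> 'b \<Rightarrow> real"
  assumes "finite M" "finite B" "card M < card B"
  shows "\<exists>c. (\<exists>i\<in>B. c i \<noteq> 0) \<and> (\<forall>l\<in>M. (\<Sum>i\<in>B. a l i * c i) = 0)"
  using assms
proof (induction M arbitrary: B a rule: finite_induct)
  case empty
  then obtain i where "i \<in> B" by (metis card_gt_0_iff card.empty equals0I)
  then show ?case by (intro exI[of _ "\<lambda>_. 1"]) auto
next
  case (insert m M)
  show ?case
  proof (cases "\<exists>i\<in>B. a m i \<noteq> 0")
    case False
    have "card M < card B" using insert by simp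
    from insert.IH[OF insert.prems(1) this, of a] False show ?thesis by auto
  next
    case True
    then obtain j where j: "j \<in> B" "a m j \<noteq> 0" by auto
    define a' where "a' l i = a l i - a l j * a m i / a m j" for l i
    have "card M < card (B - {j})" using insert j by simp
    then have "\<exists>c. (\<exists>i\<in>B - {j}. c i \<noteq> 0) \<and> (\<forall>l\<in>M. (\<Sum>i\<in>B-{j}. a' l i * c i) = 0)"
      using insert.prems by (intro insert.IH) simp_all
    then obtain c i
      where c: "i \<in> B - {j}" "c i \<noteq> 0" "\<And>l. l \<in> M \<Longrightarrow> (\<Sum>i\<in>B-{j}. a' l i * c i) = 0" by blast
    define c' where "c' = c(j := - (\<Sum>i\<in>B-{j}. a m i * c i) / a m j)"
    have split: "(\<Sum>i\<in>B. a l i * c' i) = (\<Sum>i\<in>B-{j}. a' l i * c i)" for l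
    proof -
      have "(\<Sum>i\<in>B. a l i * c' i) = a l j * c' j + (\<Sum>i\<in>B-{j}. a l i * c' i)"
        using j insert.prems by (intro sum.remove) auto
      also have "(\<Sum>i\<in>B-{j}. a l i * c' i) = (\<Sum>i\<in>B-{j}. a l i * c i)"
        by (intro sum.cong) (auto simp: c'_def)
      also have "a l j * c' j = - (\<Sum>i\<in>B-{j}. a l j * a m i / a m j * c i)"
        by (simp add: c'_def sum_distrib_left sum_divide_distrib mult.assoc)
      finally show ?thesis by (simp add: a'_def left_diff_distrib sum_subtractf)
    qed
    have "a' m i = 0" for i using j by (simp add: a'_def)
    then have "\<forall>l\<in>insert m M. (\<Sum>i\<in>B. a l i * c' i) = 0"
      using c(3) by (auto simp: split)
    moreover have "c' i \<noteq> 0" "i \<in> B" using c by (auto simp: c'_def)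
    ultimately show ?thesis by blast
  qed
qed

definition shattered :: "'a set set \<Rightarrow> 'a set \<Rightarrow> bool" where
  "shattered \<F> B \<longleftrightarrow> (\<forall>E\<subseteq>B. \<exists>A\<in>\<F>. A \<inter> B = E)"

text \<open>Pajor's strengthening of the Sauer-Shelah lemma, which has a shorter induction.\<close>
lemma card_le_card_shattered:
  assumes "finite X" "\<F> \<subseteq> Pow X"
  shows "card \<F> \<le> card {B. B \<subseteq> X \<and> shattered \<F> B}"
  using assms
proof (induction X arbitrary: \<F> rule: finite_induct)
  case empty
  then have "\<F> = {} \<or> \<F> = {{}}" by auto
  moreover have S: "{B. B \<subseteq> {} \<and> shattered {{}} B} = {{}}" unfolding shattered_def by blast
  have "card \<F> \<le> card {B. B \<subseteq> {} \<and> shattered \<F> B}" if "\<F> = {{}}"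
    unfolding that S ..
  ultimately show ?case by (metis card.empty le0)
next
  case (insert x X)
  \<comment> \<open>\<open>F0\<close> forgets \<open>x\<close>, and \<open>F1\<close> collects the
    traces that occur both with and without \<open>x\<close>, so the two cardinalities add up to
    that of \<open>\<F>\<close>. A set shattered by \<open>F1\<close> stays shattered by
    \<open>\<F>\<close> when \<open>x\<close> is added to it.\<close>
  define F0 where "F0 = (\<lambda>A. A - {x}) ` \<F>"
  define F1 where "F1 = {A. A \<subseteq> X \<and> A \<in> \<F> \<and> insert x A \<in> \<F>}"
  have sub: "F0 \<subseteq> Pow X" "F1 \<subseteq> Pow X" using insert.prems by (auto simp: F0_def F1_def)
  have finF: "finite \<F>" using finite_subset[OF insert.prems] insert.hyps by simp
  have fin0: "finite F0" "finite F1"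
    using finite_subset[OF sub(1)] finite_subset[OF sub(2)] insert.hyps by simp_all
  let ?N = "{A \<in> \<F>. x \<notin> A}" and ?Y = "{A \<in> \<F>. x \<in> A}"
  have F0: "F0 = ?N \<union> (\<lambda>A. A - {x}) ` ?Y"
  proof -
    have "F0 = (\<lambda>A. A - {x}) ` ?N \<union> (\<lambda>A. A - {x}) ` ?Y" unfolding F0_def by blast
    also have "(\<lambda>A. A - {x}) ` ?N = (\<lambda>A. A) ` ?N" by (intro image_cong) auto
    finally show ?thesis by simp
  qed
  have F1: "F1 = ?N \<inter> (\<lambda>A. A - {x}) ` ?Y"
  proof
    show "F1 \<subseteq> ?N \<inter> (\<lambda>A. A - {x}) ` ?Y"
    proof
      fix A assume A: "A \<in> F1"
      then have "x \<notin> A" using insert.hyps by (auto simp: F1_def)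
      then have "A = insert x A - {x}" by auto
      with A \<open>x \<notin> A\<close> show "A \<in> ?N \<inter> (\<lambda>A. A - {x}) ` ?Y" by (auto simp: F1_def image_iff)
    qed
    show "?N \<inter> (\<lambda>A. A - {x}) ` ?Y \<subseteq> F1"
      using insert.prems by (auto simp: F1_def insert_absorb)
  qed
  have "card \<F> = card ?N + card ?Y"
    using finF by (subst card_Un_disjoint[symmetric]) (auto intro!: arg_cong[of _ _ card])
  also have "card ?Y = card ((\<lambda>A. A - {x}) ` ?Y)"
    by (intro card_image[symmetric] inj_onI) (metis (no_types, lifting) insert_Diff mem_Collect_eq)
  also have "card ?N + card ((\<lambda>A. A - {x}) ` ?Y) = card F0 + card F1"
    unfolding F0 F1 using finF by (intro card_Un_Int) auto
  finally have cF: "card \<F> = card F0 + card F1" .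
  let ?S = "\<lambda>\<F> X. {B. B \<subseteq> X \<and> shattered \<F> B}"
  have finS: "finite (?S \<G> Y)" if "finite Y" for \<G> :: "'a set set" and Y
    using that by (auto intro: finite_subset[of _ "Pow Y"])
  have s0: "?S F0 X \<subseteq> ?S \<F> (insert x X)"
  proof
    fix B assume B: "B \<in> ?S F0 X"
    then have xB: "x \<notin> B" using insert.hyps by auto
    have "shattered \<F> B"
      unfolding shattered_def
    proof (intro allI impI)
      fix E assume "E \<subseteq> B"
      moreover have "shattered F0 B" using B by blast
      ultimately obtain A0 where "A0 \<in> F0" "A0 \<inter> B = E" unfolding shattered_def by blast
      then obtain A where A: "A \<in> \<F>" "(A - {x}) \<inter> B = E" unfolding F0_def by blast
      then show "\<exists>A\<in>\<F>. A \<inter> B = E" using xB by (intro bexI[of _ A]) auto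
    qed
    with B show "B \<in> ?S \<F> (insert x X)" by blast
  qed
  have s1: "insert x ` ?S F1 X \<subseteq> ?S \<F> (insert x X)"
  proof
    fix B' assume "B' \<in> insert x ` ?S F1 X"
    then obtain B where B: "B' = insert x B" "B \<subseteq> X" "shattered F1 B" by blast
    have "shattered \<F> B'"
      unfolding shattered_def
    proof (intro allI impI)
      fix E assume E: "E \<subseteq> B'"
      then have "E - {x} \<subseteq> B" using B by auto
      with B(3) obtain A where A: "A \<in> F1" "A \<inter> B = E - {x}" unfolding shattered_def by blast
      have xA: "x \<notin> A" "A \<in> \<F>" "insert x A \<in> \<F>" using A insert.hyps by (auto simp: F1_def)
      show "\<exists>A\<in>\<F>. A \<inter> B' = E"
      proof (cases "x \<in> E")
        case True
        then have "insert x A \<inter> B' = E" using A B by auto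
        then show ?thesis using xA by blast
      next
        case False
        then have "A \<inter> B' = E" using A B xA by auto
        then show ?thesis using xA by blast
      qed
    qed
    with B show "B' \<in> ?S \<F> (insert x X)" by blast
  qed
  have "card \<F> \<le> card (?S F0 X) + card (?S F1 X)"
    unfolding cF by (intro add_mono insert.IH sub)
  also have "card (?S F1 X) = card (insert x ` ?S F1 X)"
    using insert.hyps by (intro card_image[symmetric] inj_onI) (metis (no_types, lifting) insert_ident mem_Collect_eq subsetD)
  also have "card (?S F0 X) + card (insert x ` ?S F1 X) = card (?S F0 X \<union> insert x ` ?S F1 X)"
    using insert.hyps finS by (intro card_Un_disjoint[symmetric]) auto
  also have "\<dots> \<le> card (?S \<F> (insert x X))"
    using s0 s1 insert.hyps finS by (intro card_mono) auto
  finally show ?case .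
qed

text \<open>A set of at most \<open>D\<close> elements is coded by a list of length exactly
  \<open>D\<close>, padded with the value \<open>m\<close> from outside the range.\<close>

lemma card_small_subsets_le: "card {B. B \<subseteq> {..<m} \<and> card B \<le> D} \<le> (m + 1) ^ D"
proof -
  let ?L = "{l. set l \<subseteq> {..m} \<and> length l = D}"
  have "{B. B \<subseteq> {..<m} \<and> card B \<le> D} \<subseteq> (\<lambda>l. set l - {m}) ` ?L"
  proof
    fix B assume B: "B \<in> {B. B \<subseteq> {..<m} \<and> card B \<le> D}"
    then have "finite B" by (auto intro: finite_subset)
    then obtain l where l: "set l = B" "length l = card B" by (metis distinct_card finite_distinct_list)
    let ?l = "l @ replicate (D - card B) m"
    have "?l \<in> ?L" using B l by auto
    moreover have "B = set ?l - {m}" using B l by auto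
    ultimately show "B \<in> (\<lambda>l. set l - {m}) ` ?L" by blast
  qed
  then have "card {B. B \<subseteq> {..<m} \<and> card B \<le> D} \<le> card ((\<lambda>l. set l - {m}) ` ?L)"
    by (intro card_mono) (auto simp: finite_lists_length_eq)
  also have "\<dots> \<le> card ?L" by (intro card_image_le) (auto simp: finite_lists_length_eq)
  also have "\<dots> = (m + 1) ^ D" by (subst card_lists_length_eq) auto
  finally show ?thesis .
qed

text \<open>Positivity sets of a \<open>D\<close>-dimensional function space have VC dimension at most \<open>D\<close>: a linear
  dependency between the evaluations at \<open>D + 1\<close> points cannot be realised by its own sign pattern.\<close>
lemma card_positivity_traces_le:
  fixes \<phi> :: "'l \<Rightarrow> 'a \<Rightarrow> real" and x :: "nat \<Rightarrow> 'a"
  assumes "finite M" and P: "\<And>p. p \<in> P \<Longrightarrow> \<exists>c. \<forall>y. p y = (\<Sum>l\<in>M. c l * \<phi> l y)"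
  shows "card ((\<lambda>p. {i. i < m \<and> p (x i) > 0}) ` P) \<le> (m + 1) ^ card M"
proof -
  let ?F = "(\<lambda>p. {i. i < m \<and> p (x i) > 0}) ` P"
  have small: "card B \<le> card M" if B: "B \<subseteq> {..<m}" "shattered ?F B" for B
  proof (rule ccontr)
    assume "\<not> card B \<le> card M"
    moreover have finB: "finite B" using B by (auto intro: finite_subset)
    ultimately obtain c where c: "\<exists>i\<in>B. c i \<noteq> 0" "\<And>l. l \<in> M \<Longrightarrow> (\<Sum>i\<in>B. \<phi> l (x i) * c i) = 0"
      using homogeneous_system_nontrivial[OF assms(1), of B "\<lambda>l i. \<phi> l (x i)"] by auto
    \<comment> \<open>Realise the pattern of the positive coefficients. Every summand
      \<open>p (x i) * e i\<close> is then nonnegative while linearity makes the sum 0, which a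
      strictly positive coefficient contradicts.\<close>
    have contr: False if e: "e i0 > 0" "i0 \<in> B" and z: "\<And>l. l \<in> M \<Longrightarrow> (\<Sum>i\<in>B. \<phi> l (x i) * e i) = 0" for e :: "nat \<Rightarrow> real" and i0
    proof -
      from B(2) have "\<exists>A\<in>?F. A \<inter> B = {i\<in>B. e i > 0}" unfolding shattered_def by auto
      then obtain p where p: "p \<in> P" "{i. i < m \<and> p (x i) > 0} \<inter> B = {i\<in>B. e i > 0}" by auto
      then have iff: "p (x i) > 0 \<longleftrightarrow> e i > 0" if "i \<in> B" for i using that B(1) by auto
      from P[OF p(1)] obtain w where w: "\<And>y. p y = (\<Sum>l\<in>M. w l * \<phi> l y)" by auto
      have "(\<Sum>i\<in>B. p (x i) * e i) = (\<Sum>l\<in>M. w l * (\<Sum>i\<in>B. \<phi> l (x i) * e i))"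
        by (simp add: w sum_distrib_left sum_distrib_right mult.assoc) (rule sum.swap)
      also have "\<dots> = 0" using z by simp
      finally have "(\<Sum>i\<in>B. p (x i) * e i) = 0" .
      moreover have "p (x i) * e i \<ge> 0" if "i \<in> B" for i
        using iff[OF that] by (cases "e i > 0") (auto intro: mult_nonneg_nonneg mult_nonpos_nonpos)
      ultimately have "\<forall>i\<in>B. p (x i) * e i = 0" using sum_nonneg_eq_0_iff[OF finB, of "\<lambda>i. p (x i) * e i"] by blast
      then have "p (x i0) * e i0 = 0" using e by blast
      then show False using iff[OF e(2)] e by auto
    qed
    from c(1) obtain i0 where "i0 \<in> B" "c i0 \<noteq> 0" by auto
    \<comment> \<open>A nonzero dependency may have only negative entries; its negation then has a
      positive one.\<close>
    then show False
      using contr[of c i0] contr[of "\<lambda>i. - c i" i0] c(2) by (cases "c i0 > 0") (auto simp: sum_negf)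
  qed
  have "card ?F \<le> card {B. B \<subseteq> {..<m} \<and> shattered ?F B}"
    by (rule card_le_card_shattered) auto
  also have "\<dots> \<le> card {B. B \<subseteq> {..<m} \<and> card B \<le> card M}"
    using small by (intro card_mono) (auto intro: finite_subset[of _ "Pow {..<m}"])
  also have "\<dots> \<le> (m + 1) ^ card M" by (rule card_small_subsets_le)
  finally show ?thesis .
qed

section \<open>Uniform deviations\<close>

text \<open>Twice the moment generating function of a random sign. The constant \<open>3 / 2\<close>
  is the second-order Taylor remainder, with 3 as the bound for the exponential at arguments up to
  1.\<close>

lemma exp_plus_exp_minus_le:
  assumes "\<bar>x::real\<bar> \<le> 1"
  shows "exp x + exp (- x) \<le> 2 * exp (3 / 2 * x\<^sup>2)"
proof -
  have q: "exp y \<le> 1 + y + 3 / 2 * y\<^sup>2" if "\<bar>y\<bar> \<le> 1" for y :: real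
  proof -
    obtain t where t: "\<bar>t\<bar> \<le> \<bar>y\<bar>" "exp y = (\<Sum>m<2. y ^ m / fact m) + exp t / fact 2 * y ^ 2"
      using Maclaurin_exp_le[of y 2] by blast
    have "exp t \<le> exp 1" using t that by simp
    also have "\<dots> \<le> 3" by (rule exp_le)
    finally have "exp t / 2 * y\<^sup>2 \<le> 3 / 2 * y\<^sup>2" by (intro mult_right_mono) auto
    then show ?thesis using t(2) by (simp add: numeral_2_eq_2 fact_2)
  qed
  have "exp x + exp (- x) \<le> 2 * (1 + 3 / 2 * x\<^sup>2)" using q[of x] q[of "- x"] assms by simp
  also have "\<dots> \<le> 2 * exp (3 / 2 * x\<^sup>2)" by (intro mult_left_mono exp_ge_add_one_self) simp
  finally show ?thesis .
qed

text \<open>Massart's finite class lemma. Signs are encoded by the set \<open>\<sigma>\<close> of indices with a minus sign.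
  The tangent bound \<open>t \<le> u + exp (t - u) - 1\<close> replaces Jensen's inequality for the logarithm.\<close>
lemma rademacher_finite_class:
  fixes V :: "(nat \<Rightarrow> real) set"
  assumes V: "finite V" "V \<noteq> {}" "card V \<le> G" and v: "\<And>v i. v \<in> V \<Longrightarrow> i < n \<Longrightarrow> \<bar>v i\<bar> \<le> 1" and n: "n > 0"
  shows "(\<Sum>\<sigma>\<in>Pow {..<n}. Max ((\<lambda>v. \<bar>\<Sum>i<n. (if i \<in> \<sigma> then -1 else 1) * v i\<bar>) ` V)) \<le>
    2 ^ n * (sqrt n * (ln (2 * real G) + 3 / 2))"
proof -
  define s where "s \<sigma> v = (\<Sum>i<n. (if i \<in> \<sigma> then -1 else 1) * v i)" for \<sigma> and v :: "nat \<Rightarrow> real"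
  define mx where "mx \<sigma> = Max ((\<lambda>v. \<bar>s \<sigma> v\<bar>) ` V)" for \<sigma>
  \<comment> \<open>At this scale the \<open>n\<close> factors contribute
    \<open>exp (3 / 2 * l\<^sup>2 * n) = exp (3 / 2)\<close> in total. The next definition,
    \<open>u\<close>, is the logarithm of the resulting average; its factor 2 pays for the absolute
    value.\<close>
  define l where "l = 1 / sqrt n"
  define u where "u = ln (2 * real G) + 3 / 2"
  have l: "0 < l" "l \<le> 1" "l\<^sup>2 * n = 1" using n by (auto simp: l_def power_divide real_le_rsqrt)
  have "card V > 0" using V by (simp add: card_gt_0_iff)
  then have G: "real G > 0" using V(3) by linarith
  have prodsum: "(\<Sum>\<sigma>\<in>Pow {..<n}. exp (a * s \<sigma> v)) \<le> 2 ^ n * exp (3 / 2)" if "v \<in> V" "\<bar>a\<bar> = l" for a v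
  proof -
    have "(\<Sum>\<sigma>\<in>Pow {..<n}. exp (a * s \<sigma> v)) = (\<Sum>\<sigma>\<in>Pow {..<n}. (\<Prod>i\<in>\<sigma>. exp (- (a * v i))) * (\<Prod>i\<in>{..<n}-\<sigma>. exp (a * v i)))"
    proof (rule sum.cong[OF refl])
      fix \<sigma> assume "\<sigma> \<in> Pow {..<n}"
      then have \<sigma>: "\<sigma> \<subseteq> {..<n}" by simp
      have "exp (a * s \<sigma> v) = (\<Prod>i<n. exp (a * ((if i \<in> \<sigma> then -1 else 1) * v i)))"
        by (simp add: s_def sum_distrib_left exp_sum)
      also have "\<dots> = (\<Prod>i\<in>{..<n}-\<sigma>. exp (a * ((if i \<in> \<sigma> then -1 else 1) * v i))) * (\<Prod>i\<in>\<sigma>. exp (a * ((if i \<in> \<sigma> then -1 else 1) * v i)))"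
        by (rule prod.subset_diff[OF \<sigma>]) simp
      finally show "exp (a * s \<sigma> v) = (\<Prod>i\<in>\<sigma>. exp (- (a * v i))) * (\<Prod>i\<in>{..<n}-\<sigma>. exp (a * v i))"
        by (simp add: mult.commute)
    qed
    also have "\<dots> = (\<Prod>i<n. exp (- (a * v i)) + exp (a * v i))"
      by (rule prod_add[symmetric]) simp
    also have "\<dots> \<le> (\<Prod>i<n. 2 * exp (3 / 2 * l\<^sup>2))"
    proof (rule prod_mono)
      fix i assume "i \<in> {..<n}"
      then have vi: "\<bar>v i\<bar> \<le> 1" using v that by auto
      have av: "\<bar>a * v i\<bar> \<le> l"
        unfolding abs_mult that(2) using mult_left_mono[OF vi, of l] l by simp
      have "exp (a * v i) + exp (- (a * v i)) \<le> 2 * exp (3 / 2 * (a * v i)\<^sup>2)"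
        using av l by (intro exp_plus_exp_minus_le) linarith
      also have "(a * v i)\<^sup>2 \<le> l\<^sup>2" using power_mono[OF av, of 2] by simp
      finally show "0 \<le> exp (- (a * v i)) + exp (a * v i) \<and> exp (- (a * v i)) + exp (a * v i) \<le> 2 * exp (3 / 2 * l\<^sup>2)"
        by (simp add: add.commute)
    qed
    also have "\<dots> = 2 ^ n * exp (3 / 2 * l\<^sup>2 * n)"
      by (simp add: power_mult_distrib exp_of_nat_mult[symmetric] mult_ac)
    also have "3 / 2 * l\<^sup>2 * n = 3 / 2" using l(3) by (simp add: mult.assoc)
    finally show ?thesis .
  qed
  have mxle: "exp (l * mx \<sigma>) \<le> (\<Sum>v\<in>V. exp (l * s \<sigma> v) + exp (- l * s \<sigma> v))" for \<sigma>
  proof -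
    have "mx \<sigma> \<in> (\<lambda>v. \<bar>s \<sigma> v\<bar>) ` V" unfolding mx_def using V by (intro Max_in) auto
    then obtain v where v: "v \<in> V" "mx \<sigma> = \<bar>s \<sigma> v\<bar>" by auto
    have "exp (l * mx \<sigma>) \<le> exp (l * s \<sigma> v) + exp (- l * s \<sigma> v)"
      unfolding v(2) by (cases "s \<sigma> v \<ge> 0") auto
    also have "\<dots> \<le> (\<Sum>v\<in>V. exp (l * s \<sigma> v) + exp (- l * s \<sigma> v))"
      using V v by (intro member_le_sum) auto
    finally show ?thesis .
  qed
  have "(\<Sum>\<sigma>\<in>Pow {..<n}. exp (l * mx \<sigma>)) \<le> (\<Sum>\<sigma>\<in>Pow {..<n}. \<Sum>v\<in>V. exp (l * s \<sigma> v) + exp (- l * s \<sigma> v))"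
    by (intro sum_mono mxle)
  also have "\<dots> = (\<Sum>v\<in>V. (\<Sum>\<sigma>\<in>Pow {..<n}. exp (l * s \<sigma> v)) + (\<Sum>\<sigma>\<in>Pow {..<n}. exp (- l * s \<sigma> v)))"
    by (subst sum.swap) (simp add: sum.distrib)
  also have "\<dots> \<le> (\<Sum>v\<in>V. 2 ^ n * exp (3 / 2) + 2 ^ n * exp (3 / 2))"
    using l by (intro sum_mono add_mono prodsum) auto
  also have "\<dots> = real (card V) * (2 * (2 ^ n * exp (3 / 2)))" by simp
  also have "\<dots> \<le> real G * (2 * (2 ^ n * exp (3 / 2)))"
    using V by (intro mult_right_mono) auto
  also have "\<dots> = 2 ^ n * exp u" using G by (simp add: u_def exp_add exp_ln)
  finally have E: "(\<Sum>\<sigma>\<in>Pow {..<n}. exp (l * mx \<sigma>)) \<le> 2 ^ n * exp u" .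
  have "l * (\<Sum>\<sigma>\<in>Pow {..<n}. mx \<sigma>) \<le> (\<Sum>\<sigma>\<in>Pow {..<n}. u + exp (l * mx \<sigma>) * exp (- u) - 1)"
    unfolding sum_distrib_left
  proof (rule sum_mono)
    fix \<sigma>
    have "1 + (l * mx \<sigma> - u) \<le> exp (l * mx \<sigma> - u)" by (rule exp_ge_add_one_self)
    then show "l * mx \<sigma> \<le> u + exp (l * mx \<sigma>) * exp (- u) - 1" by (simp add: exp_diff exp_minus divide_inverse)
  qed
  also have "\<dots> = 2 ^ n * u + (\<Sum>\<sigma>\<in>Pow {..<n}. exp (l * mx \<sigma>)) * exp (- u) - 2 ^ n"
    by (simp add: sum.distrib sum_subtractf sum_distrib_right card_Pow)
  also have "\<dots> \<le> 2 ^ n * u + 2 ^ n * exp u * exp (- u) - 2 ^ n"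
    using E by simp
  also have "\<dots> = 2 ^ n * u" by (simp add: exp_minus)
  finally have "(\<Sum>\<sigma>\<in>Pow {..<n}. mx \<sigma>) \<le> 2 ^ n * u / l"
    using l by (simp add: pos_le_divide_eq mult.commute)
  also have "\<dots> = 2 ^ n * (sqrt n * u)" by (simp add: l_def)
  finally show ?thesis unfolding mx_def s_def u_def .
qed

section \<open>Symmetrization with a ghost sample\<close>

definition emp :: "nat \<Rightarrow> (nat \<Rightarrow> 'a) \<Rightarrow> 'a set \<Rightarrow> real" where
  "emp n X A = (\<Sum>i<n. indicator A (X i)) / real n"

text \<open>Exchanges the positions \<open>i\<close> and \<open>n + i\<close> for every
  \<open>i\<close> in \<open>\<sigma>\<close>; on a sample of size \<open>2 * n\<close> this flips
  the sign of the \<open>i\<close>-th difference between the two halves.\<close>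

definition swap_half :: "nat \<Rightarrow> nat set \<Rightarrow> nat \<Rightarrow> nat" where
  "swap_half n \<sigma> i = (if i < n \<and> i \<in> \<sigma> then n + i else if n \<le> i \<and> i - n \<in> \<sigma> then i - n else i)"

context prob_space
begin

lemma prob_space_iid: "prob_space (\<Pi>\<^sub>M i\<in>I. M)"
  by (rule prob_space_PiM) (rule prob_space_axioms)

lemma sample_component [measurable]: "i \<in> I \<Longrightarrow> (\<lambda>X. X i) \<in> measurable (\<Pi>\<^sub>M i\<in>I. M) M"
  by (rule measurable_component_singleton)

context
  fixes A :: "nat \<Rightarrow> 'a set" and n m G :: nat
  assumes A [measurable]: "\<And>j. A j \<in> sets M" and n: "n > 0"
    and growth: "\<And>x :: nat \<Rightarrow> 'a. card ((\<lambda>j. {i. i < 2 * n \<and> x i \<in> A j}) ` {..m}) \<le> G"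
begin

text \<open>Finitely many sets at a time, so that the maximum exists and is measurable; the bound
  does not depend on their number.\<close>

definition dev :: "(nat \<Rightarrow> 'a) \<Rightarrow> real" where
  "dev X = Max ((\<lambda>j. \<bar>emp n X (A j) - prob (A j)\<bar>) ` {..m})"

definition dev2 :: "(nat \<Rightarrow> 'a) \<Rightarrow> real" where
  "dev2 X = Max ((\<lambda>j. \<bar>(\<Sum>i<n. indicator (A j) (X i) - indicator (A j) (X (n + i))) / real n\<bar>) ` {..m})"

lemma indicator_sample [measurable]: "i \<in> I \<Longrightarrow> (\<lambda>X. indicator (A j) (X i) :: real) \<in> borel_measurable (\<Pi>\<^sub>M i\<in>I. M)"
  using borel_measurable_indicator[OF A, of j] by measurable

lemma dev_measurable: "dev \<in> borel_measurable (\<Pi>\<^sub>M i\<in>{..<n}. M)"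
  unfolding dev_def [abs_def] emp_def
  by (intro borel_measurable_Max borel_measurable_abs borel_measurable_diff borel_measurable_divide borel_measurable_sum indicator_sample) auto

lemma dev2_measurable: "dev2 \<in> borel_measurable (\<Pi>\<^sub>M i\<in>{..<2 * n}. M)"
  unfolding dev2_def [abs_def]
  by (intro borel_measurable_Max borel_measurable_abs borel_measurable_diff borel_measurable_divide borel_measurable_sum indicator_sample) auto

lemma emp_bounds: "0 \<le> emp n X B" "emp n X B \<le> 1"
proof -
  have "(\<Sum>i<n. indicator B (X i) :: real) \<le> (\<Sum>i<n. 1)" by (intro sum_mono) (simp add: indicator_def)
  then show "emp n X B \<le> 1" using n by (simp add: emp_def)
  show "0 \<le> emp n X B" by (simp add: emp_def sum_nonneg)
qed

lemma dev_bounds: "0 \<le> dev X" "dev X \<le> 1"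
proof -
  have "dev X \<in> (\<lambda>j. \<bar>emp n X (A j) - prob (A j)\<bar>) ` {..m}" unfolding dev_def by (intro Max_in) auto
  then obtain j where "dev X = \<bar>emp n X (A j) - prob (A j)\<bar>" by auto
  then show "0 \<le> dev X" "dev X \<le> 1" using emp_bounds[of X "A j"] measure_nonneg[of M "A j"] prob_le_1[of "A j"] by linarith+
qed

lemma dev2_bounds: "0 \<le> dev2 X" "dev2 X \<le> 1"
proof -
  have "dev2 X \<in> (\<lambda>j. \<bar>(\<Sum>i<n. indicator (A j) (X i) - indicator (A j) (X (n + i))) / real n\<bar>) ` {..m}" unfolding dev2_def by (intro Max_in) auto
  then obtain j where "dev2 X = \<bar>(\<Sum>i<n. indicator (A j) (X i) - indicator (A j) (X (n + i))) / real n\<bar>" by auto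
  also have "\<dots> = \<bar>emp n X (A j) - emp n (\<lambda>i. X (n + i)) (A j)\<bar>" by (simp add: emp_def sum_subtractf diff_divide_distrib)
  finally show "0 \<le> dev2 X" "dev2 X \<le> 1" using emp_bounds[of X "A j"] emp_bounds[of "\<lambda>i. X (n + i)" "A j"] by linarith+
qed

lemma dev_integrable: "integrable (\<Pi>\<^sub>M i\<in>{..<n}. M) dev"
  using dev_bounds by (intro finite_measure.integrable_const_bound[OF prob_space.finite_measure[OF prob_space_iid], of _ 1] dev_measurable) auto

lemma dev2_integrable: "integrable (\<Pi>\<^sub>M i\<in>{..<2 * n}. M) dev2"
  using dev2_bounds by (intro finite_measure.integrable_const_bound[OF prob_space.finite_measure[OF prob_space_iid], of _ 1] dev2_measurable) auto

lemma expectation_indicator_sample: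
  assumes "i \<in> I"
  shows "(\<integral>X. indicator (A j) (X i) \<partial>(\<Pi>\<^sub>M i\<in>I. M)) = prob (A j)"
    and "integrable (\<Pi>\<^sub>M i\<in>I. M) (\<lambda>X. indicator (A j) (X i) :: real)"
proof -
  have "(\<integral>X. (indicator (A j) (X i) :: real) \<partial>(\<Pi>\<^sub>M i\<in>I. M)) = (\<integral>x. indicator (A j) x \<partial>distr (\<Pi>\<^sub>M i\<in>I. M) M (\<lambda>X. X i))"
    using assms by (intro integral_distr[where f = "indicator (A j)" and g = "\<lambda>X. X i", symmetric]) auto
  also have "distr (\<Pi>\<^sub>M i\<in>I. M) M (\<lambda>X. X i) = M"
    using assms by (intro distr_PiM_component prob_space_axioms)
  finally show "(\<integral>X. indicator (A j) (X i) \<partial>(\<Pi>\<^sub>M i\<in>I. M)) = prob (A j)"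
    using sets.sets_into_space[OF A, of j] by (simp add: Int_absorb2)
  show "integrable (\<Pi>\<^sub>M i\<in>I. M) (\<lambda>X. indicator (A j) (X i) :: real)"
    using assms by (intro finite_measure.integrable_const_bound[OF prob_space.finite_measure[OF prob_space_iid], of _ 1] indicator_sample) auto
qed

text \<open>The probability of a set is the mean of its frequency in the second half. By Jensen this
  averaging can be moved outside the absolute value, and then outside the maximum.\<close>

lemma expectation_dev_le_dev2: "(\<integral>X. dev X \<partial>(\<Pi>\<^sub>M i\<in>{..<n}. M)) \<le> (\<integral>X. dev2 X \<partial>(\<Pi>\<^sub>M i\<in>{..<2 * n}. M))"
proof -
  interpret PS: product_prob_space "\<lambda>_::nat. M" UNIV by standard
  let ?I = "{..<n}" and ?J = "{n..<2 * n}"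
  let ?PI = "\<Pi>\<^sub>M i\<in>?I. M" and ?PJ = "\<Pi>\<^sub>M i\<in>?J. M"
  interpret PI: prob_space ?PI by (rule prob_space_iid)
  interpret PJ: prob_space ?PJ by (rule prob_space_iid)
  interpret PIJ: pair_prob_space ?PI ?PJ ..
  have IJ: "?I \<union> ?J = {..<2 * n}" and disj: "?I \<inter> ?J = {}" by auto
  have merge_m: "merge ?I ?J \<in> measurable (?PI \<Otimes>\<^sub>M ?PJ) (\<Pi>\<^sub>M i\<in>{..<2 * n}. M)"
    using measurable_merge[of ?I ?J "\<lambda>_. M"] unfolding IJ .
  have dm: "(\<lambda>p. dev2 (merge ?I ?J p)) \<in> borel_measurable (?PI \<Otimes>\<^sub>M ?PJ)"
    using measurable_compose[OF merge_m dev2_measurable] .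
  have di: "integrable (?PI \<Otimes>\<^sub>M ?PJ) (\<lambda>p. dev2 (merge ?I ?J p))"
    using dev2_bounds by (intro PIJ.P.integrable_const_bound[of _ 1] dm) auto
  have eq: "(\<integral>X. dev2 X \<partial>(\<Pi>\<^sub>M i\<in>{..<2 * n}. M)) = (\<integral>x. \<integral>y. dev2 (merge ?I ?J (x, y)) \<partial>?PJ \<partial>?PI)"
    using PS.product_integral_fold[OF disj, of dev2] dev2_integrable unfolding IJ by simp
  have "dev x \<le> (\<integral>y. dev2 (merge ?I ?J (x, y)) \<partial>?PJ)" if x: "x \<in> space ?PI" for x
  proof -
    have dmx: "(\<lambda>y. dev2 (merge ?I ?J (x, y))) \<in> borel_measurable ?PJ"
      using measurable_compose[OF measurable_Pair1'[OF x] dm] by simp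
    have dix: "integrable ?PJ (\<lambda>y. dev2 (merge ?I ?J (x, y)))"
      using dev2_bounds by (intro PJ.integrable_const_bound[of _ 1] dmx) auto
    have "dev x \<in> (\<lambda>j. \<bar>emp n x (A j) - prob (A j)\<bar>) ` {..m}" unfolding dev_def by (intro Max_in) auto
    then obtain j where j: "j \<le> m" "dev x = \<bar>emp n x (A j) - prob (A j)\<bar>" by auto
    let ?d = "\<lambda>y. (\<Sum>i<n. indicator (A j) (x i) - indicator (A j) (y (n + i))) / real n"
    have di: "integrable ?PJ (\<lambda>y. indicator (A j) (x i) - indicator (A j) (y (n + i)) :: real)" if "i < n" for i
      using that expectation_indicator_sample(2)[of "n + i" ?J j] by simp
    have "(\<integral>y. ?d y \<partial>?PJ) = (\<Sum>i<n. (\<integral>y. indicator (A j) (x i) - indicator (A j) (y (n + i)) \<partial>?PJ)) / real n"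
      using di by (simp add: Bochner_Integration.integral_sum del: Bochner_Integration.integral_diff)
    also have "\<dots> = (\<Sum>i<n. indicator (A j) (x i) - prob (A j)) / real n"
    proof (intro arg_cong[of _ _ "\<lambda>s. s / real n"] sum.cong refl)
      fix i assume "i \<in> {..<n}"
      then show "(\<integral>y. indicator (A j) (x i) - indicator (A j) (y (n + i)) \<partial>?PJ) = indicator (A j) (x i) - prob (A j)"
        using expectation_indicator_sample[of "n + i" ?J j] PJ.prob_space by (subst Bochner_Integration.integral_diff) auto
    qed
    also have "\<dots> = emp n x (A j) - prob (A j)"
      using n by (simp add: emp_def sum_subtractf diff_divide_distrib)
    finally have "dev x = \<bar>\<integral>y. ?d y \<partial>?PJ\<bar>" using j by simp
    also have "\<dots> \<le> (\<integral>y. \<bar>?d y\<bar> \<partial>?PJ)" by (rule integral_abs_bound)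
    also have "\<dots> \<le> (\<integral>y. dev2 (merge ?I ?J (x, y)) \<partial>?PJ)"
    proof (rule integral_mono)
      show "integrable ?PJ (\<lambda>y. \<bar>?d y\<bar>)"
        using di by (intro Bochner_Integration.integrable_abs integrable_divide Bochner_Integration.integrable_sum) auto
      show "integrable ?PJ (\<lambda>y. dev2 (merge ?I ?J (x, y)))" by (rule dix)
      fix y
      have "(\<Sum>i<n. indicator (A j) (x i) - indicator (A j) (y (n + i)) :: real) =
          (\<Sum>i<n. indicator (A j) (merge ?I ?J (x, y) i) - indicator (A j) (merge ?I ?J (x, y) (n + i)))"
        by (intro sum.cong refl) (auto simp: merge_def)
      then show "\<bar>?d y\<bar> \<le> dev2 (merge ?I ?J (x, y))"
        unfolding dev2_def using j(1) by (intro Max_ge) auto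
    qed
    finally show ?thesis .
  qed
  then have "(\<integral>x. dev x \<partial>?PI) \<le> (\<integral>x. \<integral>y. dev2 (merge ?I ?J (x, y)) \<partial>?PJ \<partial>?PI)"
    using PIJ.integrable_fst'[OF di] by (intro integral_mono_AE dev_integrable AE_I2) auto
  then show ?thesis using eq by simp
qed

lemma swap_half_inj: "inj_on (swap_half n \<sigma>) {..<2 * n}"
  by (auto simp: inj_on_def swap_half_def split: if_splits)

text \<open>A swap permutes positions, and an independent identically distributed sample is
  exchangeable.\<close>

lemma expectation_dev2_swap:
  "(\<integral>X. dev2 (\<lambda>k\<in>{..<2 * n}. X (swap_half n \<sigma> k)) \<partial>(\<Pi>\<^sub>M i\<in>{..<2 * n}. M)) = (\<integral>X. dev2 X \<partial>(\<Pi>\<^sub>M i\<in>{..<2 * n}. M))"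
  "integrable (\<Pi>\<^sub>M i\<in>{..<2 * n}. M) (\<lambda>X. dev2 (\<lambda>k\<in>{..<2 * n}. X (swap_half n \<sigma> k)))"
proof -
  let ?P = "\<Pi>\<^sub>M i\<in>{..<2 * n}. M"
  have f: "swap_half n \<sigma> \<in> {..<2 * n} \<rightarrow> {..<2 * n}" by (auto simp: swap_half_def)
  have d: "distr ?P ?P (\<lambda>X. \<lambda>k\<in>{..<2 * n}. X (swap_half n \<sigma> k)) = ?P"
    by (rule distr_PiM_reindex[where M = "\<lambda>_. M", OF prob_space_axioms swap_half_inj f])
  have m: "(\<lambda>X. \<lambda>k\<in>{..<2 * n}. X (swap_half n \<sigma> k)) \<in> measurable ?P ?P"
    using f by (intro measurable_restrict sample_component) auto
  show "(\<integral>X. dev2 (\<lambda>k\<in>{..<2 * n}. X (swap_half n \<sigma> k)) \<partial>?P) = (\<integral>X. dev2 X \<partial>?P)"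
    using integral_distr[OF m dev2_measurable] by (simp add: d)
  show "integrable ?P (\<lambda>X. dev2 (\<lambda>k\<in>{..<2 * n}. X (swap_half n \<sigma> k)))"
    using integrable_distr_eq[OF m dev2_measurable] dev2_integrable by (simp add: d)
qed

text \<open>For a fixed sample the swaps act as independent random signs. The difference vectors
  depend only on the traces of the sets, so at most \<open>G\<close> of them are distinct and the
  finite class lemma applies.\<close>

lemma dev2_swap_sum_le:
  "(\<Sum>\<sigma>\<in>Pow {..<n}. dev2 (\<lambda>k\<in>{..<2 * n}. X (swap_half n \<sigma> k))) \<le> 2 ^ n * ((ln (2 * real G) + 3 / 2) / sqrt n)"
proof -
  define v where "v j i = (if i < n then indicator (A j) (X i) - indicator (A j) (X (n + i)) else 0 :: real)" for j i
  let ?V = "v ` {..m}"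
  have fin: "finite ?V" "?V \<noteq> {}" by auto
  have "card ?V \<le> G"
  proof -
    have "v j = (\<lambda>T i. if i < n then indicator T i - indicator T (n + i) else 0) {i. i < 2 * n \<and> X i \<in> A j}" for j
      by (auto simp: v_def indicator_def)
    then have V: "?V = (\<lambda>T i. if i < n then indicator T i - indicator T (n + i) else 0) ` ((\<lambda>j. {i. i < 2 * n \<and> X i \<in> A j}) ` {..m})"
      unfolding image_image by (intro image_cong) auto
    then have "card ?V \<le> card ((\<lambda>j. {i. i < 2 * n \<and> X i \<in> A j}) ` {..m})" unfolding V by (intro card_image_le) simp
    then show ?thesis using growth[of X] by linarith
  qed
  moreover have "\<bar>w i\<bar> \<le> 1" if "w \<in> ?V" for w i using that by (auto simp: v_def indicator_def)
  ultimately have R: "(\<Sum>\<sigma>\<in>Pow {..<n}. Max ((\<lambda>w. \<bar>\<Sum>i<n. (if i \<in> \<sigma> then -1 else 1) * w i\<bar>) ` ?V)) \<le>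
    2 ^ n * (sqrt n * (ln (2 * real G) + 3 / 2))" using fin n by (intro rademacher_finite_class) auto
  have "dev2 (\<lambda>k\<in>{..<2 * n}. X (swap_half n \<sigma> k)) = Max ((\<lambda>w. \<bar>\<Sum>i<n. (if i \<in> \<sigma> then -1 else 1) * w i\<bar>) ` ?V) / n" if \<sigma>: "\<sigma> \<subseteq> {..<n}" for \<sigma>
  proof -
    have "(\<Sum>i<n. indicator (A j) ((\<lambda>k\<in>{..<2 * n}. X (swap_half n \<sigma> k)) i) - indicator (A j) ((\<lambda>k\<in>{..<2 * n}. X (swap_half n \<sigma> k)) (n + i)) :: real)
        = (\<Sum>i<n. (if i \<in> \<sigma> then -1 else 1) * v j i)" for j
      using \<sigma> by (intro sum.cong refl) (auto simp: v_def swap_half_def)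
    then have "dev2 (\<lambda>k\<in>{..<2 * n}. X (swap_half n \<sigma> k)) = Max ((\<lambda>j. \<bar>\<Sum>i<n. (if i \<in> \<sigma> then -1 else 1) * v j i\<bar> / real n) ` {..m})"
      unfolding dev2_def by (simp add: abs_divide)
    also have "(\<lambda>j. \<bar>\<Sum>i<n. (if i \<in> \<sigma> then -1 else 1) * v j i\<bar> / real n) ` {..m} = (\<lambda>t. t / real n) ` ((\<lambda>w. \<bar>\<Sum>i<n. (if i \<in> \<sigma> then -1 else 1) * w i\<bar>) ` ?V)"
      by (simp add: image_image)
    also have "Max \<dots> = Max ((\<lambda>w. \<bar>\<Sum>i<n. (if i \<in> \<sigma> then -1 else 1) * w i\<bar>) ` ?V) / n"
      using fin by (intro mono_Max_commute[symmetric]) (auto simp: mono_def divide_right_mono)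
    finally show ?thesis .
  qed
  then have "(\<Sum>\<sigma>\<in>Pow {..<n}. dev2 (\<lambda>k\<in>{..<2 * n}. X (swap_half n \<sigma> k))) =
      (\<Sum>\<sigma>\<in>Pow {..<n}. Max ((\<lambda>w. \<bar>\<Sum>i<n. (if i \<in> \<sigma> then -1 else 1) * w i\<bar>) ` ?V)) / n"
    unfolding sum_divide_distrib by (intro sum.cong) auto
  also have "\<dots> \<le> 2 ^ n * (sqrt n * (ln (2 * real G) + 3 / 2)) / n"
    using R by (rule divide_right_mono) simp
  also have "\<dots> = 2 ^ n * ((ln (2 * real G) + 3 / 2) / sqrt n)"
  proof -
    have *: "a * (t * c) / (t * t) = a * (c / t)" if "t \<noteq> 0" for a c t :: real using that by simp
    show ?thesis using *[of "sqrt n" "2 ^ n" "ln (2 * real G) + 3 / 2"] n by simp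
  qed
  finally show ?thesis .
qed

text \<open>No swap changes the expectation of \<open>dev2\<close>, so the pointwise bound for the
  average over all swaps passes to it.\<close>

lemma expectation_dev_le: "(\<integral>X. dev X \<partial>(\<Pi>\<^sub>M i\<in>{..<n}. M)) \<le> (ln (2 * real G) + 3 / 2) / sqrt n"
proof -
  let ?P = "\<Pi>\<^sub>M i\<in>{..<2 * n}. M"
  interpret P: prob_space ?P by (rule prob_space_iid)
  let ?b = "(ln (2 * real G) + 3 / 2) / sqrt n"
  have "2 ^ n * (\<integral>X. dev2 X \<partial>?P) = (\<Sum>\<sigma>\<in>Pow {..<n}. (\<integral>X. dev2 (\<lambda>k\<in>{..<2 * n}. X (swap_half n \<sigma> k)) \<partial>?P))"
    by (simp add: expectation_dev2_swap(1) card_Pow)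
  also have "\<dots> = (\<integral>X. (\<Sum>\<sigma>\<in>Pow {..<n}. dev2 (\<lambda>k\<in>{..<2 * n}. X (swap_half n \<sigma> k))) \<partial>?P)"
    by (rule Bochner_Integration.integral_sum[symmetric]) (rule expectation_dev2_swap(2))
  also have "\<dots> \<le> (\<integral>X. 2 ^ n * ?b \<partial>?P)"
    by (intro integral_mono Bochner_Integration.integrable_sum expectation_dev2_swap(2) dev2_swap_sum_le) auto
  also have "\<dots> = 2 ^ n * ?b" using P.prob_space by simp
  finally have "(\<integral>X. dev2 X \<partial>?P) \<le> ?b" by (rule mult_left_le_imp_le) simp
  then show ?thesis using expectation_dev_le_dev2 by linarith
qed

end

text \<open>Markov's inequality suffices, since a fixed confidence is wanted. The estimate does not
  depend on the number of sets and therefore survives the increasing union.\<close>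

theorem uniform_deviation:
  fixes A :: "nat \<Rightarrow> 'a set"
  assumes A [measurable]: "\<And>j. A j \<in> sets M" and n: "n > 0" and \<epsilon>: "\<epsilon> > 0"
    and growth: "\<And>(x :: nat \<Rightarrow> 'a) J. finite J \<Longrightarrow> card ((\<lambda>j. {i. i < 2 * n \<and> x i \<in> A j}) ` J) \<le> G"
  shows "{X \<in> space (\<Pi>\<^sub>M i\<in>{..<n}. M). \<exists>j. \<bar>emp n X (A j) - prob (A j)\<bar> > \<epsilon>} \<in> sets (\<Pi>\<^sub>M i\<in>{..<n}. M)" (is "?B \<in> _")
    and "measure (\<Pi>\<^sub>M i\<in>{..<n}. M) {X \<in> space (\<Pi>\<^sub>M i\<in>{..<n}. M). \<exists>j. \<bar>emp n X (A j) - prob (A j)\<bar> > \<epsilon>} \<le>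
      (ln (2 * real G) + 3 / 2) / sqrt n / \<epsilon>"
proof -
  let ?P = "\<Pi>\<^sub>M i\<in>{..<n}. M"
  let ?b = "(ln (2 * real G) + 3 / 2) / sqrt n"
  interpret P: prob_space ?P by (rule prob_space_iid)
  have em: "(\<lambda>X. emp n X (A j)) \<in> borel_measurable ?P" for j
  proof -
    have "(\<lambda>X. indicator (A j) (X i) :: real) \<in> borel_measurable ?P" if "i < n" for i
      using measurable_compose[OF measurable_component_singleton[of i "{..<n}" "\<lambda>_. M"] borel_measurable_indicator[OF A, of j]] that by simp
    then show ?thesis unfolding emp_def by (intro borel_measurable_divide borel_measurable_sum) auto
  qed
  define Bm where "Bm m = {X \<in> space ?P. \<exists>j\<le>m. \<bar>emp n X (A j) - prob (A j)\<bar> > \<epsilon>}" for m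
  have Bms: "Bm m \<in> sets ?P" for m
  proof -
    have "Bm m = (\<Union>j\<in>{..m}. {X \<in> space ?P. \<bar>emp n X (A j) - prob (A j)\<bar> > \<epsilon>})" by (auto simp: Bm_def)
    also have "\<dots> \<in> sets ?P" using em by (intro sets.finite_UN) auto
    finally show ?thesis .
  qed
  have B: "?B = (\<Union>m. Bm m)" by (auto simp: Bm_def)
  show "?B \<in> sets ?P" unfolding B using Bms by auto
  have bm: "measure ?P (Bm m) \<le> ?b / \<epsilon>" for m
  proof -
    have g: "card ((\<lambda>j. {i. i < 2 * n \<and> x i \<in> A j}) ` {..m}) \<le> G" for x :: "nat \<Rightarrow> 'a" by (rule growth) simp
    have "Bm m \<subseteq> {X \<in> space ?P. dev A n m X \<ge> \<epsilon>}"
    proof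
      fix X assume "X \<in> Bm m"
      then obtain j where j: "X \<in> space ?P" "j \<le> m" "\<bar>emp n X (A j) - prob (A j)\<bar> > \<epsilon>" by (auto simp: Bm_def)
      have "\<bar>emp n X (A j) - prob (A j)\<bar> \<le> dev A n m X"
        unfolding dev_def[OF A n g] using j by (intro Max_ge) auto
      then show "X \<in> {X \<in> space ?P. dev A n m X \<ge> \<epsilon>}" using j by auto
    qed
    then have "measure ?P (Bm m) \<le> measure ?P {X \<in> space ?P. dev A n m X \<ge> \<epsilon>}"
      using dev_measurable[OF A n g] by (intro P.finite_measure_mono) auto
    also have "\<dots> \<le> (\<integral>X. dev A n m X \<partial>?P) / \<epsilon>"
      using dev_bounds[OF A n g] \<epsilon> by (intro integral_Markov_inequality_measure[OF dev_integrable[OF A n g] sets.empty_sets]) auto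
    also have "\<dots> \<le> ?b / \<epsilon>"
      using expectation_dev_le[OF A n g] \<epsilon> by (intro divide_right_mono) auto
    finally show ?thesis .
  qed
  have inc: "incseq Bm" unfolding incseq_def Bm_def using order_trans by blast
  have "range Bm \<subseteq> sets ?P" using Bms by blast
  from P.finite_Lim_measure_incseq[OF this inc]
  have lim: "(\<lambda>m. measure ?P (Bm m)) \<longlonglongrightarrow> measure ?P (\<Union>m. Bm m)" .
  have "measure ?P (\<Union>m. Bm m) \<le> ?b / \<epsilon>"
    by (rule LIMSEQ_le_const2[OF lim]) (use bm in blast)
  then show "measure ?P ?B \<le> ?b / \<epsilon>" by (simp only: B)
qed

end

section \<open>Minimum distance estimation\<close>

text \<open>The normalising constant of a truncated Gaussian is kept inside the polynomial
  \<open>q\<close>, so that ratios of two densities are exponentials of polynomials where both are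
  positive.\<close>

definition ptf_density :: "((nat \<Rightarrow> real) \<Rightarrow> real) \<Rightarrow> ((nat \<Rightarrow> real) \<Rightarrow> real) \<Rightarrow> (nat \<Rightarrow> real) \<Rightarrow> real" where
  "ptf_density q p x = (if p x > 0 then exp (q x) else 0)"

definition density_measure :: "nat \<Rightarrow> ((nat \<Rightarrow> real) \<Rightarrow> real) \<Rightarrow> (nat \<Rightarrow> real) measure" where
  "density_measure d h = density (lborel_R d) (\<lambda>x. ennreal (h x))"

lemma sets_density_measure [simp]: "sets (density_measure d h) = sets (lborel_R d)"
  by (simp add: density_measure_def)

lemma ptf_density_nonneg [simp]: "0 \<le> ptf_density q p x"
  by (simp add: ptf_density_def)

lemma measurable_ptf_density [measurable]:
  assumes "poly_fun d k q" "poly_fun d k p"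
  shows "ptf_density q p \<in> borel_measurable (lborel_R d)"
proof -
  have [measurable]: "q \<in> borel_measurable (lborel_R d)" "p \<in> borel_measurable (lborel_R d)" using assms by auto
  show ?thesis unfolding ptf_density_def [abs_def] by measurable
qed

lemma ptf_density_less_iff:
  "ptf_density q p x > ptf_density q' p' x \<longleftrightarrow> p x > 0 \<and> (\<not> p' x > 0 \<or> q x - q' x > 0)"
  by (auto simp: ptf_density_def)

lemma density_measure_facts:
  assumes h: "h \<in> borel_measurable (lborel_R d)" "\<And>x. 0 \<le> h x" and prob: "prob_space (density_measure d h)"
  shows "integrable (lborel_R d) h" "(\<integral>x. h x \<partial>lborel_R d) = 1"
    "\<And>B. B \<in> sets (lborel_R d) \<Longrightarrow> measure (density_measure d h) B = (\<integral>x. h x * indicator B x \<partial>lborel_R d)"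
proof -
  interpret prob_space "density_measure d h" by (rule prob)
  have "(\<integral>\<^sup>+x. ennreal (h x) \<partial>lborel_R d) = emeasure (density_measure d h) (space (density_measure d h))"
    unfolding density_measure_def using h by (subst emeasure_density) (auto intro!: nn_integral_cong simp: indicator_def)
  then have n: "(\<integral>\<^sup>+x. ennreal (h x) \<partial>lborel_R d) = 1" using emeasure_space_1 by simp
  show i: "integrable (lborel_R d) h"
    using n h by (intro integrableI_nonneg) auto
  show "(\<integral>x. h x \<partial>lborel_R d) = 1"
    using nn_integral_eq_integral[OF i] h n by simp
  show "measure (density_measure d h) B = (\<integral>x. h x * indicator B x \<partial>lborel_R d)" if B: "B \<in> sets (lborel_R d)" for B
  proof -
    have iB: "integrable (lborel_R d) (\<lambda>x. h x * indicator B x)" using i B by (rule integrable_real_mult_indicator[rotated])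
    have "emeasure (density_measure d h) B = (\<integral>\<^sup>+x. ennreal (h x * indicator B x) \<partial>lborel_R d)"
      unfolding density_measure_def using h B by (subst emeasure_density) (auto intro!: nn_integral_cong simp: indicator_def)
    also have "\<dots> = ennreal (\<integral>x. h x * indicator B x \<partial>lborel_R d)"
      using nn_integral_eq_integral[OF iB] h by simp
    finally show ?thesis using h by (simp add: measure_def)
  qed
qed

text \<open>The set where \<open>h\<close> exceeds \<open>h'\<close> maximises the difference of the
  two measures. For the opposite sign pass to the complement, as both measures have mass 1.\<close>

lemma scheffe_set_bound:
  assumes h: "h \<in> borel_measurable (lborel_R d)" "\<And>x. 0 \<le> h x" "prob_space (density_measure d h)"
    and h': "h' \<in> borel_measurable (lborel_R d)" "\<And>x. 0 \<le> h' x" "prob_space (density_measure d h')"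
    and B: "B \<in> sets (lborel_R d)"
  defines "A \<equiv> {x \<in> R_space d. h x > h' x}"
  shows "\<bar>measure (density_measure d h) B - measure (density_measure d h') B\<bar> \<le>
    measure (density_measure d h) A - measure (density_measure d h') A"
proof -
  let ?P = "density_measure d h" and ?Q = "density_measure d h'"
  interpret P: prob_space ?P by (rule h(3))
  interpret Q: prob_space ?Q by (rule h'(3))
  note f = density_measure_facts[OF h] and f' = density_measure_facts[OF h']
  have A: "A \<in> sets (lborel_R d)" unfolding A_def using h(1) h'(1) by measurable
  have one: "measure ?P E - measure ?Q E \<le> measure ?P A - measure ?Q A" if E: "E \<in> sets (lborel_R d)" for E
  proof -
    have i: "integrable (lborel_R d) (\<lambda>x. h x * indicator F x)" "integrable (lborel_R d) (\<lambda>x. h' x * indicator F x)"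
      if "F \<in> sets (lborel_R d)" for F
      using f(1) f'(1) that by (auto intro: integrable_real_mult_indicator)
    have "measure ?P E - measure ?Q E = (\<integral>x. h x * indicator E x - h' x * indicator E x \<partial>lborel_R d)"
      using i[OF E] by (simp add: f(3)[OF E] f'(3)[OF E])
    also have "\<dots> \<le> (\<integral>x. h x * indicator A x - h' x * indicator A x \<partial>lborel_R d)"
      by (intro integral_mono_AE Bochner_Integration.integrable_diff i E A AE_I2)
        (auto simp: A_def indicator_def)
    also have "\<dots> = measure ?P A - measure ?Q A"
      using i[OF A] by (simp add: f(3)[OF A] f'(3)[OF A])
    finally show ?thesis .
  qed
  have "measure ?P (space ?P - B) = 1 - measure ?P B" using B by (intro P.prob_compl) simp
  moreover have "measure ?Q (space ?Q - B) = 1 - measure ?Q B" using B by (intro Q.prob_compl) simp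
  moreover have "space ?P = R_space d" "space ?Q = R_space d" by (simp_all add: density_measure_def)
  ultimately have "measure ?Q B - measure ?P B \<le> measure ?P A - measure ?Q A"
    using one[of "R_space d - B"] B by auto
  with one[OF B] show ?thesis by linarith
qed

text \<open>A Scheffe set is a Boolean combination of three positivity sets, those of the two
  thresholds and of the difference of the exponents; hence the cube.\<close>

lemma card_scheffe_traces_le:
  assumes q: "\<And>j. poly_fun d k (q j)" and p: "\<And>j. poly_fun d k (p j)"
  shows "card ((\<lambda>(i, j). {l. l < m \<and> x l \<in> {x \<in> R_space d. ptf_density (q i) (p i) x > ptf_density (q j) (p j) x}}) ` J)
    \<le> ((m + 1) ^ ((d + 1) ^ k)) ^ 3"
proof -
  let ?V = "{f. poly_fun d k f}"
  let ?t = "\<lambda>f. {l. l < m \<and> f (x l) > 0}"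
  let ?T = "?t ` ?V"
  let ?F = "\<lambda>(T1, T2, T3). {l. x l \<in> R_space d} \<inter> (T1 \<inter> ((- T2) \<union> T3))"
  have cT: "card ?T \<le> (m + 1) ^ ((d + 1) ^ k)"
  proof -
    have "\<exists>c. \<forall>y. f y = (\<Sum>l\<in>monomials d k. c l * mono_fun d l y)" if "f \<in> ?V" for f
      using that unfolding mem_Collect_eq poly_fun_span by (auto simp: fun_eq_iff)
    from card_positivity_traces_le[OF finite_monomials this, where x = x and m = m]
    show ?thesis by (simp only: card_monomials)
  qed
  have finT: "finite ?T" by (rule finite_subset[of _ "Pow {..<m}"]) auto
  let ?img = "(\<lambda>(i, j). {l. l < m \<and> x l \<in> {x \<in> R_space d. ptf_density (q i) (p i) x > ptf_density (q j) (p j) x}}) ` J"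
  have sub: "?img \<subseteq> ?F ` (?T \<times> ?T \<times> ?T)"
  proof
    fix E assume "E \<in> ?img"
    then obtain i j where E: "E = {l. l < m \<and> x l \<in> {x \<in> R_space d. ptf_density (q i) (p i) x > ptf_density (q j) (p j) x}}" by auto
    have "E = ?F (?t (p i), ?t (p j), ?t (\<lambda>x. q i x - q j x))"
      unfolding E ptf_density_less_iff by auto
    moreover have "(?t (p i), ?t (p j), ?t (\<lambda>x. q i x - q j x)) \<in> ?T \<times> ?T \<times> ?T"
    proof -
      have m: "?t f \<in> ?T" if "poly_fun d k f" for f using that by (intro imageI) simp
      show ?thesis by (intro SigmaI m p poly_fun_diff q)
    qed
    ultimately show "E \<in> ?F ` (?T \<times> ?T \<times> ?T)" by blast
  qed
  have "card ?img \<le> card (?F ` (?T \<times> ?T \<times> ?T))"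
    using finT by (intro card_mono sub) auto
  also have "\<dots> \<le> card (?T \<times> ?T \<times> ?T)" using finT by (intro card_image_le) auto
  also have "\<dots> = card ?T ^ 3" by (simp add: card_cartesian_product power3_eq_cube mult.assoc)
  also have "\<dots> \<le> ((m + 1) ^ ((d + 1) ^ k)) ^ 3" by (intro power_mono cT) simp
  finally show ?thesis .
qed

text \<open>Yatracos' minimum distance estimator over the countable family \<open>density_measure d (h j)\<close>: the
  first hypothesis whose probabilities of all Scheffe sets are close to the empirical ones.\<close>
definition min_dist_index :: "nat \<Rightarrow> (nat \<Rightarrow> (nat \<Rightarrow> real) \<Rightarrow> real) \<Rightarrow> nat \<Rightarrow> real \<Rightarrow> (nat \<Rightarrow> nat \<Rightarrow> real) \<Rightarrow> nat" where
  "min_dist_index d h n r X = (LEAST j. \<forall>a b. \<bar>emp n X {x \<in> R_space d. h a x > h b x} -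
     measure (density_measure d (h j)) {x \<in> R_space d. h a x > h b x}\<bar> \<le> r)"

text \<open>The hypothesis \<open>j0\<close> passes the test at radius
  \<open>\<eta> + \<tau>\<close>, so some index is selected. On the Scheffe set of the two, both are
  within this radius of the empirical measure and differ by at most
  \<open>2 * (\<eta> + \<tau>)\<close>; another \<open>\<eta>\<close> leads back to
  \<open>P\<close>. The abstract \<open>good\<close> lets the conclusion be stated for parameters
  instead of densities.\<close>

theorem ptf_learning:
  fixes q p :: "nat \<Rightarrow> (nat \<Rightarrow> real) \<Rightarrow> real" and n :: nat
  assumes q: "\<And>j. poly_fun d k (q j)" and p: "\<And>j. poly_fun d k (p j)"
    and prob: "\<And>j. prob_space (density_measure d (ptf_density (q j) (p j)))"
    and n: "n > 0" and \<tau>: "\<tau> > 0" and \<eta>: "\<eta> \<ge> 0"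
    and P: "prob_space P" "sets P = sets (lborel_R d)"
    and j0: "\<And>B. B \<in> sets (lborel_R d) \<Longrightarrow> \<bar>measure P B - measure (density_measure d (ptf_density (q j0) (p j0))) B\<bar> \<le> \<eta>"
    and size: "(ln (2 * real (((2 * n + 1) ^ ((d + 1) ^ k)) ^ 3)) + 3 / 2) / sqrt n / \<tau> \<le> 1 / 100"
    and good: "\<And>j. (\<And>B. B \<in> sets (lborel_R d) \<Longrightarrow> \<bar>measure P B - measure (density_measure d (ptf_density (q j) (p j))) B\<bar> \<le> 3 * \<eta> + 2 * \<tau>) \<Longrightarrow> good j"
  shows "measure (\<Pi>\<^sub>M i\<in>{..<n}. P) {X \<in> space (\<Pi>\<^sub>M i\<in>{..<n}. P).
    good (min_dist_index d (\<lambda>j. ptf_density (q j) (p j)) n (\<eta> + \<tau>) X)} \<ge> 99 / 100"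
proof -
  define h where "h j = ptf_density (q j) (p j)" for j
  define Q where "Q j = density_measure d (h j)" for j
  define A where "A a b = {x \<in> R_space d. h a x > h b x}" for a b
  let ?M = "\<Pi>\<^sub>M i\<in>{..<n}. P"
  let ?idx = "min_dist_index d h n (\<eta> + \<tau>)"
  interpret P: prob_space P by (rule P(1))
  interpret M: prob_space ?M by (rule P.prob_space_iid)
  have hm: "h j \<in> borel_measurable (lborel_R d)" for j
    unfolding h_def by (rule measurable_ptf_density[OF q p])
  have h0: "0 \<le> h j x" for j x by (simp add: h_def)
  have hprob: "prob_space (density_measure d (h j))" for j unfolding h_def by (rule prob)
  have A: "A a b \<in> sets (lborel_R d)" for a b unfolding A_def using hm[of a] hm[of b] by measurable
  have A': "A a b \<in> sets P" for a b using A by (simp add: P(2))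
  \<comment> \<open>The pairs of hypotheses are enumerated, because the deviation bound speaks of a
    sequence of sets.\<close>
  define A1 where "A1 m = (case prod_decode m of (a, b) \<Rightarrow> A a b)" for m
  have A1: "A1 m \<in> sets P" for m using A' by (simp add: A1_def split: prod.split)
  have growth: "card ((\<lambda>m. {i. i < 2 * n \<and> x i \<in> A1 m}) ` J) \<le> ((2 * n + 1) ^ ((d + 1) ^ k)) ^ 3" for x J
  proof -
    have "(\<lambda>m. {i. i < 2 * n \<and> x i \<in> A1 m}) ` J =
        (\<lambda>(i, j). {l. l < 2 * n \<and> x l \<in> {x \<in> R_space d. ptf_density (q i) (p i) x > ptf_density (q j) (p j) x}}) ` (prod_decode ` J)"
      unfolding image_image
    proof (intro image_cong refl)
      fix m
      show "{i. i < 2 * n \<and> x i \<in> A1 m} = (case prod_decode m of (i, j) \<Rightarrow>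
          {l. l < 2 * n \<and> x l \<in> {x \<in> R_space d. ptf_density (q i) (p i) x > ptf_density (q j) (p j) x}})"
        by (cases "prod_decode m") (simp add: A1_def A_def h_def)
    qed
    then show ?thesis using card_scheffe_traces_le[OF q p, where m = "2 * n" and x = x and J = "prod_decode ` J"] by simp
  qed
  let ?bad = "{X \<in> space ?M. \<exists>m. \<bar>emp n X (A1 m) - measure P (A1 m)\<bar> > \<tau>}"
  have bad: "?bad \<in> sets ?M" "measure ?M ?bad \<le> 1 / 100"
    by (rule P.uniform_deviation(1)[OF A1 n \<tau> growth], rule order_trans[OF P.uniform_deviation(2)[OF A1 n \<tau> growth] size])
  have dev: "\<bar>emp n X (A a b) - measure P (A a b)\<bar> \<le> \<tau>" if "X \<in> space ?M - ?bad" for X a b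
  proof -
    have "A1 (prod_encode (a, b)) = A a b" by (simp add: A1_def)
    then show ?thesis using that by (auto simp: not_less dest: spec[of _ "prod_encode (a, b)"])
  qed
  have idx_eq: "?idx X = (LEAST j. \<forall>a b. \<bar>emp n X (A a b) - measure (Q j) (A a b)\<bar> \<le> \<eta> + \<tau>)" for X
    by (simp add: min_dist_index_def A_def Q_def)
  have goodX: "good (?idx X)" if X: "X \<in> space ?M - ?bad" for X
  proof (rule good)
    let ?R = "\<lambda>j. \<forall>a b. \<bar>emp n X (A a b) - measure (Q j) (A a b)\<bar> \<le> \<eta> + \<tau>"
    have R0: "?R j0"
    proof (intro allI)
      fix a b
      show "\<bar>emp n X (A a b) - measure (Q j0) (A a b)\<bar> \<le> \<eta> + \<tau>"
        using dev[OF X, of a b] j0[OF A[of a b]] unfolding Q_def h_def by linarith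
    qed
    define J where "J = ?idx X"
    have RJ: "?R J" unfolding J_def idx_eq using R0 by (rule LeastI)
    fix B assume B: "B \<in> sets (lborel_R d)"
    have "\<bar>measure (Q j0) B - measure (Q J) B\<bar> \<le> measure (Q j0) (A j0 J) - measure (Q J) (A j0 J)"
      unfolding Q_def A_def by (intro scheffe_set_bound hm h0 hprob B)
    also have "\<dots> \<le> (\<eta> + \<tau>) + (\<eta> + \<tau>)"
    proof -
      have *: "a - b \<le> r + r" if "\<bar>e - a\<bar> \<le> r" "\<bar>e - b\<bar> \<le> r" for a b e r :: real
        using that by linarith
      show ?thesis by (rule *[OF R0[rule_format] RJ[rule_format]])
    qed
    finally have "\<bar>measure P B - measure (Q J) B\<bar> \<le> 3 * \<eta> + 2 * \<tau>"
      using j0[OF B] unfolding Q_def h_def by linarith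
    then show "\<bar>measure P B - measure (density_measure d (ptf_density (q (?idx X)) (p (?idx X)))) B\<bar> \<le> 3 * \<eta> + 2 * \<tau>"
      by (simp add: Q_def h_def J_def)
  qed
  have em: "(\<lambda>X. emp n X (A a b)) \<in> borel_measurable ?M" for a b
  proof -
    have "(\<lambda>X. indicator (A a b) (X i) :: real) \<in> borel_measurable ?M" if "i < n" for i
      using measurable_compose[OF measurable_component_singleton[of i "{..<n}" "\<lambda>_. P"] borel_measurable_indicator[OF A'[of a b]]] that by simp
    then show ?thesis unfolding emp_def by (intro borel_measurable_divide borel_measurable_sum) auto
  qed
  \<comment> \<open>The index takes values in a discrete space and is determined by countably many
    measurable conditions, so the event is measurable for an arbitrary predicate
    \<open>good\<close>.\<close>
  have idx_m: "?idx \<in> measurable ?M (count_space UNIV)"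
    unfolding idx_eq [abs_def] using em by measurable
  have "{X \<in> space ?M. good (?idx X)} = ?idx -` {j. good j} \<inter> space ?M" by auto
  also have "\<dots> \<in> sets ?M" by (rule measurable_sets[OF idx_m]) simp
  finally have gm: "{X \<in> space ?M. good (?idx X)} \<in> sets ?M" .
  have "99 / 100 \<le> 1 - measure ?M ?bad" using bad(2) by simp
  also have "\<dots> = measure ?M (space ?M - ?bad)" by (rule M.prob_compl[symmetric, OF bad(1)])
  also have "\<dots> \<le> measure ?M {X \<in> space ?M. good (?idx X)}"
    using goodX by (intro M.finite_measure_mono gm) auto
  finally show ?thesis by (simp add: h_def [abs_def])
qed

text \<open>Coefficients form a function space with the product topology, which supplies countable
  dense subsets and makes evaluation continuous.\<close>

definition coeff_poly :: "nat \<Rightarrow> nat \<Rightarrow> (nat list \<Rightarrow> real) \<Rightarrow> (nat \<Rightarrow> real) \<Rightarrow> real" where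
  "coeff_poly d k c x = (\<Sum>l\<in>monomials d k. c l * mono_fun d l x)"

lemma poly_fun_coeff_poly [simp]: "poly_fun d k (coeff_poly d k c)"
  unfolding poly_fun_span coeff_poly_def [abs_def] by blast

lemma tendsto_coeff_poly:
  assumes "(s \<longlongrightarrow> c) F"
  shows "((\<lambda>m. coeff_poly d k (s m) x) \<longlongrightarrow> coeff_poly d k c x) F"
proof -
  have "((\<lambda>m. s m l) \<longlongrightarrow> c l) F" for l
  proof -
    have "continuous_on UNIV (\<lambda>f::nat list \<Rightarrow> real. f l)" by simp
    then have "isCont (\<lambda>f::nat list \<Rightarrow> real. f l) c"
      using continuous_on_eq_continuous_at[OF open_UNIV] by blast
    from isCont_tendsto_compose[OF this assms] show ?thesis .
  qed
  then show ?thesis unfolding coeff_poly_def by (intro tendsto_sum tendsto_mult_right)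
qed

definition coeff_density :: "nat \<Rightarrow> nat \<Rightarrow> (nat list \<Rightarrow> real) \<times> (nat list \<Rightarrow> real) \<Rightarrow> (nat \<Rightarrow> real) \<Rightarrow> real" where
  "coeff_density d k c = ptf_density (coeff_poly d k (fst c)) (coeff_poly d k (snd c))"

text \<open>Convergent coefficients give convergent densities wherever the threshold polynomial is
  not zero, thus almost everywhere; Scheffe's lemma upgrades this to \<open>L1\<close> because all
  integrals are 1.\<close>

lemma coeff_density_approx:
  assumes c: "prob_space (density_measure d (coeff_density d k c))" "AE x in lborel_R d. coeff_poly d k (snd c) x \<noteq> 0"
    and T: "c \<in> closure T" "\<And>c'. c' \<in> T \<Longrightarrow> prob_space (density_measure d (coeff_density d k c'))" and \<eta>: "\<eta> > 0"
  shows "\<exists>c'\<in>T. \<forall>B\<in>sets (lborel_R d). \<bar>measure (density_measure d (coeff_density d k c)) B - measure (density_measure d (coeff_density d k c')) B\<bar> \<le> \<eta>"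
proof -
  obtain s where s: "\<And>m. s m \<in> T" "s \<longlonglongrightarrow> c" using T(1) unfolding closure_sequential by auto
  let ?L = "lborel_R d" and ?h = "coeff_density d k"
  have hm: "?h e \<in> borel_measurable ?L" for e
    unfolding coeff_density_def by (rule measurable_ptf_density[OF poly_fun_coeff_poly poly_fun_coeff_poly])
  have h0: "0 \<le> ?h e x" for e x by (simp add: coeff_density_def)
  note fc = density_measure_facts[OF hm h0 c(1)]
  note fs = density_measure_facts[OF hm h0 T(2)[OF s(1)]]
  have lim: "AE x in ?L. (\<lambda>m. ?h (s m) x) \<longlonglongrightarrow> ?h c x"
    using c(2)
  proof eventually_elim
    case (elim x)
    let ?p = "\<lambda>e. coeff_poly d k (snd e) x" and ?q = "\<lambda>e. coeff_poly d k (fst e) x"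
    have pl: "(\<lambda>m. ?p (s m)) \<longlonglongrightarrow> ?p c" by (intro tendsto_coeff_poly tendsto_snd s(2))
    have ql: "(\<lambda>m. exp (?q (s m))) \<longlonglongrightarrow> exp (?q c)" by (intro tendsto_exp tendsto_coeff_poly tendsto_fst s(2))
    show ?case
    proof (cases "?p c > 0")
      case True
      from order_tendstoD(1)[OF pl True] have "\<forall>\<^sub>F m in sequentially. ?h (s m) x = exp (?q (s m))"
        by eventually_elim (simp add: coeff_density_def ptf_density_def)
      moreover have "?h c x = exp (?q c)" using True by (simp add: coeff_density_def ptf_density_def)
      ultimately show ?thesis using ql by (simp add: tendsto_cong)
    next
      case False
      then have "?p c < 0" using elim by simp
      from order_tendstoD(2)[OF pl this] have "\<forall>\<^sub>F m in sequentially. ?h (s m) x = 0"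
        by eventually_elim (simp add: coeff_density_def ptf_density_def)
      moreover have "?h c x = 0" using False by (simp add: coeff_density_def ptf_density_def)
      ultimately show ?thesis by (simp add: tendsto_eventually)
    qed
  qed
  have nn: "(\<integral>\<^sup>+x. ennreal (norm (?h (s m) x)) \<partial>?L) = 1" "(\<integral>\<^sup>+x. ennreal (norm (?h c x)) \<partial>?L) = 1" for m
    using nn_integral_eq_integral[OF fs(1)[of m]] nn_integral_eq_integral[OF fc(1)] h0 fs(2)[of m] fc(2) by auto
  have "(\<lambda>m. \<integral>\<^sup>+x. ennreal (norm (?h (s m) x - ?h c x)) \<partial>?L) \<longlonglongrightarrow> 0"
    using Scheffe_lemma1[of ?L "\<lambda>m. ?h (s m)" "?h c"] fs(1) fc(1) lim nn by (simp add: Limsup_const)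
  then have "\<forall>\<^sub>F m in sequentially. (\<integral>\<^sup>+x. ennreal (norm (?h (s m) x - ?h c x)) \<partial>?L) < ennreal \<eta>"
    by (rule order_tendstoD) (use \<eta> in simp)
  then obtain m where m: "(\<integral>\<^sup>+x. ennreal (norm (?h (s m) x - ?h c x)) \<partial>?L) < ennreal \<eta>"
    unfolding eventually_sequentially by auto
  have idiff: "integrable ?L (\<lambda>x. ?h (s m) x - ?h c x)" using fs(1) fc(1) by simp
  have l1: "(\<integral>x. \<bar>?h (s m) x - ?h c x\<bar> \<partial>?L) \<le> \<eta>"
  proof -
    have "ennreal (\<integral>x. \<bar>?h (s m) x - ?h c x\<bar> \<partial>?L) = (\<integral>\<^sup>+x. ennreal (norm (?h (s m) x - ?h c x)) \<partial>?L)"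
      using idiff by (subst nn_integral_eq_integral) auto
    then have "ennreal (\<integral>x. \<bar>?h (s m) x - ?h c x\<bar> \<partial>?L) < ennreal \<eta>" using m by simp
    then show ?thesis by (metis ennreal_leI not_le order_less_imp_le)
  qed
  have "\<bar>measure (density_measure d (?h c)) B - measure (density_measure d (?h (s m))) B\<bar> \<le> \<eta>" if B: "B \<in> sets ?L" for B
  proof -
    have i: "integrable ?L (\<lambda>x. ?h c x * indicator B x)" "integrable ?L (\<lambda>x. ?h (s m) x * indicator B x)"
      using fs(1) fc(1) B by (auto intro: integrable_real_mult_indicator)
    have "\<bar>measure (density_measure d (?h c)) B - measure (density_measure d (?h (s m))) B\<bar> =
        \<bar>\<integral>x. ?h c x * indicator B x - ?h (s m) x * indicator B x \<partial>?L\<bar>"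
      using i by (simp add: fc(3)[OF B] fs(3)[OF B])
    also have "\<dots> \<le> (\<integral>x. \<bar>?h c x * indicator B x - ?h (s m) x * indicator B x\<bar> \<partial>?L)" by (rule integral_abs_bound)
    also have "\<dots> \<le> (\<integral>x. \<bar>?h (s m) x - ?h c x\<bar> \<partial>?L)"
      by (intro integral_mono Bochner_Integration.integrable_abs Bochner_Integration.integrable_diff i fs(1) fc(1)) (auto simp: indicator_def)
    finally show ?thesis using l1 by linarith
  qed
  then show ?thesis using s(1) by blast
qed

section \<open>Approximation by polynomial threshold sets\<close>

lemma cos_le_quadratic:
  assumes "0 \<le> x" "x \<le> (1::real)"
  shows "cos x \<le> 1 - x\<^sup>2 / 3"
proof -
  obtain t where t: "cos x = (\<Sum>m<3. cos_coeff m * x ^ m) + cos (t + 1/2 * real 3 * pi) / fact 3 * x ^ 3"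
    using Maclaurin_cos_expansion[of x 3] by blast
  have "cos (t + 1/2 * real 3 * pi) / fact 3 * x ^ 3 \<le> 1 / fact 3 * x ^ 3"
    using assms by (intro mult_right_mono divide_right_mono) auto
  also have "\<dots> = x\<^sup>2 * x / 6" by (simp add: fact_numeral power3_eq_cube power2_eq_square)
  also have "\<dots> \<le> x\<^sup>2 * 1 / 6" using assms by (intro divide_right_mono mult_left_mono) auto
  finally show ?thesis using t by (simp add: numeral_3_eq_3 cos_coeff_def power2_eq_square)
qed

text \<open>The source of the degree \<open>4 / \<theta>\<^sup>2\<close>:
  \<open>cos \<theta>\<close> is at most \<open>exp (- (\<theta>\<^sup>2 / 3))\<close>, so the
  exponent reaches at least 4/3, and already \<open>exp (- 1)\<close> is below 1/2.\<close>

lemma cos_power_le_half: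
  assumes "0 < \<theta>" "\<theta> \<le> 1" "4 / \<theta>\<^sup>2 \<le> real k"
  shows "(cos \<theta>) ^ Suc k \<le> 1 / 2"
proof -
  have c0: "0 \<le> cos \<theta>" using assms cos_gt_zero_pi[of \<theta>] pi_gt3 by (intro less_imp_le cos_gt_zero_pi) auto
  have "cos \<theta> \<le> 1 - \<theta>\<^sup>2 / 3" using assms by (intro cos_le_quadratic) auto
  also have "\<dots> \<le> exp (- (\<theta>\<^sup>2 / 3))" using exp_ge_add_one_self[of "- (\<theta>\<^sup>2 / 3)"] by simp
  finally have "(cos \<theta>) ^ Suc k \<le> exp (- (\<theta>\<^sup>2 / 3)) ^ Suc k" using c0 by (intro power_mono)
  also have "\<dots> = exp (- (real (Suc k) * (\<theta>\<^sup>2 / 3)))" 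
    using exp_of_nat_mult[of "Suc k" "- (\<theta>\<^sup>2 / 3)", symmetric] by (simp only: mult_minus_right)
  also have "\<dots> \<le> exp (- 1)"
  proof -
    have "4 \<le> real k * \<theta>\<^sup>2" using assms by (simp add: pos_divide_le_eq)
    also have "\<dots> \<le> real (Suc k) * \<theta>\<^sup>2" by (intro mult_right_mono) auto
    finally show ?thesis by simp
  qed
  also have "exp (-1::real) \<le> 1 / 2"
    using exp_ge_add_one_self[of 1] by (simp add: exp_minus inverse_eq_divide divide_le_eq_1 field_simps)
  finally show ?thesis .
qed

text \<open>For the values 0 and 1, \<open>\<bar>a - b\<bar> = a + b - 2 * (a * b)\<close>.\<close>

lemma noise_form_indicator:
  assumes E[measurable]: "E \<in> sets (lborel_R d)" and \<theta>: "0 < \<theta>" "\<theta> \<le> 1"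
  shows "(\<integral>x. (indicator E x)\<^sup>2 \<partial>std_gaussian d) - noise_form d (cos \<theta>) (indicator E) (indicator E) = noise_sens d (indicator E) \<theta> / 2"
proof -
  let ?NN = "std_gaussian2 d" and ?X = "\<lambda>p. lc d (cos \<theta>) (fst p) (sin \<theta>) (snd p)"
  let ?f = "indicator E :: _ \<Rightarrow> real"
  have c: "cos \<theta> > -1" "0 \<le> cos \<theta>" "cos \<theta> \<le> 1"
    using cos_gt_minus_one[of \<theta>] \<theta> pi_gt3 cos_gt_zero_pi[of \<theta>] by (auto intro: less_imp_le)
  have "sin \<theta> \<ge> 0" using \<theta> pi_gt3 by (intro sin_ge_zero) auto
  then have s: "sqrt (1 - (cos \<theta>)\<^sup>2) = sin \<theta>" by (simp add: sin_squared_eq[symmetric])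
  have cs: "(cos \<theta>)\<^sup>2 + (sin \<theta>)\<^sup>2 = 1" by simp
  have i: "integrable ?NN (\<lambda>p. u p)" if "u \<in> borel_measurable ?NN" "\<And>p. \<bar>u p\<bar> \<le> 1" for u :: "_ \<Rightarrow> real"
    using that by (intro NN.P.integrable_const_bound[of _ 1]) auto
  have i1: "integrable ?NN (\<lambda>p. ?f (?X p))" and i2: "integrable ?NN (\<lambda>p. ?f (fst p))"
    and i3: "integrable ?NN (\<lambda>p. ?f (?X p) * ?f (fst p))"
    by (rule i, simp, simp add: indicator_def)+
  have e1: "(\<integral>p. ?f (?X p) \<partial>?NN) = (\<integral>x. ?f x \<partial>std_gaussian d)"
    by (rule integral_lc_std_gaussian2(1)[OF cs c(1)]) measurable
  have e2: "(\<integral>p. ?f (fst p) \<partial>?NN) = (\<integral>x. ?f x \<partial>std_gaussian d)"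
    by (rule integral_fst_std_gaussian2(1)) measurable
  have e3: "noise_form d (cos \<theta>) ?f ?f = (\<integral>p. ?f (?X p) * ?f (fst p) \<partial>?NN)"
    by (simp add: noise_form_def s)
  have "noise_sens d ?f \<theta> = (\<integral>p. (?f (?X p) + ?f (fst p)) - 2 * (?f (?X p) * ?f (fst p)) \<partial>?NN)"
    unfolding noise_sens_def by (intro Bochner_Integration.integral_cong refl) (auto simp: indicator_def)
  also have "\<dots> = ((\<integral>p. ?f (?X p) \<partial>?NN) + (\<integral>p. ?f (fst p) \<partial>?NN)) - 2 * (\<integral>p. ?f (?X p) * ?f (fst p) \<partial>?NN)"
    using i1 i2 i3 by (simp only: Bochner_Integration.integral_diff Bochner_Integration.integral_add Bochner_Integration.integrable_add integrable_mult_right integral_mult_right_zero)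
  finally have "noise_sens d ?f \<theta> = 2 * (\<integral>x. ?f x \<partial>std_gaussian d) - 2 * noise_form d (cos \<theta>) ?f ?f"
    unfolding e1 e2 e3 by simp
  moreover have "(\<lambda>x. (?f x)\<^sup>2) = ?f" by (auto simp: indicator_def)
  ultimately show ?thesis by simp
qed

text \<open>The factor \<open>1 - (cos \<theta>) ^ Suc k\<close> is at least 1/2, which cancels the
  half in the relation between noise form and sensitivity.\<close>

theorem indicator_poly_approx:
  assumes E[measurable]: "E \<in> sets (lborel_R d)" and fin: "gaussian_surface_area d E \<le> ennreal g" and g: "0 \<le> g"
    and \<theta>: "0 < \<theta>" "\<theta> \<le> 1" and k: "4 / \<theta>\<^sup>2 \<le> real k"
  shows "\<exists>p. poly_fun d k p \<and> (\<integral>x. (indicator E x - p x)\<^sup>2 \<partial>std_gaussian d) \<le> \<theta> * g"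
proof -
  let ?f = "indicator E :: _ \<Rightarrow> real"
  have "cos \<theta> > 0" using \<theta> pi_gt3 by (intro cos_gt_zero_pi) auto
  moreover have "cos \<theta> < 1"
    using cos_le_quadratic[of \<theta>] \<theta> by (intro le_less_trans[of "cos \<theta>" "1 - \<theta>\<^sup>2 / 3"]) auto
  moreover have "L2 (std_gaussian d) ?f"
    unfolding L2_def by (auto intro!: N.integrable_const_bound[of _ 1] simp: indicator_def)
  ultimately obtain p where p: "poly_fun d k p"
    "(1 - (cos \<theta>) ^ Suc k) * (\<integral>x. (?f x - p x)\<^sup>2 \<partial>std_gaussian d) \<le> (\<integral>x. (?f x)\<^sup>2 \<partial>std_gaussian d) - noise_form d (cos \<theta>) ?f ?f"
    using poly_fun_approx[of d ?f "cos \<theta>" k] by auto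
  have I: "0 \<le> (\<integral>x. (?f x - p x)\<^sup>2 \<partial>std_gaussian d)" by (rule Bochner_Integration.integral_nonneg) simp
  have fin': "gaussian_surface_area d E < \<infinity>" using fin by (auto intro: le_less_trans)
  have "1 / 2 * (\<integral>x. (?f x - p x)\<^sup>2 \<partial>std_gaussian d) \<le> (1 - (cos \<theta>) ^ Suc k) * (\<integral>x. (?f x - p x)\<^sup>2 \<partial>std_gaussian d)"
    using cos_power_le_half[OF \<theta> k] I by (intro mult_right_mono) auto
  also have "\<dots> \<le> noise_sens d ?f \<theta> / 2" using p(2) unfolding noise_form_indicator[OF E \<theta>] .
  also have "\<dots> \<le> \<theta> * enn2real (gaussian_surface_area d E) / 2"
    using noise_sens_le_surface_area[OF E fin' \<theta>] by simp
  also have "\<dots> \<le> \<theta> * g / 2"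
    using enn2real_mono[OF fin] g \<theta> by (intro divide_right_mono mult_left_mono) auto
  finally have "(\<integral>x. (?f x - p x)\<^sup>2 \<partial>std_gaussian d) \<le> \<theta> * g" by simp
  then show ?thesis using p(1) by blast
qed

lemma sets_gaussian [simp, measurable_cong]: "sets (gaussian d \<mu> \<Sigma>) = sets (lborel_R d)"
  by (simp add: gaussian_def)

lemma space_gaussian [simp]: "space (gaussian d \<mu> \<Sigma>) = R_space d"
  by (simp add: gaussian_def)

lemma prob_space_gaussian:
  assumes "full_rank_cov d \<Sigma>" "\<mu> \<in> R_space d"
  shows "prob_space (gaussian d \<mu> \<Sigma>)"
proof -
  obtain B A b q where T: "distr (gaussian d \<mu> \<Sigma>) (lborel_R d) (affine_map d B b) = std_gaussian d"
    by (rule gaussian_standardize[OF assms])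
  have m: "affine_map d B b \<in> measurable (gaussian d \<mu> \<Sigma>) (lborel_R d)"
    using measurable_affine_map by (simp add: gaussian_def)
  have "prob_space (distr (gaussian d \<mu> \<Sigma>) (lborel_R d) (affine_map d B b))"
    unfolding T by (rule N.prob_space_axioms)
  then have "emeasure (distr (gaussian d \<mu> \<Sigma>) (lborel_R d) (affine_map d B b)) (R_space d) = 1"
    using prob_space.emeasure_space_1 by fastforce
  then have "emeasure (gaussian d \<mu> \<Sigma>) (affine_map d B b -` R_space d \<inter> R_space d) = 1"
    using emeasure_distr[OF m, of "R_space d"] by simp
  moreover have "affine_map d B b -` R_space d \<inter> R_space d = R_space d" by auto
  ultimately show ?thesis by (intro prob_spaceI) simp
qed

lemma affine_image_eq_vimage:
  assumes S: "S \<subseteq> R_space d"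
    and AB: "\<And>x. x \<in> R_space d \<Longrightarrow> affine_map d A a (affine_map d B b x) = x"
    and BA: "\<And>y. y \<in> R_space d \<Longrightarrow> affine_map d B b (affine_map d A a y) = y"
  shows "affine_map d B b ` S = affine_map d A a -` S \<inter> R_space d"
proof (rule equalityI; rule subsetI)
  fix y assume "y \<in> affine_map d B b ` S"
  then obtain x where x: "x \<in> S" "y = affine_map d B b x" by blast
  then have "affine_map d A a y = x" using AB[of x] S by blast
  moreover have "y \<in> R_space d" unfolding x(2) by (rule affine_map_R_space)
  ultimately show "y \<in> affine_map d A a -` S \<inter> R_space d" using x(1) by blast
next
  fix y assume "y \<in> affine_map d A a -` S \<inter> R_space d"
  then have "affine_map d A a y \<in> S" "y = affine_map d B b (affine_map d A a y)" using BA[of y] by simp_all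
  then show "y \<in> affine_map d B b ` S" by blast
qed

text \<open>The threshold \<open>t\<close> avoids the countably many levels of \<open>p\<close> with positive mass, so that the
  threshold function depends continuously on the coefficients almost everywhere.\<close>
theorem ptf_approx:
  assumes \<Sigma>: "full_rank_cov d \<Sigma>" and \<mu>: "\<mu> \<in> R_space d" and S: "S \<in> sets (lborel_R d)"
    and stable: "\<And>A b. A \<in> carrier_mat d d \<Longrightarrow> b \<in> R_space d \<Longrightarrow> gaussian_surface_area d (affine_map d A b ` S) \<le> ennreal g"
    and g: "0 \<le> g" and \<theta>: "0 < \<theta>" "\<theta> \<le> 1" and k: "4 / \<theta>\<^sup>2 \<le> real k"
  shows "\<exists>p. poly_fun d k p \<and> (AE x in lborel_R d. p x \<noteq> 0) \<and>
    measure (gaussian d \<mu> \<Sigma>) {x \<in> R_space d. (x \<in> S) \<noteq> (p x > 0)} \<le> 9 * (\<theta> * g)"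
proof -
  let ?G = "gaussian d \<mu> \<Sigma>"
  obtain B A b q where T: "B \<in> carrier_mat d d" "A \<in> carrier_mat d d" "b \<in> R_space d"
    "\<And>x. x \<in> R_space d \<Longrightarrow> affine_map d A \<mu> (affine_map d B b x) = x"
    "\<And>y. y \<in> R_space d \<Longrightarrow> affine_map d B b (affine_map d A \<mu> y) = y"
    "distr ?G (lborel_R d) (affine_map d B b) = std_gaussian d"
    "poly_fun d 2 q" "\<And>x. gaussian_density d \<mu> \<Sigma> x = exp (q x)"
    by (fact gaussian_standardize[OF \<Sigma> \<mu>])
  interpret G: prob_space ?G by (rule prob_space_gaussian[OF \<Sigma> \<mu>])
  let ?T = "affine_map d B b"
  have Tm: "?T \<in> measurable ?G (lborel_R d)" using measurable_affine_map[of d B b] by (simp add: gaussian_def)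
  define E where "E = ?T ` S"
  have Ssp: "S \<subseteq> R_space d" using sets.sets_into_space[OF S] .
  have Emem: "?T x \<in> E \<longleftrightarrow> x \<in> S" if "x \<in> R_space d" for x
  proof
    assume "?T x \<in> E"
    then obtain y where y: "y \<in> S" "?T x = ?T y" unfolding E_def by blast
    then have "y = x" using T(4)[OF that] T(4)[of y] Ssp by auto
    then show "x \<in> S" using y(1) by simp
  qed (auto simp: E_def)
  have E: "E \<in> sets (lborel_R d)"
  proof -
    have "E = affine_map d A \<mu> -` S \<inter> R_space d"
      unfolding E_def by (rule affine_image_eq_vimage[OF Ssp T(4,5)])
    then show ?thesis using measurable_sets[OF measurable_affine_map[of d A \<mu>] S] by (simp only:)
  qed
  obtain p where p: "poly_fun d k p" "(\<integral>x. (indicator E x - p x)\<^sup>2 \<partial>std_gaussian d) \<le> \<theta> * g"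
    using indicator_poly_approx[OF E _ g \<theta> k] stable[OF T(1,3)] unfolding E_def by blast
  define p1 where "p1 = (\<lambda>x. p (?T x))"
  have p1: "poly_fun d k p1" unfolding p1_def by (rule poly_fun_affine_map[OF p(1)])
  have p1m: "p1 \<in> borel_measurable (lborel_R d)" using p1 by auto
  have p1G: "p1 \<in> borel_measurable ?G" using p1m by (simp add: gaussian_def)
  have pm: "p \<in> borel_measurable (lborel_R d)" using p(1) by auto
  have dm: "(\<lambda>y. (indicator E y - p y)\<^sup>2) \<in> borel_measurable (lborel_R d)" using pm E by simp
  have int_eq: "(\<integral>x. (indicator S x - p1 x)\<^sup>2 \<partial>?G) = (\<integral>x. (indicator E x - p x)\<^sup>2 \<partial>std_gaussian d)"
  proof -
    have "(\<integral>y. (indicator E y - p y)\<^sup>2 \<partial>distr ?G (lborel_R d) ?T) = (\<integral>x. (indicator E (?T x) - p (?T x))\<^sup>2 \<partial>?G)"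
      by (rule integral_distr[OF Tm dm])
    also have "\<dots> = (\<integral>x. (indicator S x - p1 x)\<^sup>2 \<partial>?G)"
      by (intro Bochner_Integration.integral_cong refl) (simp add: p1_def Emem indicator_def)
    finally show ?thesis by (simp add: T(6))
  qed
  have int: "integrable ?G (\<lambda>x. (indicator S x - p1 x)\<^sup>2)"
  proof -
    have "L2 (std_gaussian d) (\<lambda>y. indicator E y - p y)"
      by (intro L2_diff poly_fun_L2[OF p(1)]) (use E in \<open>auto simp: L2_def indicator_def intro!: N.integrable_const_bound[of _ 1]\<close>)
    then have "integrable (distr ?G (lborel_R d) ?T) (\<lambda>y. (indicator E y - p y)\<^sup>2)" by (simp add: L2_def T(6))
    then have "integrable ?G (\<lambda>x. (indicator E (?T x) - p (?T x))\<^sup>2)"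
      using integrable_distr_eq[OF Tm dm] by simp
    also have "?this \<longleftrightarrow> ?thesis"
      by (intro Bochner_Integration.integrable_cong refl) (simp add: p1_def Emem indicator_def)
    finally show ?thesis .
  qed
  interpret D: prob_space "distr ?G borel p1" by (rule G.prob_space_distr[OF p1G])
  \<comment> \<open>A threshold in the middle third gives every misclassified point an error of at
    least 1/3; Markov's inequality for the square then yields the factor 9.\<close>
  have "\<exists>t\<in>{1/3<..<2/3}. t \<notin> {x. measure (distr ?G borel p1) {x} \<noteq> 0}"
    by (rule real_interval_avoid_countable_set) (auto intro: D.countable_support)
  then obtain t where t: "1/3 < t" "t < 2/3" "measure (distr ?G borel p1) {t} = 0" by auto
  define p2 where "p2 = (\<lambda>x. p1 x - t)"
  have p2: "poly_fun d k p2" unfolding p2_def by (intro poly_fun_diff p1 poly_fun_const)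
  have "measure ?G (p1 -` {t} \<inter> space ?G) = 0"
    using t(3) measure_distr[OF p1G, of "{t}"] by simp
  then have "emeasure ?G (p1 -` {t} \<inter> space ?G) = 0" unfolding G.emeasure_eq_measure by simp
  then have "p1 -` {t} \<inter> space ?G \<in> null_sets ?G"
    by (rule null_setsI) (rule measurable_sets[OF p1G], simp)
  then have "AE x in ?G. x \<notin> p1 -` {t} \<inter> space ?G" by (rule AE_not_in)
  moreover have qm: "(\<lambda>x. ennreal (gaussian_density d \<mu> \<Sigma> x)) \<in> borel_measurable (lborel_R d)"
  proof -
    have "q \<in> borel_measurable (lborel_R d)" using T(7) by (rule measurable_poly_fun)
    then have "(\<lambda>x. ennreal (exp (q x))) \<in> borel_measurable (lborel_R d)" by measurable
    then show ?thesis by (simp only: T(8))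
  qed
  \<comment> \<open>The Gaussian density is positive everywhere, so a Gaussian null set is a
    Lebesgue null set.\<close>
  ultimately have "AE x in lborel_R d. 0 < ennreal (gaussian_density d \<mu> \<Sigma> x) \<longrightarrow> x \<notin> p1 -` {t} \<inter> space ?G"
    unfolding gaussian_def AE_density[OF qm] by blast
  then have ae: "AE x in lborel_R d. p2 x \<noteq> 0"
  proof (rule AE_mp, intro AE_I2 impI)
    fix x assume x: "x \<in> R_space d" "0 < ennreal (gaussian_density d \<mu> \<Sigma> x) \<longrightarrow> x \<notin> p1 -` {t} \<inter> space ?G"
    have "0 < ennreal (gaussian_density d \<mu> \<Sigma> x)" unfolding T(8) by simp
    then show "p2 x \<noteq> 0" using x by (simp add: p2_def)
  qed
  have "measure ?G {x \<in> R_space d. (x \<in> S) \<noteq> (p2 x > 0)} \<le> measure ?G {x \<in> space ?G. (indicator S x - p1 x)\<^sup>2 \<ge> 1 / 9}"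
  proof (rule G.finite_measure_mono)
    show "{x \<in> R_space d. (x \<in> S) \<noteq> (p2 x > 0)} \<subseteq> {x \<in> space ?G. (indicator S x - p1 x)\<^sup>2 \<ge> 1 / 9}"
    proof
      fix x assume x: "x \<in> {x \<in> R_space d. (x \<in> S) \<noteq> (p2 x > 0)}"
      then have "1 / 3 \<le> \<bar>indicator S x - p1 x\<bar>"
        using t by (cases "x \<in> S") (auto simp: p2_def)
      then have "(1 / 3)\<^sup>2 \<le> (indicator S x - p1 x)\<^sup>2" using power_mono[of "1/3" "\<bar>indicator S x - p1 x\<bar>" 2] by simp
      then show "x \<in> {x \<in> space ?G. (indicator S x - p1 x)\<^sup>2 \<ge> 1 / 9}" using x by (simp add: power2_eq_square)
    qed
    show "{x \<in> space ?G. (indicator S x - p1 x)\<^sup>2 \<ge> 1 / 9} \<in> sets ?G"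
      using int by measurable
  qed
  also have "\<dots> \<le> (\<integral>x. (indicator S x - p1 x)\<^sup>2 \<partial>?G) / (1 / 9)"
    by (rule integral_Markov_inequality_measure[OF int sets.empty_sets]) auto
  also have "\<dots> \<le> 9 * (\<theta> * g)" using p(2) int_eq by simp
  finally show ?thesis using p2 ae by blast
qed

text \<open>Whitening followed by the projection that kills the last coordinate is a single singular
  affine map. Stability bounds the surface area of its image by \<open>g\<close>, while the
  projection makes it at least a third of the mass.\<close>

lemma surface_area_lower_bound:
  assumes d: "d \<ge> 1" and \<Sigma>: "full_rank_cov d \<Sigma>" and \<mu>: "\<mu> \<in> R_space d" and S: "S \<in> sets (lborel_R d)"
    and stable: "\<And>A b. A \<in> carrier_mat d d \<Longrightarrow> b \<in> R_space d \<Longrightarrow> gaussian_surface_area d (affine_map d A b ` S) \<le> ennreal g"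
    and g: "0 \<le> g"
  shows "measure (gaussian d \<mu> \<Sigma>) S / 3 \<le> g"
proof -
  let ?G = "gaussian d \<mu> \<Sigma>"
  obtain l where l: "d = Suc l" using d by (cases d) auto
  obtain B A b q where T: "B \<in> carrier_mat d d" "A \<in> carrier_mat d d" "b \<in> R_space d"
    "\<And>x. x \<in> R_space d \<Longrightarrow> affine_map d A \<mu> (affine_map d B b x) = x"
    "\<And>y. y \<in> R_space d \<Longrightarrow> affine_map d B b (affine_map d A \<mu> y) = y"
    "distr ?G (lborel_R d) (affine_map d B b) = std_gaussian d"
    "poly_fun d 2 q" "\<And>x. gaussian_density d \<mu> \<Sigma> x = exp (q x)"
    by (fact gaussian_standardize[OF \<Sigma> \<mu>])
  let ?T = "affine_map d B b"
  have Tm: "?T \<in> measurable ?G (lborel_R d)" using measurable_affine_map[of d B b] by (simp add: gaussian_def)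
  define E where "E = affine_map d A \<mu> -` S \<inter> R_space d"
  have E: "E \<in> sets (lborel_R d)" unfolding E_def by (rule measurable_sets[OF measurable_affine_map S])
  have Ssp: "S \<subseteq> R_space d" using sets.sets_into_space[OF S] .
  have TS: "?T ` S = E" unfolding E_def by (rule affine_image_eq_vimage[OF Ssp T(4,5)])
  have "measure (std_gaussian d) E = measure ?G (?T -` E \<inter> R_space d)"
    using measure_distr[OF Tm E] by (simp add: T(6))
  also have "?T -` E \<inter> R_space d = S"
  proof (rule equalityI; rule subsetI)
    fix x assume x: "x \<in> ?T -` E \<inter> R_space d"
    then have "affine_map d A \<mu> (?T x) \<in> S" by (simp add: E_def)
    then show "x \<in> S" using T(4)[of x] x by simp
  next
    fix x assume x: "x \<in> S"
    then have xR: "x \<in> R_space d" using Ssp by blast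
    show "x \<in> ?T -` E \<inter> R_space d"
      using x xR affine_map_R_space unfolding E_def by (simp only: vimage_eq Int_iff T(4)[OF xR])
  qed
  finally have m: "measure (std_gaussian d) E = measure ?G S" .
  define B' where "B' = mat d d (\<lambda>(i, j). if i = l then 0 else B $$ (i, j))"
  define b' where "b' = b(l := 0)"
  have b': "b' \<in> R_space d" using T(3) by (auto simp: b'_def space_lborel_R l extensional_def)
  have proj: "affine_map d B' b' x = (?T x)(l := 0)" for x
    by (rule ext) (auto simp: affine_map_def B'_def b'_def l)
  have "ennreal (measure (std_gaussian d) E / 3) \<le> gaussian_surface_area d ((\<lambda>y. y(l := 0)) ` E)"
    using surface_area_projection_ge[of E l] E by (simp add: l)
  also have "(\<lambda>y. y(l := 0)) ` E = affine_map d B' b' ` S"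
    unfolding TS[symmetric] image_image proj ..
  also have "gaussian_surface_area d (affine_map d B' b' ` S) \<le> ennreal g"
    by (rule stable) (auto simp: B'_def b')
  finally show ?thesis using g m by simp
qed

text \<open>Every factor becomes a power of \<open>m = max d 2\<close>; the maximum keeps the base
  at least 2 when \<open>d = 1\<close>. The exponent \<open>56 + 8 * real k + 9 * x\<close> fits
  under \<open>9000000 * x\<close> because \<open>1 \<le> 9 * x\<close> and
  \<open>8 * 1036800 = 8294400\<close>.\<close>

lemma sample_size_bound:
  fixes R \<epsilon> :: real and d n k :: nat
  assumes R: "1 / 3 \<le> R" and \<epsilon>: "0 < \<epsilon>" "\<epsilon> < 1" and k: "real k \<le> 1036800 * R\<^sup>2 / \<epsilon>\<^sup>2"
    and n: "real (max d 2) powr (9000000 * R\<^sup>2 / \<epsilon> ^ 4) \<le> real n"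
  shows "(10800 * real ((d + 1) ^ k) / \<epsilon>) ^ 4 \<le> real n"
proof -
  define m where "m = real (max d 2)"
  define x where "x = R\<^sup>2 / \<epsilon> ^ 4"
  have m2: "2 \<le> m" by (simp add: m_def)
  have e41: "0 < \<epsilon> ^ 4" "\<epsilon> ^ 4 \<le> 1" using \<epsilon> by (auto intro: power_le_one)
  have "(1 / 3)\<^sup>2 \<le> R\<^sup>2" using R by (intro power_mono) auto
  then have R2: "1 \<le> 9 * R\<^sup>2" by (simp add: power2_eq_square)
  have inv: "1 / \<epsilon> ^ 4 \<le> 9 * x"
    using divide_right_mono[OF R2, of "\<epsilon> ^ 4"] e41 by (simp add: x_def)
  have "1 \<le> 1 / \<epsilon> ^ 4" using e41 by simp
  then have x1: "1 \<le> 9 * x" using inv by simp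
  have "R\<^sup>2 / \<epsilon>\<^sup>2 \<le> x"
  proof -
    have "\<epsilon> ^ 4 \<le> \<epsilon>\<^sup>2" using \<epsilon> by (intro power_decreasing) auto
    then show ?thesis unfolding x_def using \<epsilon> by (intro divide_left_mono) auto
  qed
  then have kx: "real k \<le> 1036800 * x" using k by simp
  have "d + 1 \<le> (max d 2)\<^sup>2"
  proof (cases "d \<le> 2")
    case False
    then have "d + 1 \<le> 2 * d" "2 * d \<le> d * d" by auto
    then have "d + 1 \<le> d * d" by linarith
    then show ?thesis using False by (simp add: power2_eq_square max_def)
  qed auto
  then have "real (d + 1) \<le> real ((max d 2)\<^sup>2)" by (simp only: of_nat_le_iff)
  then have dm: "real (d + 1) \<le> m\<^sup>2" by (simp only: m_def of_nat_power)
  have "real ((d + 1) ^ k) = real (d + 1) ^ k" by (rule of_nat_power)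
  also have "\<dots> \<le> (m\<^sup>2) ^ k" using dm by (intro power_mono) auto
  also have "\<dots> = m powr real (2 * k)" unfolding power_mult[symmetric] using m2 by (intro powr_realpow[symmetric]) simp
  also have "real (2 * k) = 2 * real k" by simp
  finally have D: "real ((d + 1) ^ k) \<le> m powr (2 * real k)" .
  have "real ((d + 1) ^ k) ^ 4 \<le> (m powr (2 * real k)) ^ 4" using D by (intro power_mono) auto
  also have "\<dots> = m powr (8 * real k)" using m2 by (simp add: powr_power)
  finally have D4: "real ((d + 1) ^ k) ^ 4 \<le> m powr (8 * real k)" .
  have c: "(10800::real) ^ 4 \<le> m powr 56"
  proof -
    have "(10800::real) ^ 4 \<le> 2 ^ 56" by simp
    also have "\<dots> \<le> m ^ 56" using m2 by (intro power_mono) auto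
    also have "\<dots> = m powr real 56" using m2 by (intro powr_realpow[symmetric]) simp
    finally show ?thesis by simp
  qed
  have ie: "1 / \<epsilon> ^ 4 \<le> m powr (9 * x)"
  proof -
    have "1 / \<epsilon> ^ 4 \<le> 9 * x" by (rule inv)
    \<comment> \<open>The second-order Taylor bound already beats the argument although the rate is
      only \<open>ln 2\<close>: with \<open>ln 2 \<ge> 1/2\<close> it comes down to a completed
      square.\<close>
    also have "\<dots> \<le> 1 + 9 * x * ln 2 + (9 * x * ln 2)\<^sup>2 / 2"
    proof -
      have l: "(1::real) / 2 \<le> ln 2" using ln2_ge_two_thirds by simp
      have "(9 * x * (1 / 2))\<^sup>2 \<le> (9 * x * ln 2)\<^sup>2" using l x1 by (intro power_mono mult_left_mono) auto
      moreover have "9 * x * (1 / 2) \<le> 9 * x * ln 2" using l x1 by (intro mult_left_mono) auto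
      moreover have "9 * x \<le> 1 + 9 * x * (1 / 2) + (9 * x * (1 / 2))\<^sup>2 / 2"
      proof -
        have "0 \<le> (9 * x / 2 - 1)\<^sup>2" by simp
        then show ?thesis by (simp add: power2_eq_square algebra_simps)
      qed
      ultimately show ?thesis by linarith
    qed
    also have "\<dots> \<le> exp (9 * x * ln 2)" using x1 by (intro exp_lower_Taylor_quadratic) auto
    also have "\<dots> = 2 powr (9 * x)" by (simp add: powr_def)
    also have "\<dots> \<le> m powr (9 * x)" using m2 x1 by (intro powr_mono2) auto
    finally show ?thesis .
  qed
  have "(10800 * real ((d + 1) ^ k) / \<epsilon>) ^ 4 = 10800 ^ 4 * real ((d + 1) ^ k) ^ 4 * (1 / \<epsilon> ^ 4)"
    by (simp only: power_divide power_mult_distrib) simp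
  also have "\<dots> \<le> m powr 56 * m powr (8 * real k) * m powr (9 * x)"
    using c D4 ie e41 by (intro mult_mono) auto
  also have "\<dots> = m powr (56 + 8 * real k + 9 * x)" by (simp add: powr_add)
  also have "\<dots> \<le> m powr (9000000 * x)" using m2 kx x1 by (intro powr_mono) auto
  also have "\<dots> \<le> real n" using n by (simp add: m_def x_def)
  finally show ?thesis .
qed

text \<open>The logarithm of \<open>n\<close> is measured against the fourth root \<open>s\<close>
  of \<open>n\<close>: the numerator is at most \<open>15 * (real D * s)\<close> and the denominator
  contains \<open>s * s\<close>. What remains is \<open>60 * real D / (s * \<epsilon>)\<close>, at
  most 1/180 since \<open>10800 * real D \<le> s * \<epsilon>\<close>.\<close>

lemma deviation_bound:
  fixes \<epsilon> :: real and n D :: nat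
  assumes \<epsilon>: "0 < \<epsilon>" "\<epsilon> < 1" and D: "1 \<le> D" and n: "(10800 * real D / \<epsilon>) ^ 4 \<le> real n"
  shows "(ln (2 * real (((2 * n + 1) ^ D) ^ 3)) + 3 / 2) / sqrt n / (\<epsilon> / 4) \<le> 1 / 100"
proof -
  define s where "s = root 4 (real n)"
  have s0: "0 \<le> s" by (simp add: s_def)
  have s4: "s ^ 4 = real n" by (simp add: s_def)
  have "(10800 * real D / \<epsilon>) ^ 4 \<le> s ^ 4" using n s4 by simp
  then have s: "10800 * real D / \<epsilon> \<le> s" using s0 by (rule power_le_imp_le_base[where n = 3, simplified])
  have e: "10800 * real D \<le> s * \<epsilon>" using s \<epsilon> by (simp add: pos_divide_le_eq)
  have "10800 * real D \<le> s"
    using e mult_left_mono[of \<epsilon> 1 s] \<epsilon> s0 by simp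
  then have s1: "1 \<le> s" using D by simp
  have sq: "sqrt (real n) = s * s"
    using s0 s4 by (intro real_sqrt_unique) (auto simp: power2_eq_square power4_eq_xxxx)
  have n1: "1 \<le> n"
  proof -
    have "1 \<le> s ^ 4" using s1 by simp
    then show ?thesis using s4 by simp
  qed
  have "ln (real (2 * n + 1)) \<le> ln (3 * s ^ 4)" using n1 s4 by (intro ln_mono) auto
  also have "\<dots> = ln 3 + 4 * ln s" using s1 by (simp add: ln_mult ln_realpow)
  also have "\<dots> \<le> 2 + 4 * (s - 1)" using ln_le_minus_one[of 3] ln_le_minus_one[of s] s1 by simp
  also have "\<dots> \<le> 4 * s" by simp
  finally have l: "ln (real (2 * n + 1)) \<le> 4 * s" .
  have "ln (2 * real (((2 * n + 1) ^ D) ^ 3)) = ln 2 + real (D * 3) * ln (real (2 * n + 1))"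
    by (simp only: power_mult[symmetric] of_nat_power) (simp add: ln_mult ln_realpow)
  also have "\<dots> \<le> 1 + real (D * 3) * (4 * s)"
    using l ln_le_minus_one[of 2] by (intro add_mono mult_left_mono) auto
  finally have "ln (2 * real (((2 * n + 1) ^ D) ^ 3)) + 3 / 2 \<le> 12 * (real D * s) + 5 / 2" by simp
  also have "\<dots> \<le> 15 * (real D * s)"
  proof -
    have "1 \<le> real D * s" using mult_mono[of 1 "real D" 1 s] D s1 by simp
    then show ?thesis by linarith
  qed
  finally have num: "ln (2 * real (((2 * n + 1) ^ D) ^ 3)) + 3 / 2 \<le> 15 * (real D * s)" .
  have "(ln (2 * real (((2 * n + 1) ^ D) ^ 3)) + 3 / 2) / sqrt n / (\<epsilon> / 4) \<le> 15 * (real D * s) / (s * s) / (\<epsilon> / 4)"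
    unfolding sq using num s1 \<epsilon> by (intro divide_right_mono) auto
  also have "\<dots> = 60 * real D / (s * \<epsilon>)" using s1 \<epsilon> by (simp add: field_simps)
  also have "\<dots> \<le> 1 / 100"
  proof -
    have "0 < s * \<epsilon>" using s1 \<epsilon> by simp
    then show ?thesis using e by (simp add: pos_divide_le_eq)
  qed
  finally show ?thesis .
qed

text \<open>Replacing the set alters the numerator and the normalisation, each at a cost of
  \<open>\<eta> / \<alpha>\<close>; hence the 2. The bound \<open>\<eta> \<le> \<alpha> / 2\<close>
  keeps the new set from being null.\<close>

lemma (in prob_space) uniform_measure_close:
  assumes S: "S \<in> events" and S': "S' \<in> events" and \<alpha>: "0 < \<alpha>" "\<alpha> \<le> prob S"
    and \<eta>: "prob {x \<in> space M. (x \<in> S) \<noteq> (x \<in> S')} \<le> \<eta>" "\<eta> \<le> \<alpha> / 2"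
  shows "0 < prob S'"
    and "B \<in> events \<Longrightarrow> \<bar>measure (uniform_measure M S) B - measure (uniform_measure M S') B\<bar> \<le> 2 * \<eta> / \<alpha>"
proof -
  define D where "D = {x \<in> space M. (x \<in> S) \<noteq> (x \<in> S')}"
  have D: "D \<in> events" unfolding D_def using S S' by measurable
  have sub: "S \<subseteq> space M" "S' \<subseteq> space M" using S S' by (auto dest: sets.sets_into_space)
  have close: "\<bar>prob (S \<inter> B) - prob (S' \<inter> B)\<bar> \<le> \<eta>" if B: "B \<in> events" for B
  proof -
    have "prob (S \<inter> B) \<le> prob ((S' \<inter> B) \<union> D)"
      using S S' B D sub by (intro finite_measure_mono) (auto simp: D_def)
    also have "\<dots> \<le> prob (S' \<inter> B) + prob D" using S' B D by (intro measure_Un_le) auto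
    finally have 1: "prob (S \<inter> B) \<le> prob (S' \<inter> B) + prob D" .
    have "prob (S' \<inter> B) \<le> prob ((S \<inter> B) \<union> D)"
      using S S' B D sub by (intro finite_measure_mono) (auto simp: D_def)
    also have "\<dots> \<le> prob (S \<inter> B) + prob D" using S B D by (intro measure_Un_le) auto
    finally show ?thesis using 1 \<eta>(1) unfolding D_def by linarith
  qed
  have "S \<inter> space M = S" "S' \<inter> space M = S'" using sub by auto
  then have cl: "\<bar>prob S - prob S'\<bar> \<le> \<eta>" using close[OF sets.top] by simp
  show pos: "0 < prob S'" using cl \<alpha> \<eta>(2) by linarith
  have \<eta>0: "0 \<le> \<eta>" using order_trans[OF measure_nonneg \<eta>(1)] .
  assume B: "B \<in> events"
  let ?s = "prob S" and ?s' = "prob S'" and ?a = "prob (S \<inter> B)" and ?a' = "prob (S' \<inter> B)"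
  have s: "0 < ?s" using \<alpha> by simp
  have u: "measure (uniform_measure M S) B = ?a / ?s" "measure (uniform_measure M S') B = ?a' / ?s'"
    using s pos S S' B by (auto intro!: measure_uniform_measure simp: emeasure_eq_measure)
  have a': "?a' \<le> ?s'" using S' B by (intro finite_measure_mono) auto
  have "?a / ?s - ?a' / ?s' = (?a - ?a') / ?s + (?a' / ?s') * ((?s' - ?s) / ?s)"
    using s pos by (simp add: field_simps)
  moreover have "\<bar>(?a - ?a') / ?s\<bar> \<le> \<eta> / \<alpha>"
    unfolding abs_divide using close[OF B] s \<alpha> \<eta>0 by (intro frac_le) auto
  moreover have "\<bar>(?a' / ?s') * ((?s' - ?s) / ?s)\<bar> \<le> 1 * (\<eta> / \<alpha>)"
    unfolding abs_mult
  proof (intro mult_mono)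
    show "\<bar>?a' / ?s'\<bar> \<le> 1" using a' pos by (simp add: divide_le_eq_1)
    show "\<bar>(?s' - ?s) / ?s\<bar> \<le> \<eta> / \<alpha>"
      unfolding abs_divide using cl s \<alpha> \<eta>0 by (intro frac_le) auto
  qed auto
  ultimately have "\<bar>?a / ?s - ?a' / ?s'\<bar> \<le> \<eta> / \<alpha> + \<eta> / \<alpha>" by linarith
  then show "\<bar>measure (uniform_measure M S) B - measure (uniform_measure M S') B\<bar> \<le> 2 * \<eta> / \<alpha>"
    unfolding u by simp
qed

section \<open>Learning truncated Gaussians\<close>

text \<open>The mass of the positivity set enters as \<open>- ln m\<close> in the exponent, which
  stays a polynomial; \<open>2 \<le> k\<close> makes room for the quadratic log density.\<close>

lemma truncated_gaussian_eq_density_measure: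
  assumes \<Sigma>: "full_rank_cov d \<Sigma>" and \<mu>: "\<mu> \<in> R_space d" and k: "2 \<le> k" and p: "poly_fun d k p"
    and pos: "0 < measure (gaussian d \<mu> \<Sigma>) {x \<in> R_space d. p x > 0}"
  shows "\<exists>c. coeff_poly d k (snd c) = p \<and>
    truncated_gaussian d \<mu> \<Sigma> {x \<in> R_space d. p x > 0} = density_measure d (coeff_density d k c)"
proof -
  let ?G = "gaussian d \<mu> \<Sigma>" and ?S = "{x \<in> R_space d. p x > 0}" and ?L = "lborel_R d"
  interpret G: prob_space ?G by (rule prob_space_gaussian[OF \<Sigma> \<mu>])
  obtain B A b q where T: "B \<in> carrier_mat d d" "A \<in> carrier_mat d d" "b \<in> R_space d"
    "\<And>x. x \<in> R_space d \<Longrightarrow> affine_map d A \<mu> (affine_map d B b x) = x"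
    "\<And>y. y \<in> R_space d \<Longrightarrow> affine_map d B b (affine_map d A \<mu> y) = y"
    "distr ?G (lborel_R d) (affine_map d B b) = std_gaussian d"
    "poly_fun d 2 q" "\<And>x. gaussian_density d \<mu> \<Sigma> x = exp (q x)"
    by (fact gaussian_standardize[OF \<Sigma> \<mu>])
  define m where "m = measure ?G ?S"
  have m: "0 < m" using pos by (simp only: m_def)
  have em: "emeasure ?G ?S = ennreal m" by (simp only: m_def G.emeasure_eq_measure)
  define q' where "q' = (\<lambda>x. q x - ln m)"
  have q': "poly_fun d k q'"
    unfolding q'_def using poly_fun_mono[OF T(7) k] by (intro poly_fun_diff poly_fun_const)
  obtain c1 where c1: "q' = coeff_poly d k c1"
    using q' unfolding poly_fun_span coeff_poly_def[abs_def] by blast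
  obtain c2 where c2: "p = coeff_poly d k c2"
    using p unfolding poly_fun_span coeff_poly_def[abs_def] by blast
  have pm: "p \<in> borel_measurable ?L" by (rule measurable_poly_fun[OF p])
  have qm: "q \<in> borel_measurable ?L" by (rule measurable_poly_fun[OF T(7)])
  have S: "?S \<in> sets ?L" using pm by measurable
  have dens: "(\<lambda>x. ennreal (exp (q x))) \<in> borel_measurable ?L" using qm by measurable
  have ind: "(\<lambda>x. indicator ?S x / ennreal m) \<in> borel_measurable ?L" using S by measurable
  have "truncated_gaussian d \<mu> \<Sigma> ?S = density (density ?L (\<lambda>x. ennreal (exp (q x)))) (\<lambda>x. indicator ?S x / ennreal m)"
    unfolding truncated_gaussian_def uniform_measure_def em by (simp only: gaussian_def T(8))
  also have "\<dots> = density ?L (\<lambda>x. ennreal (exp (q x)) * (indicator ?S x / ennreal m))"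
    by (rule density_density_eq[OF dens ind])
  also have "\<dots> = density ?L (\<lambda>x. ennreal (ptf_density q' p x))"
  proof (rule density_cong)
    show "(\<lambda>x. ennreal (exp (q x)) * (indicator ?S x / ennreal m)) \<in> borel_measurable ?L"
      using dens ind by (rule borel_measurable_times_ennreal)
    show "(\<lambda>x. ennreal (ptf_density q' p x)) \<in> borel_measurable ?L"
      using measurable_ptf_density[OF q' p] by simp
    show "AE x in ?L. ennreal (exp (q x)) * (indicator ?S x / ennreal m) = ennreal (ptf_density q' p x)"
    proof (rule AE_I2)
      fix x assume x: "x \<in> space ?L"
      have "ennreal (exp (q x)) / ennreal m = ennreal (exp (q' x))"
        using m by (simp add: divide_ennreal q'_def exp_diff)
      then show "ennreal (exp (q x)) * (indicator ?S x / ennreal m) = ennreal (ptf_density q' p x)"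
        using x by (cases "p x > 0") (simp_all add: ptf_density_def ennreal_times_divide)
    qed
  qed
  finally show ?thesis
    by (intro exI[of _ "(c1, c2)"]) (simp add: density_measure_def coeff_density_def c1[symmetric] c2[symmetric])
qed

lemma tv_dist_leI:
  assumes "\<And>B. B \<in> sets M \<Longrightarrow> \<bar>measure M B - measure N B\<bar> \<le> r"
  shows "tv_dist M N \<le> r"
  unfolding tv_dist_def using sets.empty_sets[of M] assms by (intro cSUP_least) blast+

lemma prob_space_truncated_gaussian:
  assumes "full_rank_cov d \<Sigma>" "\<mu> \<in> R_space d" "0 < measure (gaussian d \<mu> \<Sigma>) S"
  shows "prob_space (truncated_gaussian d \<mu> \<Sigma> S)"
proof -
  interpret prob_space "gaussian d \<mu> \<Sigma>" by (rule prob_space_gaussian[OF assms(1,2)])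
  show ?thesis unfolding truncated_gaussian_def
    using assms(3) by (intro prob_space_uniform_measure) (auto simp: emeasure_eq_measure)
qed

lemma sets_truncated_gaussian [simp]: "sets (truncated_gaussian d \<mu> \<Sigma> S) = sets (lborel_R d)"
  by (simp add: truncated_gaussian_def)

text \<open>Positive mass is demanded so that conditioning on the set yields a probability
  measure.\<close>

definition admissible :: "nat \<Rightarrow> (nat \<Rightarrow> real) \<times> real mat \<times> (nat \<Rightarrow> real) set \<Rightarrow> bool" where
  "admissible d y = (case y of (\<mu>, \<Sigma>, S) \<Rightarrow>
     \<mu> \<in> R_space d \<and> full_rank_cov d \<Sigma> \<and> S \<in> sets (lborel_R d) \<and> measure (gaussian d \<mu> \<Sigma>) S > 0)"

definition truncated :: "nat \<Rightarrow> (nat \<Rightarrow> real) \<times> real mat \<times> (nat \<Rightarrow> real) set \<Rightarrow> (nat \<Rightarrow> real) measure" where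
  "truncated d y = (case y of (\<mu>, \<Sigma>, S) \<Rightarrow> truncated_gaussian d \<mu> \<Sigma> S)"

lemma prob_space_truncated: "admissible d y \<Longrightarrow> prob_space (truncated d y)"
  by (auto simp: admissible_def truncated_def split: prod.splits intro: prob_space_truncated_gaussian)

text \<open>Mean and covariance stay and only the set is replaced; a disagreement of mass
  \<open>9 * (\<theta> * g)\<close> doubles under conditioning, which gives 18.\<close>

lemma truncated_gaussian_approx:
  assumes \<Sigma>: "full_rank_cov d \<Sigma>" and \<mu>: "\<mu> \<in> R_space d" and S: "S \<in> sets (lborel_R d)"
    and stable: "\<And>A b. A \<in> carrier_mat d d \<Longrightarrow> b \<in> R_space d \<Longrightarrow> gaussian_surface_area d (affine_map d A b ` S) \<le> ennreal g"
    and g: "0 \<le> g" and \<theta>: "0 < \<theta>" "\<theta> \<le> 1" and k: "4 / \<theta>\<^sup>2 \<le> real k" "2 \<le> k"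
    and \<alpha>: "0 < \<alpha>" "\<alpha> \<le> measure (gaussian d \<mu> \<Sigma>) S" and small: "9 * (\<theta> * g) \<le> \<alpha> / 2"
  shows "\<exists>y c. admissible d y \<and> truncated d y = density_measure d (coeff_density d k c) \<and>
    (AE x in lborel_R d. coeff_poly d k (snd c) x \<noteq> 0) \<and>
    (\<forall>B\<in>sets (lborel_R d). \<bar>measure (truncated_gaussian d \<mu> \<Sigma> S) B -
      measure (density_measure d (coeff_density d k c)) B\<bar> \<le> 18 * (\<theta> * g) / \<alpha>)"
proof -
  interpret G: prob_space "gaussian d \<mu> \<Sigma>" by (rule prob_space_gaussian[OF \<Sigma> \<mu>])
  obtain p where p: "poly_fun d k p" "AE x in lborel_R d. p x \<noteq> 0"
    "measure (gaussian d \<mu> \<Sigma>) {x \<in> R_space d. (x \<in> S) \<noteq> (p x > 0)} \<le> 9 * (\<theta> * g)"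
    using ptf_approx[OF \<Sigma> \<mu> S stable g \<theta> k(1)] by blast
  define S' where "S' = {x \<in> R_space d. p x > 0}"
  have pm: "p \<in> borel_measurable (lborel_R d)" by (rule measurable_poly_fun[OF p(1)])
  have S': "S' \<in> sets (lborel_R d)" unfolding S'_def using pm by measurable
  have "{x \<in> space (gaussian d \<mu> \<Sigma>). (x \<in> S) \<noteq> (x \<in> S')} = {x \<in> R_space d. (x \<in> S) \<noteq> (p x > 0)}"
    by (rule Collect_cong) (simp only: S'_def space_gaussian mem_Collect_eq, blast)
  then have sym: "measure (gaussian d \<mu> \<Sigma>) {x \<in> space (gaussian d \<mu> \<Sigma>). (x \<in> S) \<noteq> (x \<in> S')} \<le> 9 * (\<theta> * g)"
    using p(3) by (simp only:)
  have S2: "S \<in> G.events" "S' \<in> G.events" using S S' by (simp_all only: sets_gaussian)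
  note cl = G.uniform_measure_close[OF S2 \<alpha> sym small]
  obtain c where c: "coeff_poly d k (snd c) = p" "truncated_gaussian d \<mu> \<Sigma> S' = density_measure d (coeff_density d k c)"
    using truncated_gaussian_eq_density_measure[OF \<Sigma> \<mu> k(2) p(1)] cl(1) unfolding S'_def by blast
  have "admissible d (\<mu>, \<Sigma>, S')" using \<Sigma> \<mu> S' cl(1) by (simp only: admissible_def prod.case) 
  moreover have "truncated d (\<mu>, \<Sigma>, S') = density_measure d (coeff_density d k c)"
    using c(2) by (simp only: truncated_def prod.case)
  moreover have "\<bar>measure (truncated_gaussian d \<mu> \<Sigma> S) B - measure (density_measure d (coeff_density d k c)) B\<bar> \<le> 18 * (\<theta> * g) / \<alpha>"
    if "B \<in> sets (lborel_R d)" for B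
  proof -
    have "B \<in> G.events" using that by (simp only: sets_gaussian)
    from cl(2)[OF this] show ?thesis
      unfolding c(2)[symmetric] truncated_gaussian_def by (simp only: mult.assoc[symmetric])
  qed
  ultimately show ?thesis using p(2) c(1) by blast
qed

theorem truncated_gaussian_learning:
  fixes \<alpha> \<epsilon> g :: real and d n :: nat
  assumes \<alpha>: "0 < \<alpha>" and d: "1 \<le> d" and \<S>: "\<S> \<subseteq> sets (lborel_R d)" and g: "0 \<le> g" and \<epsilon>: "0 < \<epsilon>" "\<epsilon> < 1"
    and stable: "\<And>A b S. A \<in> carrier_mat d d \<Longrightarrow> b \<in> R_space d \<Longrightarrow> S \<in> \<S> \<Longrightarrow> gaussian_surface_area d (affine_map d A b ` S) \<le> ennreal g"
    and n: "real (max d 2) powr (9000000 * (g / \<alpha>)\<^sup>2 / \<epsilon> ^ 4) \<le> real n"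
  shows "\<exists>est. \<forall>\<mu> \<Sigma> S. \<mu> \<in> R_space d \<longrightarrow> full_rank_cov d \<Sigma> \<longrightarrow> S \<in> \<S> \<longrightarrow> \<alpha> \<le> measure (gaussian d \<mu> \<Sigma>) S \<longrightarrow>
    99 / 100 \<le> \<P>(X in (\<Pi>\<^sub>M k\<in>{..<n}. truncated_gaussian d \<mu> \<Sigma> S).
      admissible d (est X) \<and> tv_dist (truncated_gaussian d \<mu> \<Sigma> S) (truncated d (est X)) \<le> \<epsilon>)"
proof (cases "\<exists>\<mu> \<Sigma> S. \<mu> \<in> R_space d \<and> full_rank_cov d \<Sigma> \<and> S \<in> \<S> \<and> \<alpha> \<le> measure (gaussian d \<mu> \<Sigma>) S")
  \<comment> \<open>No parameters satisfy the hypotheses, so any estimator will do. In the other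
    case one instance provides the lower bound on \<open>g\<close> that the constants
    require.\<close>
  case False
  then show ?thesis by blast
next
  case True
  then obtain \<mu>0 \<Sigma>0 S0 where 0: "\<mu>0 \<in> R_space d" "full_rank_cov d \<Sigma>0" "S0 \<in> \<S>" "\<alpha> \<le> measure (gaussian d \<mu>0 \<Sigma>0) S0"
    by blast
  define R where "R = g / \<alpha>"
  \<comment> \<open>Makes \<open>18 * (\<theta> * g) / \<alpha>\<close> equal to
    \<open>\<epsilon> / 20\<close>; the lower bound on \<open>R\<close> keeps the angle at most
    1.\<close>
  define \<theta> where "\<theta> = \<epsilon> / (360 * R)"
  define k where "k = max 2 (nat \<lceil>4 / \<theta>\<^sup>2\<rceil>)"
  have "measure (gaussian d \<mu>0 \<Sigma>0) S0 / 3 \<le> g"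
    using 0 \<S> by (intro surface_area_lower_bound[OF d 0(2,1) _ stable g]) auto
  then have R: "1 / 3 \<le> R" using 0(4) \<alpha> by (simp add: R_def field_simps)
  have \<theta>: "0 < \<theta>" "\<theta> \<le> 1" using R \<epsilon> by (auto simp: \<theta>_def)
  have k: "4 / \<theta>\<^sup>2 \<le> real k" "2 \<le> k" unfolding k_def by linarith+
  have \<theta>R: "4 / \<theta>\<^sup>2 = 518400 * (R\<^sup>2 / \<epsilon>\<^sup>2)"
    using R \<epsilon> by (simp add: \<theta>_def power_divide power_mult_distrib)
  \<comment> \<open>Here \<open>518400 = 4 * 360 ^ 2\<close>. Rounding up and the minimum degree 2
    are covered by doubling, since \<open>R\<^sup>2 / \<epsilon>\<^sup>2\<close> is at least
    1/9.\<close>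
  have k_le: "real k \<le> 1036800 * R\<^sup>2 / \<epsilon>\<^sup>2"
  proof -
    have "(1 / 3)\<^sup>2 \<le> R\<^sup>2" using R by (intro power_mono) auto
    then have "1 / 9 \<le> R\<^sup>2" by (simp add: power2_eq_square)
    moreover have "R\<^sup>2 \<le> R\<^sup>2 / \<epsilon>\<^sup>2" using \<epsilon> by (simp add: pos_le_divide_eq mult_left_le power_le_one)
    ultimately have "1 / 9 \<le> R\<^sup>2 / \<epsilon>\<^sup>2" by (rule order_trans)
    moreover have "real k \<le> max 2 (518400 * (R\<^sup>2 / \<epsilon>\<^sup>2) + 1)" unfolding k_def \<theta>R by linarith
    ultimately have "real k \<le> 1036800 * (R\<^sup>2 / \<epsilon>\<^sup>2)" by linarith
    then show ?thesis by simp
  qed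
  have nb: "(10800 * real ((d + 1) ^ k) / \<epsilon>) ^ 4 \<le> real n"
    by (rule sample_size_bound[OF R \<epsilon> k_le n[folded R_def]])
  have D1: "1 \<le> (d + 1) ^ k" by simp
  have n0: "0 < n"
  proof -
    have "0 < (10800 * real ((d + 1) ^ k) / \<epsilon>) ^ 4" using \<epsilon> D1 by (intro zero_less_power divide_pos_pos) auto
    then show ?thesis using nb by (cases n) auto
  qed
  have size: "(ln (2 * real (((2 * n + 1) ^ ((d + 1) ^ k)) ^ 3)) + 3 / 2) / sqrt n / (\<epsilon> / 4) \<le> 1 / 100"
    by (rule deviation_bound[OF \<epsilon> D1 nb])
  have \<theta>g: "\<theta> * g = \<epsilon> * \<alpha> / 360" using R \<alpha> by (auto simp: \<theta>_def R_def)
  then have small: "9 * (\<theta> * g) \<le> \<alpha> / 2" "18 * (\<theta> * g) / \<alpha> = \<epsilon> / 20" 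
    using \<epsilon> \<alpha> mult_right_mono[of \<epsilon> 1 \<alpha>] unfolding \<theta>g by simp_all
  define \<Theta> where "\<Theta> = {c. \<exists>y. admissible d y \<and> truncated d y = density_measure d (coeff_density d k c)}"
  have approx: "\<exists>c\<in>\<Theta>. (AE x in lborel_R d. coeff_poly d k (snd c) x \<noteq> 0) \<and>
      (\<forall>B\<in>sets (lborel_R d). \<bar>measure (truncated_gaussian d \<mu> \<Sigma> S) B - measure (density_measure d (coeff_density d k c)) B\<bar> \<le> \<epsilon> / 20)"
    if "\<mu> \<in> R_space d" "full_rank_cov d \<Sigma>" "S \<in> \<S>" "\<alpha> \<le> measure (gaussian d \<mu> \<Sigma>) S" for \<mu> \<Sigma> S
  proof -
    have S: "S \<in> sets (lborel_R d)" using that(3) \<S> by blast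
    show ?thesis
      using truncated_gaussian_approx[OF that(2,1) S stable g \<theta> k \<alpha> that(4) small(1)] that(3)
      unfolding small(2) \<Theta>_def by blast
  qed
  have prob: "prob_space (density_measure d (coeff_density d k c))" if "c \<in> \<Theta>" for c
    using that prob_space_truncated unfolding \<Theta>_def by force
  obtain T where T: "countable T" "T \<subseteq> \<Theta>" "\<Theta> \<subseteq> closure T" by (rule separable)
  have "T \<noteq> {}" using approx[OF 0] T(3) by auto
  define e where "e = from_nat_into T"
  have e: "range e = T" unfolding e_def by (rule range_from_nat_into[OF \<open>T \<noteq> {}\<close> T(1)])
  then have e\<Theta>: "e j \<in> \<Theta>" for j using T(2) by blast
  define y where "y j = (SOME y. admissible d y \<and> truncated d y = density_measure d (coeff_density d k (e j)))" for j
  have y: "admissible d (y j) \<and> truncated d (y j) = density_measure d (coeff_density d k (e j))" for j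
    unfolding y_def using e\<Theta>[of j] unfolding \<Theta>_def mem_Collect_eq by (rule someI_ex)
  let ?q = "\<lambda>j. coeff_poly d k (fst (e j))" and ?p = "\<lambda>j. coeff_poly d k (snd (e j))"
  have ptf: "ptf_density (?q j) (?p j) = coeff_density d k (e j)" for j by (simp only: coeff_density_def)
  \<comment> \<open>The value \<open>\<epsilon> / 10\<close> adds two errors of
    \<open>\<epsilon> / 20\<close>, from the polynomial set and from the dense subset. With
    \<open>\<epsilon> / 4\<close> for the sampling error, the final bound is
    \<open>3 * (\<epsilon> / 10) + 2 * (\<epsilon> / 4)\<close>, which is
    \<open>4 / 5 * \<epsilon>\<close>.\<close>
  define idx where "idx = min_dist_index d (\<lambda>j. ptf_density (?q j) (?p j)) n (\<epsilon> / 10 + \<epsilon> / 4)"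
  show ?thesis
  proof (intro exI[of _ "\<lambda>X. y (idx X)"] allI impI)
    fix \<mu> \<Sigma> S
    assume a: "\<mu> \<in> R_space d" "full_rank_cov d \<Sigma>" "S \<in> \<S>" "\<alpha> \<le> measure (gaussian d \<mu> \<Sigma>) S"
    let ?P = "truncated_gaussian d \<mu> \<Sigma> S"
    have P: "prob_space ?P" using a \<alpha> by (intro prob_space_truncated_gaussian) auto
    obtain c where c: "c \<in> \<Theta>" "AE x in lborel_R d. coeff_poly d k (snd c) x \<noteq> 0"
      "\<And>B. B \<in> sets (lborel_R d) \<Longrightarrow> \<bar>measure ?P B - measure (density_measure d (coeff_density d k c)) B\<bar> \<le> \<epsilon> / 20"
      using approx[OF a] by blast
    have "c \<in> closure T" using c(1) T(3) by blast
    moreover have "prob_space (density_measure d (coeff_density d k c'))" if "c' \<in> T" for c'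
      using prob that T(2) by blast
    moreover have "\<epsilon> / 20 > 0" using \<epsilon> by simp
    ultimately obtain c' where c': "c' \<in> T"
      "\<forall>B\<in>sets (lborel_R d). \<bar>measure (density_measure d (coeff_density d k c)) B - measure (density_measure d (coeff_density d k c')) B\<bar> \<le> \<epsilon> / 20"
      using coeff_density_approx[OF prob[OF c(1)] c(2)] by blast
    obtain j0 where j0: "e j0 = c'" using c'(1) e by blast
    have "99 / 100 \<le> measure (\<Pi>\<^sub>M i\<in>{..<n}. ?P) {X \<in> space (\<Pi>\<^sub>M i\<in>{..<n}. ?P).
        admissible d (y (min_dist_index d (\<lambda>j. ptf_density (?q j) (?p j)) n (\<epsilon> / 10 + \<epsilon> / 4) X)) \<and>
        tv_dist ?P (truncated d (y (min_dist_index d (\<lambda>j. ptf_density (?q j) (?p j)) n (\<epsilon> / 10 + \<epsilon> / 4) X))) \<le> \<epsilon>}"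
    proof (rule ptf_learning[where good = "\<lambda>j. admissible d (y j) \<and> tv_dist ?P (truncated d (y j)) \<le> \<epsilon>" and ?j0.0 = j0 and k = k])
      show "prob_space (density_measure d (ptf_density (?q j) (?p j)))" for j
        unfolding ptf by (rule prob[OF e\<Theta>])
      show "\<bar>measure ?P B - measure (density_measure d (ptf_density (?q j0) (?p j0))) B\<bar> \<le> \<epsilon> / 10" if "B \<in> sets (lborel_R d)" for B
        using c(3)[OF that] bspec[OF c'(2) that] unfolding ptf j0[symmetric] by linarith
      show "admissible d (y j) \<and> tv_dist ?P (truncated d (y j)) \<le> \<epsilon>"
        if "\<And>B. B \<in> sets (lborel_R d) \<Longrightarrow> \<bar>measure ?P B - measure (density_measure d (ptf_density (?q j) (?p j))) B\<bar> \<le> 3 * (\<epsilon> / 10) + 2 * (\<epsilon> / 4)" for j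
      proof (intro conjI tv_dist_leI)
        fix B assume "B \<in> sets ?P"
        then have B: "B \<in> sets (lborel_R d)" by (simp only: sets_truncated_gaussian)
        have "truncated d (y j) = density_measure d (ptf_density (?q j) (?p j))" unfolding ptf using y by blast
        then show "\<bar>measure ?P B - measure (truncated d (y j)) B\<bar> \<le> \<epsilon>" using that[OF B] \<epsilon> by simp
      qed (use y in blast)
    qed (use n0 \<epsilon> size P in simp_all)
    then show "99 / 100 \<le> \<P>(X in (\<Pi>\<^sub>M k\<in>{..<n}. ?P). admissible d (y (idx X)) \<and> tv_dist ?P (truncated d (y (idx X))) \<le> \<epsilon>)"
      unfolding idx_def .
  qed
qed

theorem theorem8:
  fixes \<alpha> K :: real
  assumes "\<alpha> > 0" and "K > 0"
  shows "\<exists>C>0. \<forall>(d::nat) (\<S> :: (nat \<Rightarrow> real) set set) (\<epsilon>::real) (n::nat).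
    d \<ge> 1 \<longrightarrow>
    \<S> \<subseteq> sets (lborel_R d) \<longrightarrow>
    family_surface_area d \<S> < \<infinity> \<longrightarrow>
    (\<forall>A\<in>carrier_mat d d. \<forall>b\<in>R_space d.
       family_surface_area d ((\<lambda>S. affine_map d A b ` S) ` \<S>)
         \<le> ennreal K * family_surface_area d \<S>) \<longrightarrow>
    \<epsilon> > 0 \<longrightarrow>
    real n \<ge> real (max d 2) powr (C * (enn2real (family_surface_area d \<S>))\<^sup>2 / \<epsilon> ^ 4) \<longrightarrow>
    (\<exists>est :: (nat \<Rightarrow> nat \<Rightarrow> real) \<Rightarrow> (nat \<Rightarrow> real) \<times> real mat \<times> (nat \<Rightarrow> real) set.
       \<forall>\<mu> \<Sigma> S.
         \<mu> \<in> R_space d \<longrightarrow> full_rank_cov d \<Sigma> \<longrightarrow> S \<in> \<S> \<longrightarrow>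
         measure (gaussian d \<mu> \<Sigma>) S \<ge> \<alpha> \<longrightarrow>
         \<P>(X in (\<Pi>\<^sub>M k\<in>{..<n}. truncated_gaussian d \<mu> \<Sigma> S).
             case est X of (\<mu>', \<Sigma>', S') \<Rightarrow>
               \<mu>' \<in> R_space d \<and> full_rank_cov d \<Sigma>' \<and>
               S' \<in> sets (lborel_R d) \<and> measure (gaussian d \<mu>' \<Sigma>') S' > 0 \<and>
               tv_dist (truncated_gaussian d \<mu> \<Sigma> S) (truncated_gaussian d \<mu>' \<Sigma>' S') \<le> \<epsilon>)
           \<ge> 99 / 100)"
proof (rule exI[of _ "9000000 * (K / \<alpha>)\<^sup>2"], intro conjI allI impI)
  show "0 < 9000000 * (K / \<alpha>)\<^sup>2" using assms by simp
next
  fix d n :: nat and \<S> :: "(nat \<Rightarrow> real) set set" and \<epsilon> :: real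
  assume d: "d \<ge> 1" and \<S>: "\<S> \<subseteq> sets (lborel_R d)" and fin: "family_surface_area d \<S> < \<infinity>"
    and aff: "\<forall>A\<in>carrier_mat d d. \<forall>b\<in>R_space d. family_surface_area d ((\<lambda>S. affine_map d A b ` S) ` \<S>) \<le> ennreal K * family_surface_area d \<S>"
    and \<epsilon>: "\<epsilon> > 0"
    and n: "real n \<ge> real (max d 2) powr (9000000 * (K / \<alpha>)\<^sup>2 * (enn2real (family_surface_area d \<S>))\<^sup>2 / \<epsilon> ^ 4)"
  \<comment> \<open>Stability allows the images a surface area larger by the factor
    \<open>K\<close>, which is why the constant in the exponent carries
    \<open>(K / \<alpha>)\<^sup>2\<close>.\<close>
  define g where "g = K * enn2real (family_surface_area d \<S>)"
  have g0: "0 \<le> g" using assms by (simp add: g_def)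
  have geq: "ennreal K * family_surface_area d \<S> = ennreal g"
    using fin assms by (simp add: g_def ennreal_mult' ennreal_enn2real)
  have stable: "gaussian_surface_area d (affine_map d A b ` S) \<le> ennreal g"
    if "A \<in> carrier_mat d d" "b \<in> R_space d" "S \<in> \<S>" for A b S
  proof -
    have "gaussian_surface_area d (affine_map d A b ` S) \<le> family_surface_area d ((\<lambda>S. affine_map d A b ` S) ` \<S>)"
      unfolding family_surface_area_def image_image by (rule SUP_upper[OF that(3)])
    also have "\<dots> \<le> ennreal g" using aff that(1,2) unfolding geq by blast
    finally show ?thesis .
  qed
  have n': "real (max d 2) powr (9000000 * (g / \<alpha>)\<^sup>2 / \<epsilon> ^ 4) \<le> real n"
    using n by (simp add: g_def power_divide power_mult_distrib mult.assoc)
  have unfold: "(case y of (\<mu>', \<Sigma>', S') \<Rightarrow> \<mu>' \<in> R_space d \<and> full_rank_cov d \<Sigma>' \<and>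
      S' \<in> sets (lborel_R d) \<and> measure (gaussian d \<mu>' \<Sigma>') S' > 0 \<and> tv_dist P (truncated_gaussian d \<mu>' \<Sigma>' S') \<le> \<epsilon>)
    \<longleftrightarrow> admissible d y \<and> tv_dist P (truncated d y) \<le> \<epsilon>" for y P
    by (simp only: admissible_def truncated_def split: prod.split) blast
  show "\<exists>est :: (nat \<Rightarrow> nat \<Rightarrow> real) \<Rightarrow> (nat \<Rightarrow> real) \<times> real mat \<times> (nat \<Rightarrow> real) set.
       \<forall>\<mu> \<Sigma> S.
         \<mu> \<in> R_space d \<longrightarrow> full_rank_cov d \<Sigma> \<longrightarrow> S \<in> \<S> \<longrightarrow>
         measure (gaussian d \<mu> \<Sigma>) S \<ge> \<alpha> \<longrightarrow>
         \<P>(X in (\<Pi>\<^sub>M k\<in>{..<n}. truncated_gaussian d \<mu> \<Sigma> S).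
             case est X of (\<mu>', \<Sigma>', S') \<Rightarrow>
               \<mu>' \<in> R_space d \<and> full_rank_cov d \<Sigma>' \<and>
               S' \<in> sets (lborel_R d) \<and> measure (gaussian d \<mu>' \<Sigma>') S' > 0 \<and>
               tv_dist (truncated_gaussian d \<mu> \<Sigma> S) (truncated_gaussian d \<mu>' \<Sigma>' S') \<le> \<epsilon>)
           \<ge> 99 / 100"
    unfolding unfold
  proof (cases "\<epsilon> < 1")
    case True
    show "\<exists>est. \<forall>\<mu> \<Sigma> S. \<mu> \<in> R_space d \<longrightarrow> full_rank_cov d \<Sigma> \<longrightarrow> S \<in> \<S> \<longrightarrow> \<alpha> \<le> measure (gaussian d \<mu> \<Sigma>) S \<longrightarrow>
      99 / 100 \<le> \<P>(X in (\<Pi>\<^sub>M k\<in>{..<n}. truncated_gaussian d \<mu> \<Sigma> S).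
      admissible d (est X) \<and> tv_dist (truncated_gaussian d \<mu> \<Sigma> S) (truncated d (est X)) \<le> \<epsilon>)"
      by (rule truncated_gaussian_learning[OF assms(1) d \<S> g0 \<epsilon> True stable n'])
  next
    case False
    \<comment> \<open>For \<open>\<epsilon> \<ge> 1\<close> every admissible answer is correct, as
      total variation never exceeds 1; the untruncated standard Gaussian serves as a fixed
      one.\<close>
    define y where "y = ((\<lambda>i\<in>{..<d}. 0) :: nat \<Rightarrow> real, 1\<^sub>m d :: real mat, R_space d)"
    have cov: "full_rank_cov d (1\<^sub>m d)"
      unfolding full_rank_cov_def
    proof (intro conjI ballI impI)
      fix v :: "real vec" assume v: "v \<in> carrier_vec d" "v \<noteq> 0\<^sub>v d"
      then obtain i where i: "i < d" "v $ i \<noteq> 0" by (metis carrier_vecD eq_vecI index_zero_vec)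
      have "0 < (\<Sum>i\<in>{0..<d}. v $ i * v $ i)"
        using i by (intro sum_pos2[of _ i]) (auto simp: zero_less_mult_iff)
      then show "0 < scalar_prod v (1\<^sub>m d *\<^sub>v v)" using v(1) by (auto simp: scalar_prod_def)
    qed auto
    have z: "(\<lambda>i\<in>{..<d}. 0) \<in> R_space d" by (simp add: space_lborel_R)
    have "measure (gaussian d (\<lambda>i\<in>{..<d}. 0) (1\<^sub>m d)) (R_space d) = 1"
      using prob_space.prob_space[OF prob_space_gaussian[OF cov z]] by simp
    then have y: "admissible d y" using cov z by (simp add: y_def admissible_def)
    show "\<exists>est. \<forall>\<mu> \<Sigma> S. \<mu> \<in> R_space d \<longrightarrow> full_rank_cov d \<Sigma> \<longrightarrow> S \<in> \<S> \<longrightarrow> \<alpha> \<le> measure (gaussian d \<mu> \<Sigma>) S \<longrightarrow>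
      99 / 100 \<le> \<P>(X in (\<Pi>\<^sub>M k\<in>{..<n}. truncated_gaussian d \<mu> \<Sigma> S).
      admissible d (est X) \<and> tv_dist (truncated_gaussian d \<mu> \<Sigma> S) (truncated d (est X)) \<le> \<epsilon>)"
    proof (intro exI[of _ "\<lambda>_. y"] allI impI)
      fix \<mu> \<Sigma> S
      assume a: "\<mu> \<in> R_space d" "full_rank_cov d \<Sigma>" "S \<in> \<S>" "\<alpha> \<le> measure (gaussian d \<mu> \<Sigma>) S"
      let ?P = "truncated_gaussian d \<mu> \<Sigma> S"
      interpret P: prob_space ?P using a assms(1) by (intro prob_space_truncated_gaussian) auto
      interpret Q: prob_space "truncated d y" by (rule prob_space_truncated[OF y])
      interpret M: prob_space "\<Pi>\<^sub>M k\<in>{..<n}. ?P" by (rule P.prob_space_iid)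
      have "tv_dist ?P (truncated d y) \<le> \<epsilon>"
      proof (rule tv_dist_leI)
        fix B
        have "0 \<le> measure ?P B" "measure ?P B \<le> 1" "0 \<le> measure (truncated d y) B" "measure (truncated d y) B \<le> 1"
          by simp_all
        then show "\<bar>measure ?P B - measure (truncated d y) B\<bar> \<le> \<epsilon>" using False by linarith
      qed
      then show "99 / 100 \<le> \<P>(X in (\<Pi>\<^sub>M k\<in>{..<n}. ?P). admissible d y \<and> tv_dist ?P (truncated d y) \<le> \<epsilon>)"
        using y M.prob_space by simp
    qed
  qed
qed

end
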